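(* Consider the linear terminal value problem $$-\partial_t w(t,m)-\frac{\nu^2}{2}\Delta_{\mathcal M}w(t,m)+\mathbf b(m)\cdot\nabla_{\mathcal M}w(t,m)+c(t,m)\,w(t,m)=0\ \text{ in }[0,T)\times\mathcal M,\qquad w(T,m)=\exp(-\beta h(m))\ \text{ on }\mathcal M, \tag{L}$$ and the Hamilton-Jacobi-Bellman (Bellman) equation $$-\partial_t W(t,m)+\mathcal H W(t,m)=0\ \text{ in }[0,T)\times\mathcal M,\qquad W(T,m)=h(m)\ \text{ on }\mathcal M, \tag{HJB}$$ with all data as in the context. Then there exists a unique classical solution $w\in C^{1,2}([0,T]\times\mathcal M)$ of (L), and it is also the unique weak solution of (L) in $W^{1,2,2}\big([0,T];H^1(\mathcal M),H^{-1}(\mathcal M)\big)$. The function $$W(t,m)=-\frac1\beta\log\big(w(t,m)\big)$$ is the unique classical solution of (HJB).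
   Context: Let $N\in\mathbb N$, $T>0$, $\lambda>0$, $\nu>0$, $\alpha\ge 0$, $\delta\ge 0$, $C_{\rm ext}\in\mathbb R\setminus\{0\}$. Let $\mathcal M=(\mathbb S^2)^N\subset(\mathbb R^3)^N$ with the product Riemannian metric induced from $(\mathbb R^3)^N$; $\Delta_{\mathcal M}$ is the Laplace-Beltrami operator and $\nabla_{\mathcal M}$ the tangential gradient in the space variable, regarded as a vector in $T_m\mathcal M\subset(\mathbb R^3)^N$. Cross products of elements of $(\mathbb R^3)^N$ are taken componentwise: $(a\times b)_i=a_i\times b_i$, $i=1,\dots,N$. Let $\mathbf J\in\mathbb R^{3N\times 3N}$ be symmetric positive semi-definite, $\mathbf D\in\mathbb R^{3N\times 3N}$ diagonal, and $\mathbf Q=\mathbf J+\mathbf D$. Let $\boldsymbol\sigma(m)\in\mathbb R^{3N\times3N}$ be the matrix with $\boldsymbol\sigma(m)v=m\times v$, and $\boldsymbol\Sigma(m)=(\mathbf{Id}-\alpha\boldsymbol\sigma(m))\boldsymbol\sigma(m)$. Put $$\mathbf f(m,u)=\boldsymbol\Sigma(m)\big(-\mathbf Qm+C_{\rm ext}u\big)\quad (m\in\mathcal M,\ u\in(\mathbb R^3)^N),\qquad \mathbf b(m)=\boldsymbol\Sigma(m)\mathbf Qm .$$ Both $\mathbf f(m,u)$ and $\mathbf b(m)$ lie in $T_m\mathcal M$. Let $h\in C^2(\mathcal M;\mathbb R)$ and $\widetilde{\mathbf m}\in C^2([0,T];\mathcal M)$ be given, and $$\beta=\frac{C_{\rm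 ext}^2(1+\alpha^2)}{\lambda\nu^2},\qquad c(t,m)=\beta\,\delta\,\|m-\widetilde{\mathbf m}(t)\|^2_{(\mathbb R^3)^N}.$$ The Hamiltonian acts on $\psi\in C^2(\mathcal M)$ (at time $t$) by $$\mathcal H\psi(m)=-\frac{\nu^2}{2}\Delta_{\mathcal M}\psi(m)-\delta\|m-\widetilde{\mathbf m}(t)\|^2_{(\mathbb R^3)^N}+\sup_{u\in(\mathbb R^3)^N}\Big(-\mathbf f(m,u)\cdot\nabla_{\mathcal M}\psi(m)-\frac\lambda2\|u\|^2_{(\mathbb R^3)^N}\Big).$$ A classical solution of (L) or (HJB) is a function in $C^{1,2}([0,T]\times\mathcal M)$ satisfying the equation and terminal condition pointwise. Sobolev-Bochner space: $W^{1,2,2}\big([0,T];H^1(\mathcal M),H^{-1}(\mathcal M)\big)=\{u\in L^2([0,T];H^1(\mathcal M)):\ \tfrac{du}{dt}\in L^2([0,T];H^{-1}(\mathcal M))\}$. A weak solution of (L) is a $w$ in this space with $w(T)=\exp(-\beta h)$ such that for all $\psi\in L^2(0,T;H^1(\mathcal M))$ $$\int_0^T\int_{\mathcal M}-\partial_tw\,\psi+\frac{\nu^2}{2}\nabla_{\mathcal M}w\cdot\nabla_{\mathcal M}\psi+\mathbf b\cdot\nabla_{\mathcal M}w\,\psi+c\,w\,\psi\;dm\,dt=0,$$ where the term with $\partial_t w$ is understood as the $H^{-1}$-$H^1$ duality pairing. *)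

theory Defs
  imports "HOL-Analysis.Analysis"
begin

section \<open>The manifold \<open>(S\<^sup>2)\<^sup>N\<close>\<close>

text \<open>
  With \<open>N = CARD('n)\<close>, the space \<open>(\<real>\<^sup>3)\<^sup>N\<close> is the type \<open>real ^ ('n \<times> 3)\<close>, so that a
  \<open>3N \<times> 3N\<close> matrix is a matrix over the index type \<open>'n \<times> 3\<close>; \<open>blk m i\<close> is the \<open>\<real>\<^sup>3\<close>-component \<open>m\<^sub>i\<close>.
\<close>

type_synonym 'n vec3 = "real ^ ('n \<times> 3)"
type_synonym 'n mat3 = "real ^ ('n \<times> 3) ^ ('n \<times> 3)"

definition blk :: "'n::finite vec3 \<Rightarrow> 'n \<Rightarrow> real ^ 3" where
  "blk m i = (\<chi> k. m $ (i, k))"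

definition cross_vec :: "'n::finite vec3 \<Rightarrow> 'n vec3 \<Rightarrow> 'n vec3" where
  "cross_vec a b = (\<chi> p. cross3 (blk a (fst p)) (blk b (fst p)) $ snd p)"

definition Mfd :: "'n::finite vec3 set" where
  "Mfd = {m. \<forall>i. norm (blk m i) = 1}"

definition tangent :: "'n::finite vec3 \<Rightarrow> 'n vec3 set" where
  "tangent m = {v. \<forall>i. blk m i \<bullet> blk v i = 0}"

section \<open>Differential operators on \<open>Mfd\<close>\<close>

text \<open>
  \<open>(f has_derivative f') (at m within Mfd)\<close> is differentiability of \<open>f\<close> at \<open>m\<close> relative to the
  embedded submanifold. It determines \<open>f'\<close> exactly on the tangent space, where it is the
  differential of \<open>f\<close>; the metric is the one induced by the ambient inner product.
\<close>

definition grad_M :: "('n::finite vec3 \<Rightarrow> real) \<Rightarrow> 'n vec3 \<Rightarrow> 'n vec3" where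
  "grad_M f m =
     (THE g. g \<in> tangent m \<and> (f has_derivative (\<lambda>v. g \<bullet> v)) (at m within Mfd))"

definition orthonormal_basis :: "'a::euclidean_space set \<Rightarrow> 'a set \<Rightarrow> bool" where
  "orthonormal_basis B V \<longleftrightarrow> pairwise orthogonal B \<and> (\<forall>e\<in>B. norm e = 1) \<and> span B = V"

text \<open>
  Divergence of a tangential vector field: the trace of its covariant derivative. The
  Levi-Civita derivative of \<open>X\<close> along \<open>e\<close> is the tangential part of \<open>X' e\<close>, and the
  normal part does not contribute to \<open>X' e \<bullet> e\<close>.
\<close>

definition div_M :: "('n::finite vec3 \<Rightarrow> 'n vec3) \<Rightarrow> 'n vec3 \<Rightarrow> real" where
  "div_M X m =
     (THE d. \<exists>X' B. (X has_derivative X') (at m within Mfd) \<and>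
        orthonormal_basis B (tangent m) \<and> d = (\<Sum>e\<in>B. X' e \<bullet> e))"

definition laplace_beltrami :: "('n::finite vec3 \<Rightarrow> real) \<Rightarrow> 'n vec3 \<Rightarrow> real" where
  "laplace_beltrami f m = div_M (grad_M f) m"

definition C1_M :: "('n::finite vec3 \<Rightarrow> 'b::real_normed_vector) \<Rightarrow> bool" where
  "C1_M f \<longleftrightarrow> (\<exists>f' :: 'n vec3 \<Rightarrow> 'n vec3 \<Rightarrow>\<^sub>L 'b. continuous_on Mfd f' \<and>
     (\<forall>m\<in>Mfd. (f has_derivative blinfun_apply (f' m)) (at m within Mfd)))"

definition C2_M :: "('n::finite vec3 \<Rightarrow> real) \<Rightarrow> bool" where
  "C2_M f \<longleftrightarrow> C1_M f \<and> C1_M (grad_M f)"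

definition C2_curve :: "real \<Rightarrow> (real \<Rightarrow> 'n::finite vec3) \<Rightarrow> bool" where
  "C2_curve T \<gamma> \<longleftrightarrow> (\<forall>t\<in>{0..T}. \<gamma> t \<in> Mfd) \<and>
     (\<exists>\<gamma>' \<gamma>''. continuous_on {0..T} \<gamma>'' \<and>
        (\<forall>t\<in>{0..T}. (\<gamma> has_vector_derivative \<gamma>' t) (at t within {0..T}) \<and>
                    (\<gamma>' has_vector_derivative \<gamma>'' t) (at t within {0..T})))"

definition time_deriv :: "real \<Rightarrow> (real \<Rightarrow> 'a \<Rightarrow> real) \<Rightarrow> real \<Rightarrow> 'a \<Rightarrow> real" where
  "time_deriv T w t m = vector_derivative (\<lambda>s. w s m) (at t within {0..T})"

text \<open>\<open>w\<close>, its time derivative, and its first and second space derivatives (\<open>H\<close>) exist and are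
  jointly continuous on \<open>[0,T] \<times> Mfd\<close>.\<close>

definition C12 :: "real \<Rightarrow> (real \<Rightarrow> 'n::finite vec3 \<Rightarrow> real) \<Rightarrow> bool" where
  "C12 T w \<longleftrightarrow>
     continuous_on ({0..T} \<times> Mfd) (\<lambda>(t, m). w t m) \<and>
     continuous_on ({0..T} \<times> Mfd) (\<lambda>(t, m). time_deriv T w t m) \<and>
     continuous_on ({0..T} \<times> Mfd) (\<lambda>(t, m). grad_M (w t) m) \<and>
     (\<forall>t\<in>{0..T}. \<forall>m\<in>Mfd.
        ((\<lambda>s. w s m) has_vector_derivative time_deriv T w t m) (at t within {0..T}) \<and>
        (w t has_derivative (\<lambda>v. grad_M (w t) m \<bullet> v)) (at m within Mfd)) \<and>
     (\<exists>H :: real \<times> 'n vec3 \<Rightarrow> 'n vec3 \<Rightarrow>\<^sub>L 'n vec3.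
        continuous_on ({0..T} \<times> Mfd) H \<and>
        (\<forall>t\<in>{0..T}. \<forall>m\<in>Mfd.
           (grad_M (w t) has_derivative blinfun_apply (H (t, m))) (at m within Mfd)))"

section \<open>The data of the control problem\<close>

definition sigma_mat :: "'n::finite vec3 \<Rightarrow> 'n mat3" where
  "sigma_mat m = matrix (\<lambda>v. cross_vec m v)"

definition Sigma_mat :: "real \<Rightarrow> 'n::finite vec3 \<Rightarrow> 'n mat3" where
  "Sigma_mat \<alpha> m = (mat 1 - \<alpha> *\<^sub>R sigma_mat m) ** sigma_mat m"

definition f_field ::
    "real \<Rightarrow> real \<Rightarrow> 'n::finite mat3 \<Rightarrow> 'n vec3 \<Rightarrow> 'n vec3 \<Rightarrow> 'n vec3" where
  "f_field \<alpha> Cext Q m u = Sigma_mat \<alpha> m *v (- (Q *v m) + Cext *\<^sub>R u)"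

definition b_field :: "real \<Rightarrow> 'n::finite mat3 \<Rightarrow> 'n vec3 \<Rightarrow> 'n vec3" where
  "b_field \<alpha> Q m = Sigma_mat \<alpha> m *v (Q *v m)"

text \<open>The supremum is finite because \<open>\<lambda> > 0\<close>, so the real-valued \<open>SUP\<close> is the intended one.\<close>

definition hamiltonian ::
    "real \<Rightarrow> real \<Rightarrow> real \<Rightarrow> (real \<Rightarrow> 'n::finite vec3) \<Rightarrow> ('n vec3 \<Rightarrow> 'n vec3 \<Rightarrow> 'n vec3) \<Rightarrow>
     real \<Rightarrow> ('n vec3 \<Rightarrow> real) \<Rightarrow> 'n vec3 \<Rightarrow> real" where
  "hamiltonian lam \<nu> \<delta> mt f t \<psi> m =
     - (\<nu>\<^sup>2 / 2) * laplace_beltrami \<psi> m - \<delta> * (norm (m - mt t))\<^sup>2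
     + (SUP u. - (f m u \<bullet> grad_M \<psi> m) - lam / 2 * (norm u)\<^sup>2)"

section \<open>Classical solutions\<close>

definition classical_solution_L ::
    "real \<Rightarrow> real \<Rightarrow> ('n::finite vec3 \<Rightarrow> 'n vec3) \<Rightarrow> (real \<Rightarrow> 'n vec3 \<Rightarrow> real) \<Rightarrow>
     ('n vec3 \<Rightarrow> real) \<Rightarrow> (real \<Rightarrow> 'n vec3 \<Rightarrow> real) \<Rightarrow> bool" where
  "classical_solution_L T \<nu> b c g w \<longleftrightarrow> C12 T w \<and>
     (\<forall>t\<in>{0..<T}. \<forall>m\<in>Mfd.
        - time_deriv T w t m - \<nu>\<^sup>2 / 2 * laplace_beltrami (w t) m
        + b m \<bullet> grad_M (w t) m + c t m * w t m = 0) \<and>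
     (\<forall>m\<in>Mfd. w T m = g m)"

definition classical_solution_HJB ::
    "real \<Rightarrow> (real \<Rightarrow> ('n::finite vec3 \<Rightarrow> real) \<Rightarrow> 'n vec3 \<Rightarrow> real) \<Rightarrow>
     ('n vec3 \<Rightarrow> real) \<Rightarrow> (real \<Rightarrow> 'n vec3 \<Rightarrow> real) \<Rightarrow> bool" where
  "classical_solution_HJB T H h W \<longleftrightarrow> C12 T W \<and>
     (\<forall>t\<in>{0..<T}. \<forall>m\<in>Mfd. - time_deriv T W t m + H t (W t) m = 0) \<and>
     (\<forall>m\<in>Mfd. W T m = h m)"

section \<open>Sobolev spaces on \<open>Mfd\<close>\<close>

text \<open>
  The Riemannian volume of the product manifold is the \<open>N\<close>-fold product of the area measure of
  \<open>S\<^sup>2\<close>. By polar coordinates the latter is \<open>A \<mapsto> 3 \<cdot> vol {r a | 0 < r \<le> 1, a \<in> A}\<close>, so the volume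
  of \<open>Mfd\<close> is \<open>3\<^sup>N\<close> times the image of Lebesgue measure on the product of \<open>N\<close> punctured unit balls
  under blockwise normalisation.
\<close>

definition normalise :: "'n::finite vec3 \<Rightarrow> 'n vec3" where
  "normalise x = (\<chi> p. x $ p / norm (blk x (fst p)))"

definition vol_M :: "'n::finite vec3 measure" where
  "vol_M = scale_measure (3 ^ CARD('n))
     (distr (restrict_space lborel {x. \<forall>i. 0 < norm (blk x i) \<and> norm (blk x i) \<le> 1})
            (restrict_space borel Mfd) normalise)"

text \<open>Elements of function spaces are represented by functions; almost everywhere equal
  representatives are not identified.\<close>

definition L2_M :: "('n::finite vec3 \<Rightarrow> real) set" where
  "L2_M = {f. f \<in> borel_measurable vol_M \<and> integrable vol_M (\<lambda>m. (f m)\<^sup>2)}"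

definition L2_norm :: "('n::finite vec3 \<Rightarrow> real) \<Rightarrow> real" where
  "L2_norm f = sqrt (LINT m|vol_M. (f m)\<^sup>2)"

definition is_weak_grad :: "('n::finite vec3 \<Rightarrow> real) \<Rightarrow> ('n vec3 \<Rightarrow> 'n vec3) \<Rightarrow> bool" where
  "is_weak_grad f g \<longleftrightarrow>
     g \<in> borel_measurable vol_M \<and> integrable vol_M (\<lambda>m. (norm (g m))\<^sup>2) \<and>
     (\<forall>m\<in>Mfd. g m \<in> tangent m) \<and>
     (\<forall>X. C1_M X \<and> (\<forall>m\<in>Mfd. X m \<in> tangent m) \<longrightarrow>
        (LINT m|vol_M. g m \<bullet> X m) = - (LINT m|vol_M. f m * div_M X m))"

definition H1 :: "('n::finite vec3 \<Rightarrow> real) set" where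
  "H1 = {f \<in> L2_M. \<exists>g. is_weak_grad f g}"

text \<open>The weak gradient is unique up to null sets.\<close>

definition weak_grad :: "('n::finite vec3 \<Rightarrow> real) \<Rightarrow> 'n vec3 \<Rightarrow> 'n vec3" where
  "weak_grad f = (SOME g. is_weak_grad f g)"

definition H1_norm :: "('n::finite vec3 \<Rightarrow> real) \<Rightarrow> real" where
  "H1_norm f = sqrt ((LINT m|vol_M. (f m)\<^sup>2) + (LINT m|vol_M. (norm (weak_grad f m))\<^sup>2))"

text \<open>The dual space of \<open>H1\<close>: functionals are only constrained on \<open>H1\<close>.\<close>

definition Hm1 :: "(('n::finite vec3 \<Rightarrow> real) \<Rightarrow> real) set" where
  "Hm1 = {F. (\<forall>f\<in>H1. \<forall>g\<in>H1. \<forall>a b. F (\<lambda>m. a * f m + b * g m) = a * F f + b * F g) \<and>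
             (\<exists>K. \<forall>f\<in>H1. \<bar>F f\<bar> \<le> K * H1_norm f)}"

definition Hm1_norm :: "(('n::finite vec3 \<Rightarrow> real) \<Rightarrow> real) \<Rightarrow> real" where
  "Hm1_norm F = (SUP f\<in>{f \<in> H1. H1_norm f \<le> 1}. \<bar>F f\<bar>)"

section \<open>Bochner spaces and weak solutions\<close>

text \<open>
  \<open>L\<^sup>2([0,T]; V)\<close> for a space \<open>V\<close> of real-valued functions with (semi)norm \<open>p\<close>: Bochner-measurable
  (almost everywhere limit in \<open>p\<close> of \<open>V\<close>-valued simple functions) with square-integrable norm. It is
  used for \<open>V = H1\<close> and for \<open>V = Hm1\<close>.
\<close>

definition L2_Bochner ::
    "real \<Rightarrow> ('x \<Rightarrow> real) set \<Rightarrow> (('x \<Rightarrow> real) \<Rightarrow> real) \<Rightarrow> (real \<Rightarrow> 'x \<Rightarrow> real) \<Rightarrow> bool" where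
  "L2_Bochner T V p u \<longleftrightarrow>
     (AE t in lebesgue_on {0..T}. u t \<in> V) \<and>
     (\<exists>s :: nat \<Rightarrow> real \<Rightarrow> 'x \<Rightarrow> real.
        (\<forall>n. simple_function (lebesgue_on {0..T}) (s n) \<and> (\<forall>t\<in>{0..T}. s n t \<in> V)) \<and>
        (AE t in lebesgue_on {0..T}. (\<lambda>n. p (\<lambda>x. s n t x - u t x)) \<longlonglongrightarrow> 0)) \<and>
     integrable (lebesgue_on {0..T}) (\<lambda>t. (p (u t))\<^sup>2)"

definition test_function :: "real \<Rightarrow> (real \<Rightarrow> real) \<Rightarrow> bool" where
  "test_function T \<phi> \<longleftrightarrow>
     (\<forall>k t. (deriv ^^ k) \<phi> field_differentiable at t) \<and>
     (\<exists>a b. 0 < a \<and> b < T \<and> (\<forall>t. t \<notin> {a..b} \<longrightarrow> \<phi> t = 0))"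

text \<open>
  \<open>v = du/dt\<close> as an \<open>H\<^sup>-\<^sup>1\<close>-valued distribution on \<open>(0,T)\<close>, where \<open>u t \<in> L\<^sup>2\<close> is identified with the
  functional \<open>\<eta> \<mapsto> \<integral> u t \<eta>\<close>; the identity between \<open>H\<^sup>-\<^sup>1\<close>-valued integrals is tested with \<open>\<eta> \<in> H1\<close>.
\<close>

definition weak_time_deriv ::
    "real \<Rightarrow> (real \<Rightarrow> 'n::finite vec3 \<Rightarrow> real) \<Rightarrow> (real \<Rightarrow> ('n vec3 \<Rightarrow> real) \<Rightarrow> real) \<Rightarrow> bool" where
  "weak_time_deriv T u v \<longleftrightarrow>
     (\<forall>\<phi> \<eta>. test_function T \<phi> \<and> \<eta> \<in> H1 \<longrightarrow>
        (LINT t|lebesgue_on {0..T}. deriv \<phi> t * (LINT m|vol_M. u t m * \<eta> m))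
        = - (LINT t|lebesgue_on {0..T}. \<phi> t * v t \<eta>))"

text \<open>
  \<open>u(T) = g\<close> in the sense of the embedding of \<open>W\<^sup>1\<^sup>,\<^sup>2\<^sup>,\<^sup>2\<close> into \<open>C([0,T]; L\<^sup>2)\<close>: the continuous
  representative of \<open>u\<close> takes the value \<open>g\<close> at \<open>T\<close>.
\<close>

definition has_terminal_value ::
    "real \<Rightarrow> (real \<Rightarrow> 'n::finite vec3 \<Rightarrow> real) \<Rightarrow> ('n vec3 \<Rightarrow> real) \<Rightarrow> bool" where
  "has_terminal_value T u g \<longleftrightarrow>
     (\<exists>uc. (\<forall>t\<in>{0..T}. uc t \<in> L2_M) \<and>
        (\<forall>t\<in>{0..T}. ((\<lambda>s. L2_norm (\<lambda>m. uc s m - uc t m)) \<longlongrightarrow> 0) (at t within {0..T})) \<and>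
        (AE t in lebesgue_on {0..T}. AE m in vol_M. uc t m = u t m) \<and>
        (AE m in vol_M. uc T m = g m))"

text \<open>The first two conjuncts and \<open>weak_time_deriv\<close> say \<open>w \<in> W\<^sup>1\<^sup>,\<^sup>2\<^sup>,\<^sup>2([0,T]; H\<^sup>1, H\<^sup>-\<^sup>1)\<close> with \<open>v = dw/dt\<close>;
  \<open>v t (\<psi> t)\<close> is the duality pairing.\<close>

definition weak_solution_L ::
    "real \<Rightarrow> real \<Rightarrow> ('n::finite vec3 \<Rightarrow> 'n vec3) \<Rightarrow> (real \<Rightarrow> 'n vec3 \<Rightarrow> real) \<Rightarrow>
     ('n vec3 \<Rightarrow> real) \<Rightarrow> (real \<Rightarrow> 'n vec3 \<Rightarrow> real) \<Rightarrow> bool" where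
  "weak_solution_L T \<nu> b c g w \<longleftrightarrow>
     (\<exists>v. L2_Bochner T H1 H1_norm w \<and> L2_Bochner T Hm1 Hm1_norm v \<and> weak_time_deriv T w v \<and>
        has_terminal_value T w g \<and>
        (\<forall>\<psi>. L2_Bochner T H1 H1_norm \<psi> \<longrightarrow>
           (LINT t|lebesgue_on {0..T}.
              - v t (\<psi> t)
              + (LINT m|vol_M.
                   \<nu>\<^sup>2 / 2 * (weak_grad (w t) m \<bullet> weak_grad (\<psi> t) m)
                   + (b m \<bullet> weak_grad (w t) m) * \<psi> t m + c t m * w t m * \<psi> t m)) = 0))"

end

(*
  In the frame of rotation fields xi a x = e_a x x the Laplacian is the sum of squares of the angular
  derivatives and every coefficient is a polynomial. A monotone finite difference scheme built from the
  rotations maps polynomials to polynomials and is stable in all C^k norms, so it converges, together with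
  two space derivatives, to a classical solution of the linear equation; monotonicity gives positivity.
  Uniqueness is shown for weak solutions, by pairing them with classical solutions of the adjoint equation
  with polynomial data. The substitution w = exp (- beta W) exchanges the linear and the Bellman equation,
  because the supremum in the Hamiltonian is a quadratic function of the gradient.
*)

theory Submission
 imports Defs
begin

section \<open>Rotations of the blocks\<close>

text \<open>Classical parabolic theory is replaced by estimates on polynomials. The rotation fields
  form a global, redundant but Parseval frame, so no charts are needed. Rotations permute the
  fields, hence composing with a rotation is an isometry for the uniform bound on all derivative
  words of a given length, and only commutators with the coefficients remain to be estimated. Errors
  are analysed in the sup norm alone: a bound on three derivatives and Landau interpolation lift
  convergence to two derivatives. This forces polynomial data first; \<open>h\<close> being merely
  \<open>C^2\<close>, the general case is reached by stability in \<open>C^2\<close> and density of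
  polynomials in \<open>C^2\<close>, obtained by convolution with an invariant polynomial kernel. On
  \<open>Mfd\<close> the norm is constant, so the running cost is affine in \<open>m\<close> and the
  dependence on space stays polynomial. For uniqueness a weak solution is differentiated in time
  only against fixed \<open>C^2\<close> functions, through the du Bois-Reymond lemma; the adjoint
  problem is solved for polynomial data by the same scheme, and polynomials are enough to separate
  integrable functions.\<close>

lemma blk_simps [simp]:
 "blk (x + y) i = blk x i + blk y i" "blk (x - y) i = blk x i - blk y i"
 "blk (- x) i = - blk x i" "blk (r *\<^sub>R x) i = r *\<^sub>R blk x i" "blk 0 i = 0"
 by (auto simp: blk_def vec_eq_iff)

lemma blk_nth [simp]: "blk x i $ k = x $ (i, k)"
 by (simp add: blk_def)

lemma blk_eq_iff: "x = y \<longleftrightarrow> (ALL i. blk x i = blk y i)"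
 by (auto simp: blk_def vec_eq_iff)

lemma blk_axis [simp]: "blk (axis (i, k) c) j = (if j = i then axis k c else 0)"
 by (auto simp: vec_eq_iff axis_def)

lemma blk_cross_vec [simp]: "blk (cross_vec a b) i = cross3 (blk a i) (blk b i)"
 by (auto simp: cross_vec_def vec_eq_iff)

lemma inner_blk: "x \<bullet> y = (SUM i:UNIV. blk x i \<bullet> blk y i)" for x y :: "'n::finite vec3"
proof -
 have "x \<bullet> y = (SUM p:UNIV \<times> UNIV. x $ p * y $ p)"
 by (simp add: inner_vec_def)
 also have "... = (SUM i:UNIV. SUM k:UNIV. x $ (i, k) * y $ (i, k))"
 by (subst sum.cartesian_product) (simp add: case_prod_beta)
 finally show ?thesis by (simp add: inner_vec_def)
qed

lemma bilinear_cross_vec: "bilinear (cross_vec :: 'n::finite vec3 => _)"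
 unfolding bilinear_def
 by (auto intro!: linearI
 simp: blk_eq_iff cross_add_left cross_add_right cross_mult_left cross_mult_right)

lemma bounded_bilinear_cross_vec: "bounded_bilinear (cross_vec :: 'n::finite vec3 => _)"
 using bilinear_conv_bounded_bilinear bilinear_cross_vec by blast

interpretation cross_vec: bounded_bilinear "cross_vec :: 'n::finite vec3 => _"
 by (rule bounded_bilinear_cross_vec)

lemma cross_vec_jacobi:
 "cross_vec a (cross_vec b c) = cross_vec (cross_vec a b) c + cross_vec b (cross_vec a c)"
 unfolding blk_eq_iff by (simp add: cross3_simps forall_3)

lemma inner_cross_vec: "cross_vec a b \<bullet> c = a \<bullet> cross_vec b c"
 unfolding inner_blk by (intro sum.cong) (auto simp: cross3_simps)

lemma cross_vec_inner_self [simp]: "cross_vec a b \<bullet> b = 0" "b \<bullet> cross_vec a b = 0"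
 unfolding inner_blk by (simp_all add: dot_cross_self)

lemma tangent_cross_vec [simp]: "cross_vec a x:tangent x"
 by (simp add: tangent_def dot_cross_self)

lemma cross_vec_cross_vec_tangent:
 assumes "x:Mfd" "v:tangent x"
 shows "cross_vec (cross_vec x v) x = v"
 unfolding blk_eq_iff
proof
 fix i
 have *: "blk x i \<bullet> blk x i = 1" "blk x i \<bullet> blk v i = 0"
 using assms by (auto simp: Mfd_def tangent_def norm_eq_1)
 have "cross3 (cross3 a b) a = (a \<bullet> a) *\<^sub>R b - (a \<bullet> b) *\<^sub>R a" for a b :: "real^3"
 by (simp add: cross3_simps forall_3)
 then show "blk (cross_vec (cross_vec x v) x) i = blk v i" using * by simp
qed

lemma norm_cross_vec_le: "norm (cross_vec a x) <= norm a" if "x:Mfd" for x :: "'n::finite vec3"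
proof -
 have "norm (cross3 (blk a i) (blk x i)) <= norm (blk a i)" for i
 proof -
 have "(norm (cross3 (blk a i) (blk x i)))^2 <= (norm (blk a i))^2"
 proof -
 have "norm (blk x i) = 1" using that by (simp add: Mfd_def)
 then have "(norm (cross3 (blk a i) (blk x i)))^2 + (blk a i \<bullet> blk x i)^2 = (norm (blk a i))^2"
 using norm_cross_dot[of "blk a i" "blk x i"] by simp
 then show ?thesis using zero_le_power2[of "blk a i \<bullet> blk x i"] by linarith
 qed
 then show ?thesis using norm_ge_zero power2_le_imp_le by blast
 qed
 then show ?thesis
 unfolding norm_le inner_blk by (intro sum_mono) (simp add: norm_le)
qed

text \<open>For \<open>a = (i, k)\<close> this is the velocity field of the rotation of block
  \<open>i\<close> about its \<open>k\<close>-th axis; it is zero in all other blocks.\<close>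

definition xi :: "'n \<times> 3 => 'n::finite vec3 => 'n vec3" where
 "xi a x = cross_vec (axis a 1) x"

lemma tangent_xi [simp]: "xi a x:tangent x"
 by (simp add: xi_def)

lemma linear_xi: "linear (xi a)" and bounded_linear_xi: "bounded_linear (xi a)"
 unfolding xi_def[abs_def]
 using cross_vec.bounded_linear_right linear_conv_bounded_linear by blast+

lemma xi_simps:
 "xi a (x + y) = xi a x + xi a y" "xi a (x - y) = xi a x - xi a y"
 "xi a (c *\<^sub>R x) = c *\<^sub>R xi a x" "xi a (- x) = - xi a x" "xi a 0 = 0"
 by (simp_all add: xi_def cross_vec.add_right cross_vec.diff_right cross_vec.scaleR_right
 cross_vec.minus_right cross_vec.zero_right)

text \<open>On its block \<open>xi a\<close> is the cross product with a unit vector. The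
  exponential of \<open>s * xi a\<close> therefore closes up after the quadratic term, which gives
  the formula for \<open>rot\<close>.\<close>

lemma xi_cube: "xi a (xi a (xi a x)) = - xi a x"
proof -
 obtain i k where a: "a = (i, k)" by force
 have *: "cross3 e (cross3 e (cross3 e y)) = - (e \<bullet> e) *\<^sub>R cross3 e y" for e y :: "real^3"
 by (simp add: cross3_simps forall_3)
 have e: "(axis k 1 :: real^3) \<bullet> axis k 1 = 1"
 by (simp add: inner_axis_axis)
 show ?thesis
 unfolding blk_eq_iff xi_def a by (simp add: * e)
qed

lemma sum_xi: "(SUM a:UNIV. w $ a *\<^sub>R xi a x) = cross_vec w x"
proof -
 have "w = (SUM a:UNIV. w $ a *\<^sub>R axis a 1)"
 by (simp add: vec_eq_iff axis_def if_distrib cong: if_cong)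
 then have "cross_vec w x = cross_vec (SUM a:UNIV. w $ a *\<^sub>R axis a 1) x" by simp
 then show ?thesis by (simp add: xi_def cross_vec.sum_left cross_vec.scaleR_left)
qed

lemma inner_xi: "v \<bullet> xi a x = cross_vec x v $ a"
 unfolding xi_def by (subst inner_commute, subst inner_cross_vec) (simp add: inner_axis')

text \<open>The 3N fields are redundant on a tangent space of dimension 2N, but they form a Parseval
  frame there: the sum collapses to \<open>cross_vec (cross_vec x v) x\<close>, which is
  \<open>v\<close> when the blocks of \<open>x\<close> are unit vectors. This replaces charts and
  local orthonormal frames.\<close>

lemma tangent_frame:
 assumes "x:Mfd" "v:tangent x"
 shows "(SUM a:UNIV. (v \<bullet> xi a x) *\<^sub>R xi a x) = v"
 unfolding inner_xi sum_xi using cross_vec_cross_vec_tangent[OF assms] .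

lemma norm_xi_le: "x:Mfd ==> norm (xi a x) <= 1"
 unfolding xi_def using norm_cross_vec_le[of x "axis a 1"] by simp

text \<open>Rodrigues' formula for the exponential of \<open>s * xi a\<close>, as a linear map of
  the whole space, so that it acts on polynomials.\<close>

definition rot :: "'n \<times> 3 => real => 'n::finite vec3 => 'n vec3" where
 "rot a s x = x + sin s *\<^sub>R xi a x + (1 - cos s) *\<^sub>R xi a (xi a x)"

lemma linear_rot: "linear (rot a s)"
 by (rule linearI) (simp_all add: rot_def xi_simps algebra_simps)

lemma bounded_linear_rot: "bounded_linear (rot a s)"
 using linear_conv_bounded_linear linear_rot by blast

lemma xi_rot: "xi a (rot a s x) = cos s *\<^sub>R xi a x + sin s *\<^sub>R xi a (xi a x)"
 by (simp add: rot_def xi_simps xi_cube algebra_simps)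

lemma rot_0 [simp]: "rot a 0 x = x"
 by (simp add: rot_def)

lemma rot_rot: "rot a s (rot a t x) = rot a (s + t) x"
proof -
 have "rot a s (rot a t x) = rot a t x + sin s *\<^sub>R xi a (rot a t x) + (1 - cos s) *\<^sub>R xi a (xi a (rot a t x))"
 by (simp add: rot_def)
 also have "... = x + (sin t + sin s * cos t - (1 - cos s) * sin t) *\<^sub>R xi a x
 + (1 - cos t + sin s * sin t + (1 - cos s) * cos t) *\<^sub>R xi a (xi a x)"
 unfolding xi_rot xi_simps xi_cube by (simp add: rot_def algebra_simps)
 also have "... = rot a (s + t) x"
 unfolding rot_def sin_add cos_add by (simp add: algebra_simps)
 finally show ?thesis .
qed

lemma rot_inverse [simp]: "rot a s (rot a (- s) x) = x" "rot a (- s) (rot a s x) = x"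
 by (simp_all add: rot_rot)

lemma has_vector_derivative_rot:
 "((%s. rot a s x) has_vector_derivative xi a (rot a s x)) (at s within S)"
 unfolding xi_rot unfolding rot_def
 by (auto intro!: derivative_eq_intros)

text \<open>\<open>xi a\<close> is a derivation of the cross product (Jacobi identity), so the
  product of the rotated vectors, pulled back by \<open>rot a (- s)\<close>, has derivative zero in
  \<open>s\<close>. It follows that rotations permute the fields \<open>cross_vec om\<close> among
  themselves.\<close>

lemma rot_cross_vec: "rot a s (cross_vec u v) = cross_vec (rot a s u) (rot a s v)"
proof -
 define c where "c s = cross_vec (rot a s u) (rot a s v)" for s
 \<comment> \<open>This is \<open>rot a (- s) (c s)\<close> written out, so that the product rule
   applies term by term.\<close>
 define F where "F s = c s - sin s *\<^sub>R xi a (c s) + (1 - cos s) *\<^sub>R xi a (xi a (c s))" for s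
 have F: "F s = rot a (- s) (c s)" for s
 by (simp add: F_def rot_def)
 have c: "(c has_vector_derivative xi a (c s)) (at s)" for s
 proof -
 have "((%s. cross_vec (rot a s u) (rot a s v)) has_derivative
 (%h. cross_vec (rot a s u) (h *\<^sub>R xi a (rot a s v)) + cross_vec (h *\<^sub>R xi a (rot a s u)) (rot a s v))) (at s)"
 by (rule cross_vec.FDERIV; rule has_vector_derivative_rot[unfolded has_vector_derivative_def])
 moreover have "(%h. cross_vec (rot a s u) (h *\<^sub>R xi a (rot a s v)) + cross_vec (h *\<^sub>R xi a (rot a s u)) (rot a s v))
 = (%h. h *\<^sub>R xi a (c s))"
 unfolding c_def xi_def
 by (simp add: fun_eq_iff cross_vec_jacobi[of "axis a 1"] cross_vec.scaleR_left cross_vec.scaleR_right scaleR_add_right)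
 ultimately show ?thesis
 by (simp add: has_vector_derivative_def c_def[abs_def])
 qed
 have c1: "((%s. xi a (c s)) has_vector_derivative xi a (xi a (c s))) (at s)" for s
 by (rule bounded_linear.has_vector_derivative[OF bounded_linear_xi c])
 have c2: "((%s. xi a (xi a (c s))) has_vector_derivative - xi a (c s)) (at s)" for s
 by (rule has_vector_derivative_eq_rhs[OF bounded_linear.has_vector_derivative[OF bounded_linear_xi c1]])
 (simp add: xi_cube)
 have "(F has_vector_derivative 0) (at s)" for s
 proof -
 have "(F has_vector_derivative
 (xi a (c s) - (sin s *\<^sub>R xi a (xi a (c s)) + cos s *\<^sub>R xi a (c s))
 + ((1 - cos s) *\<^sub>R (- xi a (c s)) + sin s *\<^sub>R xi a (xi a (c s))))) (at s)"
 unfolding F_def[abs_def]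
 by (intro has_vector_derivative_add has_vector_derivative_diff has_vector_derivative_scaleR c c1 c2)
 (auto intro!: derivative_eq_intros)
 then show ?thesis by (simp add: algebra_simps)
 qed
 then have "F s = F 0"
 using has_vector_derivative_zero_constant[of UNIV F] by (metis UNIV_I convex_UNIV)
 then have "rot a s (F s) = rot a s (cross_vec u v)"
 by (simp add: F_def c_def)
 then show ?thesis by (simp add: F c_def)
qed

lemma rot_blk_norm [simp]: "norm (blk (rot a s x) i) = norm (blk x i)"
proof -
 obtain j k where a: "a = (j, k)" by force
 have sc: "cos s * cos s = 1 - sin s * sin s" using sin_cos_squared_add[of s] by (simp add: power2_eq_square)
 let ?y = "blk x i" and ?e = "if i = j then axis k 1 else 0 :: real^3"
 have "?e \<bullet> ?e = 1 \<or> ?e = 0" by (auto simp: inner_axis_axis)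
 moreover have "(y + s' *\<^sub>R cross3 e y + (1 - c) *\<^sub>R cross3 e (cross3 e y)) \<bullet> (y + s' *\<^sub>R cross3 e y + (1 - c) *\<^sub>R cross3 e (cross3 e y)) = y \<bullet> y"
 if "e \<bullet> e = 1" "c * c = 1 - s' * s'" for e y :: "real^3" and c s'
 proof -
 let ?u = "cross3 e y" and ?v = "cross3 e (cross3 e y)"
 have 1: "y \<bullet> ?u = 0" "?u \<bullet> ?v = 0" by (simp_all add: dot_cross_self)
 have 2: "y \<bullet> ?v = - (?u \<bullet> ?u)" by (simp add: cross3_simps)
 have 3: "?v \<bullet> ?v = (e \<bullet> e) * (?u \<bullet> ?u)"
 using norm_cross_dot[of e ?u] by (simp add: dot_cross_self power_mult_distrib power2_norm_eq_inner)
 have "(y + s' *\<^sub>R ?u + (1 - c) *\<^sub>R ?v) \<bullet> (y + s' *\<^sub>R ?u + (1 - c) *\<^sub>R ?v)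
 = y \<bullet> y + s' * s' * (?u \<bullet> ?u) + (1 - c) * (1 - c) * (?v \<bullet> ?v) + 2 * s' * (y \<bullet> ?u)
 + 2 * (1 - c) * (y \<bullet> ?v) + 2 * s' * (1 - c) * (?u \<bullet> ?v)"
 by (simp add: inner_add_left inner_add_right inner_commute algebra_simps)
 also have "... = y \<bullet> y + (s' * s' + (1 - c) * (1 - c) - 2 * (1 - c)) * (?u \<bullet> ?u)"
 unfolding 1 2 3 that by (simp add: algebra_simps)
 also have "s' * s' + (1 - c) * (1 - c) - 2 * (1 - c) = 0"
 using that by (simp add: algebra_simps)
 finally show ?thesis by simp
 qed
 ultimately have "blk (rot a s x) i \<bullet> blk (rot a s x) i = ?y \<bullet> ?y"
 using sc by (auto simp: rot_def xi_def a)
 then show ?thesis by (simp add: norm_eq)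
qed

lemma norm_rot [simp]: "norm (rot a s x) = norm x"
 unfolding norm_eq inner_blk
 by (intro sum.cong refl) (use rot_blk_norm[of a s x] in \<open>simp only: norm_eq\<close>)

lemma rot_Mfd [simp]: "rot a s x:Mfd \<longleftrightarrow> x:Mfd"
 by (simp add: Mfd_def)

lemma continuous_on_blk [continuous_intros]: "continuous_on S f ==> continuous_on S (%x. blk (f x) i)"
 unfolding blk_def by (intro continuous_intros)

lemma compact_Mfd: "compact (Mfd :: 'n::finite vec3 set)"
proof -
 have eq: "Mfd = (\<Inter>i. {x :: 'n vec3. norm (blk x i) = 1})" by (auto simp: Mfd_def)
 have "closed (Mfd :: 'n vec3 set)"
 unfolding eq
 by (intro closed_INT ballI closed_Collect_eq continuous_intros)
 moreover have "bounded (Mfd :: 'n vec3 set)"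
 proof (rule boundedI)
 fix x :: "'n vec3" assume "x:Mfd"
 then have "x \<bullet> x = CARD('n)" by (simp add: inner_blk Mfd_def norm_eq_1)
 then show "norm x <= sqrt CARD('n)" by (simp add: norm_eq_sqrt_inner)
 qed
 ultimately show ?thesis by (simp add: compact_eq_bounded_closed)
qed

lemma norm_Mfd: "x:Mfd ==> (norm x)^2 = CARD('n)" for x :: "'n::finite vec3"
 by (simp add: power2_norm_eq_inner inner_blk Mfd_def norm_eq_1)

lemma Mfd_nonempty: "(Mfd :: 'n::finite vec3 set) \<noteq> {}"
proof -
 have "(\<chi> p. axis 1 1 $ snd p):(Mfd :: 'n vec3 set)"
 by (simp add: Mfd_def blk_def)
 then show ?thesis by blast
qed

section \<open>Angular derivatives of polynomials\<close>

abbreviation poly_fun :: "('a::real_normed_vector => real) => bool" where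
 "poly_fun \<equiv> real_polynomial_function"

lemma poly_fun_scale [intro]: "poly_fun f ==> poly_fun (%x. c * f x)"
 by (rule real_polynomial_function.intros(4)[OF real_polynomial_function.intros(2)])

text \<open>Derivative along the rotation field of \<open>om\<close>, which is tangent to
  \<open>Mfd\<close>. It is taken in the ambient space, which is meaningful for polynomials; on
  \<open>Mfd\<close> it depends on the restriction to \<open>Mfd\<close> alone.\<close>

definition Rd :: "'n::finite vec3 => ('n vec3 => real) => 'n vec3 => real" where
 "Rd om f x = frechet_derivative f (at x) (cross_vec om x)"

lemma poly_fun_differentiable:
 "poly_fun f ==> (f has_derivative frechet_derivative f (at x)) (at x within S)"
 using differentiable_at_real_polynomial_function frechet_derivative_works has_derivative_at_withinI by blast

lemma Rd_eqI: "(f has_derivative f') (at x) ==> Rd om f x = f' (cross_vec om x)"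
 unfolding Rd_def using frechet_derivative_at by metis

lemma Rd_const [simp]: "Rd om (%x. c) = (%x. 0)"
 by (rule ext, subst Rd_eqI[OF has_derivative_const]) auto

lemma Rd_linear: "bounded_linear f ==> Rd om f = (%x. f (cross_vec om x))"
 by (rule ext, rule Rd_eqI, rule bounded_linear_imp_has_derivative)

lemma Rd_add: "poly_fun f ==> poly_fun g ==> Rd om (%x. f x + g x) = (%x. Rd om f x + Rd om g x)"
 by (rule ext, subst Rd_eqI[OF has_derivative_add[OF poly_fun_differentiable poly_fun_differentiable]])
 (auto simp: Rd_def)

lemma Rd_mult: "poly_fun f ==> poly_fun g ==> Rd om (%x. f x * g x) = (%x. Rd om f x * g x + f x * Rd om g x)"
 by (rule ext, subst Rd_eqI[OF has_derivative_mult[OF poly_fun_differentiable poly_fun_differentiable]])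
 (auto simp: Rd_def)

lemma Rd_scale: "poly_fun f ==> Rd om (%x. c * f x) = (%x. c * Rd om f x)"
 by (subst Rd_mult) auto

lemma poly_fun_Rd [intro]: "poly_fun f ==> poly_fun (Rd om f)"
proof (induction f rule: real_polynomial_function.induct)
 case (linear f)
 then show ?case
 unfolding Rd_linear[OF linear]
 using bounded_linear_compose[OF linear cross_vec.bounded_linear_right] by blast
qed (auto simp: Rd_add Rd_mult)

lemma Rd_sum:
 "finite I ==> (!!i. i:I ==> poly_fun (f i)) ==> Rd om (%x. SUM i:I. f i x) = (%x. SUM i:I. Rd om (f i) x)"
proof (induction I rule: finite_induct)
 case (insert a I)
 then have "poly_fun (%x. SUM i:I. f i x)" by (intro real_polynomial_function_sum) auto
 with insert show ?case by (simp add: Rd_add)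
qed simp

lemma Rd_direction_linear: "poly_fun f ==> linear (%om. Rd om f x)"
 unfolding Rd_def
 by (rule linear_compose[unfolded o_def, OF bounded_linear.linear[OF cross_vec.bounded_linear_left]])
 (rule has_derivative_linear[OF poly_fun_differentiable])

lemma Rd_axis_sum: "poly_fun f ==> Rd om f x = (SUM a:UNIV. om $ a * Rd (axis a 1) f x)"
proof -
 assume f: "poly_fun f"
 have "om = (SUM a:UNIV. om $ a *\<^sub>R axis a 1)"
 by (simp add: vec_eq_iff axis_def if_distrib cong: if_cong)
 then have "Rd om f x = Rd (SUM a:UNIV. om $ a *\<^sub>R axis a 1) f x" by simp
 then show ?thesis
 by (simp add: linear_sum[OF Rd_direction_linear[OF f]] linear_cmul[OF Rd_direction_linear[OF f]])
qed

lemma poly_fun_rot: "poly_fun f ==> poly_fun (%x. f (rot a s x))"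
 using real_polynomial_function_compose[OF polynomial_function_bounded_linear[OF bounded_linear_rot], of f a s]
 by (simp add: o_def)

text \<open>By \<open>rot_cross_vec\<close>, composing with a rotation merely rotates the direction.
  Since the bounds \<open>wb\<close> admit every direction in the unit ball, they are exactly
  rotation invariant, and stability of the scheme never meets a commutator of two fields.\<close>

lemma Rd_rot: "poly_fun f ==> Rd om (%x. f (rot a s x)) = (%x. Rd (rot a s om) f (rot a s x))"
proof
 fix x assume f: "poly_fun f"
 have "((%x. f (rot a s x)) has_derivative (%v. frechet_derivative f (at (rot a s x)) (rot a s v))) (at x)"
 by (rule has_derivative_compose[OF bounded_linear_imp_has_derivative[OF bounded_linear_rot] poly_fun_differentiable[OF f]])
 from Rd_eqI[OF this] show "Rd om (%x. f (rot a s x)) x = Rd (rot a s om) f (rot a s x)"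
 by (simp add: rot_cross_vec Rd_def)
qed

lemma has_real_derivative_rot:
 assumes "poly_fun f"
 shows "((%s. f (rot a s x)) has_real_derivative Rd (axis a 1) f (rot a s x)) (at s)"
proof -
 have "((%s. f (rot a s x)) has_derivative (%h. frechet_derivative f (at (rot a s x)) (h *\<^sub>R xi a (rot a s x)))) (at s)"
 by (rule has_derivative_compose[OF has_vector_derivative_rot[unfolded has_vector_derivative_def] poly_fun_differentiable[OF assms]])
 moreover have "linear (frechet_derivative f (at (rot a s x)))"
 by (rule has_derivative_linear[OF poly_fun_differentiable[OF assms]])
 ultimately show ?thesis
 unfolding has_field_derivative_def Rd_def xi_def
 by (simp add: linear_cmul mult.commute[of _ "frechet_derivative f (at (rot a s x)) (cross_vec (axis a 1) (rot a s x))"])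
qed

section \<open>Words of angular derivatives and uniform bounds on them\<close>

fun Rw :: "'n::finite vec3 list => ('n vec3 => real) => 'n vec3 => real" where
 "Rw [] f = f" |
 "Rw (om # ws) f = Rw ws (Rd om f)"

lemma poly_fun_Rw [intro]: "poly_fun f ==> poly_fun (Rw ws f)"
 by (induction ws arbitrary: f) auto

lemma Rw_add: "poly_fun f ==> poly_fun g ==> Rw ws (%x. f x + g x) = (%x. Rw ws f x + Rw ws g x)"
 by (induction ws arbitrary: f g) (auto simp: Rd_add poly_fun_Rd)

lemma Rw_scale: "poly_fun f ==> Rw ws (%x. c * f x) = (%x. c * Rw ws f x)"
 by (induction ws arbitrary: f) (auto simp: Rd_scale poly_fun_Rd)

lemma Rw_diff: "poly_fun f ==> poly_fun g ==> Rw ws (%x. f x - g x) = (%x. Rw ws f x - Rw ws g x)"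
 using Rw_add[of f "%x. (-1) * g x" ws] Rw_scale[of g ws "-1"] by auto

lemma Rw_sum:
 "finite I ==> (!!i. i:I ==> poly_fun (f i)) ==> Rw ws (%x. SUM i:I. f i x) = (%x. SUM i:I. Rw ws (f i) x)"
proof (induction ws arbitrary: f)
 case (Cons w ws)
 then show ?case by (simp add: Rd_sum poly_fun_Rd)
qed simp

lemma Rw_rot: "poly_fun f ==> Rw ws (%x. f (rot a s x)) = (%x. Rw (map (rot a s) ws) f (rot a s x))"
 by (induction ws arbitrary: f) (auto simp: Rd_rot poly_fun_Rd)

definition unit_word :: "nat => 'n::finite vec3 list => bool" where
 "unit_word k ws \<longleftrightarrow> length ws <= k & (ALL om:set ws. norm om <= 1)"

lemma unit_word_simps [simp]:
 "unit_word k []" "unit_word 0 ws \<longleftrightarrow> ws = []"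
 "unit_word (Suc k) (om # ws) \<longleftrightarrow> norm om <= 1 & unit_word k ws"
 by (auto simp: unit_word_def)

lemma unit_word_rot [simp]: "unit_word k (map (rot a s) ws) \<longleftrightarrow> unit_word k ws"
 by (simp add: unit_word_def)

lemma unit_word_mono: "unit_word j ws ==> j <= k ==> unit_word k ws"
 by (auto simp: unit_word_def)

text \<open>A bound in the \<open>C\<^sup>k\<close> norm. Words range over all \<open>om\<close> in the unit ball, not only over the basis
 vectors, so that the norm is invariant under rotations.\<close>

definition wb :: "nat => ('n::finite vec3 => real) => real => bool" where
 "wb k f K \<longleftrightarrow> (ALL ws. unit_word k ws --> (ALL x:Mfd. \<bar>Rw ws f x\<bar> <= K))"

lemma wbD: "wb k f K ==> unit_word k ws ==> x:Mfd ==> \<bar>Rw ws f x\<bar> <= K"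
 by (auto simp: wb_def)

lemma wb_mono: "wb k f K ==> j <= k ==> K <= L ==> wb j f L"
 unfolding wb_def by (meson order_trans unit_word_mono)

lemma wb_nonneg: "wb k f K ==> 0 <= K" for f :: "'n::finite vec3 => real"
proof -
 obtain x :: "'n vec3" where x: "x:Mfd" using Mfd_nonempty by blast
 assume "wb k f K"
 from wbD[OF this _ x, of "[]"] have "\<bar>f x\<bar> <= K" by simp
 then show ?thesis using abs_ge_zero order_trans by blast
qed

lemma wb_0: "wb 0 f K \<longleftrightarrow> (ALL x:Mfd. \<bar>f x\<bar> <= K)"
 by (simp add: wb_def)

lemma wb_Rd: "wb (Suc k) f K ==> norm om <= 1 ==> wb k (Rd om f) K"
 unfolding wb_def by (metis Rw.simps(2) unit_word_simps(3))

lemma wb_SucI: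
 assumes "wb 0 f K" "!!om. norm om <= 1 ==> wb k (Rd om f) K"
 shows "wb (Suc k) f K"
 unfolding wb_def
proof (intro allI impI ballI)
 fix ws :: "'a vec3 list" and x :: "'a vec3" assume "unit_word (Suc k) ws" "x:Mfd"
 then show "\<bar>Rw ws f x\<bar> <= K"
 using assms by (cases ws) (auto simp: wb_def)
qed

lemma wb_add: "poly_fun f ==> poly_fun g ==> wb k f K ==> wb k g L ==> wb k (%x. f x + g x) (K + L)"
 unfolding wb_def by (auto simp: Rw_add intro!: order_trans[OF abs_triangle_ineq] add_mono)

lemma wb_diff: "poly_fun f ==> poly_fun g ==> wb k f K ==> wb k g L ==> wb k (%x. f x - g x) (K + L)"
 unfolding wb_def by (auto simp: Rw_diff intro!: order_trans[OF abs_triangle_ineq4] add_mono)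

lemma wb_scale: "poly_fun f ==> wb k f K ==> wb k (%x. c * f x) (\<bar>c\<bar> * K)"
 unfolding wb_def by (auto simp: Rw_scale abs_mult intro!: mult_left_mono)

lemma wb_sum:
 "finite I ==> (!!i. i:I ==> poly_fun (f i)) ==> (!!i. i:I ==> wb k (f i) (K i))
 ==> wb k (%x. SUM i:I. f i x) (SUM i:I. K i)"
 unfolding wb_def by (auto simp: Rw_sum intro!: order_trans[OF sum_abs] sum_mono)

lemma wb_rot: "poly_fun f ==> wb k f K ==> wb k (%x. f (rot a s x)) K"
 unfolding wb_def by (auto simp: Rw_rot)

lemma continuous_on_poly_fun: "poly_fun f ==> continuous_on S f"
 by (simp add: continuous_on_polymonial_function real_polynomial_function_eq)

text \<open>Linearity in the direction reduces the infinitely many words to words in the axes, and a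
  polynomial is bounded on the compact set \<open>Mfd\<close>.\<close>

lemma wb_exists: "poly_fun f ==> EX K. wb k f K" for f :: "'n::finite vec3 => real"
proof (induction k arbitrary: f)
 case 0
 have "compact (f ` Mfd)"
 using continuous_on_poly_fun[OF 0] compact_Mfd compact_continuous_image by blast
 then obtain K where "ALL y:f ` Mfd. norm y <= K"
 using compact_imp_bounded bounded_iff by blast
 then show ?case unfolding wb_0 by auto
next
 case (Suc k)
 have "EX K. ALL a. wb k (Rd (axis a 1) f) (K a)"
 by (intro choice allI Suc.IH poly_fun_Rd Suc.prems)
 then obtain K where K: "!!a. wb k (Rd (axis a 1) f) (K a)" by blast
 obtain K0 where "wb k f K0" using Suc.IH[OF Suc.prems] ..
 then have K0: "wb 0 f K0" by (rule wb_mono) auto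
 have nn: "0 <= K a" for a using wb_nonneg[OF K] .
 have "wb (Suc k) f (max K0 (SUM a:UNIV. K a))"
 proof (rule wb_SucI)
 fix om :: "'n vec3" assume om: "norm om <= 1"
 have "wb k (%x. SUM a:UNIV. om $ a * Rd (axis a 1) f x)
 (SUM a:UNIV. \<bar>om $ a\<bar> * K a)"
 by (intro wb_sum wb_scale poly_fun_scale poly_fun_Rd Suc.prems K finite)
 moreover have "(SUM a:UNIV. \<bar>om $ a\<bar> * K a) <= (SUM a:UNIV. K a)"
 by (intro sum_mono mult_left_le_one_le nn) (auto intro: order_trans[OF component_le_norm_cart om])
 moreover have "Rd om f = (%x. SUM a:UNIV. om $ a * Rd (axis a 1) f x)"
 by (rule ext, rule Rd_axis_sum[OF Suc.prems])
 ultimately show "wb k (Rd om f) (max K0 (SUM a:UNIV. K a))"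
 using wb_mono[of k _ "SUM a:UNIV. K a" k "max K0 (SUM a:UNIV. K a)"] wb_mono[of k "Rd om f" "SUM a:UNIV. \<bar>om $ a\<bar> * K a" k "max K0 (SUM a:UNIV. K a)"] by simp
 qed (rule wb_mono[OF K0], auto)
 then show ?case by blast
qed

text \<open>Only proper subwords of \<open>ws\<close> fall on \<open>g\<close> in the error term; this is what lets the drift term of
 the scheme below lose no derivative.\<close>

lemma Rw_mult_error:
 fixes b g :: "'n::finite vec3 => real"
 assumes "poly_fun b" "poly_fun g" "wb k b B" "unit_word k ws" "x:Mfd" "0 <= G"
 and "!!v. unit_word k v ==> length v < length ws ==> \<bar>Rw v g x\<bar> <= G"
 shows "\<bar>Rw ws (%x. b x * g x) x - b x * Rw ws g x\<bar> <= (2 ^ length ws - 1) * B * G"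
 using assms
proof (induction "length ws" arbitrary: ws b g k rule: less_induct)
 case less
 note prems = less.prems(1-7)
 show ?case
 proof (cases ws)
 case (Cons w us)
 obtain j where k: "k = Suc j"
 using prems(4) unfolding Cons by (cases k) simp_all
 have w: "norm w <= 1" "unit_word j us" using prems(4) unfolding Cons k by simp_all
 have B: "0 <= B" using wb_nonneg[OF prems(3)] .
 have b': "poly_fun (Rd w b)" "wb j (Rd w b) B"
 using poly_fun_Rd[OF prems(1)] wb_Rd[OF prems(3)[unfolded k] w(1)] .
 have g': "poly_fun (Rd w g)" using poly_fun_Rd[OF prems(2)] .
 have bj: "wb j b B" using wb_mono[OF prems(3)] k by simp
 have us: "\<bar>Rw us g x\<bar> <= G"
 using prems(7)[of us] w(2) k Cons unit_word_mono[of j us k] by simp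
 have 1: "\<bar>Rw us (%x. Rd w b x * g x) x - Rd w b x * Rw us g x\<bar> <= (2 ^ length us - 1) * B * G"
 proof (rule less.hyps[of us "Rd w b" g j])
 fix v :: "'n vec3 list" assume "unit_word j v" "length v < length us"
 then show "\<bar>Rw v g x\<bar> <= G"
 using prems(7)[of v] k Cons unit_word_mono[of j v "Suc j"] by auto
 qed (fact | simp add: Cons)+
 have 2: "\<bar>Rw us (%x. b x * Rd w g x) x - b x * Rw us (Rd w g) x\<bar> <= (2 ^ length us - 1) * B * G"
 proof (rule less.hyps[of us b "Rd w g" j])
 fix v :: "'n vec3 list" assume "unit_word j v" "length v < length us"
 then show "\<bar>Rw v (Rd w g) x\<bar> <= G"
 using prems(7)[of "w # v"] w k Cons by simp
 qed (fact | simp add: Cons)+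
 have "\<bar>Rd w b x\<bar> <= B"
 using wbD[OF b'(2) unit_word_simps(1) prems(5)] by simp
 then have 3: "\<bar>Rd w b x * Rw us g x\<bar> <= B * G"
 unfolding abs_mult using us B by (intro mult_mono) auto
 have "Rw ws (%x. b x * g x) x - b x * Rw ws g x =
 (Rw us (%x. Rd w b x * g x) x - Rd w b x * Rw us g x) + Rd w b x * Rw us g x
 + (Rw us (%x. b x * Rd w g x) x - b x * Rw us (Rd w g) x)"
 unfolding Cons Rw.simps Rd_mult[OF prems(1,2)]
 Rw_add[OF real_polynomial_function.intros(4)[OF b'(1) prems(2)] real_polynomial_function.intros(4)[OF prems(1) g']]
 by simp
 then have "\<bar>Rw ws (%x. b x * g x) x - b x * Rw ws g x\<bar> <= (2 ^ length us - 1) * B * G + B * G + (2 ^ length us - 1) * B * G"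
 using 1 2 3 by linarith
 also have "... = (2 ^ length ws - 1) * B * G" using Cons by (simp add: algebra_simps)
 finally show ?thesis .
 qed simp
qed

lemma wb_mult:
 assumes "poly_fun b" "poly_fun g" "wb k b B" "wb k g G"
 shows "wb k (%x. b x * g x) (2 ^ k * B * G)"
 unfolding wb_def
proof (intro allI impI ballI)
 fix ws :: "'a vec3 list" and x :: "'a vec3" assume ws: "unit_word k ws" and x: "x:Mfd"
 have nn: "0 <= B" "0 <= G" using assms wb_nonneg by blast+
 have "\<bar>Rw ws (%x. b x * g x) x - b x * Rw ws g x\<bar> <= (2 ^ length ws - 1) * B * G"
 using assms ws x nn by (intro Rw_mult_error) (auto dest: wbD)
 moreover have "\<bar>b x * Rw ws g x\<bar> <= B * G"
 unfolding abs_mult using wbD[OF assms(3), of "[]" x] wbD[OF assms(4) ws x] x nn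
 by (intro mult_mono) auto
 ultimately have "\<bar>Rw ws (%x. b x * g x) x\<bar> <= 2 ^ length ws * B * G"
 by (simp add: algebra_simps abs_le_iff) linarith
 also have "... <= 2 ^ k * B * G"
 using ws nn by (auto simp: unit_word_def intro!: mult_right_mono)
 finally show "\<bar>Rw ws (%x. b x * g x) x\<bar> <= 2 ^ k * B * G" .
qed

text \<open>Finite sums of products \<open>tht(s) f(x)\<close>: for these, differentiation in \<open>s\<close> visibly commutes with \<open>Rw ws\<close>.\<close>

inductive separated :: "(real => 'n::finite vec3 => real) => bool" where
 base: "(!!s. (tht has_real_derivative tht' s) (at s)) ==> poly_fun f ==> separated (%s x. tht s * f x)"
| plus: "separated F ==> separated G ==> separated (%s x. F s x + G s x)"

lemma separated_mult_base:
 assumes "separated F" "!!s. (tht has_real_derivative tht' s) (at s)" "poly_fun f"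
 shows "separated (%s x. (tht s * f x) * F s x)"
 using assms(1)
proof induction
 case (base et et' g)
 have "separated (%s x. (tht s * et s) * (f x * g x))"
 by (rule separated.base[where tht' = "%s. tht' s * et s + tht s * et' s"])
 (use base assms(2,3) in \<open>auto intro!: derivative_eq_intros\<close>)
 then show ?case by (simp add: mult_ac)
next
 case (plus F G)
 show ?case using separated.plus[OF plus.IH] by (simp add: distrib_left)
qed

lemma separated_mult: "separated F ==> separated G ==> separated (%s x. F s x * G s x)"
proof (induction rule: separated.induct)
 case (base tht tht' f)
 then show ?case using separated_mult_base by blast
next
 case (plus F1 F2)
 show ?case using separated.plus[OF plus.IH(1)[OF plus.prems] plus.IH(2)[OF plus.prems]] by (simp add: distrib_right)
qed

lemma separated_poly_rot: "poly_fun f ==> separated (%s x. f (rot a s x))"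
proof (induction f rule: real_polynomial_function.induct)
 case (linear f)
 have 1: "separated (%s x. 1 * f x)"
 by (rule separated.base[where tht' = "%_. 0"]) (use linear in auto)
 have 2: "separated (%s x. sin s * f (xi a x))"
 by (rule separated.base[where tht' = cos])
 (use bounded_linear_compose[OF linear bounded_linear_xi, of a] in \<open>auto intro!: derivative_eq_intros\<close>)
 have 3: "separated (%s x. (1 - cos s) * f (xi a (xi a x)))"
 by (rule separated.base[where tht' = sin])
 (use bounded_linear_compose[OF linear bounded_linear_compose[OF bounded_linear_xi bounded_linear_xi], of a a] in \<open>auto intro!: derivative_eq_intros\<close>)
 have "f (rot a s x) = (1 * f x + sin s * f (xi a x)) + (1 - cos s) * f (xi a (xi a x))" for s x
 by (simp add: rot_def linear_simps[OF linear] algebra_simps)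
 then show ?case using separated.plus[OF separated.plus[OF 1 2] 3] by simp
next
 case (const c)
 show ?case using separated.base[of "%_. 1" "%_. 0" "%_. c"] by auto
qed (auto intro: separated.plus separated_mult)

lemma separated_derivative:
 "separated F ==> EX F'. ALL s. poly_fun (F s) & poly_fun (F' s) &
 (ALL ws x. ((%s. Rw ws (F s) x) has_real_derivative Rw ws (F' s) x) (at s))"
proof (induction rule: separated.induct)
 case (base tht tht' f)
 show ?case
 by (rule exI[of _ "%s x. tht' s * f x"])
 (use base in \<open>auto simp: Rw_scale poly_fun_scale intro: DERIV_cmult_right\<close>)
next
 case (plus F G)
 then obtain F' G' where *: "ALL s. poly_fun (F s) & poly_fun (F' s) &
 (ALL ws x. ((%s. Rw ws (F s) x) has_real_derivative Rw ws (F' s) x) (at s))"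
 "ALL s. poly_fun (G s) & poly_fun (G' s) &
 (ALL ws x. ((%s. Rw ws (G s) x) has_real_derivative Rw ws (G' s) x) (at s))" by blast
 show ?case
 by (rule exI[of _ "%s x. F' s x + G' s x"])
 (use * in \<open>auto simp: Rw_add intro: real_polynomial_function.intros(3) DERIV_add\<close>)
qed

lemma has_real_derivative_Rw_rot:
 assumes f: "poly_fun f"
 shows "((%s. Rw ws (%x. f (rot a s x)) x) has_real_derivative
 Rw ws (%x. Rd (axis a 1) f (rot a s x)) x) (at s)"
proof -
 obtain F' where F': "!!s. poly_fun (F' s)"
 "!!ws x s. ((%s. Rw ws (%x. f (rot a s x)) x) has_real_derivative Rw ws (F' s) x) (at s)"
 using separated_derivative[OF separated_poly_rot[OF f, of a]] by blast
 \<comment> \<open>The abstract derivative is identified through the empty word, for which the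
   derivative in \<open>s\<close> is already known.\<close>
 have "F' s = (%x. Rd (axis a 1) f (rot a s x))"
 proof
 fix x show "F' s x = Rd (axis a 1) f (rot a s x)"
 using DERIV_unique[OF F'(2)[of "[]" x s] ] has_real_derivative_rot[OF f, of a x s] by simp
 qed
 then show ?thesis using F'(2)[of ws x s] by simp
qed

text \<open>Mean value inequality in the angle: the derivative in \<open>s\<close> is one more
  angular derivative at a rotated point, so one order of smoothness buys a factor
  \<open>\<bar>s - t\<bar>\<close>.\<close>

lemma wb_rot_diff:
 assumes f: "poly_fun f" "wb (Suc k) f K"
 shows "wb k (%x. f (rot a s x) - f (rot a t x)) (\<bar>s - t\<bar> * K)"
 unfolding wb_def
proof (intro allI impI ballI)
 fix ws :: "'a vec3 list" and x :: "'a vec3" assume ws: "unit_word k ws" and x: "x:Mfd"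
 have "wb k (%x. Rd (axis a 1) f (rot a r x)) K" for r
 using wb_rot[OF poly_fun_Rd[OF f(1)] wb_Rd[OF f(2)]] by simp
 then have "\<bar>Rw ws (%x. Rd (axis a 1) f (rot a r x)) x\<bar> <= K" for r
 using wbD ws x by blast
 then have "norm (Rw ws (%x. f (rot a s x)) x - Rw ws (%x. f (rot a t x)) x) <= K * norm (s - t)"
 by (intro field_differentiable_bound[OF convex_UNIV has_field_derivative_at_within[OF has_real_derivative_Rw_rot[OF f(1)]]]) auto
 then show "\<bar>Rw ws (%x. f (rot a s x) - f (rot a t x)) x\<bar> <= \<bar>s - t\<bar> * K"
 using f by (simp add: Rw_diff poly_fun_rot mult.commute)
qed

section \<open>A monotone finite difference scheme\<close>

lemma wb_Rd_axis: "wb (Suc k) f K ==> wb k (Rd (axis a 1) f) K"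
 by (rule wb_Rd) auto

text \<open>A quadratic error suffices, although a third derivative would make it cubic: the scheme
  multiplies this difference by \<open>tu / (2 * h tu)\<close>, and \<open>h\<close> is of order
  \<open>sqrt tu\<close>.\<close>

lemma taylor_rot_odd:
 assumes f: "poly_fun f" and K: "wb 2 f K" and x: "x:Mfd"
 shows "\<bar>f (rot a h x) - f (rot a (- h) x) - 2 * h * Rd (axis a 1) f x\<bar> <= h^2 * K"
proof -
 let ?R = "Rd (axis a 1) :: ('a vec3 => real) => _"
 define ph where "ph m s = (?R ^^ m) f (rot a s x)" for m s
 have p: "poly_fun ((?R ^^ m) f)" for m by (induction m) (auto intro: f)
 have d: "DERIV (ph m) t :> ph (Suc m) t" for m t
 unfolding ph_def using has_real_derivative_rot[OF p[of m], of a x t] by simp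
 have "wb 1 (?R f) K" "wb 0 (?R (?R f)) K"
 using wb_Rd_axis[of 1 f K a] wb_Rd_axis[of 0 "?R f" K a] K by (simp_all add: numeral_2_eq_2)
 then have b: "\<bar>ph 2 s\<bar> <= K" for s
 using x by (simp add: ph_def numeral_2_eq_2 wb_0)
 have e0: "ph 0 0 = f x" "ph 1 0 = ?R f x" "ph 0 s = f (rot a s x)" for s
 by (simp_all add: ph_def)
 have t2: "\<bar>f (rot a s x) - (f x + ?R f x * s)\<bar> <= K / 2 * s^2" for s
 proof -
 obtain t where t: "ph 0 s = (SUM m<2. ph m 0 / fact m * s ^ m) + ph 2 t / fact 2 * s ^ 2"
 using Maclaurin_bi_le[of ph "ph 0" 2 s] d by auto
 have "ph 0 s - (f x + ?R f x * s) = ph 2 t / 2 * s^2"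
 unfolding t using e0 by (simp add: eval_nat_numeral fact_numeral)
 then have "\<bar>ph 0 s - (f x + ?R f x * s)\<bar> = \<bar>ph 2 t\<bar> / 2 * s^2"
 by (simp only: abs_mult abs_divide abs_numeral abs_power2)
 also have "... <= K / 2 * s^2"
 using b by (intro mult_right_mono divide_right_mono) auto
 finally show ?thesis by (simp add: e0)
 qed
 have "f (rot a h x) - f (rot a (- h) x) - 2 * h * ?R f x
 = (f (rot a h x) - (f x + ?R f x * h)) - (f (rot a (- h) x) - (f x + ?R f x * (- h)))"
 by (simp add: algebra_simps)
 then have "\<bar>f (rot a h x) - f (rot a (- h) x) - 2 * h * ?R f x\<bar> <= K / 2 * h^2 + K / 2 * h^2"
 using order_trans[OF abs_triangle_ineq4 add_mono[OF t2[of h] t2[of "- h", unfolded power2_minus]]] by (simp only:)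
 then show ?thesis by (simp add: mult.commute)
qed

text \<open>The odd terms of the two expansions cancel and the remainders are of third order. With
  the weight \<open>1 / (2 * M)\<close> the error has order \<open>tu * sqrt tu\<close>; this is
  where three derivatives enter.\<close>

lemma taylor_rot_even:
 assumes f: "poly_fun f" and K: "wb 3 f K" and x: "x:Mfd"
 shows "\<bar>f (rot a h x) + f (rot a (- h) x) - 2 * f x - h^2 * Rd (axis a 1) (Rd (axis a 1) f) x\<bar> <= \<bar>h\<bar> ^ 3 * K"
proof -
 let ?R = "Rd (axis a 1) :: ('a vec3 => real) => _"
 define ph where "ph m s = (?R ^^ m) f (rot a s x)" for m s
 have p: "poly_fun ((?R ^^ m) f)" for m by (induction m) (auto intro: f)
 have d: "DERIV (ph m) t :> ph (Suc m) t" for m t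
 unfolding ph_def using has_real_derivative_rot[OF p[of m], of a x t] by simp
 have "wb 2 (?R f) K" "wb 1 (?R (?R f)) K" "wb 0 (?R (?R (?R f))) K"
 using wb_Rd_axis[of 2 f K a] wb_Rd_axis[of 1 "?R f" K a] wb_Rd_axis[of 0 "?R (?R f)" K a] K
 by (simp_all add: numeral_2_eq_2 numeral_3_eq_3)
 then have b: "\<bar>ph 3 s\<bar> <= K" for s
 using x by (simp add: ph_def numeral_3_eq_3 wb_0)
 have e0: "ph 0 0 = f x" "ph 1 0 = ?R f x" "ph 2 0 = ?R (?R f) x" "ph 0 s = f (rot a s x)" for s
 by (simp_all add: ph_def numeral_2_eq_2)
 have K0: "0 <= K" using K wb_nonneg by blast
 have t3: "\<bar>f (rot a s x) - (f x + ?R f x * s + ?R (?R f) x / 2 * s^2)\<bar> <= K / 6 * \<bar>s\<bar> ^ 3" for s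
 proof -
 obtain t where t: "ph 0 s = (SUM m<3. ph m 0 / fact m * s ^ m) + ph 3 t / fact 3 * s ^ 3"
 using Maclaurin_bi_le[of ph "ph 0" 3 s] d by auto
 have "ph 0 s - (f x + ?R f x * s + ?R (?R f) x / 2 * s^2) = ph 3 t / 6 * s ^ 3"
 unfolding t using e0 by (simp add: eval_nat_numeral fact_numeral)
 then have "\<bar>ph 0 s - (f x + ?R f x * s + ?R (?R f) x / 2 * s^2)\<bar> = \<bar>ph 3 t\<bar> / 6 * \<bar>s\<bar> ^ 3"
 by (simp only: abs_mult power_abs abs_divide abs_numeral)
 also have "... <= K / 6 * \<bar>s\<bar> ^ 3"
 using b by (intro mult_right_mono divide_right_mono) auto
 finally show ?thesis by (simp add: e0)
 qed
 have "f (rot a h x) + f (rot a (- h) x) - 2 * f x - h^2 * ?R (?R f) x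
 = (f (rot a h x) - (f x + ?R f x * h + ?R (?R f) x / 2 * h^2))
 + (f (rot a (- h) x) - (f x + ?R f x * (- h) + ?R (?R f) x / 2 * (- h)^2))"
 by (simp add: algebra_simps)
 then have "\<bar>f (rot a h x) + f (rot a (- h) x) - 2 * f x - h^2 * ?R (?R f) x\<bar> <= K / 6 * \<bar>h\<bar> ^ 3 + K / 6 * \<bar>h\<bar> ^ 3"
 using order_trans[OF abs_triangle_ineq add_mono[OF t3[of h] t3[of "- h", unfolded abs_minus_cancel]]] by (simp only:)
 also have "... <= \<bar>h\<bar> ^ 3 * K" using K0 by (simp add: mult.commute)
 finally show ?thesis .
qed

text \<open>Landau's inequality along the rotation orbits.\<close>

lemma Rd_interpolation:
 assumes f: "poly_fun f" "wb 2 f K" and A: "!!x. x:Mfd ==> \<bar>f x\<bar> <= A * dl^2" and dl: "dl > 0" and x: "x:Mfd"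
 shows "\<bar>Rd (axis a 1) f x\<bar> <= dl * (A + K)"
proof -
 have K: "0 <= K" using wb_nonneg[OF f(2)] .
 have "\<bar>2 * dl * Rd (axis a 1) f x\<bar> <= A * dl^2 + A * dl^2 + dl^2 * K"
 using taylor_rot_odd[OF f x, of a dl] A[of "rot a dl x"] A[of "rot a (- dl) x"] x
 unfolding rot_Mfd by linarith
 also have "... = 2 * dl * (dl * (A + K / 2))" by (simp add: power2_eq_square algebra_simps)
 finally have "2 * dl * \<bar>Rd (axis a 1) f x\<bar> <= 2 * dl * (dl * (A + K / 2))"
 using dl by (simp add: abs_mult)
 then have "\<bar>Rd (axis a 1) f x\<bar> <= dl * (A + K / 2)" using dl by simp
 also have "... <= dl * (A + K)" using dl K by simp
 finally show ?thesis .
qed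

lemma poly_fun_inner: "poly_fun (%x. v \<bullet> x)"
 using real_polynomial_function.intros(1)[OF bounded_linear_inner_right] .

text \<open>The bound is linear in \<open>norm v\<close>, so that a single constant serves the
  time-dependent coefficients \<open>tht t\<close> for all times.\<close>

lemma wb_inner_exists: "EX K>=0. ALL v. wb k (%x::'n::finite vec3. v \<bullet> x) (norm v * K)"
proof -
 have pf: "poly_fun (%x::'n vec3. x $ p)" for p
 by (rule real_polynomial_function.intros(1)[OF bounded_linear_vec_nth])
 have "EX K. ALL p. wb k (%x::'n vec3. x $ p) (K p)"
 by (intro choice allI wb_exists pf)
 then obtain K where K: "!!p. wb k (%x::'n vec3. x $ p) (K p)" by blast
 have "wb k (%x. v \<bullet> x) (norm v * (SUM p:UNIV. K p))" for v :: "'n vec3"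
 proof -
 have "wb k (%x. SUM p:UNIV. v $ p * x $ p) (SUM p:UNIV. \<bar>v $ p\<bar> * K p)"
 by (intro wb_sum wb_scale poly_fun_scale pf K finite)
 then have "wb k (%x. v \<bullet> x) (SUM p:UNIV. \<bar>v $ p\<bar> * K p)" by (simp add: inner_vec_def)
 then show ?thesis
 by (rule wb_mono)
 (auto simp: sum_distrib_left intro!: sum_mono mult_right_mono component_le_norm_cart wb_nonneg[OF K])
 qed
 moreover have "(SUM p:UNIV. K p) >= 0" by (intro sum_nonneg wb_nonneg[OF K])
 ultimately show ?thesis by blast
qed

lemma abs_add3_le: "\<bar>a\<bar> <= A ==> \<bar>b\<bar> <= B ==> \<bar>c\<bar> <= C ==> \<bar>a + b + c\<bar> <= A + B + C" for a b c :: real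
 by linarith

text \<open>The forward equation \<open>u\<^sub>t = kp \<Sum>\<^sub>a R\<^sub>a R\<^sub>a u + \<Sum>\<^sub>a be\<^sub>a R\<^sub>a u + gm u\<close>, where \<open>R\<^sub>a\<close> is the derivative along the
 rotation field \<open>xi a\<close>; \<open>\<Sum>\<^sub>a R\<^sub>a R\<^sub>a\<close> is the Laplace-Beltrami operator.\<close>

locale angular_parabolic =
 fixes kp T :: real and be :: "'n \<times> 3 => 'n::finite vec3 => real"
 and gm0 :: "'n vec3 => real" and tht :: "real => 'n vec3" and \<Lambda> :: real
 assumes kp: "kp > 0" and T: "T > 0" and poly_be: "poly_fun (be a)" and poly_gm0: "poly_fun gm0"
 and lipschitz: "s:{0..T} ==> t:{0..T} ==> norm (tht t - tht s) <= \<Lambda> * \<bar>t - s\<bar>"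
begin

definition gm :: "real => 'n vec3 => real" where "gm t x = gm0 x + tht t \<bullet> x"

definition L :: "real => ('n vec3 => real) => 'n vec3 => real" where
 "L t f x = kp * (SUM a:UNIV. Rd (axis a 1) (Rd (axis a 1) f) x)
 + (SUM a:UNIV. be a x * Rd (axis a 1) f x) + gm t x * f x"

definition M :: real where "M = real CARD('n \<times> 3)"

text \<open>The angle for which \<open>(h tu)^2 / (2 * M) = kp * tu\<close>: the averaged second
  differences then reproduce \<open>tu * kp\<close> times the Laplacian.\<close>

definition h :: "real => real" where "h tu = sqrt (2 * M * kp * tu)"

text \<open>The weights \<open>1/(2M) \<plusminus> tu be\<^sub>a/(2h)\<close> of \<open>f (rot a (\<plusminus>h) x)\<close> are non-negative for small \<open>tu\<close>, because
 \<open>h\<close> is of order \<open>\<surd>tu\<close>.\<close>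

definition S :: "real => real => ('n vec3 => real) => 'n vec3 => real" where
 "S tu t f x = (SUM a:UNIV. 1 / (2 * M) * (f (rot a (h tu) x) + f (rot a (- h tu) x))
 + tu / (2 * h tu) * (be a x * (f (rot a (h tu) x) - f (rot a (- h tu) x))))
 + tu * (gm t x * f x)"

lemma M_ge1: "M >= 1"
proof -
 have "(1::nat) <= CARD('n \<times> 3)"
 using Suc_leI[OF zero_less_card_finite[where 'a = "'n \<times> 3"]] unfolding One_nat_def .
 then show ?thesis unfolding M_def by (metis of_nat_1 of_nat_le_iff)
qed

lemma h_pos: "tu > 0 ==> h tu > 0" and h_square: "tu > 0 ==> (h tu)^2 = 2 * M * kp * tu"
 and h_eq: "tu > 0 ==> h tu = sqrt (2 * M * kp) * sqrt tu"
 unfolding h_def using M_ge1 kp by (simp_all flip: real_sqrt_mult)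

lemma poly_gm: "poly_fun (gm t)"
 unfolding gm_def[abs_def] by (intro real_polynomial_function.intros(3) poly_gm0 poly_fun_inner)

lemma poly_S: "poly_fun f ==> poly_fun (S tu t f)"
 unfolding S_def[abs_def]
 by (intro real_polynomial_function.intros(2-4) real_polynomial_function_sum real_polynomial_function_diff
 poly_be poly_gm poly_fun_rot finite)

lemma S_diff: "S tu t (%x. f x - g x) x = S tu t f x - S tu t g x"
proof -
 have "S tu t f x - S tu t g x = (SUM a:UNIV.
 (1 / (2 * M) * (f (rot a (h tu) x) + f (rot a (- h tu) x))
 + tu / (2 * h tu) * (be a x * (f (rot a (h tu) x) - f (rot a (- h tu) x))))
 - (1 / (2 * M) * (g (rot a (h tu) x) + g (rot a (- h tu) x))
 + tu / (2 * h tu) * (be a x * (g (rot a (h tu) x) - g (rot a (- h tu) x)))))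
 + (tu * (gm t x * f x) - tu * (gm t x * g x))"
 unfolding S_def sum_subtractf by simp
 also have "... = S tu t (%x. f x - g x) x"
 unfolding S_def by (intro arg_cong2[where f = "(+)"] sum.cong refl) (simp_all add: algebra_simps)
 finally show ?thesis by simp
qed

lemma tht_bounded: "EX K>=0. ALL t:{0..T}. norm (tht t) <= K"
proof -
 have "norm (tht t) <= norm (tht 0) + \<bar>\<Lambda>\<bar> * T" if "t:{0..T}" for t
 proof -
 have "norm (tht t) <= norm (tht 0) + norm (tht t - tht 0)" by norm
 also have "norm (tht t - tht 0) <= \<Lambda> * \<bar>t - 0\<bar>" using that T by (intro lipschitz) auto
 also have "\<Lambda> * \<bar>t - 0\<bar> <= \<bar>\<Lambda>\<bar> * T" using that by (intro mult_mono) auto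
 finally show ?thesis by simp
 qed
 moreover have "0 <= norm (tht 0) + \<bar>\<Lambda>\<bar> * T" using T by simp
 ultimately show ?thesis by blast
qed

lemma coefficient_bounds:
 obtains B \<Gamma> where "B >= 0" "\<Gamma> >= 0" "!!a. wb 3 (be a) B" "!!t. t:{0..T} ==> wb 3 (gm t) \<Gamma>"
proof -
 have "EX K. ALL a. wb 3 (be a) (K a)" by (intro choice allI wb_exists poly_be)
 then obtain K where K: "!!a. wb 3 (be a) (K a)" by blast
 have nn: "0 <= K a" for a using wb_nonneg[OF K] .
 have 1: "wb 3 (be a) (SUM a:UNIV. K a)" for a
 by (rule wb_mono[OF K[of a]]) (auto intro!: member_le_sum nn)
 obtain K1 where K1: "K1 >= 0" "!!v. wb 3 (%x::'n vec3. v \<bullet> x) (norm v * K1)" using wb_inner_exists by blast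
 obtain K2 where K2: "K2 >= 0" "!!t. t:{0..T} ==> norm (tht t) <= K2" using tht_bounded by blast
 obtain K3 where K3: "wb 3 gm0 K3" using wb_exists[OF poly_gm0] by blast
 have 2: "wb 3 (gm t) (K3 + K2 * K1)" if "t:{0..T}" for t
 proof -
 have "wb 3 (gm t) (K3 + norm (tht t) * K1)"
 unfolding gm_def[abs_def] by (intro wb_add K3 K1 poly_gm0 poly_fun_inner)
 then show ?thesis by (rule wb_mono) (use K1 K2 that in \<open>auto intro!: mult_right_mono\<close>)
 qed
 show ?thesis
 by (rule that[OF _ _ 1 2]) (use K1 K2 wb_nonneg[OF K3] nn in \<open>auto intro!: sum_nonneg\<close>)
qed

text \<open>Rotations take words to words, so a word applied to \<open>S tu t f\<close> is a
  combination of words of \<open>f\<close> at rotated points, with non-negative weights of total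
  mass 1, plus commutators with the coefficients. The commutator with \<open>be\<close> sees only
  proper subwords of a symmetric difference, hence is of order \<open>h\<close>, and its factor
  \<open>tu / (2 * h tu)\<close> makes it of order \<open>tu\<close>: no derivative is lost. The
  same weights give the minimum principle.\<close>

lemma S_stable:
 "EX C>=0. EX tu0>0. tu0 <= 1 & (ALL tu t f k K. 0 < tu & tu <= tu0 & t:{0..T} & poly_fun f & k <= 3 & wb k f K -->
 wb k (S tu t f) (exp (C * tu) * K)
 & ((ALL t:{0..T}. ALL x:Mfd. 0 <= gm t x) -->
 (ALL m>=0. (ALL x:Mfd. m <= f x) --> (ALL x:Mfd. m <= S tu t f x))))"
proof -
 obtain B \<Gamma> where B: "B >= 0" "\<Gamma> >= 0" "!!a. wb 3 (be a) B" "!!t. t:{0..T} ==> wb 3 (gm t) \<Gamma>"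
 using coefficient_bounds by metis
 \<comment> \<open>For words of length at most 3 the product rule costs \<open>2 ^ 3 - 1\<close> in
   the commutator, rounded up to 8, and \<open>2 ^ 3\<close> in the zeroth-order term.\<close>
 define C where "C = 8 * M * B + 8 * \<Gamma>"
 \<comment> \<open>Ensures \<open>q * B <= 1 / (2 * M)\<close>, that is, non-negative weights; after
   squaring this reads \<open>tu * M * B^2 <= 2 * kp\<close>. The \<open>+ 1\<close> covers the case
   \<open>B = 0\<close>.\<close>
 define tu0 where "tu0 = min 1 (2 * kp / (M * B^2 + 1))"
 have MB: "M * B^2 + 1 > 0" using M_ge1 by (simp add: add_nonneg_pos)
 have C: "C >= 0" using B M_ge1 by (simp add: C_def)
 have tu0: "tu0 > 0" using MB kp B by (simp add: tu0_def)
 { fix tu t :: real and f :: "'n vec3 => real" and k :: nat and K :: real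
 assume tu: "0 < tu" "tu <= tu0" and t: "t:{0..T}" and f: "poly_fun f" "wb k f K" and k: "k <= (3::nat)"
 have K: "0 <= K" using wb_nonneg[OF f(2)] .
 define q where "q = tu / (2 * h tu)"
 have hp: "h tu > 0" using h_pos tu by blast
 have q: "q >= 0" using tu hp by (simp add: q_def)
 have "tu * (M * B^2 + 1) <= 2 * kp" using tu MB by (simp add: tu0_def pos_le_divide_eq)
 then have "tu * (M * B^2) <= 2 * kp" using tu by (simp add: algebra_simps)
 then have "M * tu * (tu * (M * B^2)) <= M * tu * (2 * kp)"
 using M_ge1 tu by (intro mult_left_mono) auto
 then have "(M * tu * B)^2 <= (h tu)^2"
 using h_square[OF tu(1)] by (simp add: power_mult_distrib power2_eq_square algebra_simps)
 then have "M * tu * B <= h tu" using hp power2_le_imp_le by (meson less_imp_le)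
 then have qB: "q * B <= 1 / (2 * M)"
 using hp M_ge1 by (simp add: q_def field_simps)
 have qbe: "\<bar>q * be a x\<bar> <= 1 / (2 * M)" if "x:Mfd" for a x
 proof -
 have "\<bar>be a x\<bar> <= B" using wbD[OF B(3) unit_word_simps(1) that] by simp
 then have "q * \<bar>be a x\<bar> <= q * B" using q by (rule mult_left_mono)
 then show ?thesis using qB q by (simp add: abs_mult)
 qed
 have sumM: "(SUM a:(UNIV::('n\<times>3) set). c / M) = c" for c
 using M_ge1 by (simp add: M_def)
 have sumM': "(SUM a:(UNIV::('n\<times>3) set). c) = M * c" for c
 by (simp add: M_def)
 have stab: "wb k (S tu t f) (exp (C * tu) * K)"
 unfolding wb_def
 proof (intro allI impI ballI)
 fix ws :: "'n vec3 list" and x :: "'n vec3" assume ws: "unit_word k ws" and x: "x:Mfd"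
 define P where "P a = Rw ws (%x. f (rot a (h tu) x)) x" for a
 define N where "N a = Rw ws (%x. f (rot a (- h tu) x)) x" for a
 define g where "g a x = f (rot a (h tu) x) - f (rot a (- h tu) x)" for a x
 have g: "poly_fun (g a)" for a
 unfolding g_def[abs_def] by (intro real_polynomial_function_diff poly_fun_rot f)
 have Rg: "Rw ws (g a) x = P a - N a" for a
 unfolding g_def[abs_def] P_def N_def using f by (simp add: Rw_diff poly_fun_rot)
 have PN: "\<bar>P a\<bar> <= K" "\<bar>N a\<bar> <= K" for a
 unfolding P_def N_def using wbD[OF wb_rot[OF f] ws x] by auto
 \<comment> \<open>The commutator of the word with the coefficient \<open>be a\<close>; what remains
   keeps the convex weights.\<close>
 define e where "e a = Rw ws (%x. be a x * g a x) x - be a x * (P a - N a)" for a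
 have e: "\<bar>e a\<bar> <= 7 * B * (2 * h tu * K)" for a
 proof -
 have "\<bar>e a\<bar> <= (2 ^ length ws - 1) * B * (2 * h tu * K)"
 unfolding e_def Rg[symmetric]
 proof (rule Rw_mult_error[OF poly_be g _ ws x])
 show "wb k (be a) B" by (rule wb_mono[OF B(3)]) (use k in auto)
 fix v :: "'n vec3 list" assume v: "unit_word k v" "length v < length ws"
 obtain j where j: "k = Suc j" using v ws by (cases k) (auto simp: unit_word_def)
 have "unit_word j v" using v ws j by (auto simp: unit_word_def)
 moreover have "wb j (g a) (\<bar>h tu - - h tu\<bar> * K)"
 unfolding g_def[abs_def] using wb_rot_diff[of f j K a "h tu" "- h tu"] f j by simp
 ultimately show "\<bar>Rw v (g a) x\<bar> <= 2 * h tu * K"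
 using wbD[of j "g a" "\<bar>h tu - - h tu\<bar> * K" v x] x hp by simp
 qed (use hp K in auto)
 also have "... <= 7 * B * (2 * h tu * K)"
 proof -
 have "(2::real) ^ length ws <= 2 ^ 3" using ws k by (intro power_increasing) (auto simp: unit_word_def)
 then show ?thesis using B hp K by (intro mult_right_mono) auto
 qed
 finally show ?thesis .
 qed
 have c: "\<bar>Rw ws (%x. gm t x * f x) x\<bar> <= 8 * \<Gamma> * K"
 proof -
 have "wb k (gm t) \<Gamma>" by (rule wb_mono[OF B(4)[OF t]]) (use k in auto)
 then have "wb k (%x. gm t x * f x) (2 ^ k * \<Gamma> * K)" using wb_mult[OF poly_gm f(1) _ f(2)] by blast
 then have "\<bar>Rw ws (%x. gm t x * f x) x\<bar> <= 2 ^ k * \<Gamma> * K" using wbD ws x by blast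
 also have "... <= 2 ^ 3 * \<Gamma> * K"
 using k B K by (intro mult_right_mono power_increasing) auto
 finally show ?thesis by simp
 qed
 have eq: "Rw ws (S tu t f) x = (SUM a:UNIV. (1 / (2 * M) + q * be a x) * P a + (1 / (2 * M) - q * be a x) * N a + q * e a)
 + tu * Rw ws (%x. gm t x * f x) x"
 proof -
 have p: "poly_fun (%x. 1 / (2 * M) * (f (rot a (h tu) x) + f (rot a (- h tu) x)))"
 "poly_fun (%x. q * (be a x * g a x))" "poly_fun (%x. be a x * g a x)" "poly_fun (%x. gm t x * f x)"
 "poly_fun (%x. f (rot a (h tu) x) + f (rot a (- h tu) x))" for a
 by (intro real_polynomial_function.intros(2-4) g poly_be poly_gm poly_fun_rot f)+
 have pp: "poly_fun (%x. 1 / (2 * M) * (f (rot a (h tu) x) + f (rot a (- h tu) x)) + q * (be a x * g a x))" for a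
 by (intro real_polynomial_function.intros(3) p)
 have "Rw ws (S tu t f) x = Rw ws (%x. (SUM a:UNIV. 1 / (2 * M) * (f (rot a (h tu) x) + f (rot a (- h tu) x))
 + q * (be a x * g a x)) + tu * (gm t x * f x)) x"
 unfolding S_def[abs_def] q_def g_def ..
 also have "... = (SUM a:UNIV. 1 / (2 * M) * (P a + N a) + q * (Rw ws (%x. be a x * g a x) x)) + tu * Rw ws (%x. gm t x * f x) x"
 unfolding P_def N_def
 by (subst Rw_add, (intro real_polynomial_function_sum pp poly_fun_scale p finite)+,
 subst Rw_sum, (intro finite pp)+, subst Rw_add, (intro p)+, subst (1 2) Rw_scale, (intro p)+,
 subst Rw_add, (intro poly_fun_rot f)+, subst Rw_scale, (intro p)+, rule refl)
 also have "... = (SUM a:UNIV. (1 / (2 * M) + q * be a x) * P a + (1 / (2 * M) - q * be a x) * N a + q * e a)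
 + tu * Rw ws (%x. gm t x * f x) x"
 proof -
 have "1 / (2 * M) * (P a + N a) + q * (Rw ws (%x. be a x * g a x) x)
 = (1 / (2 * M) + q * be a x) * P a + (1 / (2 * M) - q * be a x) * N a + q * e a" for a
 unfolding e_def by (simp add: algebra_simps add_divide_distrib)
 then show ?thesis by (simp only:)
 qed
 finally show ?thesis .
 qed
 have s: "\<bar>(1 / (2 * M) + q * be a x) * P a + (1 / (2 * M) - q * be a x) * N a + q * e a\<bar> <= K / M + 7 * tu * B * K" for a
 proof -
 have w: "0 <= 1 / (2 * M) + q * be a x" "0 <= 1 / (2 * M) - q * be a x" using qbe[OF x, of a] by linarith+
 have "\<bar>(1 / (2 * M) + q * be a x) * P a\<bar> <= (1 / (2 * M) + q * be a x) * K"
 "\<bar>(1 / (2 * M) - q * be a x) * N a\<bar> <= (1 / (2 * M) - q * be a x) * K"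
 using w PN[of a] by (auto simp: abs_mult intro!: mult_left_mono)
 moreover have "\<bar>q * e a\<bar> <= q * (7 * B * (2 * h tu * K))" using q e[of a] by (auto simp: abs_mult intro!: mult_left_mono)
 ultimately have "\<bar>(1 / (2 * M) + q * be a x) * P a + (1 / (2 * M) - q * be a x) * N a + q * e a\<bar>
 <= (1 / (2 * M) + q * be a x) * K + (1 / (2 * M) - q * be a x) * K + q * (7 * B * (2 * h tu * K))"
 by (rule abs_add3_le)
 moreover have "q * (7 * B * (2 * h tu * K)) = 7 * tu * B * K" using hp by (simp add: q_def)
 moreover have "(1 / (2 * M) + q * be a x) * K + (1 / (2 * M) - q * be a x) * K = K / M"
 using M_ge1 by (simp add: field_simps)
 ultimately show ?thesis by (simp only:)
 qed
 have t1: "\<bar>tu * Rw ws (%x. gm t x * f x) x\<bar> <= tu * (8 * \<Gamma> * K)"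
 using c tu by (auto simp: abs_mult intro!: mult_left_mono)
 have t2: "\<bar>SUM a:UNIV. (1 / (2 * M) + q * be a x) * P a + (1 / (2 * M) - q * be a x) * N a + q * e a\<bar>
 <= (SUM a:(UNIV::('n\<times>3) set). K / M + 7 * tu * B * K)"
 by (rule order_trans[OF sum_abs sum_mono[OF s]])
 have "\<bar>Rw ws (S tu t f) x\<bar> <= (SUM a:(UNIV::('n\<times>3) set). K / M + 7 * tu * B * K) + tu * (8 * \<Gamma> * K)"
 unfolding eq by (rule order_trans[OF abs_triangle_ineq add_mono[OF t2 t1]])
 also have "... = K + (7 * M * B + 8 * \<Gamma>) * tu * K"
 unfolding sum.distrib sumM sumM' by (simp add: algebra_simps)
 also have "... <= K + C * tu * K"
 proof -
 have "7 * M * B + 8 * \<Gamma> <= C" unfolding C_def using B(1) M_ge1 by (simp add: mult_right_mono)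
 then show ?thesis using tu K by (intro add_left_mono mult_right_mono) auto
 qed
 also have "... = (1 + C * tu) * K" by (simp add: algebra_simps)
 also have "... <= exp (C * tu) * K" using K by (intro mult_right_mono exp_ge_add_one_self)
 finally show "\<bar>Rw ws (S tu t f) x\<bar> <= exp (C * tu) * K" .
 qed
 \<comment> \<open>A convex combination of values not below \<open>m\<close> is not below
   \<open>m\<close>, and the zeroth-order term is non-negative because \<open>gm\<close> is and
   \<open>0 <= m <= f\<close>.\<close>
 have low: "m <= S tu t f x" if gmnn: "ALL t:{0..T}. ALL x:Mfd. 0 <= gm t x"
 and m: "m >= 0" "ALL x:Mfd. m <= f x" and x: "x:Mfd" for m x
 proof -
 have "1 / M * m <= 1 / (2 * M) * (f (rot a (h tu) x) + f (rot a (- h tu) x))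
 + q * (be a x * (f (rot a (h tu) x) - f (rot a (- h tu) x)))" for a
 proof -
 have w: "0 <= 1 / (2 * M) + q * be a x" "0 <= 1 / (2 * M) - q * be a x" using qbe[OF x, of a] by linarith+
 have "(1 / (2 * M) + q * be a x) * m + (1 / (2 * M) - q * be a x) * m
 <= (1 / (2 * M) + q * be a x) * f (rot a (h tu) x) + (1 / (2 * M) - q * be a x) * f (rot a (- h tu) x)"
 using w m x by (intro add_mono mult_left_mono) auto
 moreover have "(1 / (2 * M) + q * be a x) * m + (1 / (2 * M) - q * be a x) * m = 1 / M * m"
 using M_ge1 by (simp add: field_simps)
 ultimately show ?thesis by (simp add: algebra_simps)
 qed
 then have "(SUM a:(UNIV::('n\<times>3) set). 1 / M * m) <= (SUM a:UNIV. 1 / (2 * M) * (f (rot a (h tu) x) + f (rot a (- h tu) x))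
 + q * (be a x * (f (rot a (h tu) x) - f (rot a (- h tu) x))))"
 by (intro sum_mono)
 then have 1: "m <= S tu t f x - tu * (gm t x * f x)"
 unfolding S_def q_def[symmetric] using sumM[of m] by simp
 moreover have "0 <= tu * (gm t x * f x)"
 proof -
 have "0 <= f x" using m x by (meson order_trans)
 moreover have "0 <= gm t x" using gmnn t x by blast
 ultimately show ?thesis using tu by simp
 qed
 ultimately show ?thesis by linarith
 qed
 have "wb k (S tu t f) (exp (C * tu) * K) & ((ALL t:{0..T}. ALL x:Mfd. 0 <= gm t x) -->
 (ALL m>=0. (ALL x:Mfd. m <= f x) --> (ALL x:Mfd. m <= S tu t f x)))"
 using stab low by blast
 } note main = this
 have "tu0 <= 1" by (simp add: tu0_def)
 then have "0 <= C & 0 < tu0 & tu0 <= 1" using C tu0 by simp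
 moreover have "ALL tu t f k K. 0 < tu & tu <= tu0 & t:{0..T} & poly_fun f & k <= 3 & wb k f K -->
 wb k (S tu t f) (exp (C * tu) * K)
 & ((ALL t:{0..T}. ALL x:Mfd. 0 <= gm t x) -->
 (ALL m>=0. (ALL x:Mfd. m <= f x) --> (ALL x:Mfd. m <= S tu t f x)))"
 by (intro allI impI, elim conjE, rule main)
 ultimately show ?thesis by blast
qed


text \<open>Trading one derivative for the angle \<open>h\<close> gives a rate of only
  \<open>sqrt tu\<close>, but for two derivatives of the difference; the rate \<open>tu\<close>
  would cost a fourth derivative. In \<open>S_two_step\<close> this estimate is multiplied by a
  further \<open>tu\<close>, so the weaker rate is enough.\<close>

lemma S_minus_id:
 "EX C>=0. ALL tu t f K. 0 < tu & tu <= 1 & t:{0..T} & poly_fun f & wb 3 f K -->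
 wb 2 (%x. S tu t f x - f x) (C * sqrt tu * K)"
proof -
 obtain B \<Gamma> where B: "B >= 0" "\<Gamma> >= 0" "!!a. wb 3 (be a) B" "!!t. t:{0..T} ==> wb 3 (gm t) \<Gamma>"
 using coefficient_bounds by metis
 define C where "C = sqrt (2 * M * kp) + 4 * M * B + 4 * \<Gamma>"
 have C: "C >= 0" using B M_ge1 kp by (simp add: C_def)
 have "wb 2 (%x. S tu t f x - f x) (C * sqrt tu * K)"
 if tu: "0 < tu" "tu <= 1" and t: "t:{0..T}" and f: "poly_fun f" "wb 3 f K" for tu t f K
 proof -
 have K: "0 <= K" using wb_nonneg[OF f(2)] .
 define q where "q = tu / (2 * h tu)"
 have hp: "h tu > 0" using h_pos tu by blast
 have q: "q >= 0" "q * h tu = tu / 2" using tu hp by (auto simp add: q_def)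
 define D where "D a s s' x = f (rot a s x) - f (rot a s' x)" for a s s' x
 have D: "poly_fun (D a s s')" "wb 2 (D a s s') (\<bar>s - s'\<bar> * K)" for a s s'
 unfolding D_def[abs_def] using f wb_rot_diff[of f 2 K a s s']
 by (simp_all add: real_polynomial_function_diff poly_fun_rot numeral_3_eq_3 numeral_2_eq_2)
 \<comment> \<open>The identity is spread as \<open>f x / M\<close> over the \<open>M\<close>
   summands, so that each of them becomes a difference.\<close>
 have eq: "(%x. S tu t f x - f x) = (%x. (SUM a:UNIV. 1 / (2 * M) * (D a (h tu) 0 x + D a (- h tu) 0 x)
 + q * (be a x * D a (h tu) (- h tu) x)) + tu * (gm t x * f x))"
 proof
 fix x
 have "1 / (2 * M) * (D a (h tu) 0 x + D a (- h tu) 0 x) + q * (be a x * D a (h tu) (- h tu) x)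
 = (1 / (2 * M) * (f (rot a (h tu) x) + f (rot a (- h tu) x))
 + tu / (2 * h tu) * (be a x * (f (rot a (h tu) x) - f (rot a (- h tu) x)))) - f x / M" for a
 unfolding D_def q_def using M_ge1 by (simp add: field_simps)
 moreover have "(SUM a:(UNIV::('n\<times>3) set). f x / M) = f x" using M_ge1 by (simp add: M_def)
 ultimately show "S tu t f x - f x = (SUM a:UNIV. 1 / (2 * M) * (D a (h tu) 0 x + D a (- h tu) 0 x)
 + q * (be a x * D a (h tu) (- h tu) x)) + tu * (gm t x * f x)"
 unfolding S_def by (simp add: sum_subtractf)
 qed
 have w: "wb 2 (be a) B" "wb 2 (gm t) \<Gamma>" "wb 2 f K" for a
 using wb_mono[OF B(3)] wb_mono[OF B(4)[OF t]] wb_mono[OF f(2)] by simp_all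
 have "wb 2 (%x. S tu t f x - f x)
 ((SUM a:(UNIV::('n\<times>3) set). \<bar>1 / (2 * M)\<bar> * (\<bar>h tu - 0\<bar> * K + \<bar>- h tu - 0\<bar> * K) + \<bar>q\<bar> * (2 ^ 2 * B * (\<bar>h tu - - h tu\<bar> * K)))
 + \<bar>tu\<bar> * (2 ^ 2 * \<Gamma> * K))"
 unfolding eq
 by (intro wb_add wb_sum wb_scale wb_mult D w finite real_polynomial_function.intros(2-4) real_polynomial_function_sum
 poly_be poly_gm f(1))
 moreover have "(SUM a:(UNIV::('n\<times>3) set). \<bar>1 / (2 * M)\<bar> * (\<bar>h tu - 0\<bar> * K + \<bar>- h tu - 0\<bar> * K) + \<bar>q\<bar> * (2 ^ 2 * B * (\<bar>h tu - - h tu\<bar> * K)))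
 + \<bar>tu\<bar> * (2 ^ 2 * \<Gamma> * K) = h tu * K + (4 * M * B + 4 * \<Gamma>) * tu * K"
 proof -
 have "\<bar>1 / (2 * M)\<bar> * (\<bar>h tu - 0\<bar> * K + \<bar>- h tu - 0\<bar> * K) = h tu * K / M"
 using hp M_ge1 by simp
 moreover have "\<bar>q\<bar> * (2 ^ 2 * B * (\<bar>h tu - - h tu\<bar> * K)) = 4 * B * tu * K"
 proof -
 have "\<bar>q\<bar> * (2 ^ 2 * B * (\<bar>h tu - - h tu\<bar> * K)) = 8 * B * (q * h tu) * K" using q hp by simp
 then show ?thesis unfolding q by simp
 qed
 moreover have "(SUM a:(UNIV::('n\<times>3) set). h tu * K / M + 4 * B * tu * K) = h tu * K + 4 * M * B * tu * K"
 proof -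
 have "(SUM a:(UNIV::('n\<times>3) set). h tu * K / M + 4 * B * tu * K) = M * (h tu * K / M + 4 * B * tu * K)"
 by (simp add: M_def)
 then show ?thesis using M_ge1 by (simp add: algebra_simps)
 qed
 ultimately have s: "(SUM a:(UNIV::('n\<times>3) set). \<bar>1 / (2 * M)\<bar> * (\<bar>h tu - 0\<bar> * K + \<bar>- h tu - 0\<bar> * K) + \<bar>q\<bar> * (2 ^ 2 * B * (\<bar>h tu - - h tu\<bar> * K)))
 = h tu * K + 4 * M * B * tu * K"
 by (simp only:)
 show ?thesis unfolding s using tu by (simp add: algebra_simps)
 qed
 moreover have "h tu * K + (4 * M * B + 4 * \<Gamma>) * tu * K <= C * sqrt tu * K"
 proof -
 have "tu <= sqrt tu" using tu by (simp add: real_le_rsqrt power2_eq_square mult_left_le_one_le)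
 then have "(4 * M * B + 4 * \<Gamma>) * tu <= (4 * M * B + 4 * \<Gamma>) * sqrt tu"
 using B M_ge1 by (intro mult_left_mono) auto
 then have "h tu + (4 * M * B + 4 * \<Gamma>) * tu <= C * sqrt tu"
 unfolding C_def h_eq[OF tu(1)] by (simp add: algebra_simps)
 from mult_right_mono[OF this K] show ?thesis by (simp add: algebra_simps)
 qed
 ultimately show ?thesis by (metis wb_mono order_refl)
 qed
 then show ?thesis using C by blast
qed

text \<open>Taylor expansion with three derivatives; the choice of \<open>h\<close> matches the
  second-order part. The order \<open>tu * sqrt tu\<close> of the local error is high enough, since
  \<open>T / tu\<close> steps accumulate it to \<open>sqrt tu\<close>.\<close>

lemma S_consistent:
 "EX C>=0. ALL tu t f K x. 0 < tu & t:{0..T} & poly_fun f & wb 3 f K & x:Mfd -->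
 \<bar>S tu t f x - f x - tu * L t f x\<bar> <= C * (tu * sqrt tu) * K"
proof -
 obtain B \<Gamma> where B: "B >= 0" "\<Gamma> >= 0" "!!a. wb 3 (be a) B" "!!t. t:{0..T} ==> wb 3 (gm t) \<Gamma>"
 using coefficient_bounds by metis
 define C where "C = (kp + B / 2) * M * sqrt (2 * M * kp)"
 have C: "C >= 0" using B M_ge1 kp by (simp add: C_def)
 have "\<bar>S tu t f x - f x - tu * L t f x\<bar> <= C * (tu * sqrt tu) * K"
 if tu: "0 < tu" and t: "t:{0..T}" and f: "poly_fun f" "wb 3 f K" and x: "x:Mfd" for tu t f K x
 proof -
 have K: "0 <= K" using wb_nonneg[OF f(2)] .
 define q where "q = tu / (2 * h tu)"
 have hp: "h tu > 0" using h_pos tu by blast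
 have q: "q >= 0" "q * (2 * h tu) = tu" using tu hp by (auto simp add: q_def)
 have hM: "(h tu)^2 / (2 * M) = kp * tu" using h_square[OF tu] M_ge1 by simp
 let ?R = "%a. Rd (axis a 1) :: ('n vec3 => real) => _"
 define A where "A a = f (rot a (h tu) x) + f (rot a (- h tu) x) - 2 * f x - (h tu)^2 * ?R a (?R a f) x" for a
 define E where "E a = f (rot a (h tu) x) - f (rot a (- h tu) x) - 2 * h tu * ?R a f x" for a
 have A: "\<bar>A a\<bar> <= h tu ^ 3 * K" and E: "\<bar>E a\<bar> <= (h tu)^2 * K" for a
 unfolding A_def E_def using taylor_rot_even[OF f x, of a "h tu"]
 taylor_rot_odd[OF f(1) wb_mono[OF f(2)] x, of K a "h tu"] hp by simp_all
 have term_eq: "1 / (2 * M) * (f (rot a (h tu) x) + f (rot a (- h tu) x))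
 + q * (be a x * (f (rot a (h tu) x) - f (rot a (- h tu) x)))
 = (1 / (2 * M) * A a + q * be a x * E a) + (f x / M + tu * (kp * ?R a (?R a f) x) + tu * (be a x * ?R a f x))" for a
 proof -
 have "1 / (2 * M) * (f (rot a (h tu) x) + f (rot a (- h tu) x))
 = 1 / (2 * M) * A a + f x / M + (h tu)^2 / (2 * M) * ?R a (?R a f) x"
 unfolding A_def using M_ge1 by (simp add: field_simps)
 moreover have "q * (be a x * (f (rot a (h tu) x) - f (rot a (- h tu) x)))
 = q * be a x * E a + q * (2 * h tu) * (be a x * ?R a f x)"
 unfolding E_def by (simp add: algebra_simps)
 ultimately show ?thesis unfolding hM q by (simp add: algebra_simps)
 qed
 have "(SUM a:(UNIV::('n\<times>3) set). f x / M) = f x" using M_ge1 by (simp add: M_def)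
 then have "S tu t f x - f x - tu * L t f x = (SUM a:UNIV. 1 / (2 * M) * A a + q * be a x * E a)"
 unfolding S_def q_def[symmetric] term_eq L_def sum.distrib
 by (simp add: sum_distrib_left algebra_simps)
 also have "\<bar>...\<bar> <= (SUM a:(UNIV::('n\<times>3) set). kp * tu * h tu * K + tu * h tu * B * K / 2)"
 proof (intro order_trans[OF sum_abs] sum_mono)
 fix a
 have "\<bar>be a x\<bar> <= B" using wbD[OF B(3) unit_word_simps(1) x] by simp
 then have "\<bar>q * be a x\<bar> <= q * B" using q by (simp add: abs_mult mult_left_mono)
 then have "\<bar>q * be a x * E a\<bar> <= q * B * ((h tu)^2 * K)"
 unfolding abs_mult[of "q * be a x"] using E[of a] q B by (intro mult_mono) auto
 also have "... = q * (2 * h tu) * h tu * B * K / 2" by (simp add: power2_eq_square)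
 finally have 1: "\<bar>q * be a x * E a\<bar> <= tu * h tu * B * K / 2" unfolding q .
 have "\<bar>1 / (2 * M) * A a\<bar> <= 1 / (2 * M) * (h tu ^ 3 * K)"
 using A[of a] M_ge1 by (simp add: abs_mult divide_right_mono)
 also have "... = (h tu)^2 / (2 * M) * h tu * K" by (simp add: power2_eq_square power3_eq_cube)
 finally have "\<bar>1 / (2 * M) * A a\<bar> <= kp * tu * h tu * K" unfolding hM .
 with 1 show "\<bar>1 / (2 * M) * A a + q * be a x * E a\<bar> <= kp * tu * h tu * K + tu * h tu * B * K / 2"
 by (rule order_trans[OF abs_triangle_ineq add_mono, rotated])
 qed
 also have "... = M * (kp * tu * h tu * K + tu * h tu * B * K / 2)" by (simp add: M_def)
 also have "... = C * (tu * sqrt tu) * K" unfolding C_def h_eq[OF tu] by (simp add: algebra_simps)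
 finally show ?thesis .
 qed
 then show ?thesis using C by blast
qed

lemma L_diff: "poly_fun f ==> poly_fun g ==> L t (%x. f x - g x) x = L t f x - L t g x"
proof -
 assume fg: "poly_fun f" "poly_fun g"
 have Rd_diff: "Rd w (%x. f x - g x) = (%x. Rd w f x - Rd w g x)" if "poly_fun f" "poly_fun g" for w and f g :: "'n vec3 => real"
 using Rw_diff[OF that, of "[w]"] by simp
 show ?thesis
 unfolding L_def Rd_diff[OF fg] Rd_diff[OF poly_fun_Rd[OF fg(1)] poly_fun_Rd[OF fg(2)]]
 by (simp add: sum_subtractf right_diff_distrib)
qed

text \<open>Phrased for independent numbers in place of the derivatives, so that it serves
  polynomials in \<open>L_bound\<close> and jets in \<open>LJ_bound\<close> alike.\<close>

lemma symbol_bound: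
 obtains C where "C >= 0"
 "!!t x eps (F2 :: 'n \<times> 3 => real) F1 F0. t:{0..T} ==> x:Mfd ==> \<bar>F0\<bar> <= eps ==> (!!a. \<bar>F1 a\<bar> <= eps) ==> (!!a. \<bar>F2 a\<bar> <= eps)
 ==> \<bar>kp * (SUM a:UNIV. F2 a) + (SUM a:UNIV. be a x * F1 a) + gm t x * F0\<bar> <= C * eps"
proof -
 obtain B \<Gamma> where B: "B >= 0" "\<Gamma> >= 0" "!!a. wb 3 (be a) B" "!!t. t:{0..T} ==> wb 3 (gm t) \<Gamma>"
 using coefficient_bounds by metis
 have "\<bar>kp * (SUM a:UNIV. F2 a) + (SUM a:UNIV. be a x * F1 a) + gm t x * F0\<bar> <= (kp * M + M * B + \<Gamma>) * eps"
 if t: "t:{0..T}" and x: "x:Mfd" and f: "\<bar>F0\<bar> <= eps" "!!a. \<bar>F1 a\<bar> <= eps" "!!a. \<bar>F2 a\<bar> <= eps" for t x eps F0 and F2 F1 :: "'n \<times> 3 => real"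
 proof -
 have eps: "0 <= eps" using f(1) by linarith
 have "\<bar>SUM a:UNIV. F2 a\<bar> <= (SUM a:(UNIV::('n\<times>3) set). eps)"
 proof -
 have "\<bar>SUM a:UNIV. F2 a\<bar> <= (SUM a:UNIV. \<bar>F2 a\<bar>)" by (rule sum_abs)
 also have "... <= (SUM a:(UNIV::('n\<times>3) set). eps)" by (rule sum_mono) (rule f)
 finally show ?thesis .
 qed
 then have 1: "\<bar>kp * (SUM a:UNIV. F2 a)\<bar> <= kp * (M * eps)"
 using kp by (simp add: abs_mult M_def)
 have "\<bar>SUM a:UNIV. be a x * F1 a\<bar> <= (SUM a:(UNIV::('n\<times>3) set). B * eps)"
 by (intro order_trans[OF sum_abs] sum_mono)
 (use f wbD[OF B(3) unit_word_simps(1) x] B eps in \<open>auto simp: abs_mult intro!: mult_mono\<close>)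
 then have 2: "\<bar>SUM a:UNIV. be a x * F1 a\<bar> <= M * (B * eps)" by (simp add: M_def)
 have 3: "\<bar>gm t x * F0\<bar> <= \<Gamma> * eps"
 unfolding abs_mult using f(1) wbD[OF B(4)[OF t] unit_word_simps(1) x] B eps by (intro mult_mono) auto
 show ?thesis
 using abs_add3_le[OF 1 2 3] by (simp add: algebra_simps)
 qed
 moreover have "0 <= kp * M + M * B + \<Gamma>" using kp B M_ge1 by simp
 ultimately show ?thesis using that by blast
qed

lemma L_bound:
 "EX C>=0. ALL t f eps x. t:{0..T} & x:Mfd & \<bar>f x\<bar> <= eps & (ALL a. \<bar>Rd (axis a 1) f x\<bar> <= eps)
 & (ALL a. \<bar>Rd (axis a 1) (Rd (axis a 1) f) x\<bar> <= eps) --> \<bar>L t f x\<bar> <= C * eps"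
proof -
 obtain C where C: "C >= 0"
 "!!t x eps (F2 :: 'n \<times> 3 => real) F1 F0. t:{0..T} ==> x:Mfd ==> \<bar>F0\<bar> <= eps ==> (!!a. \<bar>F1 a\<bar> <= eps) ==> (!!a. \<bar>F2 a\<bar> <= eps)
 ==> \<bar>kp * (SUM a:UNIV. F2 a) + (SUM a:UNIV. be a x * F1 a) + gm t x * F0\<bar> <= C * eps"
 by (rule symbol_bound) blast
 show ?thesis
 unfolding L_def
 proof (intro exI[of _ C] conjI C(1) allI impI)
 fix t eps :: real and f :: "'n vec3 => real" and x :: "'n vec3"
 assume h: "t:{0..T} & x:Mfd & \<bar>f x\<bar> <= eps & (ALL a. \<bar>Rd (axis a 1) f x\<bar> <= eps)
 & (ALL a. \<bar>Rd (axis a 1) (Rd (axis a 1) f) x\<bar> <= eps)"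
 show "\<bar>kp * (SUM a:UNIV. Rd (axis a 1) (Rd (axis a 1) f) x) + (SUM a:UNIV. be a x * Rd (axis a 1) f x) + gm t x * f x\<bar> <= C * eps"
 by (rule C(2)) (use h in \<open>simp_all only:\<close>)
 qed
qed

lemma wb_basis_words:
 assumes "wb 2 f K" "x:Mfd"
 shows "\<bar>f x\<bar> <= K" "\<bar>Rd (axis a 1) f x\<bar> <= K" "\<bar>Rd (axis b 1) (Rd (axis a 1) f) x\<bar> <= K"
 using wbD[OF assms(1) _ assms(2), of "[]"] wbD[OF assms(1) _ assms(2), of "[axis a 1]"]
 wbD[OF assms(1) _ assms(2), of "[axis a 1, axis b 1]"]
 by (simp_all add: numeral_2_eq_2)

lemma gm_lipschitz:
 "EX C>=0. ALL s:{0..T}. ALL t:{0..T}. ALL x:Mfd. \<bar>gm t x - gm s x\<bar> <= C * \<bar>t - s\<bar>"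
proof -
 have "\<bar>gm t x - gm s x\<bar> <= (\<bar>\<Lambda>\<bar> * sqrt CARD('n)) * \<bar>t - s\<bar>" if "s:{0..T}" "t:{0..T}" "x:Mfd" for s t x
 proof -
 have "\<bar>gm t x - gm s x\<bar> = \<bar>(tht t - tht s) \<bullet> x\<bar>" by (simp add: gm_def inner_diff_left)
 also have "... <= norm (tht t - tht s) * norm x" by (rule Cauchy_Schwarz_ineq2)
 also have "norm x = sqrt CARD('n)" using norm_Mfd[OF that(3)] by (metis norm_ge_zero real_sqrt_unique)
 also have "norm (tht t - tht s) * sqrt CARD('n) <= (\<bar>\<Lambda>\<bar> * \<bar>t - s\<bar>) * sqrt CARD('n)"
 using lipschitz[OF that(1,2)] by (intro mult_right_mono) (auto elim!: order_trans intro!: mult_right_mono)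
 finally show ?thesis by (simp add: mult_ac)
 qed
 then show ?thesis by (intro exI[of _ "\<bar>\<Lambda>\<bar> * sqrt CARD('n)"]) auto
qed

text \<open>A double step and two single steps are both compared with \<open>2 * tu * L t f\<close>.
  The second single step starts from \<open>S tu t f\<close> at time \<open>t + tu\<close>; this
  costs the distance to \<open>f\<close> in two derivatives and the Lipschitz constant of
  \<open>gm\<close>, each with a factor \<open>tu\<close>.\<close>

lemma S_two_step:
 "EX C>=0. EX tu0>0. ALL tu t f K x. 0 < tu & tu <= tu0 & t:{0..T} & t + tu:{0..T} & poly_fun f & wb 3 f K & x:Mfd -->
 \<bar>S (2 * tu) t f x - S tu (t + tu) (S tu t f) x\<bar> <= C * (tu * sqrt tu) * K"
proof -
 obtain C1 tu0 where 1: "C1 >= 0" "tu0 > 0" "tu0 <= 1" "!!tu t f k K. 0 < tu ==> tu <= tu0 ==> t:{0..T} ==> poly_fun f ==> k <= 3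
 ==> wb k f K ==> wb k (S tu t f) (exp (C1 * tu) * K)"
 using S_stable by metis
 obtain C2 where 2: "C2 >= 0" "!!tu t f K x. 0 < tu ==> t:{0..T} ==> poly_fun f ==> wb 3 f K ==> x:Mfd ==>
 \<bar>S tu t f x - f x - tu * L t f x\<bar> <= C2 * (tu * sqrt tu) * K" using S_consistent by metis
 obtain C3 where 3: "C3 >= 0" "!!tu t f K. 0 < tu ==> tu <= 1 ==> t:{0..T} ==> poly_fun f ==> wb 3 f K ==>
 wb 2 (%x. S tu t f x - f x) (C3 * sqrt tu * K)" using S_minus_id by metis
 obtain C4 where 4: "C4 >= 0" "!!t f eps x. t:{0..T} ==> x:Mfd ==> \<bar>f x\<bar> <= eps ==> ALL a. \<bar>Rd (axis a 1) f x\<bar> <= eps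
 ==> ALL a. \<bar>Rd (axis a 1) (Rd (axis a 1) f) x\<bar> <= eps ==> \<bar>L t f x\<bar> <= C4 * eps" using L_bound by metis
 obtain C5 where 5: "C5 >= 0" "!!s t x. s:{0..T} ==> t:{0..T} ==> x:Mfd ==> \<bar>gm t x - gm s x\<bar> <= C5 * \<bar>t - s\<bar>"
 using gm_lipschitz by metis
 \<comment> \<open>In order: the double step, where
   \<open>(2 * tu) * sqrt (2 * tu) <= 4 * (tu * sqrt tu)\<close>; the second and the first single
   step; the change of the operator through its argument and through \<open>gm\<close>.\<close>
 define C where "C = 4 * C2 + C2 * exp C1 + C2 + C4 * C3 + C5"
 have C: "C >= 0" using 1 2 3 4 5 by (simp add: C_def)
 have "\<bar>S (2 * tu) t f x - S tu (t + tu) (S tu t f) x\<bar> <= C * (tu * sqrt tu) * K"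
 if tu: "0 < tu" "tu <= tu0" and t: "t:{0..T}" "t + tu:{0..T}" and f: "poly_fun f" "wb 3 f K" and x: "x:Mfd" for tu t f K x
 proof -
 have K: "0 <= K" using wb_nonneg[OF f(2)] .
 have tu1: "tu <= 1" using tu 1 by simp
 define g where "g = S tu t f"
 have g: "poly_fun g" unfolding g_def by (rule poly_S[OF f(1)])
 have "wb 3 g (exp (C1 * tu) * K)" unfolding g_def by (rule 1) (use tu t f in auto)
 then have g3: "wb 3 g (exp C1 * K)"
 by (rule wb_mono) (use tu1 1 K in \<open>auto intro!: mult_right_mono mult_left_le\<close>)
 have gf: "wb 2 (%x. g x - f x) (C3 * sqrt tu * K)" unfolding g_def by (rule 3) (use tu tu1 t f in auto)
 have e1: "\<bar>S (2 * tu) t f x - f x - (2 * tu) * L t f x\<bar> <= C2 * (4 * (tu * sqrt tu)) * K"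
 proof -
 have "sqrt 2 <= 2" by (rule real_le_lsqrt) auto
 then have "2 * tu * sqrt (2 * tu) <= 4 * (tu * sqrt tu)"
 using tu by (simp add: real_sqrt_mult)
 then have "C2 * (2 * tu * sqrt (2 * tu)) * K <= C2 * (4 * (tu * sqrt tu)) * K"
 using 2(1) K by (intro mult_right_mono mult_left_mono)
 moreover have "\<bar>S (2 * tu) t f x - f x - (2 * tu) * L t f x\<bar> <= C2 * (2 * tu * sqrt (2 * tu)) * K"
 by (rule 2) (use tu t f x in auto)
 ultimately show ?thesis by linarith
 qed
 have e2: "\<bar>S tu (t + tu) g x - g x - tu * L (t + tu) g x\<bar> <= C2 * (tu * sqrt tu) * (exp C1 * K)"
 by (rule 2) (use tu t g g3 x in auto)
 have e3: "\<bar>g x - f x - tu * L t f x\<bar> <= C2 * (tu * sqrt tu) * K"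
 unfolding g_def by (rule 2) (use tu t f x in auto)
 have e4: "\<bar>tu * (L (t + tu) g x - L t f x)\<bar> <= tu * (C4 * (C3 * sqrt tu * K) + C5 * sqrt tu * K)"
 proof -
 have "L (t + tu) g x - L t f x = L (t + tu) (%x. g x - f x) x + (gm (t + tu) x - gm t x) * f x"
 unfolding L_diff[OF g f(1)] by (simp add: L_def algebra_simps)
 moreover have "\<bar>L (t + tu) (%x. g x - f x) x\<bar> <= C4 * (C3 * sqrt tu * K)"
 by (rule 4) (use wb_basis_words[OF gf x] t x in auto)
 moreover have "\<bar>(gm (t + tu) x - gm t x) * f x\<bar> <= C5 * sqrt tu * K"
 proof -
 have "tu <= sqrt tu" using tu tu1 by (simp add: real_le_rsqrt power2_eq_square mult_left_le_one_le)
 then have "\<bar>gm (t + tu) x - gm t x\<bar> <= C5 * sqrt tu"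
 using 5(2)[OF t x] 5(1) tu by (auto elim!: order_trans intro!: mult_left_mono)
 moreover have "\<bar>f x\<bar> <= K" using wbD[OF f(2) unit_word_simps(1) x] by simp
 ultimately show ?thesis unfolding abs_mult using 5(1) tu by (intro mult_mono) auto
 qed
 ultimately have "\<bar>L (t + tu) g x - L t f x\<bar> <= C4 * (C3 * sqrt tu * K) + C5 * sqrt tu * K" by linarith
 then show ?thesis using tu by (simp add: abs_mult)
 qed
 have split: "\<bar>a - b\<bar> <= A + B + A' + B'"
 if "a - b = u - v - w - z" "\<bar>u\<bar> <= A" "\<bar>v\<bar> <= B" "\<bar>w\<bar> <= A'" "\<bar>z\<bar> <= B'" for a b u v w z A B A' B' :: real
 using that by linarith
 have "\<bar>S (2 * tu) t f x - S tu (t + tu) g x\<bar> <= C2 * (4 * (tu * sqrt tu)) * K + C2 * (tu * sqrt tu) * (exp C1 * K)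
 + C2 * (tu * sqrt tu) * K + tu * (C4 * (C3 * sqrt tu * K) + C5 * sqrt tu * K)"
 by (rule split[OF _ e1 e2 e3 e4]) (simp add: algebra_simps)
 also have "... = C * (tu * sqrt tu) * K" by (simp add: C_def algebra_simps)
 finally show ?thesis unfolding g_def .
 qed
 then show ?thesis using C 1(2) by blast
qed

end

section \<open>Convergence of the scheme\<close>

definition Rb :: "('n \<times> 3) list => ('n::finite vec3 => real) => 'n vec3 => real" where
 "Rb as = Rw (map (%a. axis a 1) as)"

lemma Rb_simps [simp]:
 "Rb [] f = f" "Rb [a] f = Rd (axis a 1) f" "Rb [a, b] f = Rd (axis b 1) (Rd (axis a 1) f)"
 by (simp_all add: Rb_def)

lemma length_le_2_cases:
 assumes "length as <= 2"
 obtains "as = []" | a where "as = [a]" | a b where "as = [a, b]"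
 using assms by (cases as rule: list.exhaust; cases "tl as"; cases "tl (tl as)") auto

lemma Rb_diff: "poly_fun f ==> poly_fun g ==> Rb as (%x. f x - g x) x = Rb as f x - Rb as g x"
 by (simp add: Rb_def Rw_diff)

lemma wb_Rb: "wb 2 f K ==> length as <= 2 ==> x:Mfd ==> \<bar>Rb as f x\<bar> <= K"
 unfolding Rb_def by (erule wbD) (auto simp: unit_word_def)

text \<open>Expanding one letter of the word in the axes costs a factor equal to their number,
  because each component of a vector in the unit ball is at most 1.\<close>

lemma wb_of_basis_words:
 fixes f :: "'n::finite vec3 => real"
 assumes "poly_fun f" "!!as x. length as <= k ==> x:Mfd ==> \<bar>Rb as f x\<bar> <= eps"
 shows "wb k f (real CARD('n \<times> 3) ^ k * eps)"
 using assms
proof (induction k arbitrary: f)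
 case 0
 show ?case using 0(2)[of "[]"] by (simp add: wb_0)
next
 case (Suc k)
 let ?M = "real CARD('n \<times> 3)"
 have "(1::nat) <= CARD('n \<times> 3)"
 using Suc_leI[OF zero_less_card_finite[where 'a = "'n \<times> 3"]] unfolding One_nat_def .
 then have M: "1 <= ?M" by (metis of_nat_1 of_nat_le_iff)
 obtain y :: "'n vec3" where "y:Mfd" using Mfd_nonempty by blast
 then have eps: "0 <= eps" using Suc.prems(2)[of "[]" y] by simp
 show ?case
 proof (rule wb_SucI)
 have "eps <= ?M ^ Suc k * eps" using eps M one_le_power[OF M, of "Suc k"] by (metis mult_1 mult_right_mono)
 then show "wb 0 f (?M ^ Suc k * eps)"
 unfolding wb_0 using Suc.prems(2)[of "[]"] by fastforce
 fix om :: "'n vec3" assume om: "norm om <= 1"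
 have 1: "wb k (Rd (axis a 1) f) (?M ^ k * eps)" for a
 proof (rule Suc.IH[OF poly_fun_Rd[OF Suc.prems(1)]])
 fix as :: "('n \<times> 3) list" and x :: "'n vec3" assume "length as <= k" "x:Mfd"
 then show "\<bar>Rb as (Rd (axis a 1) f) x\<bar> <= eps"
 using Suc.prems(2)[of "a # as" x] by (simp add: Rb_def)
 qed
 have "wb k (%x. SUM a:UNIV. om $ a * Rd (axis a 1) f x) (SUM a:(UNIV::('n\<times>3) set). \<bar>om $ a\<bar> * (?M ^ k * eps))"
 by (intro wb_sum wb_scale poly_fun_scale poly_fun_Rd Suc.prems 1 finite)
 moreover have "Rd om f = (%x. SUM a:UNIV. om $ a * Rd (axis a 1) f x)"
 by (rule ext, rule Rd_axis_sum[OF Suc.prems(1)])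
 moreover have "(SUM a:(UNIV::('n\<times>3) set). \<bar>om $ a\<bar> * (?M ^ k * eps)) <= (SUM a:(UNIV::('n\<times>3) set). ?M ^ k * eps)"
 using eps by (intro sum_mono mult_left_le_one_le) (auto intro: order_trans[OF component_le_norm_cart om])
 moreover have "... = ?M ^ Suc k * eps" by simp
 ultimately show "wb k (Rd om f) (?M ^ Suc k * eps)"
 using wb_mono[of k "Rd om f" _ k "?M ^ Suc k * eps"] by simp
 qed
qed

text \<open>Two interpolations turn an error \<open>z\<close> in the sup norm into
  \<open>sqrt z\<close> for first and \<open>sqrt (sqrt z)\<close> for second derivatives; the sum
  covers the three cases at once.\<close>

definition mu :: "real => real" where "mu z = sqrt (sqrt z) + sqrt z + z"

lemma mu_mono: "z <= z' ==> mu z <= mu z'"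
 by (auto simp: mu_def intro!: add_mono)

lemma isCont_mu: "isCont mu z"
 unfolding mu_def by (intro continuous_intros)

lemma mu_0 [simp]: "mu 0 = 0"
 by (simp add: mu_def)

text \<open>Landau's inequality is applied to \<open>f\<close> with angle \<open>sqrt z\<close>,
  then to its first derivatives with angle \<open>sqrt (sqrt z)\<close>. Given a bound on three
  derivatives, uniform smallness thus implies smallness of two derivatives, and differences of
  schemes need to be compared in the sup norm only.\<close>

lemma Rb_interpolation:
 assumes f: "poly_fun f" "wb 3 f K" and z: "z > 0" "!!x. x:Mfd ==> \<bar>f x\<bar> <= z"
 and as: "length as <= 2" and x: "x:Mfd"
 shows "\<bar>Rb as f x\<bar> <= (1 + 2 * K) * mu z"
proof -
 have K: "0 <= K" using wb_nonneg[OF f(2)] .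
 have s: "sqrt z > 0" "sqrt (sqrt z) > 0" "(sqrt z)^2 = z" "(sqrt (sqrt z))^2 = sqrt z" using z by auto
 have f2: "wb 2 f K" by (rule wb_mono[OF f(2)]) auto
 have 1: "\<bar>Rd (axis a 1) f x\<bar> <= sqrt z * (1 + K)" if "x:Mfd" for a x
 by (rule Rd_interpolation[OF f(1) f2]) (use z s that in auto)
 have R: "poly_fun (Rd (axis a 1) f)" "wb 2 (Rd (axis a 1) f) K" for a
 using f wb_Rd_axis[of 2 f K a] by (auto simp: numeral_3_eq_3 numeral_2_eq_2)
 have 2: "\<bar>Rd (axis b 1) (Rd (axis a 1) f) x\<bar> <= sqrt (sqrt z) * ((1 + K) + K)" for a b
 by (rule Rd_interpolation[OF R]) (use z s 1 x in \<open>auto simp: mult.commute\<close>)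
 have mu: "z <= mu z" "sqrt z <= mu z" "sqrt (sqrt z) <= mu z" "0 <= mu z" using z by (auto simp: mu_def)
 from as show ?thesis
 proof (cases rule: length_le_2_cases)
 case 1
 have "\<bar>f x\<bar> <= 1 * mu z" using z(2)[OF x] mu by linarith
 also have "... <= (1 + 2 * K) * mu z" using K mu by (intro mult_right_mono) auto
 finally show ?thesis using 1 by simp
 next
 case (2 a)
 have "sqrt z * (1 + K) <= mu z * (1 + 2 * K)" using K mu s by (intro mult_mono) auto
 then show ?thesis using 1[OF x, of a] 2 by (simp add: mult.commute)
 next
 case (3 a b)
 have "sqrt (sqrt z) * ((1 + K) + K) <= mu z * (1 + 2 * K)" using K mu s by (intro mult_mono) auto
 then show ?thesis using 2[of b a] 3 by (simp add: mult.commute)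
 qed
qed

text \<open>Serves Lipschitz bounds in time with \<open>d = 0\<close> and difference quotients with
  the slope frozen at \<open>d\<close>.\<close>

lemma telescope_bound:
 fixes X :: "nat => real"
 assumes "m <= n" "!!j. m <= j ==> j < n ==> \<bar>X (Suc j) - X j - d\<bar> <= e"
 shows "\<bar>X n - X m - (real n - real m) * d\<bar> <= (real n - real m) * e"
 using assms
proof (induction n rule: dec_induct)
 case (step n)
 then have "\<bar>X n - X m - (real n - real m) * d\<bar> <= (real n - real m) * e" "\<bar>X (Suc n) - X n - d\<bar> <= e" by auto
 then have "\<bar>(X n - X m - (real n - real m) * d) + (X (Suc n) - X n - d)\<bar> <= (real n - real m) * e + e" by linarith
 then show ?case by (simp add: algebra_simps)
qed simp

section \<open>Iteration of the scheme on dyadic time grids\<close>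

context angular_parabolic
begin

primrec U :: "real => nat => ('n vec3 => real) => 'n vec3 => real" where
 "U tu 0 g = g" |
 "U tu (Suc n) g = S tu (real n * tu) (U tu n g)"

text \<open>Halving nests the grids: \<open>n\<close> steps of \<open>dt N\<close> and
  \<open>2 * n\<close> steps of \<open>dt (Suc N)\<close> end at the same time.\<close>

definition dt :: "nat => real" where "dt N = T / 2 ^ N"

lemma dt_simps: "dt N > 0" "2 * dt (Suc N) = dt N" "2 ^ N * dt N = T"
 using T by (auto simp: dt_def field_simps)

lemma dt_mono: "N <= N' ==> dt N' <= dt N"
 using T unfolding dt_def by (intro divide_left_mono power_increasing) auto

lemma poly_U: "poly_fun g ==> poly_fun (U tu n g)"
 by (induction n) (auto intro: poly_S)

lemma U_diff: "U tu n (%x. f x - g x) x = U tu n f x - U tu n g x"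
proof -
 have "U tu n (%x. f x - g x) = (%x. U tu n f x - U tu n g x)"
 proof (induction n)
 case (Suc n)
 show ?case unfolding U.simps Suc.IH by (rule ext, rule S_diff)
 qed simp
 then show ?thesis by simp
qed

lemma n_dt: "n <= 2 ^ N ==> real n * dt N:{0..T}"
proof -
 assume "n <= 2 ^ N"
 then have "real n <= 2 ^ N" by (metis of_nat_le_iff of_nat_numeral of_nat_power)
 then have "real n * dt N <= 2 ^ N * dt N" using dt_simps(1)[of N] by (intro mult_right_mono) auto
 moreover have "0 <= real n * dt N" using dt_simps(1)[of N] by simp
 ultimately show ?thesis by (simp add: dt_simps)
qed

text \<open>Lax's argument: stability propagates the defects of \<open>S_two_step\<close> with a
  factor of at most \<open>exp (C1 * T)\<close>, so that a defect \<open>tu * sqrt tu\<close> per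
  step accumulates to order \<open>sqrt tu\<close>.\<close>

lemma U_estimates:
 obtains C N0 where "C >= 1"
 "!!N n k g K. N >= N0 ==> n <= 2 ^ N ==> k <= 3 ==> poly_fun g ==> wb k g K ==> wb k (U (dt N) n g) (C * K)"
 "!!N n g K x. N >= N0 ==> n <= 2 ^ N ==> poly_fun g ==> wb 3 g K ==> x:Mfd ==>
 \<bar>U (dt N) n g x - U (dt (Suc N)) (2 * n) g x\<bar> <= C * sqrt (dt N) * K"
 "!!N n g K x. N >= N0 ==> n < 2 ^ N ==> poly_fun g ==> wb 3 g K ==> x:Mfd ==>
 \<bar>U (dt N) (Suc n) g x - U (dt N) n g x - dt N * L (real n * dt N) (U (dt N) n g) x\<bar> <= C * (dt N * sqrt (dt N)) * K"
 "!!N n g m. (ALL t:{0..T}. ALL x:Mfd. 0 <= gm t x) ==> N >= N0 ==> n <= 2 ^ N ==> poly_fun g ==> m >= 0 ==> ALL x:Mfd. m <= g x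
 ==> ALL x:Mfd. m <= U (dt N) n g x"
 "dt N0 <= 1"
proof -
 obtain C1 tu0 where 0: "C1 >= 0" "tu0 > 0" "tu0 <= 1" and S: "ALL tu t f k K. 0 < tu & tu <= tu0 & t:{0..T} & poly_fun f & k <= 3 & wb k f K -->
 wb k (S tu t f) (exp (C1 * tu) * K)
 & ((ALL t:{0..T}. ALL x:Mfd. 0 <= gm t x) -->
 (ALL m>=0. (ALL x:Mfd. m <= f x) --> (ALL x:Mfd. m <= S tu t f x)))"
 using S_stable by (elim exE conjE) (rule that; assumption)
 have S1: "wb k (S tu t f) (exp (C1 * tu) * K)"
 if "0 < tu" "tu <= tu0" "t:{0..T}" "poly_fun f" "k <= 3" "wb k f K" for tu t f k K
 by (rule conjunct1[OF S[rule_format]]) (intro conjI that)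
 note 1 = 0 S1
 have low: "ALL x:Mfd. m <= S tu t f x" if "0 < tu" "tu <= tu0" "t:{0..T}" "poly_fun f" "k <= 3" "wb k f K"
 and "ALL t:{0..T}. ALL x:Mfd. 0 <= gm t x" "m >= 0" "ALL x:Mfd. m <= f x" for tu t f k K m
 proof -
 have "(ALL t:{0..T}. ALL x:Mfd. 0 <= gm t x) -->
 (ALL m>=0. (ALL x:Mfd. m <= f x) --> (ALL x:Mfd. m <= S tu t f x))"
 by (rule conjunct2[OF S[rule_format, of tu t f k K]]) (intro conjI that)
 from mp[OF this that(7)] have "0 <= m --> (ALL x:Mfd. m <= f x) --> (ALL x:Mfd. m <= S tu t f x)"
 by (rule spec)
 from mp[OF mp[OF this that(8)] that(9)] show ?thesis .
 qed
 obtain C2 where 2: "C2 >= 0" "!!tu t f K x. 0 < tu ==> t:{0..T} ==> poly_fun f ==> wb 3 f K ==> x:Mfd ==>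
 \<bar>S tu t f x - f x - tu * L t f x\<bar> <= C2 * (tu * sqrt tu) * K" using S_consistent by metis
 obtain C3 tu1 where 3: "C3 >= 0" "tu1 > 0" "!!tu t f K x. 0 < tu ==> tu <= tu1 ==> t:{0..T} ==> t + tu:{0..T} ==> poly_fun f
 ==> wb 3 f K ==> x:Mfd ==> \<bar>S (2 * tu) t f x - S tu (t + tu) (S tu t f) x\<bar> <= C3 * (tu * sqrt tu) * K"
 using S_two_step by metis
 have "dt \<longlonglongrightarrow> 0"
 unfolding dt_def[abs_def] divide_inverse power_inverse[symmetric]
 by (intro tendsto_mult_right_zero LIMSEQ_power_zero) auto
 then have "eventually (%N. dt N < min tu0 tu1) sequentially"
 by (rule order_tendstoD) (use 1 3 in auto)
 then obtain N0 where N0: "dt N0 < min tu0 tu1" by (auto simp: eventually_sequentially)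
 have dt0: "dt N <= tu0" "dt N <= tu1" if "N >= N0" for N using dt_mono[OF that] N0 by auto
 define E where "E = exp (C1 * T)"
 have E: "E >= 1" using 1 T by (simp add: E_def)
 have a0: "wb k (U (dt N) n g) (exp (C1 * (real n * dt N)) * K)"
 if "N >= N0" "n <= 2 ^ N" "k <= 3" "poly_fun g" "wb k g K" for N n k g K
 using that(2)
 proof (induction n)
 case 0 then show ?case using that by simp
 next
 case (Suc n)
 have "wb k (U (dt N) (Suc n) g) (exp (C1 * dt N) * (exp (C1 * (real n * dt N)) * K))"
 unfolding U.simps
 by (rule 1(4)[OF dt_simps(1) dt0(1)[OF that(1)] _ poly_U[OF that(4)] that(3) Suc.IH])
 (use n_dt[of n N] Suc.prems in auto)
 moreover have "exp (C1 * (real (Suc n) * dt N)) * K = exp (C1 * dt N) * (exp (C1 * (real n * dt N)) * K)"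
 unfolding mult.assoc[symmetric, of _ _ K] exp_add[symmetric] by (simp add: algebra_simps)
 ultimately show ?case by (simp only:)
 qed
 have expE: "exp (C1 * (real n * dt N)) <= E" if "n <= 2 ^ N" for n N
 unfolding E_def using n_dt[OF that] 1 by (auto intro!: mult_left_mono)
 have a: "wb k (U (dt N) n g) (E * K)"
 if "N >= N0" "n <= 2 ^ N" "k <= 3" "poly_fun g" "wb k g K" for N n k g K
 by (rule wb_mono[OF a0[OF that]]) (use expE[OF that(2)] wb_nonneg[OF that(5)] in \<open>auto intro!: mult_right_mono\<close>)
 have b: "\<bar>U (dt N) n g x - U (dt (Suc N)) (2 * n) g x\<bar> <= (E * (C3 * E * T)) * sqrt (dt N) * K"
 if N: "N >= N0" and n: "n <= 2 ^ N" and g: "poly_fun g" "wb 3 g K" and x: "x:Mfd" for N n g K x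
 proof -
 have K: "0 <= K" using wb_nonneg[OF g(2)] .
 let ?d = "dt N" and ?e = "dt (Suc N)"
 have de: "2 * ?e = ?d" "?e > 0" "?d > 0" using dt_simps by auto
 define dl where "dl = C3 * (?e * sqrt ?e) * (E * K)"
 have dl: "dl >= 0" using 3 E K de by (simp add: dl_def)
 \<comment> \<open>Discrete Gronwall: by linearity of \<open>S\<close> one coarse step carries the
   old error along with growth \<open>exp (C1 * dt N)\<close>, and the two-step defect
   \<open>dl\<close> is added.\<close>
 have ind: "wb 0 (%x. U ?d n g x - U ?e (2 * n) g x) (exp (C1 * (real n * ?d)) * (real n * dl))"
 using n
 proof (induction n)
 case 0 then show ?case by (simp add: wb_0)
 next
 case (Suc n)
 define F where "F = U ?e (2 * n) g"
 define t where "t = real n * ?d"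
 have t: "t:{0..T}" "t + ?e:{0..T}" "t + ?d:{0..T}"
 using n_dt[of n N] n_dt[of "Suc n" N] Suc.prems de by (auto simp: t_def algebra_simps)
 have eq: "U ?e (2 * Suc n) g = S ?e (t + ?e) (S ?e t F)"
 proof -
 have "real (2 * n) * ?e = t" "real (2 * n + 1) * ?e = t + ?e" using de by (auto simp: t_def algebra_simps)
 then show ?thesis by (simp add: F_def)
 qed
 have F: "poly_fun F" "wb 3 F (E * K)"
 unfolding F_def using poly_U g a[of "Suc N" "2 * n" 3 g K] N Suc.prems by auto
 have w: "wb 0 (%x. U ?d n g x - F x) (exp (C1 * t) * (real n * dl))"
 using Suc by (simp add: t_def F_def)
 have p: "poly_fun (%x. U ?d n g x - F x)" using poly_U[OF g(1)] F by auto
 have w2: "wb 0 (S ?d t (%x. U ?d n g x - F x)) (exp (C1 * ?d) * (exp (C1 * t) * (real n * dl)))"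
 by (rule 1(4)[OF de(3) dt0(1)[OF N] t(1) p _ w]) simp
 show ?case
 unfolding wb_0
 proof
 fix x :: "'n vec3" assume x: "x:Mfd"
 have "\<bar>S (2 * ?e) t F x - S ?e (t + ?e) (S ?e t F) x\<bar> <= dl"
 unfolding dl_def by (rule 3(3)[OF de(2) dt0(2) t(1,2) F x]) (use N in simp)
 moreover have "\<bar>S ?d t (%x. U ?d n g x - F x) x\<bar> <= exp (C1 * ?d) * (exp (C1 * t) * (real n * dl))"
 using w2 x by (simp add: wb_0)
 moreover have "U ?d (Suc n) g x - U ?e (2 * Suc n) g x
 = S ?d t (%x. U ?d n g x - F x) x + (S (2 * ?e) t F x - S ?e (t + ?e) (S ?e t F) x)"
 unfolding eq S_diff de by (simp add: t_def)
 moreover have "exp (C1 * ?d) * (exp (C1 * t) * (real n * dl)) + dl <= exp (C1 * (real (Suc n) * ?d)) * (real (Suc n) * dl)"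
 proof -
 have "exp (C1 * ?d) * exp (C1 * t) = exp (C1 * (real (Suc n) * ?d))"
 by (simp add: t_def algebra_simps flip: exp_add)
 moreover have "dl <= exp (C1 * (real (Suc n) * ?d)) * dl"
 using dl 1(1) de by (simp add: mult_le_cancel_right1)
 ultimately show ?thesis by (simp add: algebra_simps)
 qed
 ultimately show "\<bar>U ?d (Suc n) g x - U ?e (2 * Suc n) g x\<bar> <= exp (C1 * (real (Suc n) * ?d)) * (real (Suc n) * dl)"
 by linarith
 qed
 qed
 then have "\<bar>U ?d n g x - U ?e (2 * n) g x\<bar> <= exp (C1 * (real n * ?d)) * (real n * dl)"
 using x by (simp add: wb_0)
 also have "... <= E * (C3 * E * T * sqrt ?d * K)"
 proof (rule mult_mono)
 have "real n * dl = C3 * (real n * ?e) * sqrt ?e * (E * K)" by (simp add: dl_def)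
 also have "... <= C3 * T * sqrt ?d * (E * K)"
 proof (intro mult_right_mono mult_mono mult_left_mono)
 have "real n * ?e <= real n * ?d" using de by (intro mult_left_mono) auto
 then show "real n * ?e <= T" using n_dt[OF n] by simp
 show "sqrt ?e <= sqrt ?d" using de by simp
 qed (use 3 T E K de in auto)
 finally show "real n * dl <= C3 * E * T * sqrt ?d * K" by (simp add: mult_ac)
 qed (use E dl expE[OF n] in auto)
 finally show ?thesis by (simp add: mult_ac)
 qed
 have c: "\<bar>U (dt N) (Suc n) g x - U (dt N) n g x - dt N * L (real n * dt N) (U (dt N) n g) x\<bar> <= (C2 * E) * (dt N * sqrt (dt N)) * K"
 if "N >= N0" "n < 2 ^ N" "poly_fun g" "wb 3 g K" "x:Mfd" for N n g K x
 proof -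
 have "\<bar>S (dt N) (real n * dt N) (U (dt N) n g) x - U (dt N) n g x - dt N * L (real n * dt N) (U (dt N) n g) x\<bar> <= C2 * (dt N * sqrt (dt N)) * (E * K)"
 by (rule 2(2)[OF dt_simps(1) n_dt poly_U[OF that(3)] a[OF that(1) _ _ that(3,4)] that(5)]) (use that(2) in auto)
 then show ?thesis by (simp add: mult_ac)
 qed
 have d: "ALL x:Mfd. m <= U (dt N) n g x" if dd: "(ALL t:{0..T}. ALL x:Mfd. 0 <= gm t x)" "N >= N0" "n <= 2 ^ N" "poly_fun g" "m >= 0" "ALL x:Mfd. m <= g x" for N n g m
 using dd(3)
 proof (induction n)
 case 0 then show ?case using dd by simp
 next
 case (Suc n)
 obtain K where K: "wb 0 (U (dt N) n g) K" using wb_exists[OF poly_U[OF dd(4)]] by blast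
 have n: "n <= 2 ^ N" using Suc.prems by simp
 show ?case
 unfolding U.simps
 by (rule low[OF dt_simps(1) dt0(1)[OF dd(2)] n_dt[OF n] poly_U[OF dd(4)] _ K dd(1,5) Suc.IH[OF n]]) simp
 qed
 define C where "C = E + E * (C3 * E * T) + C2 * E"
 have C: "E <= C" "E * (C3 * E * T) <= C" "C2 * E <= C" "1 <= C"
 proof -
 have "0 <= E * (C3 * E * T)" "0 <= C2 * E" using E 2(1) 3(1) T by auto
 then show "E <= C" "E * (C3 * E * T) <= C" "C2 * E <= C" "1 <= C" using E by (auto simp: C_def)
 qed
 show ?thesis
 proof (rule that[of C N0])
 show "wb k (U (dt N) n g) (C * K)" if "N >= N0" "n <= 2 ^ N" "k <= 3" "poly_fun g" "wb k g K" for N n k g K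
 by (rule wb_mono[OF a[OF that]]) (use C wb_nonneg[OF that(5)] in \<open>auto intro!: mult_right_mono\<close>)
 show "\<bar>U (dt N) n g x - U (dt (Suc N)) (2 * n) g x\<bar> <= C * sqrt (dt N) * K"
 if "N >= N0" "n <= 2 ^ N" "poly_fun g" "wb 3 g K" "x:Mfd" for N n g K x
 proof -
 have "(E * (C3 * E * T)) * sqrt (dt N) * K <= C * sqrt (dt N) * K"
 using C wb_nonneg[OF that(4)] dt_simps(1)[of N] by (intro mult_right_mono) auto
 then show ?thesis using b[OF that] by linarith
 qed
 show "\<bar>U (dt N) (Suc n) g x - U (dt N) n g x - dt N * L (real n * dt N) (U (dt N) n g) x\<bar> <= C * (dt N * sqrt (dt N)) * K"
 if "N >= N0" "n < 2 ^ N" "poly_fun g" "wb 3 g K" "x:Mfd" for N n g K x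
 proof -
 have "(C2 * E) * (dt N * sqrt (dt N)) * K <= C * (dt N * sqrt (dt N)) * K"
 using C wb_nonneg[OF that(4)] dt_simps(1)[of N] by (intro mult_right_mono) auto
 then show ?thesis using c[OF that] by linarith
 qed
 show "dt N0 <= 1" using N0 1 by auto
 qed (use C d in auto)
qed

end

section \<open>Extension to all times and convergence under refinement\<close>

context angular_parabolic
begin

definition idx :: "nat => real => nat" where "idx N t = nat \<lfloor>t / dt N\<rfloor>"

definition V :: "nat => ('n vec3 => real) => real => 'n vec3 => real" where
 "V N g t = U (dt N) (idx N t) g"

text \<open>The ratio of successive values of \<open>sqrt (dt N)\<close>; refinement errors are
  summed as a geometric series with this ratio.\<close>

abbreviation rh :: real where "rh \<equiv> sqrt (1 / 2)"

lemma idx_bounds: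
 assumes "t:{0..T}"
 shows "real (idx N t) * dt N <= t" "t < (real (idx N t) + 1) * dt N" "idx N t <= 2 ^ N"
proof -
 have d: "dt N > 0" by (rule dt_simps)
 have "0 <= t / dt N" using assms d by simp
 then have i: "real (idx N t) = of_int \<lfloor>t / dt N\<rfloor>" by (simp add: idx_def)
 have "real (idx N t) <= t / dt N" "t / dt N < real (idx N t) + 1" unfolding i by linarith+
 then show 1: "real (idx N t) * dt N <= t" "t < (real (idx N t) + 1) * dt N"
 using d by (simp_all add: field_simps)
 have "real (idx N t) * dt N <= 2 ^ N * dt N" using 1(1) assms by (simp add: dt_simps)
 then have "real (idx N t) <= 2 ^ N" using d by simp
 then show "idx N t <= 2 ^ N" by (metis of_nat_le_iff of_nat_numeral of_nat_power)
qed

lemma idx_Suc: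
 assumes "t:{0..T}"
 shows "idx (Suc N) t = 2 * idx N t \<or> idx (Suc N) t = Suc (2 * idx N t)"
proof -
 let ?i = "idx N t" and ?j = "idx (Suc N) t" and ?e = "dt (Suc N)"
 have e: "?e > 0" "dt N = 2 * ?e" using dt_simps[of "Suc N"] dt_simps(2)[of N] by auto
 have "real (2 * ?i) * ?e < (real ?j + 1) * ?e" "real ?j * ?e < (real (2 * ?i) + 2) * ?e"
 using idx_bounds(1,2)[OF assms, of N] idx_bounds(1,2)[OF assms, of "Suc N"] unfolding e by (auto simp: algebra_simps)
 then have "real (2 * ?i) < real ?j + 1" "real ?j < real (2 * ?i) + 2"
 using e by (auto simp: mult_less_cancel_right_disj)
 then have "2 * ?i < ?j + 1" "?j < 2 * ?i + 2" by linarith+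
 then show ?thesis by linarith
qed

lemma idx_multiple: "j <= 2 ^ N ==> idx N (real j * dt N) = j"
 using dt_simps(1)[of N] by (simp add: idx_def)

lemma poly_V: "poly_fun g ==> poly_fun (V N g t)"
 by (simp add: V_def poly_U)

lemma dt_rh: "sqrt (dt N) = sqrt T * rh ^ N" "dt N <= T * rh ^ N" "0 < rh" "rh < 1"
proof -
 show "sqrt (dt N) = sqrt T * rh ^ N"
 by (simp add: dt_def real_sqrt_divide real_sqrt_power power_divide flip: real_sqrt_mult)
 have "(1 / 2 :: real) <= rh" by (rule real_le_rsqrt) (simp add: power2_eq_square)
 then have "(1 / 2 :: real) ^ N <= rh ^ N" by (intro power_mono) auto
 then have "T * (1 / 2) ^ N <= T * rh ^ N" using T by (intro mult_left_mono) auto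
 then show "dt N <= T * rh ^ N" by (simp add: dt_def power_divide)
qed auto

text \<open>In time \<open>V\<close> is Lipschitz up to one grid step, and the refinement errors
  form a geometric series. The factor \<open>K + 1\<close> keeps the bound positive even for
  \<open>K = 0\<close>, since the interpolation lemma asks for a positive \<open>z\<close>.\<close>

lemma V_estimates:
 obtains C N0 where "C >= 1" "dt N0 <= 1"
 "!!N k g K t. N >= N0 ==> k <= 3 ==> poly_fun g ==> wb k g K ==> t:{0..T} ==> wb k (V N g t) (C * K)"
 "!!N N' g K s t x. N >= N0 ==> N <= N' ==> poly_fun g ==> wb 3 g K ==> s:{0..T} ==> t:{0..T} ==> x:Mfd ==>
 \<bar>V N g t x - V N' g s x\<bar> <= C * (K + 1) * (rh ^ N + \<bar>t - s\<bar>)"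
 "!!N n g K x. N >= N0 ==> n < 2 ^ N ==> poly_fun g ==> wb 3 g K ==> x:Mfd ==>
 \<bar>U (dt N) (Suc n) g x - U (dt N) n g x - dt N * L (real n * dt N) (V N g (real n * dt N)) x\<bar> <= C * (dt N * sqrt (dt N)) * K"
 "!!N g m t. (ALL t:{0..T}. ALL x:Mfd. 0 <= gm t x) ==> N >= N0 ==> t:{0..T} ==> poly_fun g ==> m >= 0 ==> ALL x:Mfd. m <= g x
 ==> ALL x:Mfd. m <= V N g t x"
proof -
 obtain C N0 where C: "C >= 1" and
 a: "!!N n k g K. N >= N0 ==> n <= 2 ^ N ==> k <= 3 ==> poly_fun g ==> wb k g K ==> wb k (U (dt N) n g) (C * K)" and
 b: "!!N n g K x. N >= N0 ==> n <= 2 ^ N ==> poly_fun g ==> wb 3 g K ==> x:Mfd ==>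
 \<bar>U (dt N) n g x - U (dt (Suc N)) (2 * n) g x\<bar> <= C * sqrt (dt N) * K" and
 c: "!!N n g K x. N >= N0 ==> n < 2 ^ N ==> poly_fun g ==> wb 3 g K ==> x:Mfd ==>
 \<bar>U (dt N) (Suc n) g x - U (dt N) n g x - dt N * L (real n * dt N) (U (dt N) n g) x\<bar> <= C * (dt N * sqrt (dt N)) * K" and
 d: "!!N n g m. (ALL t:{0..T}. ALL x:Mfd. 0 <= gm t x) ==> N >= N0 ==> n <= 2 ^ N ==> poly_fun g ==> m >= 0 ==> ALL x:Mfd. m <= g x
 ==> ALL x:Mfd. m <= U (dt N) n g x" and
 N0: "dt N0 <= 1"
 by (rule U_estimates) (rule that; assumption)
 obtain C4 where C4: "C4 >= 0" "!!t f eps x. t:{0..T} ==> x:Mfd ==> \<bar>f x\<bar> <= eps ==> ALL a. \<bar>Rd (axis a 1) f x\<bar> <= eps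
 ==> ALL a. \<bar>Rd (axis a 1) (Rd (axis a 1) f) x\<bar> <= eps ==> \<bar>L t f x\<bar> <= C4 * eps" using L_bound by metis
 define A where "A = C + C4 * C"
 have A: "A >= 0" using C C4 by (simp add: A_def)
 have step: "\<bar>U (dt N) (Suc n) g x - U (dt N) n g x - 0\<bar> <= dt N * (A * K)"
 if "N >= N0" "n < 2 ^ N" "poly_fun g" "wb 3 g K" "x:Mfd" for N n g K x
 proof -
 have K: "0 <= K" using wb_nonneg[OF that(4)] .
 have w: "wb 2 (U (dt N) n g) (C * K)"
 by (rule wb_mono[OF a[OF that(1) less_imp_le[OF that(2)] order_refl that(3,4)]]) auto
 have "\<bar>L (real n * dt N) (U (dt N) n g) x\<bar> <= C4 * (C * K)"
 by (rule C4(2)[OF n_dt[OF less_imp_le[OF that(2)]] that(5)]) (intro allI wb_basis_words[OF w that(5)])+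
 then have 1: "\<bar>dt N * L (real n * dt N) (U (dt N) n g) x\<bar> <= dt N * (C4 * (C * K))"
 using dt_simps(1)[of N] by (simp add: abs_mult)
 have "sqrt (dt N) <= 1" using dt_mono[OF that(1)] N0 by simp
 then have "C * (dt N * sqrt (dt N)) * K <= C * (dt N * 1) * K"
 using C K dt_simps(1)[of N] by (intro mult_right_mono mult_left_mono) auto
 then have 2: "\<bar>U (dt N) (Suc n) g x - U (dt N) n g x - dt N * L (real n * dt N) (U (dt N) n g) x\<bar> <= dt N * (C * K)"
 using c[OF that] by (simp add: mult_ac)
 have "\<bar>U (dt N) (Suc n) g x - U (dt N) n g x\<bar> <= dt N * (C * K) + dt N * (C4 * (C * K))"
 using 1 2 by linarith
 then show ?thesis by (simp add: A_def algebra_simps)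
 qed
 have steps: "\<bar>U (dt N) n g x - U (dt N) m g x\<bar> <= \<bar>real n - real m\<bar> * (dt N * (A * K))"
 if ou: "N >= N0" "n <= 2 ^ N" "m <= 2 ^ N" "poly_fun g" "wb 3 g K" "x:Mfd" for N n m g K x
 proof -
 have *: "\<bar>U (dt N) n g x - U (dt N) m g x\<bar> <= (real n - real m) * (dt N * (A * K))" if h: "m <= n" "n <= 2 ^ N" for n m
 proof -
 have "\<bar>U (dt N) n g x - U (dt N) m g x - (real n - real m) * 0\<bar> <= (real n - real m) * (dt N * (A * K))"
 by (rule telescope_bound[OF h(1), of "%j. U (dt N) j g x"], rule step[OF ou(1) _ ou(4-6)])
 (use h in linarith)
 then show ?thesis by simp
 qed
 show ?thesis
 proof (cases "m <= n")
 case True then show ?thesis using *[OF True ou(2)] by simp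
 next
 case False
 then have "n <= m" by simp
 from *[OF this ou(3)] this show ?thesis by (simp add: abs_minus_commute)
 qed
 qed
 have time: "\<bar>V N g t x - V N g s x\<bar> <= (\<bar>t - s\<bar> + dt N) * (A * K)"
 if "N >= N0" "poly_fun g" "wb 3 g K" "x:Mfd" "s:{0..T}" "t:{0..T}" for N g K x s t
 proof -
 have K: "0 <= K" using wb_nonneg[OF that(3)] .
 have "\<bar>V N g t x - V N g s x\<bar> <= \<bar>real (idx N t) - real (idx N s)\<bar> * (dt N * (A * K))"
 unfolding V_def by (rule steps[OF that(1) idx_bounds(3) idx_bounds(3) that(2-4)]) fact+
 also have "... = \<bar>real (idx N t) * dt N - real (idx N s) * dt N\<bar> * (A * K)"
 using dt_simps(1)[of N] by (simp add: abs_mult flip: left_diff_distrib)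
 also have "... <= (\<bar>t - s\<bar> + dt N) * (A * K)"
 proof (rule mult_right_mono)
 have "p <= t ==> t < p + d ==> q <= s ==> s < q + d ==> \<bar>p - q\<bar> <= \<bar>t - s\<bar> + d" for p q d :: real
 by linarith
 then show "\<bar>real (idx N t) * dt N - real (idx N s) * dt N\<bar> <= \<bar>t - s\<bar> + dt N"
 using idx_bounds(1,2)[OF that(5), of N] idx_bounds(1,2)[OF that(6), of N] by (simp only: distrib_right mult_1)
 qed (use A K in auto)
 finally show ?thesis .
 qed
 define B where "B = A * T + C * sqrt T"
 have B: "B >= 0" using A C T by (simp add: B_def)
 have refine: "\<bar>V (Suc N) g t x - V N g t x\<bar> <= B * K * rh ^ N"
 if "N >= N0" "poly_fun g" "wb 3 g K" "x:Mfd" "t:{0..T}" for N g K x t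
 proof -
 have K: "0 <= K" using wb_nonneg[OF that(3)] .
 have i: "2 * idx N t <= 2 ^ Suc N" using idx_bounds(3)[OF that(5), of N] by simp
 have "\<bar>V (Suc N) g t x - U (dt (Suc N)) (2 * idx N t) g x\<bar> <= \<bar>real (idx (Suc N) t) - real (2 * idx N t)\<bar> * (dt (Suc N) * (A * K))"
 unfolding V_def by (rule steps[OF _ idx_bounds(3) i that(2-4)]) (use that in auto)
 also have "... <= 1 * (dt N * (A * K))"
 using idx_Suc[OF that(5), of N] A K dt_mono[of N "Suc N"] dt_simps(1)[of "Suc N"]
 by (intro mult_mono mult_right_mono) auto
 also have "... <= (T * rh ^ N) * (A * K)" using dt_rh(2)[of N] A K by (simp add: mult_right_mono)
 finally have "\<bar>V (Suc N) g t x - U (dt (Suc N)) (2 * idx N t) g x\<bar> <= (T * rh ^ N) * (A * K)" .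
 moreover have "\<bar>V N g t x - U (dt (Suc N)) (2 * idx N t) g x\<bar> <= C * (sqrt T * rh ^ N) * K"
 unfolding V_def dt_rh(1)[symmetric] by (rule b[OF that(1) idx_bounds(3) that(2-4)]) fact
 ultimately have "\<bar>V (Suc N) g t x - V N g t x\<bar> <= (T * rh ^ N) * (A * K) + C * (sqrt T * rh ^ N) * K" by linarith
 then show ?thesis by (simp add: B_def algebra_simps)
 qed
 have refines: "\<bar>V N' g t x - V N g t x\<bar> <= B * K / (1 - rh) * rh ^ N"
 if N: "N0 <= N" "N <= N'" and h: "poly_fun g" "wb 3 g K" "x:Mfd" "t:{0..T}" for N N' g K x t
 proof -
 have K: "0 <= K" using wb_nonneg[OF h(2)] .
 have r: "1 - rh > 0" using dt_rh(4) by linarith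
 from N(2) have "\<bar>V N' g t x - V N g t x\<bar> <= B * K / (1 - rh) * (rh ^ N - rh ^ N')"
 proof (induction N' rule: dec_induct)
 case (step N')
 have "\<bar>V (Suc N') g t x - V N' g t x\<bar> <= B * K * rh ^ N'" by (rule refine) (use step N h in auto)
 then have "\<bar>V (Suc N') g t x - V N g t x\<bar> <= B * K / (1 - rh) * (rh ^ N - rh ^ N') + B * K * rh ^ N'"
 using step.IH by linarith
 also have "B * K * rh ^ N' = B * K / (1 - rh) * (rh ^ N' - rh ^ Suc N')"
 proof -
 have "rh ^ N' - rh ^ Suc N' = (1 - rh) * rh ^ N'" by (simp add: algebra_simps)
 then show ?thesis using r by simp
 qed
 also have "B * K / (1 - rh) * (rh ^ N - rh ^ N') + ... = B * K / (1 - rh) * (rh ^ N - rh ^ Suc N')"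
 by (simp only: distrib_left[symmetric]) simp
 finally show ?case .
 qed simp
 also have "... <= B * K / (1 - rh) * rh ^ N"
 using B K r dt_rh(3) by (intro mult_left_mono) auto
 finally show ?thesis .
 qed
 define C' where "C' = C + A + A * T + B / (1 - rh)"
 have r: "1 - rh > 0" using dt_rh(4) by linarith
 have C': "C <= C'" "1 <= C'" "A + (A * T + B / (1 - rh)) <= C'"
 proof -
 have "0 <= A * T" "0 <= B / (1 - rh)" using A B T r by auto
 then show "C <= C'" "1 <= C'" "A + (A * T + B / (1 - rh)) <= C'" using C A by (auto simp: C'_def)
 qed
 show ?thesis
 proof (rule that[of C' N0])
 show "wb k (V N g t) (C' * K)" if "N0 <= N" "k <= 3" "poly_fun g" "wb k g K" "t:{0..T}" for N k g K t
 unfolding V_def by (rule wb_mono[OF a[OF that(1) idx_bounds(3)[OF that(5)] that(2-4)]])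
 (use C' wb_nonneg[OF that(4)] in \<open>auto intro!: mult_right_mono\<close>)
 show "\<bar>V N g t x - V N' g s x\<bar> <= C' * (K + 1) * (rh ^ N + \<bar>t - s\<bar>)"
 if "N0 <= N" "N <= N'" "poly_fun g" "wb 3 g K" "s:{0..T}" "t:{0..T}" "x:Mfd" for N N' g K s t x
 proof -
 have K: "0 <= K" using wb_nonneg[OF that(4)] .
 have 1: "\<bar>V N g t x - V N g s x\<bar> <= (\<bar>t - s\<bar> + dt N) * (A * K)" by (rule time) fact+
 have "(\<bar>t - s\<bar> + dt N) * (A * K) <= (\<bar>t - s\<bar> + T * rh ^ N) * (A * K)"
 using dt_rh(2)[of N] A K by (intro mult_right_mono) auto
 moreover have "\<bar>V N' g s x - V N g s x\<bar> <= B * K / (1 - rh) * rh ^ N" by (rule refines) fact+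
 ultimately have "\<bar>V N g t x - V N' g s x\<bar> <= (\<bar>t - s\<bar> + T * rh ^ N) * (A * K) + B * K / (1 - rh) * rh ^ N"
 using 1 by linarith
 also have "... = K * (A * \<bar>t - s\<bar> + (A * T + B / (1 - rh)) * rh ^ N)" by (simp add: algebra_simps)
 also have "... <= K * (C' * \<bar>t - s\<bar> + C' * rh ^ N)"
 proof -
 have "0 <= A * T + B / (1 - rh)" using A B T r by simp
 then have "A <= C'" "A * T + B / (1 - rh) <= C'" using C'(3) A by linarith+
 then show ?thesis using K dt_rh(3) by (intro mult_left_mono add_mono mult_right_mono) auto
 qed
 also have "... <= (K + 1) * (C' * \<bar>t - s\<bar> + C' * rh ^ N)"
 using C' dt_rh(3) by (intro mult_right_mono) auto
 finally show ?thesis by (simp add: algebra_simps)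
 qed
 show "\<bar>U (dt N) (Suc n) g x - U (dt N) n g x - dt N * L (real n * dt N) (V N g (real n * dt N)) x\<bar> <= C' * (dt N * sqrt (dt N)) * K"
 if "N0 <= N" "n < 2 ^ N" "poly_fun g" "wb 3 g K" "x:Mfd" for N n g K x
 proof -
 have "C * (dt N * sqrt (dt N)) * K <= C' * (dt N * sqrt (dt N)) * K"
 using C' wb_nonneg[OF that(4)] dt_simps(1)[of N] by (intro mult_right_mono) auto
 moreover have "V N g (real n * dt N) = U (dt N) n g" using that(2) by (simp add: V_def idx_multiple)
 ultimately show ?thesis using c[OF that] by simp
 qed
 show "ALL x:Mfd. m <= V N g t x" if "ALL t:{0..T}. ALL x:Mfd. 0 <= gm t x" "N0 <= N" "t:{0..T}" "poly_fun g" "m >= 0" "ALL x:Mfd. m <= g x" for N g m t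
 unfolding V_def by (rule d[OF that(1,2) idx_bounds(3)[OF that(3)] that(4-6)])
 qed (use C' N0 in auto)
qed

end

section \<open>Existence for the forward equation\<close>

text \<open>\<open>F as\<close> plays the role of the iterated derivative \<open>Rb as f\<close> of a \<open>C\<^sup>2\<close> function \<open>f = F []\<close>: the jet \<open>F\<close> is
 a uniform limit of jets of polynomials.\<close>

definition jet_approx :: "(('n \<times> 3) list => 'n::finite vec3 => real) => bool" where
 "jet_approx F \<longleftrightarrow> (ALL eps>0. EX p. poly_fun p & (ALL as x. length as <= 2 & x:Mfd --> \<bar>Rb as p x - F as x\<bar> < eps))"

context angular_parabolic
begin

text \<open>\<open>L\<close> evaluated on a jet: \<open>Rd\<close> is an ambient derivative and has
  no meaning for the limits of the scheme, whose convergence is controlled on \<open>Mfd\<close>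
  only.\<close>

definition LJ :: "real => (('n \<times> 3) list => 'n vec3 => real) => 'n vec3 => real" where
 "LJ t F x = kp * (SUM a:UNIV. F [a, a] x) + (SUM a:UNIV. be a x * F [a] x) + gm t x * F [] x"

lemma L_eq_LJ: "L t f x = LJ t (%as. Rb as f) x"
 by (simp add: L_def LJ_def)

lemma LJ_diff: "LJ t (%as x. F as x - G as x) x = LJ t F x - LJ t G x"
 by (simp add: LJ_def sum_subtractf algebra_simps)

lemma LJ_bound:
 obtains C where "C >= 0"
 "!!t x eps F. t:{0..T} ==> x:Mfd ==> (!!as. length as <= 2 ==> \<bar>F as x\<bar> <= eps) ==> \<bar>LJ t F x\<bar> <= C * eps"
proof -
 obtain C where C: "C >= 0"
 "!!t x eps (F2 :: 'n \<times> 3 => real) F1 F0. t:{0..T} ==> x:Mfd ==> \<bar>F0\<bar> <= eps ==> (!!a. \<bar>F1 a\<bar> <= eps) ==> (!!a. \<bar>F2 a\<bar> <= eps)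
 ==> \<bar>kp * (SUM a:UNIV. F2 a) + (SUM a:UNIV. be a x * F1 a) + gm t x * F0\<bar> <= C * eps"
 by (rule symbol_bound) blast
 have "\<bar>LJ t F x\<bar> <= C * eps" if "t:{0..T}" "x:Mfd" "!!as. length as <= 2 ==> \<bar>F as x\<bar> <= eps" for t x eps F
 unfolding LJ_def by (rule C(2)[OF that(1,2)]) (rule that(3), simp)+
 then show ?thesis using that C(1) by blast
qed

lemma tendsto_LJ:
 assumes "!!as. length as <= 2 ==> ((%n. F n as x) \<longlongrightarrow> G as x) net"
 shows "((%n. LJ t (F n) x) \<longlongrightarrow> LJ t G x) net"
 unfolding LJ_def by (intro tendsto_intros assms) auto

text \<open>The clause on \<open>s\<close> and \<open>t\<close> is continuity in time, uniform over
  \<open>Mfd\<close> and over the words; together with \<open>jet_approx\<close> it yields joint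
  continuity of all components. The evolution equation is imposed on the function itself, the word
  \<open>[]\<close>.\<close>

definition jet_solution :: "(('n \<times> 3) list => 'n vec3 => real) => (('n \<times> 3) list => real => 'n vec3 => real) => bool" where
 "jet_solution G u \<longleftrightarrow>
 (ALL t:{0..T}. jet_approx (%as. u as t)) &
 (ALL eps>0. EX dl>0. ALL s:{0..T}. ALL t:{0..T}. \<bar>t - s\<bar> < dl -->
 (ALL as x. length as <= 2 & x:Mfd --> \<bar>u as t x - u as s x\<bar> < eps)) &
 (ALL as x. length as <= 2 & x:Mfd --> u as 0 x = G as x) &
 (ALL t:{0..T}. ALL x:Mfd. ((%s. u [] s x) has_real_derivative LJ t (%as. u as t) x) (at t within {0..T}))"

text \<open>Polynomial data have bounded third derivatives, so interpolation gives convergence of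
  two derivatives. The dependence on the data is recorded with two derivatives, because data that
  are only \<open>C^2\<close> have to be reached by approximation.\<close>

lemma poly_solution:
 obtains E u where "E >= 0"
 "!!g. poly_fun g ==> jet_solution (%as. Rb as g) (u g)"
 "!!g g' K t as x. poly_fun g ==> poly_fun g' ==> wb 2 (%x. g x - g' x) K ==> t:{0..T} ==> length as <= 2 ==> x:Mfd
 ==> \<bar>u g as t x - u g' as t x\<bar> <= E * K"
 "!!g m t x. (ALL t:{0..T}. ALL x:Mfd. 0 <= gm t x) ==> poly_fun g ==> m >= 0 ==> ALL x:Mfd. m <= g x ==> t:{0..T} ==> x:Mfd
 ==> m <= u g [] t x"
proof -
 obtain C N0 where C: "C >= 1" and
 a: "!!N k g K t. N >= N0 ==> k <= 3 ==> poly_fun g ==> wb k g K ==> t:{0..T} ==> wb k (V N g t) (C * K)" and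
 b: "!!N N' g K s t x. N >= N0 ==> N <= N' ==> poly_fun g ==> wb 3 g K ==> s:{0..T} ==> t:{0..T} ==> x:Mfd ==>
 \<bar>V N g t x - V N' g s x\<bar> <= C * (K + 1) * (rh ^ N + \<bar>t - s\<bar>)" and
 c: "!!N n g K x. N >= N0 ==> n < 2 ^ N ==> poly_fun g ==> wb 3 g K ==> x:Mfd ==>
 \<bar>U (dt N) (Suc n) g x - U (dt N) n g x - dt N * L (real n * dt N) (V N g (real n * dt N)) x\<bar> <= C * (dt N * sqrt (dt N)) * K" and
 d: "!!N g m t. (ALL t:{0..T}. ALL x:Mfd. 0 <= gm t x) ==> N >= N0 ==> t:{0..T} ==> poly_fun g ==> m >= 0 ==> ALL x:Mfd. m <= g x
 ==> ALL x:Mfd. m <= V N g t x"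
 by (rule V_estimates) (rule that; assumption)
 obtain C4 where C4: "C4 >= 0" "!!t x eps F. t:{0..T} ==> x:Mfd ==> (!!as. length as <= 2 ==> \<bar>F as x\<bar> <= eps) ==> \<bar>LJ t F x\<bar> <= C4 * eps"
 by (rule LJ_bound) blast
 obtain C5 where C5: "C5 >= 0" "!!s t x. s:{0..T} ==> t:{0..T} ==> x:Mfd ==> \<bar>gm t x - gm s x\<bar> <= C5 * \<bar>t - s\<bar>"
 using gm_lipschitz by metis
 define u where "u g as t x = lim (%N. Rb as (V N g t) x)" for g as t x
 define A1 where "A1 K = 1 + 4 * C * K" for K
 define A2 where "A2 K = C * (K + 1)" for K
 have rh0: "(%N. rh ^ N) \<longlonglongrightarrow> 0" using dt_rh(3,4) by (intro LIMSEQ_power_zero) auto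
 have rhp: "rh ^ N > 0" for N using dt_rh(3) by simp
 \<comment> \<open>The difference of two approximations is a polynomial whose third-order bound is
   \<open>2 * C * K\<close>; with \<open>1 + 2 * (2 * C * K)\<close> this gives \<open>A1 K\<close>,
   while \<open>A2 K\<close> scales its sup norm.\<close>
 have close: "\<bar>Rb as (V N g t) x - Rb as (V N' g s) x\<bar> <= A1 K * mu (A2 K * (rh ^ N + \<bar>t - s\<bar>))"
 if h: "N >= N0" "N <= N'" "poly_fun g" "wb 3 g K" "s:{0..T}" "t:{0..T}" "x:Mfd" "length as <= 2" for N N' g K s t x as
 proof -
 have K: "0 <= K" using wb_nonneg[OF h(4)] .
 let ?f = "%x. V N g t x - V N' g s x"
 have p: "poly_fun (V N g t)" "poly_fun (V N' g s)" using poly_V[OF h(3)] by auto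
 have "wb 3 ?f (C * K + C * K)"
 by (rule wb_diff[OF p a[OF h(1) order_refl h(3,4,6)] a[OF _ order_refl h(3,4,5)]]) (use h in simp)
 moreover have "A2 K * (rh ^ N + \<bar>t - s\<bar>) > 0"
 proof -
 have "0 < C * (K + 1)" "0 < rh ^ N + \<bar>t - s\<bar>" using C K rhp[of N] by (simp_all add: add_pos_nonneg add_nonneg_pos)
 then show ?thesis unfolding A2_def by (rule mult_pos_pos)
 qed
 moreover have "\<bar>?f y\<bar> <= A2 K * (rh ^ N + \<bar>t - s\<bar>)" if "y:Mfd" for y
 unfolding A2_def by (rule b) fact+
 ultimately have "\<bar>Rb as ?f x\<bar> <= (1 + 2 * (C * K + C * K)) * mu (A2 K * (rh ^ N + \<bar>t - s\<bar>))"
 using p h by (intro Rb_interpolation real_polynomial_function_diff) auto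
 then show ?thesis unfolding Rb_diff[OF p] A1_def by (simp add: algebra_simps)
 qed
 have mu_lim: "(%N. A1 K * mu (A2 K * (rh ^ N + r))) \<longlonglongrightarrow> A1 K * mu (A2 K * r)" for K r
 proof -
 have "(%N. A2 K * (rh ^ N + r)) \<longlonglongrightarrow> A2 K * (0 + r)" by (intro tendsto_intros rh0)
 then have "(%N. A2 K * (rh ^ N + r)) \<longlonglongrightarrow> A2 K * r" by simp
 from isCont_tendsto_compose[OF isCont_mu this] show ?thesis by (rule tendsto_mult_left)
 qed
 have K_ex: "EX K. wb 3 g K" if "poly_fun g" for g :: "'n vec3 => real" by (rule wb_exists[OF that])
 have lim: "(%N. Rb as (V N g t) x) \<longlonglongrightarrow> u g as t x"
 if h: "poly_fun g" "t:{0..T}" "x:Mfd" "length as <= 2" for g t x as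
 proof -
 obtain K where K: "wb 3 g K" using K_ex[OF h(1)] by blast
 have "Cauchy (%N. Rb as (V N g t) x)"
 proof (rule CauchyI')
 fix e :: real assume e: "0 < e"
 have "(%N. A1 K * mu (A2 K * (rh ^ N + 0))) \<longlonglongrightarrow> A1 K * mu (A2 K * 0)" by (rule mu_lim)
 then have "eventually (%N. A1 K * mu (A2 K * (rh ^ N + 0)) < e) sequentially"
 by (rule order_tendstoD) (use e in simp)
 then obtain M where M: "!!N. N >= M ==> A1 K * mu (A2 K * (rh ^ N + 0)) < e" by (auto simp: eventually_sequentially)
 have "norm (Rb as (V m g t) x - Rb as (V n g t) x) < e" if "m >= max M N0" "n > m" for m n
 using close[of m n g K t t x as] h K M[of m] that by simp
 then show "EX M. ALL m>=M. ALL n>m. dist (Rb as (V m g t) x) (Rb as (V n g t) x) < e"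
 by (auto simp: dist_norm intro!: exI[of _ "max M N0"])
 qed
 then have "convergent (%N. Rb as (V N g t) x)" by (simp add: Cauchy_convergent_iff)
 then show ?thesis unfolding u_def by (rule convergent_LIMSEQ_iff[THEN iffD1])
 qed
 have uconv: "\<bar>Rb as (V N g t) x - u g as t x\<bar> <= A1 K * mu (A2 K * (rh ^ N + 0))"
 if h: "N >= N0" "poly_fun g" "wb 3 g K" "t:{0..T}" "x:Mfd" "length as <= 2" for N g K t x as
 proof (rule tendsto_upperbound)
 show "(%N'. \<bar>Rb as (V N g t) x - Rb as (V N' g t) x\<bar>) \<longlonglongrightarrow> \<bar>Rb as (V N g t) x - u g as t x\<bar>"
 by (intro tendsto_intros lim) fact+
 show "eventually (%N'. \<bar>Rb as (V N g t) x - Rb as (V N' g t) x\<bar> <= A1 K * mu (A2 K * (rh ^ N + 0))) sequentially"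
 unfolding eventually_sequentially using close[OF h(1) _ h(2,3,4,4,5,6)] by (auto intro!: exI[of _ N])
 qed simp
 have ucont: "\<bar>u g as t x - u g as s x\<bar> <= A1 K * mu (A2 K * \<bar>t - s\<bar>)"
 if h: "poly_fun g" "wb 3 g K" "s:{0..T}" "t:{0..T}" "x:Mfd" "length as <= 2" for g K s t x as
 proof (rule LIMSEQ_le)
 show "(%N. \<bar>Rb as (V N g t) x - Rb as (V N g s) x\<bar>) \<longlonglongrightarrow> \<bar>u g as t x - u g as s x\<bar>"
 by (intro tendsto_intros lim) fact+
 show "(%N. A1 K * mu (A2 K * (rh ^ N + \<bar>t - s\<bar>))) \<longlonglongrightarrow> A1 K * mu (A2 K * \<bar>t - s\<bar>)" by (rule mu_lim)
 show "EX N. ALL n>=N. \<bar>Rb as (V n g t) x - Rb as (V n g s) x\<bar> <= A1 K * mu (A2 K * (rh ^ n + \<bar>t - s\<bar>))"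
 using close[OF _ order_refl h] by blast
 qed
 have mu_small: "EX dl>0. ALL r. 0 <= r & r < dl --> A1 K * mu (A2 K * r) < e" if "e > 0" for e K
 proof -
 have "isCont (%r. A1 K * mu (A2 K * r)) 0"
 by (intro continuous_intros isCont_o2[OF _ isCont_mu])
 from this[unfolded continuous_at_eps_delta, rule_format, OF that]
 obtain dl where dl: "dl > 0" "ALL r. dist r 0 < dl --> dist (A1 K * mu (A2 K * r)) (A1 K * mu (A2 K * 0)) < e"
 by (elim exE conjE)
 have "A1 K * mu (A2 K * r) < e" if "0 <= r & r < dl" for r
 using dl(2)[rule_format, of r] that by (simp add: dist_norm)
 then show ?thesis using dl(1) by blast
 qed
 \<comment> \<open>The difference quotient is estimated before \<open>N\<close> tends to infinity:
   the increments of the scheme between the grid times of \<open>s\<close> and \<open>t\<close> are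
   summed, each compared with \<open>dt N\<close> times the operator frozen at time
   \<open>s\<close>.\<close>
 have deriv: "((%t. u g [] t x) has_real_derivative LJ s (%as. u g as s) x) (at s within {0..T})"
 if g: "poly_fun g" and s: "s:{0..T}" and x: "x:Mfd" for g s x
 proof -
 obtain K where K: "wb 3 g K" using K_ex[OF g] by blast
 have K0: "0 <= K" using wb_nonneg[OF K] .
 have A1: "A1 K >= 0" "A2 K >= 0" using K0 C by (auto simp: A1_def A2_def)
 \<comment> \<open>The terms are the local error of the scheme, the change of the jet between the
   current grid time and \<open>s\<close>, and the change of \<open>gm\<close>; \<open>z\<close>
   will bound the distance in time together with the mesh size.\<close>
 define W where "W z = C * K * z + C4 * (A1 K * mu (A2 K * z)) + C5 * z * (C * K)" for z
 have W_cont: "isCont W z" for z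
 unfolding W_def by (intro continuous_intros isCont_o2[OF _ isCont_mu])
 have step: "\<bar>U (dt N) (Suc j) g x - U (dt N) j g x - dt N * L s (V N g s) x\<bar> <= dt N * W z"
 if N: "N >= N0" and j: "j < 2 ^ N" and z: "rh ^ N + \<bar>real j * dt N - s\<bar> <= z" "sqrt (dt N) <= z" for N j z
 proof -
 let ?q = "real j * dt N"
 have q: "?q:{0..T}" by (rule n_dt[OF less_imp_le[OF j]])
 have z0: "\<bar>?q - s\<bar> <= z" using z(1) rhp[of N] by linarith
 have e: "\<bar>Rb as (V N g ?q) x - Rb as (V N g s) x\<bar> <= A1 K * mu (A2 K * z)" if "length as <= 2" for as
 by (rule order_trans[OF close[OF N order_refl g K s q x that]])
 (intro mult_left_mono mu_mono z A1)
 have eq: "L ?q (V N g ?q) x - L s (V N g s) x = LJ ?q (%as x. Rb as (V N g ?q) x - Rb as (V N g s) x) x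
 + (gm ?q x - gm s x) * V N g s x"
 unfolding LJ_diff L_eq_LJ by (simp add: LJ_def algebra_simps)
 have 1: "\<bar>LJ ?q (%as x. Rb as (V N g ?q) x - Rb as (V N g s) x) x\<bar> <= C4 * (A1 K * mu (A2 K * z))"
 by (rule C4(2)[OF q x]) (rule e)
 have "\<bar>V N g s x\<bar> <= C * K" using wbD[OF a[OF N order_refl g K s] unit_word_simps(1) x] by simp
 moreover have "\<bar>gm ?q x - gm s x\<bar> <= C5 * z"
 using C5(2)[OF s q x] mult_left_mono[OF z0 C5(1)] by linarith
 ultimately have 2: "\<bar>(gm ?q x - gm s x) * V N g s x\<bar> <= C5 * z * (C * K)"
 unfolding abs_mult using C5(1) z0 by (intro mult_mono) auto
 have 3: "\<bar>U (dt N) (Suc j) g x - U (dt N) j g x - dt N * L ?q (V N g ?q) x\<bar> <= dt N * (C * K * z)"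
 proof -
 have "C * (dt N * sqrt (dt N)) * K <= C * (dt N * z) * K"
 using C K0 dt_simps(1)[of N] z(2) by (intro mult_right_mono mult_left_mono) auto
 then show ?thesis using c[OF N j g K x] by (simp add: mult_ac)
 qed
 have "\<bar>dt N * (L ?q (V N g ?q) x - L s (V N g s) x)\<bar> <= dt N * (C4 * (A1 K * mu (A2 K * z)) + C5 * z * (C * K))"
 unfolding abs_mult eq using dt_simps(1)[of N] 1 2 by (intro mult_mono) auto
 then have "\<bar>(U (dt N) (Suc j) g x - U (dt N) j g x - dt N * L ?q (V N g ?q) x) + dt N * (L ?q (V N g ?q) x - L s (V N g s) x)\<bar>
 <= dt N * (C * K * z) + dt N * (C4 * (A1 K * mu (A2 K * z)) + C5 * z * (C * K))"
 using 3 by linarith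
 then show ?thesis by (simp add: W_def algebra_simps)
 qed
 have disc: "\<bar>V N g t x - V N g s x - (real (idx N t) * dt N - real (idx N s) * dt N) * L s (V N g s) x\<bar>
 <= \<bar>real (idx N t) * dt N - real (idx N s) * dt N\<bar> * W (\<bar>t - s\<bar> + (1 + T) * rh ^ N)"
 if N: "N >= N0" and t: "t:{0..T}" for N t
 proof -
 define z where "z = \<bar>t - s\<bar> + (1 + T) * rh ^ N"
 have "sqrt T <= 1 + T" using T by (intro real_le_lsqrt) (auto simp: power2_eq_square algebra_simps)
 then have "sqrt T * rh ^ N <= (1 + T) * rh ^ N" using rhp[of N] by (intro mult_right_mono) auto
 then have z2: "sqrt (dt N) <= z" unfolding dt_rh(1) z_def by linarith
 have z3: "rh ^ N + (\<bar>t - s\<bar> + dt N) <= z" unfolding z_def using dt_rh(2)[of N] by (simp add: algebra_simps)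
 have mono: "real m * dt N <= real n * dt N" if "m <= n" for m n
 using that dt_simps(1)[of N] by (intro mult_right_mono) auto
 have lin: "p <= t ==> t < p + d ==> q <= s ==> s < q + d ==> (q <= j & j <= p \<or> p <= j & j <= q) ==> \<bar>j - s\<bar> <= \<bar>t - s\<bar> + d" for p q d j :: real
 by linarith
 have bt: "real (idx N t) * dt N <= t" "t < real (idx N t) * dt N + dt N" "real (idx N s) * dt N <= s" "s < real (idx N s) * dt N + dt N"
 using idx_bounds(1,2)[OF t, of N] idx_bounds(1,2)[OF s, of N] by (simp_all only: distrib_right mult_1)
 have near: "rh ^ N + \<bar>real j * dt N - s\<bar> <= z"
 if "idx N s <= j & j <= idx N t \<or> idx N t <= j & j <= idx N s" for j
 proof -
 have "real (idx N s) * dt N <= real j * dt N & real j * dt N <= real (idx N t) * dt N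
 \<or> real (idx N t) * dt N <= real j * dt N & real j * dt N <= real (idx N s) * dt N"
 using that mono by blast
 from lin[OF bt this] z3 show ?thesis by linarith
 qed
 show ?thesis
 proof (cases "idx N s <= idx N t")
 case True
 have "\<bar>U (dt N) (idx N t) g x - U (dt N) (idx N s) g x - (real (idx N t) - real (idx N s)) * (dt N * L s (V N g s) x)\<bar>
 <= (real (idx N t) - real (idx N s)) * (dt N * W z)"
 proof (rule telescope_bound[OF True, of "%j. U (dt N) j g x"], rule step[OF N _ near z2])
 fix j assume "idx N s <= j" "j < idx N t"
 then show "j < 2 ^ N" "idx N s <= j & j <= idx N t \<or> idx N t <= j & j <= idx N s"
 using idx_bounds(3)[OF t, of N] by linarith+
 qed
 then show ?thesis using mono[OF True] by (simp add: V_def z_def left_diff_distrib mult.assoc)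
 next
 case False
 then have le: "idx N t <= idx N s" by simp
 have "\<bar>U (dt N) (idx N s) g x - U (dt N) (idx N t) g x - (real (idx N s) - real (idx N t)) * (dt N * L s (V N g s) x)\<bar>
 <= (real (idx N s) - real (idx N t)) * (dt N * W z)"
 proof (rule telescope_bound[OF le, of "%j. U (dt N) j g x"], rule step[OF N _ near z2])
 fix j assume "idx N t <= j" "j < idx N s"
 then show "j < 2 ^ N" "idx N s <= j & j <= idx N t \<or> idx N t <= j & j <= idx N s"
 using idx_bounds(3)[OF s, of N] by linarith+
 qed
 moreover have "U (dt N) (idx N s) g x - U (dt N) (idx N t) g x - (real (idx N s) - real (idx N t)) * (dt N * L s (V N g s) x)
 = - (V N g t x - V N g s x - (real (idx N t) * dt N - real (idx N s) * dt N) * L s (V N g s) x)"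
 by (simp add: V_def algebra_simps)
 moreover have "(real (idx N s) - real (idx N t)) * (dt N * W z)
 = \<bar>real (idx N t) * dt N - real (idx N s) * dt N\<bar> * W z"
 using mono[OF le] by (simp add: algebra_simps)
 ultimately show ?thesis unfolding z_def[symmetric] by (simp only: abs_minus_cancel)
 qed
 qed
 have idx_lim: "(%N. real (idx N t) * dt N) \<longlonglongrightarrow> t" if t: "t:{0..T}" for t
 proof -
 have "(%N. t - T * rh ^ N) \<longlonglongrightarrow> t - T * 0" by (intro tendsto_intros rh0)
 then have "(%N. t - T * rh ^ N) \<longlonglongrightarrow> t" by simp
 then show ?thesis
 proof (rule tendsto_sandwich[rotated 2])
 show "(%N. t) \<longlonglongrightarrow> t" by simp
 show "eventually (%N. t - T * rh ^ N <= real (idx N t) * dt N) sequentially"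
 proof (rule always_eventually, rule allI)
 fix N show "t - T * rh ^ N <= real (idx N t) * dt N"
 using idx_bounds(2)[OF t, of N] dt_rh(2)[of N] by (simp only: distrib_right mult_1)
 qed
 show "eventually (%N. real (idx N t) * dt N <= t) sequentially"
 using idx_bounds(1)[OF t] by simp
 qed
 qed
 \<comment> \<open>In the limit the contributions of the mesh disappear and the modulus
   \<open>W \<bar>t - s\<bar>\<close> remains, which tends to 0 with \<open>t - s\<close>.\<close>
 have main: "\<bar>u g [] t x - u g [] s x - (t - s) * LJ s (%as. u g as s) x\<bar> <= \<bar>t - s\<bar> * W \<bar>t - s\<bar>" if t: "t:{0..T}" for t
 proof (rule LIMSEQ_le)
 have V: "(%N. V N g t x) \<longlonglongrightarrow> u g [] t x" if "t:{0..T}" for t using lim[OF g that x, of "[]"] by simp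
 have Ls: "(%N. L s (V N g s) x) \<longlonglongrightarrow> LJ s (%as. u g as s) x"
 unfolding L_eq_LJ by (rule tendsto_LJ) (rule lim[OF g s x])
 show "(%N. \<bar>V N g t x - V N g s x - (real (idx N t) * dt N - real (idx N s) * dt N) * L s (V N g s) x\<bar>)
 \<longlonglongrightarrow> \<bar>u g [] t x - u g [] s x - (t - s) * LJ s (%as. u g as s) x\<bar>"
 by (intro tendsto_intros V Ls idx_lim s t)
 have "(%N. \<bar>t - s\<bar> + (1 + T) * rh ^ N) \<longlonglongrightarrow> \<bar>t - s\<bar> + (1 + T) * 0" by (intro tendsto_intros rh0)
 then have "(%N. \<bar>t - s\<bar> + (1 + T) * rh ^ N) \<longlonglongrightarrow> \<bar>t - s\<bar>" by simp
 from isCont_tendsto_compose[OF W_cont this]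
 show "(%N. \<bar>real (idx N t) * dt N - real (idx N s) * dt N\<bar> * W (\<bar>t - s\<bar> + (1 + T) * rh ^ N)) \<longlonglongrightarrow> \<bar>t - s\<bar> * W \<bar>t - s\<bar>"
 by (intro tendsto_intros idx_lim s t)
 show "EX N. ALL n>=N. \<bar>V n g t x - V n g s x - (real (idx n t) * dt n - real (idx n s) * dt n) * L s (V n g s) x\<bar>
 <= \<bar>real (idx n t) * dt n - real (idx n s) * dt n\<bar> * W (\<bar>t - s\<bar> + (1 + T) * rh ^ n)"
 using disc[OF _ t] by blast
 qed
 show ?thesis
 unfolding has_field_derivative_iff
 proof (rule LIM_zero_cancel, rule Lim_null_comparison)
 show "eventually (%y. norm ((u g [] y x - u g [] s x) / (y - s) - LJ s (%as. u g as s) x) <= W \<bar>y - s\<bar>) (at s within {0..T})"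
 unfolding eventually_at_filter
 proof (rule always_eventually, intro allI impI)
 fix y assume y: "y \<noteq> s" "y:{0..T}"
 have "(u g [] y x - u g [] s x) / (y - s) - LJ s (%as. u g as s) x
 = (u g [] y x - u g [] s x - (y - s) * LJ s (%as. u g as s) x) / (y - s)"
 using y by (simp add: diff_divide_distrib)
 then have "norm ((u g [] y x - u g [] s x) / (y - s) - LJ s (%as. u g as s) x)
 = \<bar>u g [] y x - u g [] s x - (y - s) * LJ s (%as. u g as s) x\<bar> / \<bar>y - s\<bar>" by simp
 also have "... <= \<bar>y - s\<bar> * W \<bar>y - s\<bar> / \<bar>y - s\<bar>" by (rule divide_right_mono[OF main[OF y(2)]]) simp
 also have "... = W \<bar>y - s\<bar>" using y by simp
 finally show "norm ((u g [] y x - u g [] s x) / (y - s) - LJ s (%as. u g as s) x) <= W \<bar>y - s\<bar>" .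
 qed
 have "((%y. \<bar>y - s\<bar>) \<longlongrightarrow> \<bar>s - s\<bar>) (at s within {0..T})" by (intro tendsto_intros)
 then have "((%y. \<bar>y - s\<bar>) \<longlongrightarrow> 0) (at s within {0..T})" by simp
 from isCont_tendsto_compose[OF W_cont this]
 show "((%y. W \<bar>y - s\<bar>) \<longlongrightarrow> 0) (at s within {0..T})" by (simp add: W_def)
 qed
 qed
 have sol: "jet_solution (%as. Rb as g) (u g)" if g: "poly_fun g" for g
 unfolding jet_solution_def
 proof (intro conjI ballI allI impI)
 obtain K where K: "wb 3 g K" using K_ex[OF g] by blast
 fix t assume t: "t:{0..T}"
 show "jet_approx (%as. u g as t)"
 unfolding jet_approx_def
 proof (intro allI impI)
 fix e :: real assume e: "e > 0"
 have "(%N. A1 K * mu (A2 K * (rh ^ N + 0))) \<longlonglongrightarrow> A1 K * mu (A2 K * 0)" by (rule mu_lim)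
 then have "eventually (%N. A1 K * mu (A2 K * (rh ^ N + 0)) < e) sequentially"
 by (rule order_tendstoD) (use e in simp)
 then obtain N where N: "N >= N0" "A1 K * mu (A2 K * (rh ^ N + 0)) < e"
 unfolding eventually_sequentially by (meson max.cobounded1 max.cobounded2)
 show "EX p. poly_fun p & (ALL as x. length as <= 2 & x:Mfd --> \<bar>Rb as p x - u g as t x\<bar> < e)"
 by (rule exI[of _ "V N g t"]) (use uconv[OF N(1) g K t] N(2) poly_V[OF g] in \<open>force intro: le_less_trans\<close>)
 qed
 next
 obtain K where K: "wb 3 g K" using K_ex[OF g] by blast
 fix e :: real assume e: "e > 0"
 obtain dl where dl: "dl > 0" "!!r. 0 <= r ==> r < dl ==> A1 K * mu (A2 K * r) < e" using mu_small[OF e] by blast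
 show "EX dl>0. ALL s:{0..T}. ALL t:{0..T}. \<bar>t - s\<bar> < dl --> (ALL as x. length as <= 2 & x:Mfd --> \<bar>u g as t x - u g as s x\<bar> < e)"
 proof (intro exI[of _ dl] conjI dl(1) ballI allI impI, elim conjE)
 fix s t and as :: "('n \<times> 3) list" and x :: "'n vec3"
 assume "s:{0..T}" "t:{0..T}" "\<bar>t - s\<bar> < dl" "length as <= 2" "x:Mfd"
 then show "\<bar>u g as t x - u g as s x\<bar> < e"
 using ucont[OF g K, of s t x as] dl(2)[of "\<bar>t - s\<bar>"] by linarith
 qed
 next
 fix as :: "('n \<times> 3) list" and x assume h: "length as <= 2 & x:(Mfd :: 'n vec3 set)"
 have "V N g 0 = g" for N by (simp add: V_def idx_def)
 then have "(%N. Rb as g x) \<longlonglongrightarrow> u g as 0 x" using lim[OF g _ _ , of 0 x as] h T by simp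
 then show "u g as 0 x = Rb as g x" by (simp add: LIMSEQ_const_iff)
 next
 fix t and x :: "'n vec3" assume "t:{0..T}" "x:Mfd"
 then show "((%s. u g [] s x) has_real_derivative LJ t (%as. u g as t) x) (at t within {0..T})" by (rule deriv[OF g])
 qed
 \<comment> \<open>The scheme is linear, so its stability in two derivatives applies to the
   approximations with datum \<open>g - g'\<close>.\<close>
 have stab: "\<bar>u g as t x - u g' as t x\<bar> <= C * K"
 if h: "poly_fun g" "poly_fun g'" "wb 2 (%x. g x - g' x) K" "t:{0..T}" "length as <= 2" "x:Mfd" for g g' K t as x
 proof (rule tendsto_upperbound)
 show "(%N. \<bar>Rb as (V N g t) x - Rb as (V N g' t) x\<bar>) \<longlonglongrightarrow> \<bar>u g as t x - u g' as t x\<bar>"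
 by (intro tendsto_intros lim) fact+
 have "\<bar>Rb as (V N g t) x - Rb as (V N g' t) x\<bar> <= C * K" if N: "N >= N0" for N
 proof -
 have "wb 2 (V N (%x. g x - g' x) t) (C * K)"
 by (rule a[OF N _ real_polynomial_function_diff[OF h(1,2)] h(3,4)]) simp
 moreover have "V N (%x. g x - g' x) t = (%x. V N g t x - V N g' t x)"
 unfolding V_def by (rule ext, rule U_diff)
 ultimately have "\<bar>Rb as (%x. V N g t x - V N g' t x) x\<bar> <= C * K"
 using wb_Rb h(5,6) by metis
 then show ?thesis by (simp add: Rb_diff[OF poly_V[OF h(1)] poly_V[OF h(2)]])
 qed
 then show "eventually (%N. \<bar>Rb as (V N g t) x - Rb as (V N g' t) x\<bar> <= C * K) sequentially"
 unfolding eventually_sequentially by blast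
 qed simp
 have low: "m <= u g [] t x"
 if h: "(ALL t:{0..T}. ALL x:Mfd. 0 <= gm t x)" "poly_fun g" "m >= 0" "ALL x:Mfd. m <= g x" "t:{0..T}" "x:Mfd" for g m t x
 proof (rule tendsto_lowerbound)
 show "(%N. V N g t x) \<longlonglongrightarrow> u g [] t x" using lim[OF h(2,5,6), of "[]"] by simp
 show "eventually (%N. m <= V N g t x) sequentially"
 unfolding eventually_sequentially using d[OF h(1) _ h(5,2,3,4)] h(6) by blast
 qed simp
 show ?thesis by (rule that[of C u, OF _ sol stab low]) (use C in auto)
qed

text \<open>Approximating the datum in \<open>C^2\<close> by polynomials makes the solutions Cauchy
  with two derivatives, uniformly in time. The equation survives the limit because the time
  derivatives, being \<open>LJ\<close> of the jets, converge uniformly as well.\<close>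

lemma general_solution:
 assumes G: "jet_approx G"
 obtains v where "jet_solution G v"
 "!!m t x. (ALL t:{0..T}. ALL x:Mfd. 0 <= gm t x) ==> m > 0 ==> ALL x:Mfd. m <= G [] x ==> t:{0..T} ==> x:Mfd ==> m <= v [] t x"
proof -
 obtain E u where E: "E >= 0" and
 sol: "!!g. poly_fun g ==> jet_solution (%as. Rb as g) (u g)" and
 stab: "!!g g' K t as x. poly_fun g ==> poly_fun g' ==> wb 2 (%x. g x - g' x) K ==> t:{0..T} ==> length as <= 2 ==> x:Mfd
 ==> \<bar>u g as t x - u g' as t x\<bar> <= E * K" and
 low: "!!g m t x. (ALL t:{0..T}. ALL x:Mfd. 0 <= gm t x) ==> poly_fun g ==> m >= 0 ==> ALL x:Mfd. m <= g x ==> t:{0..T} ==> x:Mfd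
 ==> m <= u g [] t x"
 by (rule poly_solution) (rule that; assumption)
 obtain C4 where C4: "C4 >= 0" "!!t x eps F. t:{0..T} ==> x:Mfd ==> (!!as. length as <= 2 ==> \<bar>F as x\<bar> <= eps) ==> \<bar>LJ t F x\<bar> <= C4 * eps"
 by (rule LJ_bound) blast
 have "EX p. ALL n. poly_fun (p n) & (ALL as x. length as <= 2 & x:Mfd --> \<bar>Rb as (p n) x - G as x\<bar> < inverse (real (Suc n)))"
 using G unfolding jet_approx_def by (intro choice allI) simp
 then obtain p where p: "!!n. poly_fun (p n)"
 "!!n as x. length as <= 2 ==> x:Mfd ==> \<bar>Rb as (p n) x - G as x\<bar> < inverse (real (Suc n))" by blast
 \<comment> \<open>The power of the cardinality passes from words in the axes to all unit words, the
   2 is the triangle inequality between two approximants, and the \<open>+ 1\<close> makes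
   \<open>A\<close> positive.\<close>
 define A where "A = E * (real CARD('n \<times> 3) ^ 2 * 2) + 1"
 have A: "A > 0" using E by (simp add: A_def add_nonneg_pos)
 define e where "e n = A * inverse (real (Suc n))" for n
 have e_lim: "e \<longlonglongrightarrow> 0"
 unfolding e_def using tendsto_mult_right_zero[OF LIMSEQ_inverse_real_of_nat, of A] by simp
 have e_mono: "n <= n' ==> e n' <= e n" for n n'
 unfolding e_def using A by (intro mult_left_mono) (auto simp: field_simps)
 have close: "\<bar>u (p n) as t x - u (p n') as t x\<bar> <= e n"
 if h: "n <= n'" "t:{0..T}" "length as <= 2" "x:Mfd" for n n' as t x
 proof -
 have "inverse (real (Suc n')) <= inverse (real (Suc n))" using h(1) by (simp add: field_simps)
 then have "\<bar>Rb bs (%x. p n x - p n' x) y\<bar> <= 2 * inverse (real (Suc n))" if "length bs <= 2" "y:Mfd" for bs y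
 using p(2)[OF that, of n] p(2)[OF that, of n'] unfolding Rb_diff[OF p(1) p(1)] by linarith
 then have "wb 2 (%x. p n x - p n' x) (real CARD('n \<times> 3) ^ 2 * (2 * inverse (real (Suc n))))"
 by (rule wb_of_basis_words[OF real_polynomial_function_diff[OF p(1) p(1)]])
 from stab[OF p(1) p(1) this h(2,3,4)]
 have "\<bar>u (p n) as t x - u (p n') as t x\<bar> <= E * (real CARD('n \<times> 3) ^ 2 * (2 * inverse (real (Suc n))))" .
 also have "... <= e n" unfolding e_def A_def by (simp add: distrib_right mult_ac)
 finally show ?thesis .
 qed
 define v where "v as t x = lim (%n. u (p n) as t x)" for as t x
 have lim: "(%n. u (p n) as t x) \<longlonglongrightarrow> v as t x" if h: "t:{0..T}" "length as <= 2" "x:Mfd" for as t x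
 proof -
 have "Cauchy (%n. u (p n) as t x)"
 proof (rule CauchyI')
 fix r :: real assume "r > 0"
 then have "eventually (%n. e n < r) sequentially" using e_lim by (rule order_tendstoD(2)[rotated])
 then obtain n where "e n < r" by (auto simp: eventually_sequentially)
 then have "dist (u (p m) as t x) (u (p m') as t x) < r" if "m >= n" "m' > m" for m m'
 using close[of m m' t as x] h that e_mono[of n m] by (simp add: dist_norm)
 then show "EX M. ALL m>=M. ALL n>m. dist (u (p m) as t x) (u (p n) as t x) < r" by blast
 qed
 then have "convergent (%n. u (p n) as t x)" by (simp add: Cauchy_convergent_iff)
 then show ?thesis unfolding v_def by (rule convergent_LIMSEQ_iff[THEN iffD1])
 qed
 have uconv: "\<bar>u (p n) as t x - v as t x\<bar> <= e n" if h: "t:{0..T}" "length as <= 2" "x:Mfd" for n as t x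
 proof (rule tendsto_upperbound)
 show "(%n'. \<bar>u (p n) as t x - u (p n') as t x\<bar>) \<longlonglongrightarrow> \<bar>u (p n) as t x - v as t x\<bar>"
 by (intro tendsto_intros lim h)
 show "eventually (%n'. \<bar>u (p n) as t x - u (p n') as t x\<bar> <= e n) sequentially"
 unfolding eventually_sequentially using close[OF _ h] by blast
 qed simp
 have small: "EX n. e n < r" if "r > 0" for r
 proof -
 have "eventually (%n. e n < r) sequentially" using e_lim that by (rule order_tendstoD(2))
 then show ?thesis by (auto simp: eventually_sequentially)
 qed
 have "jet_solution G v"
 unfolding jet_solution_def
 proof (intro conjI ballI allI impI)
 fix t assume t: "t:{0..T}"
 show "jet_approx (%as. v as t)"
 unfolding jet_approx_def
 proof (intro allI impI)
 fix r :: real assume r: "r > 0"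
 obtain n where n: "e n < r / 2" using small[of "r / 2"] r by auto
 have "jet_approx (%as. u (p n) as t)" using sol[OF p(1)] t by (simp add: jet_solution_def)
 then obtain q where q: "poly_fun q" "!!as x. length as <= 2 ==> x:Mfd ==> \<bar>Rb as q x - u (p n) as t x\<bar> < r / 2"
 using r unfolding jet_approx_def by (meson half_gt_zero)
 have "\<bar>Rb as q x - v as t x\<bar> < r" if "length as <= 2 & x:Mfd" for as x
 using q(2)[of as x] uconv[OF t, of as x n] that n by linarith
 then show "EX p. poly_fun p & (ALL as x. length as <= 2 & x:Mfd --> \<bar>Rb as p x - v as t x\<bar> < r)"
 using q(1) by blast
 qed
 next
 fix r :: real assume r: "r > 0"
 obtain n where n: "e n < r / 3" using small[of "r / 3"] r by auto
 have "r / 3 > 0" using r by simp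
 moreover have "ALL eps>0. EX dl>0. ALL s:{0..T}. ALL t:{0..T}. \<bar>t - s\<bar> < dl -->
 (ALL as x. length as <= 2 & x:Mfd --> \<bar>u (p n) as t x - u (p n) as s x\<bar> < eps)"
 using sol[OF p(1), of n] unfolding jet_solution_def by (elim conjE)
 ultimately obtain dl where dl: "dl > 0" "ALL s:{0..T}. ALL t:{0..T}. \<bar>t - s\<bar> < dl -->
 (ALL as x. length as <= 2 & x:Mfd --> \<bar>u (p n) as t x - u (p n) as s x\<bar> < r / 3)" by blast
 show "EX dl>0. ALL s:{0..T}. ALL t:{0..T}. \<bar>t - s\<bar> < dl --> (ALL as x. length as <= 2 & x:Mfd --> \<bar>v as t x - v as s x\<bar> < r)"
 proof (intro exI[of _ dl] conjI dl(1) ballI allI impI, elim conjE)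
 fix s t and as :: "('n \<times> 3) list" and x :: "'n vec3"
 assume h: "s:{0..T}" "t:{0..T}" "\<bar>t - s\<bar> < dl" "length as <= 2" "x:Mfd"
 have "\<bar>u (p n) as t x - u (p n) as s x\<bar> < r / 3" using dl(2) h by blast
 then show "\<bar>v as t x - v as s x\<bar> < r"
 using uconv[OF h(1) h(4,5), of n] uconv[OF h(2) h(4,5), of n] n by linarith
 qed
 next
 fix as :: "('n \<times> 3) list" and x assume h: "length as <= 2 & x:(Mfd :: 'n vec3 set)"
 have "u (p n) as 0 x = Rb as (p n) x" for n
 using sol[OF p(1), of n] h unfolding jet_solution_def by blast
 then have "(%n. Rb as (p n) x) \<longlonglongrightarrow> v as 0 x" using lim[of 0 as x] h T by simp
 moreover have "(%n. Rb as (p n) x) \<longlonglongrightarrow> G as x"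
 proof (rule LIM_zero_cancel, rule Lim_null_comparison)
 show "eventually (%n. norm (Rb as (p n) x - G as x) <= inverse (real (Suc n))) sequentially"
 using p(2) h by (intro always_eventually allI) (simp add: less_imp_le)
 qed (rule LIMSEQ_inverse_real_of_nat)
 ultimately show "v as 0 x = G as x" by (rule LIMSEQ_unique)
 next
 fix t and x :: "'n vec3" assume t: "t:{0..T}" and x: "x:Mfd"
 have "EX g. ALL s:{0..T}. (%n. u (p n) [] s x) \<longlonglongrightarrow> g s &
 (g has_derivative (%h. LJ s (%as. v as s) x * h)) (at s within {0..T})"
 proof (rule has_derivative_sequence)
 fix n s assume s: "s:{0..T}"
 have "((%s. u (p n) [] s x) has_real_derivative LJ s (%as. u (p n) as s) x) (at s within {0..T})"
 using sol[OF p(1), of n] s x unfolding jet_solution_def by blast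
 then show "((%s. u (p n) [] s x) has_derivative (%h. LJ s (%as. u (p n) as s) x * h)) (at s within {0..T})"
 by (simp add: has_field_derivative_def)
 next
 fix r :: real assume r: "r > 0"
 have "r / (C4 + 1) > 0" using r C4(1) by simp
 with e_lim have "eventually (%n. e n < r / (C4 + 1)) sequentially" by (rule order_tendstoD(2))
 then show "eventually (%n. ALL s:{0..T}. ALL h. norm (LJ s (%as. u (p n) as s) x * h - LJ s (%as. v as s) x * h) <= r * norm h) sequentially"
 proof (rule eventually_mono, intro ballI allI)
 fix n s h assume n: "e n < r / (C4 + 1)" and s: "s:{0..T}"
 have "\<bar>LJ s (%as x. u (p n) as s x - v as s x) x\<bar> <= C4 * e n"
 by (rule C4(2)[OF s x]) (rule uconv[OF s _ x])
 also have "... <= (C4 + 1) * (r / (C4 + 1))"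
 using C4(1) n A by (intro mult_mono) (auto simp: e_def)
 also have "... = r" using C4(1) by simp
 finally have "\<bar>LJ s (%as. u (p n) as s) x - LJ s (%as. v as s) x\<bar> <= r" unfolding LJ_diff .
 then show "norm (LJ s (%as. u (p n) as s) x * h - LJ s (%as. v as s) x * h) <= r * norm h"
 by (simp add: abs_mult mult_right_mono flip: left_diff_distrib)
 qed
 qed (use lim[of 0 "[]" x] x T in auto)
 then obtain g where g: "!!s. s:{0..T} ==> (%n. u (p n) [] s x) \<longlonglongrightarrow> g s"
 "!!s. s:{0..T} ==> (g has_derivative (%h. LJ s (%as. v as s) x * h)) (at s within {0..T})" by blast
 have "g s = v [] s x" if "s:{0..T}" for s
 using LIMSEQ_unique[OF g(1)[OF that] lim[OF that _ x, of "[]"]] by simp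
 then show "((%s. v [] s x) has_real_derivative LJ t (%as. v as t) x) (at t within {0..T})"
 unfolding has_field_derivative_def using has_derivative_transform[OF t _ g(2)[OF t], of "%s. v [] s x"] by simp
 qed
 moreover have "m <= v [] t x"
 if h: "(ALL t:{0..T}. ALL x:Mfd. 0 <= gm t x)" "m > 0" "ALL x:Mfd. m <= G [] x" "t:{0..T}" "x:Mfd" for m t x
 proof (rule LIMSEQ_le)
 show "(%n. u (p n) [] t x) \<longlonglongrightarrow> v [] t x" by (rule lim[OF h(4) _ h(5)]) simp
 \<comment> \<open>The polynomial data are known to lie above \<open>m - 1 / (n + 1)\<close> only;
   since \<open>m > 0\<close> this is non-negative for large \<open>n\<close>, as the minimum
   principle of the scheme demands.\<close>
 show "(%n. m - inverse (real (Suc n))) \<longlonglongrightarrow> m"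
 using tendsto_diff[OF tendsto_const LIMSEQ_inverse_real_of_nat, of m] by simp
 have "eventually (%n. inverse (real (Suc n)) < m) sequentially"
 by (rule order_tendstoD(2)[OF LIMSEQ_inverse_real_of_nat h(2)])
 then obtain n0 where n0: "!!n. n >= n0 ==> inverse (real (Suc n)) < m" by (auto simp: eventually_sequentially)
 have "m - inverse (real (Suc n)) <= u (p n) [] t x" if n: "n >= n0" for n
 proof (rule low[OF h(1) p(1) _ _ h(4,5)])
 show "0 <= m - inverse (real (Suc n))" using n0[OF n] by linarith
 show "ALL x:Mfd. m - inverse (real (Suc n)) <= p n x"
 proof
 fix y :: "'n vec3" assume y: "y:Mfd"
 show "m - inverse (real (Suc n)) <= p n y"
 using p(2)[of "[]" y n] h(3)[rule_format, OF y] y by simp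
 qed
 qed
 then show "EX N. ALL n>=N. m - inverse (real (Suc n)) <= u (p n) [] t x" by blast
 qed
 ultimately show ?thesis by (rule that)
qed

end

section \<open>Gradient, divergence and Laplacian on the sphere product\<close>

text \<open>The orbit stays in \<open>Mfd\<close>, so differentiability relative to
  \<open>Mfd\<close> yields an ordinary two-sided derivative in the angle.\<close>

lemma has_vector_derivative_along_rot:
 assumes "(f has_derivative f') (at m within Mfd)" "m:Mfd"
 shows "((%s. f (rot a s m)) has_vector_derivative f' (xi a m)) (at 0)"
proof -
 have r: "((%s. rot a s m) has_derivative (%h. h *\<^sub>R xi a m)) (at 0)"
 using has_vector_derivative_rot[of a m 0 UNIV] by (simp add: has_vector_derivative_def)
 have "(%s. rot a s m) ` UNIV \<subseteq> Mfd" using assms(2) by auto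
 moreover have "(f has_derivative f') (at (rot a 0 m) within Mfd)" using assms(1) by simp
 ultimately have "((%s. f (rot a s m)) has_derivative (%h. f' (h *\<^sub>R xi a m))) (at 0)"
 using has_derivative_in_compose2[of Mfd f "%_. f'" "%s. rot a s m" UNIV 0] r
 has_derivative_in_compose[OF r, of f f'] has_derivative_subset[of f f' "rot a 0 m" Mfd "range (%s. rot a s m)"]
 by auto
 then show ?thesis
 unfolding has_vector_derivative_def
 using linear_cmul[OF has_derivative_linear[OF assms(1)]] by simp
qed

text \<open>A derivative relative to \<open>Mfd\<close> is determined on the velocities of the
  rotation orbits, and by \<open>tangent_frame\<close> these span the tangent space.\<close>

lemma derivative_unique_tangent:
 assumes "(f has_derivative f1) (at m within Mfd)" "(f has_derivative f2) (at m within Mfd)"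
 and m: "m:Mfd" and v: "v:tangent m"
 shows "f1 v = f2 v"
proof -
 have l: "linear f1" "linear f2" using assms has_derivative_linear by blast+
 have "f1 (xi a m) = f2 (xi a m)" for a
 using has_vector_derivative_along_rot[OF assms(1) m, of a] has_vector_derivative_along_rot[OF assms(2) m, of a]
 by (rule vector_derivative_unique_at)
 then have "f1 (SUM a:UNIV. (v \<bullet> xi a m) *\<^sub>R xi a m) = f2 (SUM a:UNIV. (v \<bullet> xi a m) *\<^sub>R xi a m)"
 by (simp add: linear_sum[OF l(1)] linear_sum[OF l(2)] linear_cmul[OF l(1)] linear_cmul[OF l(2)])
 then show ?thesis unfolding tangent_frame[OF m v] .
qed

lemma subspace_tangent: "subspace (tangent m)"
 by (auto simp: subspace_def tangent_def inner_add_right)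

lemma grad_M_eqI:
 assumes "(f has_derivative (%v. g \<bullet> v)) (at m within Mfd)" "g:tangent m" "m:Mfd"
 shows "grad_M f m = g"
 unfolding grad_M_def
proof (rule the_equality)
 fix g' assume g': "g':tangent m & (f has_derivative (%v. g' \<bullet> v)) (at m within Mfd)"
 have "g' - g:tangent m" using g' assms(2) subspace_tangent subspace_diff by blast
 then have "g' \<bullet> (g' - g) = g \<bullet> (g' - g)"
 by (intro derivative_unique_tangent[of f "%v. g' \<bullet> v" m "%v. g \<bullet> v"]) (use g' assms in auto)
 then have "(g' - g) \<bullet> (g' - g) = 0" by (simp add: inner_diff_left)
 then show "g' = g" by simp
qed (use assms in auto)

lemma sum_inner_xi: "m:Mfd ==> v:tangent m ==> (SUM a:UNIV. (v \<bullet> xi a m) * (w \<bullet> xi a m)) = v \<bullet> w"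
proof -
 assume h: "m:Mfd" "v:tangent m"
 have "(SUM a:UNIV. (v \<bullet> xi a m) *\<^sub>R xi a m) \<bullet> w = (SUM a:UNIV. (v \<bullet> xi a m) * (w \<bullet> xi a m))"
 by (simp add: inner_sum_left inner_commute[of w])
 then show ?thesis using tangent_frame[OF h] by simp
qed

text \<open>The traces over an orthonormal basis and over the Parseval frame agree: expand the basis
  vectors in the frame and exchange the sums. As this holds for every admissible derivative and
  basis, the description in \<open>div_M\<close> is well defined.\<close>

lemma div_M_eq:
 assumes X: "(X has_derivative X') (at m within Mfd)" and m: "m:Mfd"
 shows "div_M X m = (SUM a:UNIV. X' (xi a m) \<bullet> xi a m)"
 unfolding div_M_def
proof (rule the_equality)
 obtain B where B: "B \<subseteq> tangent m" "pairwise orthogonal B" "!!x. x:B ==> norm x = 1" "span B = tangent m"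
 by (rule orthonormal_basis_subspace[OF subspace_tangent[of m]]) (rule that; assumption)
 have *: "(SUM e:B. Y' e \<bullet> e) = (SUM a:UNIV. X' (xi a m) \<bullet> xi a m)"
 if Y: "(X has_derivative Y') (at m within Mfd)" and B: "orthonormal_basis B (tangent m)" for Y' B
 proof -
 have B': "pairwise orthogonal B" "!!e. e:B ==> norm e = 1" "span B = tangent m"
 using B by (auto simp: orthonormal_basis_def)
 then have "0 \<notin> B" by force
 then have fin: "finite B" using pairwise_orthogonal_independent[OF B'(1)] independent_imp_finite by blast
 have eB: "e:tangent m" if "e:B" for e using that B'(3) span_base by blast
 have lin: "linear X'" using X has_derivative_linear by blast
 have "(SUM e:B. Y' e \<bullet> e) = (SUM e:B. X' e \<bullet> e)"
 using derivative_unique_tangent[OF Y X m] eB by simp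
 also have "... = (SUM e:B. X' (SUM a:UNIV. (e \<bullet> xi a m) *\<^sub>R xi a m) \<bullet> e)"
 using tangent_frame[OF m] eB by simp
 also have "... = (SUM e:B. SUM a:UNIV. (e \<bullet> xi a m) * (X' (xi a m) \<bullet> e))"
 by (simp add: linear_sum[OF lin] linear_cmul[OF lin] inner_sum_left)
 also have "... = (SUM a:UNIV. SUM e:B. (e \<bullet> xi a m) * (X' (xi a m) \<bullet> e))"
 by (rule sum.swap)
 also have "... = (SUM a:UNIV. X' (xi a m) \<bullet> (SUM e:B. (xi a m \<bullet> e) *\<^sub>R e))"
 by (simp add: inner_sum_right inner_commute)
 also have "... = (SUM a:UNIV. X' (xi a m) \<bullet> xi a m)"
 using orthonormal_basis_expand[OF B'(1) B'(2) _ fin] B'(3) by simp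
 finally show ?thesis .
 qed
 show "EX Y' B. (X has_derivative Y') (at m within Mfd) & orthonormal_basis B (tangent m)
 & (SUM a:UNIV. X' (xi a m) \<bullet> xi a m) = (SUM e:B. Y' e \<bullet> e)"
 using X *[OF X, of B] B by (intro exI[of _ X'] exI[of _ B]) (simp add: orthonormal_basis_def)
 fix d assume "EX X' B. (X has_derivative X') (at m within Mfd) & orthonormal_basis B (tangent m) & d = (SUM e:B. X' e \<bullet> e)"
 then obtain Y B where "(X has_derivative Y) (at m within Mfd)" "orthonormal_basis B (tangent m)" "d = (SUM e:B. Y e \<bullet> e)"
 by (elim exE conjE)
 then show "d = (SUM a:UNIV. X' (xi a m) \<bullet> xi a m)" using * by simp
qed

lemma blk_sum: "blk (SUM a:A. f a) j = (SUM a:A. blk (f a) j)"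
 by (induction A rule: infinite_finite_induct) auto

text \<open>The accelerations of the rotations add up to a vector normal to \<open>Mfd\<close>.
  Paired with a tangential field it vanishes, and for this reason the Laplacian is a sum of squares
  without first-order correction.\<close>

lemma sum_xi_xi: "(SUM a:UNIV. xi a (xi a m)) = - 2 *\<^sub>R m" for m :: "'n::finite vec3"
proof -
 have e: "cross3 (axis k 1) (cross3 (axis k 1) x) = x $ k *\<^sub>R axis k 1 - x" for k :: 3 and x :: "real^3"
 proof -
 have "cross3 b (cross3 b x) = (b \<bullet> x) *\<^sub>R b - (b \<bullet> b) *\<^sub>R x" for b :: "real^3"
 by (simp add: cross3_simps forall_3)
 then show ?thesis by (simp add: inner_axis_axis inner_axis')
 qed
 have s: "(SUM k:UNIV. x $ k *\<^sub>R axis k 1 - x) = - 2 *\<^sub>R x" for x :: "real^3"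
 by (simp add: vec_eq_iff forall_3 sum_3 axis_def)
 have b: "blk (xi (i, k) (xi (i, k) m)) j = (if j = i then blk m j $ k *\<^sub>R axis k 1 - blk m j else 0)" for i k j
 by (simp add: xi_def e)
 have "blk (SUM a:UNIV. xi a (xi a m)) j = (SUM a:UNIV \<times> UNIV. blk (xi a (xi a m)) j)" for j by (simp add: blk_sum)
 also have "... j = (SUM i:UNIV. SUM k:UNIV. blk (xi (i, k) (xi (i, k) m)) j)" for j
 by (subst sum.cartesian_product) (simp add: case_prod_beta)
 also have "... j = (SUM i:UNIV. if j = i then - 2 *\<^sub>R blk m j else 0)" for j
 unfolding b by (intro sum.cong refl) (use s[of "blk m j"] in auto)
 also have "... j = - 2 *\<^sub>R blk m j" for j by simp
 finally show ?thesis unfolding blk_eq_iff by simp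
qed

lemma tangent_inner_self: "v:tangent m ==> v \<bullet> m = 0"
 unfolding inner_blk tangent_def by (simp add: inner_commute)

text \<open>Taking the frame inside the derivative produces the extra terms
  \<open>X m \<bullet> xi a (xi a m)\<close>, whose sum is zero by \<open>sum_xi_xi\<close>.\<close>

lemma div_M_tangential:
 assumes X: "(X has_derivative X') (at m within Mfd)" and m: "m:Mfd" and t: "X m:tangent m"
 and D: "!!a. ((%y. X y \<bullet> xi a y) has_derivative D a) (at m within Mfd)"
 shows "div_M X m = (SUM a:UNIV. D a (xi a m))"
proof -
 have "((%y. X y \<bullet> xi a y) has_derivative (%v. X m \<bullet> xi a v + X' v \<bullet> xi a m)) (at m within Mfd)" for a
 by (rule has_derivative_inner[OF X bounded_linear_imp_has_derivative[OF bounded_linear_xi]])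
 then have "D a (xi a m) = X m \<bullet> xi a (xi a m) + X' (xi a m) \<bullet> xi a m" for a
 by (rule derivative_unique_tangent[OF D _ m tangent_xi])
 moreover have "(SUM a:UNIV. X m \<bullet> xi a (xi a m)) = 0"
 using tangent_inner_self[OF t] by (simp add: sum_xi_xi flip: inner_sum_right)
 ultimately show ?thesis by (simp add: div_M_eq[OF X m] sum.distrib)
qed

text \<open>Differentiability along \<open>Mfd\<close> is inherited by \<open>C\<^sup>1\<close> limits of polynomials: compose with \<open>normalise\<close>, which
 retracts a ball around a point of \<open>Mfd\<close>, and use that balls are convex.\<close>

definition proj :: "'n => 'n::finite vec3 => 'n vec3" where
 "proj i x = (\<chi> p. if fst p = i then x $ p else 0)"

lemma blk_proj: "blk (proj i x) j = (if j = i then blk x i else 0)"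
 by (auto simp: blk_def proj_def vec_eq_iff)

lemma norm_blk_le: "norm (blk x i) <= norm x" for x :: "'n::finite vec3"
proof -
 have "blk x i \<bullet> blk x i <= x \<bullet> x"
 unfolding inner_blk by (rule member_le_sum) auto
 then show ?thesis by (simp add: norm_le)
qed

lemma norm_proj: "norm (proj i x) = norm (blk x i)"
proof -
 have "proj i x \<bullet> proj i x = blk x i \<bullet> blk x i"
 unfolding inner_blk blk_proj by (simp add: if_distrib cong: if_cong)
 then show ?thesis by (simp add: norm_eq)
qed

lemma bounded_linear_proj: "bounded_linear (proj i)"
proof -
 have "linear (proj i)" by (rule linearI) (auto simp: proj_def vec_eq_iff)
 then show ?thesis using linear_conv_bounded_linear by blast
qed

lemma bounded_linear_blk: "bounded_linear (%x. blk x i)"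
proof -
 have "linear (%x. blk x i)" by (rule linearI) auto
 then show ?thesis using linear_conv_bounded_linear by blast
qed

lemma blk_normalise: "blk (normalise x) i = blk x i /\<^sub>R norm (blk x i)"
 by (simp add: normalise_def blk_def vec_eq_iff divide_inverse mult.commute)

lemma normalise_sum: "normalise x = (SUM i:UNIV. inverse (norm (blk x i)) *\<^sub>R proj i x)"
 by (simp add: vec_eq_iff normalise_def proj_def divide_inverse if_distrib mult.commute cong: if_cong)

lemma normalise_Mfd [simp]: "x:Mfd ==> normalise x = x"
 unfolding blk_eq_iff blk_normalise by (simp add: Mfd_def)

lemma normalise_in_Mfd: "(!!i. blk x i \<noteq> 0) ==> normalise x:Mfd"
 unfolding Mfd_def by (simp add: blk_normalise)

text \<open>The derivative of the retraction \<open>normalise\<close>; at points of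
  \<open>Mfd\<close> it is the orthogonal projection onto the tangent space.\<close>

definition dnormalise :: "'n::finite vec3 => 'n vec3 => 'n vec3" where
 "dnormalise x v = (SUM i:UNIV. inverse (norm (blk x i)) *\<^sub>R proj i v
 + (- (inverse (norm (blk x i)) * (sgn (blk x i) \<bullet> blk v i) * inverse (norm (blk x i)))) *\<^sub>R proj i x)"

lemma has_derivative_normalise:
 assumes "!!i. blk x i \<noteq> 0"
 shows "(normalise has_derivative dnormalise x) (at x)"
proof -
 have n: "((%x. norm (blk x i)) has_derivative (%v. sgn (blk x i) \<bullet> blk v i)) (at x)" for i
 proof -
 have "((%x. norm (blk x i)) has_derivative (%v. blk v i \<bullet> sgn (blk x i))) (at x)"
 by (rule has_derivative_compose[OF bounded_linear_imp_has_derivative[OF bounded_linear_blk] has_derivative_norm[OF assms]])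
 then show ?thesis by (simp add: inner_commute)
 qed
 have "((%x. inverse (norm (blk x i)) *\<^sub>R proj i x) has_derivative
 (%v. inverse (norm (blk x i)) *\<^sub>R proj i v
 + (- (inverse (norm (blk x i)) * (sgn (blk x i) \<bullet> blk v i) * inverse (norm (blk x i)))) *\<^sub>R proj i x)) (at x)" for i
 by (rule has_derivative_scaleR[OF Deriv.has_derivative_inverse[OF _ n] bounded_linear_imp_has_derivative[OF bounded_linear_proj]])
 (use assms in auto)
 then have "((%x. SUM i:UNIV. inverse (norm (blk x i)) *\<^sub>R proj i x) has_derivative dnormalise x) (at x)"
 unfolding dnormalise_def[abs_def] by (rule has_derivative_sum)
 moreover have "(%x. SUM i:UNIV. inverse (norm (blk x i)) *\<^sub>R proj i x) = (normalise :: 'a vec3 => _)"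
 by (rule ext) (rule normalise_sum[symmetric])
 ultimately show ?thesis by simp
qed

lemma blk_nonzero: "m:Mfd ==> blk m i \<noteq> 0"
 by (metis (mono_tags) Mfd_def mem_Collect_eq norm_zero zero_neq_one)

lemma norm_dnormalise_le:
 fixes x v :: "'n::finite vec3"
 assumes "!!i. 1 / 2 <= norm (blk x i)"
 shows "norm (dnormalise x v) <= 4 * real CARD('n) * norm v"
proof -
 have "norm (inverse (norm (blk x i)) *\<^sub>R proj i v
 + (- (inverse (norm (blk x i)) * (sgn (blk x i) \<bullet> blk v i) * inverse (norm (blk x i)))) *\<^sub>R proj i x) <= 4 * norm v" for i
 proof -
 have i: "inverse (norm (blk x i)) <= 2" "0 < norm (blk x i)"
 using assms[of i] le_imp_inverse_le[of "1/2" "norm (blk x i)"] by auto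
 have "\<bar>sgn (blk x i) \<bullet> blk v i\<bar> <= norm (sgn (blk x i)) * norm (blk v i)" by (rule Cauchy_Schwarz_ineq2)
 also have "... <= norm v" using norm_blk_le[of v i] i by (simp add: norm_sgn)
 finally have s: "\<bar>sgn (blk x i) \<bullet> blk v i\<bar> <= norm v" .
 have "norm (inverse (norm (blk x i)) *\<^sub>R proj i v) <= 2 * norm v"
 using i norm_blk_le[of v i] by (simp only: norm_scaleR norm_proj abs_of_pos[OF positive_imp_inverse_positive[OF i(2)]]) (intro mult_mono, auto)
 moreover have "norm ((- (inverse (norm (blk x i)) * (sgn (blk x i) \<bullet> blk v i) * inverse (norm (blk x i)))) *\<^sub>R proj i x)
 = inverse (norm (blk x i)) * \<bar>sgn (blk x i) \<bullet> blk v i\<bar>"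
 using i by (simp add: norm_proj abs_mult)
 moreover have "inverse (norm (blk x i)) * \<bar>sgn (blk x i) \<bullet> blk v i\<bar> <= 2 * norm v"
 using i s by (intro mult_mono) auto
 ultimately show ?thesis by (intro order_trans[OF norm_triangle_ineq]) linarith
 qed
 then have "norm (dnormalise x v) <= (SUM i:(UNIV::'n set). 4 * norm v)"
 unfolding dnormalise_def by (intro order_trans[OF norm_sum] sum_mono)
 then show ?thesis by (simp add: mult_ac)
qed

lemma blk_dnormalise:
 "blk (dnormalise x v) i = inverse (norm (blk x i)) *\<^sub>R blk v i
 - (inverse (norm (blk x i)) * (sgn (blk x i) \<bullet> blk v i) * inverse (norm (blk x i))) *\<^sub>R blk x i"
 (is "_ = ?A")
proof -
 have "blk (dnormalise x v) i = (SUM j:UNIV. if i = j then ?A else 0)"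
 unfolding dnormalise_def blk_sum by (rule sum.cong) (auto simp: blk_proj)
 then show ?thesis by simp
qed

lemma dnormalise_tangent:
 assumes x: "!!i. blk x i \<noteq> 0"
 shows "dnormalise x v:tangent (normalise x)"
 unfolding tangent_def
proof (rule CollectI, rule allI)
 fix i
 have "norm (blk x i) \<noteq> 0" "blk x i \<bullet> blk x i = norm (blk x i) * norm (blk x i)"
 using x[of i] by (auto simp: power2_norm_eq_inner simp flip: power2_eq_square)
 then show "blk (normalise x) i \<bullet> blk (dnormalise x v) i = 0"
 unfolding blk_dnormalise blk_normalise sgn_div_norm by (simp add: inner_diff_right field_simps)
qed

lemma dnormalise_inner_xi:
 assumes m: "m:Mfd"
 shows "dnormalise m v \<bullet> xi a m = v \<bullet> xi a m"
proof -
 have b: "blk (dnormalise m v) i = blk v i - (blk m i \<bullet> blk v i) *\<^sub>R blk m i" for i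
 using m by (simp add: blk_dnormalise Mfd_def sgn_div_norm)
 have "(dnormalise m v - v) \<bullet> xi a m = 0"
 unfolding inner_blk by (simp add: b xi_def dot_cross_self)
 then show ?thesis by (simp add: inner_diff_left)
qed

lemma poly_derivative_tangent:
 assumes p: "poly_fun p" and y: "y:Mfd" and w: "w:tangent y"
 shows "frechet_derivative p (at y) w = (SUM a:UNIV. (w \<bullet> xi a y) * Rd (axis a 1) p y)"
proof -
 have l: "linear (frechet_derivative p (at y))" by (rule has_derivative_linear[OF poly_fun_differentiable[OF p]])
 have "frechet_derivative p (at y) w = frechet_derivative p (at y) (SUM a:UNIV. (w \<bullet> xi a y) *\<^sub>R xi a y)"
 using tangent_frame[OF y w] by simp
 also have "... = (SUM a:UNIV. (w \<bullet> xi a y) * Rd (axis a 1) p y)"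
 by (simp add: linear_sum[OF l] linear_cmul[OF l] Rd_def xi_def)
 finally show ?thesis .
qed

lemma C1_limit_has_derivative:
 fixes f :: "'n::finite vec3 => real"
 assumes approx: "!!eps. eps > 0 ==> EX p. poly_fun p & (ALL y:Mfd. \<bar>p y - f y\<bar> < eps & (ALL a. \<bar>Rd (axis a 1) p y - fa a y\<bar> < eps))"
 and m: "m:Mfd"
 shows "(f has_derivative (%v. (SUM a:UNIV. fa a m *\<^sub>R xi a m) \<bullet> v)) (at m within Mfd)"
 and "(SUM a:UNIV. fa a m *\<^sub>R xi a m) \<bullet> xi b m = fa b m"
proof -
 have "EX p. ALL n. poly_fun (p n) & (ALL y:Mfd. \<bar>p n y - f y\<bar> < inverse (real (Suc n)) & (ALL a. \<bar>Rd (axis a 1) (p n) y - fa a y\<bar> < inverse (real (Suc n))))"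
 by (intro choice allI approx) simp
 then obtain p where p: "!!n. poly_fun (p n)" "!!n y. y:Mfd ==> \<bar>p n y - f y\<bar> < inverse (real (Suc n))"
 "!!n y a. y:Mfd ==> \<bar>Rd (axis a 1) (p n) y - fa a y\<bar> < inverse (real (Suc n))" by blast
 have plim: "(%n. p n y) \<longlonglongrightarrow> f y" if "y:Mfd" for y
 proof (rule LIM_zero_cancel, rule Lim_null_comparison)
 show "eventually (%n. norm (p n y - f y) <= inverse (real (Suc n))) sequentially"
 using p(2)[OF that] by (intro always_eventually allI) (simp add: less_imp_le)
 qed (rule LIMSEQ_inverse_real_of_nat)
 have Rlim: "(%n. Rd (axis a 1) (p n) y) \<longlonglongrightarrow> fa a y" if "y:Mfd" for a y
 proof (rule LIM_zero_cancel, rule Lim_null_comparison)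
 show "eventually (%n. norm (Rd (axis a 1) (p n) y - fa a y) <= inverse (real (Suc n))) sequentially"
 using p(3)[OF that] by (intro always_eventually allI) (simp add: less_imp_le)
 qed (rule LIMSEQ_inverse_real_of_nat)
 \<comment> \<open>Radius \<open>1 / 2\<close> keeps every block norm above \<open>1 / 2\<close>,
   where the derivative of \<open>normalise\<close> is bounded; the ball is convex, as passing to
   the limit of derivatives requires.\<close>
 define S where "S = ball m (1 / 2)"
 have half: "1 / 2 <= norm (blk x i)" if "x:S" for x i
 proof -
 have "norm (blk (m - x) i) < 1 / 2"
 using that norm_blk_le[of "m - x" i] by (simp add: S_def dist_norm)
 moreover have "norm (blk m i) <= norm (blk x i) + norm (blk (m - x) i)"
 by (metis add.commute blk_simps(2) diff_add_cancel norm_triangle_ineq)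
 moreover have "norm (blk m i) = 1" using m by (simp add: Mfd_def)
 ultimately show ?thesis by linarith
 qed
 have nz: "blk x i \<noteq> 0" if "x:S" for x i using half[OF that, of i] by auto
 define B where "B = 4 * real CARD('n)"
 have "EX g. ALL x:S. (%n. p n (normalise x)) \<longlonglongrightarrow> g x &
 (g has_derivative (%v. SUM a:UNIV. (dnormalise x v \<bullet> xi a (normalise x)) * fa a (normalise x))) (at x within S)"
 proof (rule has_derivative_sequence)
 show "convex S" by (simp add: S_def)
 fix n x assume x: "x:S"
 have y: "normalise x:Mfd" using nz[OF x] by (rule normalise_in_Mfd)
 have "((%x. p n (normalise x)) has_derivative (%v. frechet_derivative (p n) (at (normalise x)) (dnormalise x v))) (at x within S)"
 by (rule has_derivative_compose[OF has_derivative_at_withinI[OF has_derivative_normalise[OF nz[OF x]]] poly_fun_differentiable[OF p(1)]])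
 then show "((%x. p n (normalise x)) has_derivative (%v. SUM a:UNIV. (dnormalise x v \<bullet> xi a (normalise x)) * Rd (axis a 1) (p n) (normalise x))) (at x within S)"
 by (simp add: poly_derivative_tangent[OF p(1) y dnormalise_tangent[OF nz[OF x]]])
 next
 fix e :: real assume e: "e > 0"
 let ?M = "real CARD('n \<times> 3)"
 have BM: "?M * B > 0" by (simp add: B_def)
 then have "eventually (%n. inverse (real (Suc n)) < e / (?M * B)) sequentially"
 by (intro order_tendstoD(2)[OF LIMSEQ_inverse_real_of_nat]) (use e in simp)
 then show "eventually (%n. ALL x:S. ALL v. norm ((SUM a:UNIV. (dnormalise x v \<bullet> xi a (normalise x)) * Rd (axis a 1) (p n) (normalise x))
 - (SUM a:UNIV. (dnormalise x v \<bullet> xi a (normalise x)) * fa a (normalise x))) <= e * norm v) sequentially"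
 proof (rule eventually_mono, intro ballI allI)
 fix n x v assume n: "inverse (real (Suc n)) < e / (?M * B)" and x: "x:S"
 have y: "normalise x:Mfd" using nz[OF x] by (rule normalise_in_Mfd)
 have "\<bar>(dnormalise x v \<bullet> xi a (normalise x)) * (Rd (axis a 1) (p n) (normalise x) - fa a (normalise x))\<bar> <= (B * norm v) * (e / (?M * B))" for a
 unfolding abs_mult
 proof (rule mult_mono)
 have "\<bar>dnormalise x v \<bullet> xi a (normalise x)\<bar> <= norm (dnormalise x v) * norm (xi a (normalise x))" by (rule Cauchy_Schwarz_ineq2)
 also have "... <= norm (dnormalise x v) * 1" by (intro mult_left_mono norm_xi_le y) auto
 finally show "\<bar>dnormalise x v \<bullet> xi a (normalise x)\<bar> <= B * norm v"
 using norm_dnormalise_le[of x v] half[OF x] by (simp add: B_def)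
 show "\<bar>Rd (axis a 1) (p n) (normalise x) - fa a (normalise x)\<bar> <= e / (?M * B)"
 using p(3)[OF y, of a n] n by linarith
 qed (auto simp: B_def)
 then have "(SUM a:UNIV. \<bar>(dnormalise x v \<bullet> xi a (normalise x)) * (Rd (axis a 1) (p n) (normalise x) - fa a (normalise x))\<bar>)
 <= (SUM a:(UNIV::('n\<times>3) set). (B * norm v) * (e / (?M * B)))" by (rule sum_mono)
 also have "... = ?M * ((B * norm v) * (e / (?M * B)))" by simp
 also have "... = e * norm v" using BM by (simp add: field_simps del: mult_pos_pos) (auto simp: B_def)
 finally show "norm ((SUM a:UNIV. (dnormalise x v \<bullet> xi a (normalise x)) * Rd (axis a 1) (p n) (normalise x))
 - (SUM a:UNIV. (dnormalise x v \<bullet> xi a (normalise x)) * fa a (normalise x))) <= e * norm v"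
 by (simp only: real_norm_def sum_subtractf[symmetric] right_diff_distrib[symmetric]) (rule order_trans[OF sum_abs])
 qed
 next
 show "m:S" by (simp add: S_def)
 show "(%n. p n (normalise m)) \<longlonglongrightarrow> f m" using plim[OF m] m by simp
 qed
 then obtain g where g: "!!x. x:S ==> (%n. p n (normalise x)) \<longlonglongrightarrow> g x"
 "!!x. x:S ==> (g has_derivative (%v. SUM a:UNIV. (dnormalise x v \<bullet> xi a (normalise x)) * fa a (normalise x))) (at x within S)" by blast
 have mS: "m:S" by (simp add: S_def)
 have "g y = f y" if "y:S \<inter> Mfd" for y
 using LIMSEQ_unique[OF g(1) plim] that by simp
 moreover have "(g has_derivative (%v. SUM a:UNIV. (dnormalise m v \<bullet> xi a m) * fa a m)) (at m within S \<inter> Mfd)"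
 using has_derivative_subset[OF g(2)[OF mS], of "S \<inter> Mfd"] m by simp
 ultimately have "(f has_derivative (%v. SUM a:UNIV. (dnormalise m v \<bullet> xi a m) * fa a m)) (at m within S \<inter> Mfd)"
 using has_derivative_transform[of m "S \<inter> Mfd" f g] mS m by auto
 then have "(f has_derivative (%v. SUM a:UNIV. (dnormalise m v \<bullet> xi a m) * fa a m)) (at m within Mfd)"
 proof -
 assume *: "(f has_derivative (%v. SUM a:UNIV. (dnormalise m v \<bullet> xi a m) * fa a m)) (at m within S \<inter> Mfd)"
 have "at m within S \<inter> Mfd = at m within Mfd"
 by (rule at_within_nhd[OF mS]) (auto simp: S_def)
 with * show ?thesis by simp
 qed
 moreover have "(SUM a:UNIV. (dnormalise m v \<bullet> xi a m) * fa a m) = (SUM a:UNIV. fa a m *\<^sub>R xi a m) \<bullet> v" for v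
 proof -
 have "dnormalise m v \<bullet> xi a m = v \<bullet> xi a m" for a by (rule dnormalise_inner_xi[OF m])
 then show ?thesis
 unfolding inner_sum_left inner_scaleR_left by (intro sum.cong refl) (simp add: inner_commute)
 qed
 ultimately show "(f has_derivative (%v. (SUM a:UNIV. fa a m *\<^sub>R xi a m) \<bullet> v)) (at m within Mfd)" by simp
 \<comment> \<open>The frame is redundant, so arbitrary coefficients are not recovered by pairing
   with \<open>xi b\<close>. Here they are, being limits of the frame coefficients of genuine
   gradients.\<close>
 have "(SUM a:UNIV. (xi b m \<bullet> xi a m) * Rd (axis a 1) (p n) m) = Rd (axis b 1) (p n) m" for n
 using poly_derivative_tangent[OF p(1) m tangent_xi[of b], of n] by (simp add: Rd_def xi_def)
 moreover have "(%n. SUM a:UNIV. (xi b m \<bullet> xi a m) * Rd (axis a 1) (p n) m) \<longlonglongrightarrow> (SUM a:UNIV. (xi b m \<bullet> xi a m) * fa a m)"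
 by (intro tendsto_intros Rlim m)
 ultimately have "(SUM a:UNIV. (xi b m \<bullet> xi a m) * fa a m) = fa b m"
 using LIMSEQ_unique[OF _ Rlim[OF m, of b]] by simp
 then show "(SUM a:UNIV. fa a m *\<^sub>R xi a m) \<bullet> xi b m = fa b m"
 unfolding inner_sum_left inner_scaleR_left by (simp add: inner_commute mult.commute)
qed


text \<open>\<open>Rb\<close> applies the head of the list first, so differentiating
  \<open>F as\<close> appends the new letter at the end.\<close>

lemma jet_approx_derivative:
 assumes F: "jet_approx F" and m: "m:Mfd"
 shows "length as <= 1 ==> (F as has_derivative (%v. (SUM b:UNIV. F (as @ [b]) m *\<^sub>R xi b m) \<bullet> v)) (at m within Mfd)"
 and "length as <= 1 ==> (SUM b:UNIV. F (as @ [b]) m *\<^sub>R xi b m) \<bullet> xi a m = F (as @ [a]) m"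
proof -
 have "EX p. poly_fun p & (ALL y:Mfd. \<bar>p y - F as y\<bar> < eps & (ALL b. \<bar>Rd (axis b 1) p y - F (as @ [b]) y\<bar> < eps))"
 if as: "length as <= 1" and eps: "eps > 0" for as eps
 proof -
 obtain p where p0: "poly_fun p & (ALL as x. length as <= 2 & x:Mfd --> \<bar>Rb as p x - F as x\<bar> < eps)"
 using F eps unfolding jet_approx_def by meson
 then have p: "poly_fun p" "!!as x. length as <= 2 ==> x:Mfd ==> \<bar>Rb as p x - F as x\<bar> < eps" by simp_all
 have "Rw (as' @ [w]) g = Rd w (Rw as' g)" for as' w and g :: "'a vec3 => real"
 by (induction as' arbitrary: g) auto
 then have "Rb (as @ [b]) p = Rd (axis b 1) (Rb as p)" for b by (simp add: Rb_def)
 moreover have "poly_fun (Rb as p)" unfolding Rb_def by (rule poly_fun_Rw[OF p(1)])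
 ultimately have "ALL y:Mfd. \<bar>Rb as p y - F as y\<bar> < eps & (ALL b. \<bar>Rd (axis b 1) (Rb as p) y - F (as @ [b]) y\<bar> < eps)"
 using p(2)[of as] p(2)[of "as @ [b]" for b] as by simp
 with \<open>poly_fun (Rb as p)\<close> show ?thesis by blast
 qed
 note * = C1_limit_has_derivative[of "F as" "%b. F (as @ [b])", OF this m]
 show "length as <= 1 ==> (F as has_derivative (%v. (SUM b:UNIV. F (as @ [b]) m *\<^sub>R xi b m) \<bullet> v)) (at m within Mfd)"
 by (rule *(1))
 show "length as <= 1 ==> (SUM b:UNIV. F (as @ [b]) m *\<^sub>R xi b m) \<bullet> xi a m = F (as @ [a]) m"
 by (rule *(2))
qed

lemma jet_approx_grad:
 assumes F: "jet_approx F" and m: "m:Mfd"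
 shows "grad_M (F []) m = (SUM a:UNIV. F [a] m *\<^sub>R xi a m)"
 and "(F [] has_derivative (%v. grad_M (F []) m \<bullet> v)) (at m within Mfd)"
 and "grad_M (F []) m \<bullet> xi a m = F [a] m"
proof -
 have d: "(F [] has_derivative (%v. (SUM a:UNIV. F [a] m *\<^sub>R xi a m) \<bullet> v)) (at m within Mfd)"
 using jet_approx_derivative(1)[OF F m, of "[]"] by simp
 show g: "grad_M (F []) m = (SUM a:UNIV. F [a] m *\<^sub>R xi a m)"
 by (rule grad_M_eqI[OF d _ m]) (intro subspace_sum subspace_tangent subspace_mul tangent_xi)
 show "(F [] has_derivative (%v. grad_M (F []) m \<bullet> v)) (at m within Mfd)" unfolding g by (rule d)
 show "grad_M (F []) m \<bullet> xi a m = F [a] m"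
 unfolding g using jet_approx_derivative(2)[OF F m, of "[]" a] by simp
qed

definition jet_hess :: "(('n \<times> 3) list => 'n::finite vec3 => real) => 'n vec3 => 'n vec3 => 'n vec3" where
 "jet_hess F m v = (SUM a:UNIV. F [a] m *\<^sub>R xi a v + ((SUM b:UNIV. F [a, b] m *\<^sub>R xi b m) \<bullet> v) *\<^sub>R xi a m)"

lemma bounded_linear_jet_hess: "bounded_linear (jet_hess F m)"
 unfolding jet_hess_def
 by (intro bounded_linear_sum bounded_linear_add bounded_linear_scaleR_const bounded_linear_inner_right
 bounded_linear_const_scaleR bounded_linear_xi)

lemma jet_approx_hess:
 assumes F: "jet_approx F" and m: "m:Mfd"
 shows "(grad_M (F []) has_derivative jet_hess F m) (at m within Mfd)"
proof -
 have "((%y. F [a] y *\<^sub>R xi a y) has_derivative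
 (%v. F [a] m *\<^sub>R xi a v + ((SUM b:UNIV. F [a, b] m *\<^sub>R xi b m) \<bullet> v) *\<^sub>R xi a m)) (at m within Mfd)" for a
 using jet_approx_derivative(1)[OF F m, of "[a]"]
 by (intro has_derivative_scaleR bounded_linear_imp_has_derivative bounded_linear_xi) simp
 then have "((%y. SUM a:UNIV. F [a] y *\<^sub>R xi a y) has_derivative jet_hess F m) (at m within Mfd)"
 unfolding jet_hess_def[abs_def] by (rule has_derivative_sum)
 then show ?thesis
 by (rule has_derivative_transform[OF m, rotated]) (simp add: jet_approx_grad(1)[OF F])
qed

text \<open>The frame components of the gradient are the \<open>F [a]\<close>, and by
  \<open>div_M_tangential\<close> component \<open>a\<close> is differentiated once more along
  \<open>xi a\<close>.\<close>

lemma jet_approx_laplace: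
 assumes F: "jet_approx F" and m: "m:Mfd"
 shows "laplace_beltrami (F []) m = (SUM a:UNIV. F [a, a] m)"
proof -
 have D: "((%y. grad_M (F []) y \<bullet> xi a y) has_derivative (%v. (SUM b:UNIV. F [a, b] m *\<^sub>R xi b m) \<bullet> v)) (at m within Mfd)" for a
 by (rule has_derivative_transform[OF m _ jet_approx_derivative(1)[OF F m, of "[a]", simplified]])
 (simp add: jet_approx_grad(3)[OF F])
 have "grad_M (F []) m:tangent m"
 unfolding jet_approx_grad(1)[OF F m] by (intro subspace_sum subspace_tangent subspace_mul tangent_xi)
 from div_M_tangential[OF jet_approx_hess[OF F m] m this D]
 show ?thesis
 unfolding laplace_beltrami_def using jet_approx_derivative(2)[OF F m, of "[_]"] by simp
qed

section \<open>Verification and consequences of \<open>C12\<close> regularity\<close>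

lemma C12I:
 fixes w :: "real => 'n::finite vec3 => real"
 assumes T: "T > 0"
 and w: "continuous_on ({0..T} \<times> Mfd) (%(t, m). w t m)"
 and wt: "continuous_on ({0..T} \<times> Mfd) (%(t, m). wt t m)"
 "!!t m. t:{0..T} ==> m:Mfd ==> ((%s. w s m) has_real_derivative wt t m) (at t within {0..T})"
 and g: "continuous_on ({0..T} \<times> Mfd) (%(t, m). g t m)" "!!t m. t:{0..T} ==> m:Mfd ==> g t m:tangent m"
 "!!t m. t:{0..T} ==> m:Mfd ==> (w t has_derivative (%v. g t m \<bullet> v)) (at m within Mfd)"
 and H: "!!t m. t:{0..T} ==> m:Mfd ==> (g t has_derivative H t m) (at m within Mfd)"
 "!!e. continuous_on ({0..T} \<times> Mfd) (%(t, m). H t m e)"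
 shows "C12 T w" and "!!t m. t:{0..T} ==> m:Mfd ==> time_deriv T w t m = wt t m"
 and "!!t m. t:{0..T} ==> m:Mfd ==> grad_M (w t) m = g t m"
proof -
 show td: "time_deriv T w t m = wt t m" if "t:{0..T}" "m:Mfd" for t m
 unfolding time_deriv_def
 by (rule vector_derivative_within_closed_interval[OF T that(1)])
 (use wt(2)[OF that] in \<open>simp add: has_real_derivative_iff_has_vector_derivative\<close>)
 show gd: "grad_M (w t) m = g t m" if "t:{0..T}" "m:Mfd" for t m
 by (rule grad_M_eqI[OF g(3)[OF that] g(2)[OF that] that(2)])
 have bl: "blinfun_apply (Blinfun (H t m)) = H t m" if "t:{0..T}" "m:Mfd" for t m
 using bounded_linear_Blinfun_apply has_derivative_bounded_linear[OF H(1)[OF that]] by blast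
 show "C12 T w"
 unfolding C12_def
 proof (intro conjI ballI exI[of _ "%(t, m). Blinfun (H t m)"])
 show "continuous_on ({0..T} \<times> Mfd) (%(t, m). time_deriv T w t m)"
 using wt(1) by (rule continuous_on_eq) (auto simp: td)
 show "continuous_on ({0..T} \<times> Mfd) (%(t, m). grad_M (w t) m)"
 using g(1) by (rule continuous_on_eq) (auto simp: gd)
 \<comment> \<open>Continuity in operator norm is tested on fixed vectors, which is enough in finite
   dimension.\<close>
 show "continuous_on ({0..T} \<times> Mfd) (%(t, m). Blinfun (H t m))"
 proof (rule continuous_on_blinfun_componentwise)
 fix e show "continuous_on ({0..T} \<times> Mfd) (%x. blinfun_apply (case x of (t, m) => Blinfun (H t m)) e)"
 using H(2)[of e] by (rule continuous_on_eq) (auto simp: bl)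
 qed
 fix t m assume h: "t:{0..T}" "m:(Mfd :: 'n vec3 set)"
 show "((%s. w s m) has_vector_derivative time_deriv T w t m) (at t within {0..T})"
 using wt(2)[OF h] by (simp add: td[OF h] has_real_derivative_iff_has_vector_derivative)
 show "(w t has_derivative (%v. grad_M (w t) m \<bullet> v)) (at m within Mfd)"
 using g(3)[OF h] by (simp add: gd[OF h])
 show "(grad_M (w t) has_derivative blinfun_apply (case (t, m) of (t, m) => Blinfun (H t m))) (at m within Mfd)"
 using has_derivative_transform[OF h(2) _ H(1)[OF h], of "grad_M (w t)"] gd[OF h(1)] by (simp add: bl[OF h])
 qed (rule w)
qed

lemma C12D:
 assumes "C12 T w"
 shows "continuous_on ({0..T} \<times> Mfd) (%(t, m). w t m)"
 "continuous_on ({0..T} \<times> Mfd) (%(t, m). time_deriv T w t m)"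
 "continuous_on ({0..T} \<times> Mfd) (%(t, m). grad_M (w t) m)"
 "!!t m. t:{0..T} ==> m:Mfd ==> ((%s. w s m) has_real_derivative time_deriv T w t m) (at t within {0..T})"
 "!!t m. t:{0..T} ==> m:Mfd ==> (w t has_derivative (%v. grad_M (w t) m \<bullet> v)) (at m within Mfd)"
 "!!t m. t:{0..T} ==> m:Mfd ==> grad_M (w t) m:tangent m"
 "EX H. (ALL t:{0..T}. ALL m:Mfd. (grad_M (w t) has_derivative H t m) (at m within Mfd))
 & (ALL e. continuous_on ({0..T} \<times> Mfd) (%(t, m). H t m e))"
proof -
 show "continuous_on ({0..T} \<times> Mfd) (%(t, m). w t m)"
 "continuous_on ({0..T} \<times> Mfd) (%(t, m). time_deriv T w t m)"
 "continuous_on ({0..T} \<times> Mfd) (%(t, m). grad_M (w t) m)"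
 using assms by (simp_all add: C12_def)
 show "((%s. w s m) has_real_derivative time_deriv T w t m) (at t within {0..T})" if "t:{0..T}" "m:Mfd" for t m
 using assms that by (simp add: C12_def has_real_derivative_iff_has_vector_derivative)
 show d: "(w t has_derivative (%v. grad_M (w t) m \<bullet> v)) (at m within Mfd)" if "t:{0..T}" "m:Mfd" for t m
 using assms that by (simp add: C12_def)
 \<comment> \<open>\<open>C12\<close> says that \<open>grad_M\<close> represents the derivative, not
   that the description defining it is satisfied. Composing with \<open>normalise\<close> replaces
   the representing vector by its tangential part, which does satisfy the description.\<close>
 show "grad_M (w t) m:tangent m" if h: "t:{0..T}" "m:Mfd" for t m
 proof -
 let ?g = "SUM a:UNIV. (grad_M (w t) m \<bullet> xi a m) *\<^sub>R xi a m"
 have tg: "?g:tangent m" by (intro subspace_sum subspace_tangent subspace_mul tangent_xi)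
 have dn: "dnormalise m v = (SUM a:UNIV. (v \<bullet> xi a m) *\<^sub>R xi a m)" for v
 proof -
 have "dnormalise m v:tangent m" using dnormalise_tangent[OF blk_nonzero[OF h(2)], of v] h(2) by simp
 from tangent_frame[OF h(2) this]
 have "dnormalise m v = (SUM a:UNIV. (dnormalise m v \<bullet> xi a m) *\<^sub>R xi a m)" by simp
 then show ?thesis by (simp add: dnormalise_inner_xi[OF h(2)])
 qed
 have "(normalise has_derivative dnormalise m) (at m within Mfd)"
 by (rule has_derivative_at_withinI[OF has_derivative_normalise[OF blk_nonzero[OF h(2)]]])
 moreover have "(w t has_derivative (%v. grad_M (w t) m \<bullet> v)) (at (normalise m) within normalise ` Mfd)"
 using d[OF h] h(2) by (rule_tac has_derivative_subset[of _ _ _ Mfd]) auto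
 ultimately have "((%y. w t (normalise y)) has_derivative (%v. grad_M (w t) m \<bullet> dnormalise m v)) (at m within Mfd)"
 by (rule has_derivative_in_compose)
 then have "(w t has_derivative (%v. grad_M (w t) m \<bullet> dnormalise m v)) (at m within Mfd)"
 by (rule has_derivative_transform[OF h(2), rotated]) simp
 moreover have "grad_M (w t) m \<bullet> dnormalise m v = ?g \<bullet> v" for v
 unfolding dn inner_sum_left inner_sum_right inner_scaleR_left inner_scaleR_right
 by (intro sum.cong refl) (simp add: inner_commute)
 ultimately have "(w t has_derivative (%v. ?g \<bullet> v)) (at m within Mfd)" by simp
 from grad_M_eqI[OF this tg h(2)] tg show ?thesis by simp
 qed
 show "EX H. (ALL t:{0..T}. ALL m:Mfd. (grad_M (w t) has_derivative H t m) (at m within Mfd))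
 & (ALL e. continuous_on ({0..T} \<times> Mfd) (%(t, m). H t m e))"
 proof -
 obtain H :: "real \<times> 'a vec3 => 'a vec3 \<Rightarrow>\<^sub>L 'a vec3" where H: "continuous_on ({0..T} \<times> Mfd) H"
 "ALL t:{0..T}. ALL m:Mfd. (grad_M (w t) has_derivative blinfun_apply (H (t, m))) (at m within Mfd)"
 using assms unfolding C12_def by (elim conjE exE)
 have "continuous_on ({0..T} \<times> Mfd) (%(t, m). blinfun_apply (H (t, m)) e)" for e
 using blinfun.continuous_on[OF H(1) continuous_on_const[of _ e]] by (simp add: case_prod_beta)
 then show ?thesis using H(2) by (intro exI[of _ "%t m. blinfun_apply (H (t, m))"]) simp
 qed
qed

lemma C1_M_D:
 assumes "C1_M f"
 obtains f' where "!!m. m:Mfd ==> (f has_derivative f' m) (at m within Mfd)" "!!e. continuous_on Mfd (%m. f' m e)"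
 "continuous_on Mfd f" "!!a. continuous_on Mfd (%m. f' m (xi a m))"
proof -
 obtain f' where f': "continuous_on Mfd f'" "ALL m:Mfd. (f has_derivative blinfun_apply (f' m)) (at m within Mfd)"
 using assms unfolding C1_M_def by (elim exE conjE)
 have "continuous_on Mfd f"
 unfolding continuous_on_eq_continuous_within using f'(2) has_derivative_continuous by blast
 moreover have "continuous_on Mfd (%m. blinfun_apply (f' m) (xi a m))" for a
 by (rule blinfun.continuous_on[OF f'(1) linear_continuous_on[OF bounded_linear_xi]])
 moreover have "continuous_on Mfd (%m. blinfun_apply (f' m) e)" for e
 by (rule blinfun.continuous_on[OF f'(1) continuous_on_const])
 ultimately show ?thesis using that[of "%m. blinfun_apply (f' m)"] f'(2) by blast
qed

section \<open>The volume measure\<close>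

lemma nn_integral_lborel_plus:
 fixes c :: "'a::euclidean_space"
 assumes "f:borel_measurable borel"
 shows "(\<integral>\<^sup>+x. f (c + x) \<partial>lborel) = (\<integral>\<^sup>+x. f x \<partial>lborel)"
proof -
 have "(\<integral>\<^sup>+x. f x \<partial>distr lborel borel ((+) c)) = (\<integral>\<^sup>+x. f (c + x) \<partial>lborel)"
 by (rule nn_integral_distr) (use assms in auto)
 then show ?thesis by (simp add: lborel_distr_plus)
qed

lemma linear_borel_measurable: "linear Q ==> Q:borel_measurable borel"
 for Q :: "'a::euclidean_space => 'b::real_normed_vector"
 by (intro borel_measurable_continuous_onI linear_continuous_on) (simp add: linear_conv_bounded_linear)

text \<open>Tonelli for \<open>(x, y) \<mapsto> 1\<^sub>A (Q x + y) 1\<^sub>B y\<close> with the unit ball \<open>B\<close>, whose measure \<open>Q\<close> preserves trivially, together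
 with translation invariance.\<close>

lemma lborel_distr_isometry:
 fixes Q :: "'a::euclidean_space => 'a"
 assumes Q: "linear Q" "!!x. norm (Q x) = norm x"
 shows "distr lborel borel Q = lborel"
proof (rule measure_eqI)
 fix A assume "A:sets (distr lborel borel Q)"
 then have A[measurable]: "A:sets borel" by simp
 have [measurable]: "Q:borel_measurable borel" by (rule linear_borel_measurable[OF Q(1)])
 have "inj Q" using Q by (metis linear_injective_0 norm_eq_zero)
 then have "surj Q" using linear_injective_imp_surjective[OF Q(1)] by blast
 then obtain P where P: "!!y. Q (P y) = y" by (metis surjD)
 define B :: "'a set" where "B = ball 0 1"
 have [measurable]: "B:sets borel" by (simp add: B_def)
 let ?f = "%x y. indicator A (Q x + y) * indicator B y :: ennreal"
 have 1: "(\<integral>\<^sup>+x. ?f x y \<partial>lborel) = emeasure lborel (Q -` A) * indicator B y" for y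
 proof -
 have "(\<integral>\<^sup>+x. ?f x y \<partial>lborel) = (\<integral>\<^sup>+x. indicator A (Q (P y + x)) * indicator B y \<partial>lborel)"
 by (simp add: linear_add[OF Q(1)] P add.commute)
 also have "... = (\<integral>\<^sup>+x. indicator A (Q x) * indicator B y \<partial>lborel)"
 by (rule nn_integral_lborel_plus) measurable
 also have "... = (\<integral>\<^sup>+x. indicator A (Q x) \<partial>lborel) * indicator B y"
 by (rule nn_integral_multc) measurable
 also have "(\<integral>\<^sup>+x. indicator A (Q x) \<partial>lborel) = (\<integral>\<^sup>+x. indicator (Q -` A) x \<partial>lborel)"
 by (simp add: indicator_def)
 also have "... = emeasure lborel (Q -` A)"
 using measurable_sets[of Q borel borel A] by (intro nn_integral_indicator) simp
 finally show ?thesis .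
 qed
 have 2: "(\<integral>\<^sup>+y. ?f x y \<partial>lborel) = (\<integral>\<^sup>+y. indicator A y * indicator B (y - Q x) \<partial>lborel)" for x
 using nn_integral_lborel_plus[of "%y. indicator A y * indicator B (y - Q x)" "Q x"] by simp
 have 3: "(\<integral>\<^sup>+x. indicator A y * indicator B (y - Q x) \<partial>lborel) = emeasure lborel B * indicator A y" for y
 proof -
 have "norm (y - Q x) = norm (- P y + x)" for x
 proof -
 have "y - Q x = Q (P y - x)" by (simp add: linear_diff[OF Q(1)] P)
 then show ?thesis using Q(2)[of "P y - x"] by (simp add: norm_minus_commute)
 qed
 then have "indicator B (y - Q x) = (indicator B (- P y + x) :: ennreal)" for x
 by (simp add: B_def indicator_def)
 then have "(\<integral>\<^sup>+x. indicator A y * indicator B (y - Q x) \<partial>lborel) = (\<integral>\<^sup>+x. indicator A y * indicator B (- P y + x) \<partial>lborel)" by simp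
 also have "... = (\<integral>\<^sup>+x. indicator A y * indicator B x \<partial>lborel)" by (rule nn_integral_lborel_plus) measurable
 also have "... = indicator A y * emeasure lborel B"
 by (subst nn_integral_cmult) auto
 finally show ?thesis by (simp add: mult.commute)
 qed
 have "emeasure lborel (Q -` A) * emeasure lborel B = (\<integral>\<^sup>+y. \<integral>\<^sup>+x. ?f x y \<partial>lborel \<partial>lborel)"
 unfolding 1 by (subst nn_integral_cmult) auto
 also have "... = (\<integral>\<^sup>+x. \<integral>\<^sup>+y. ?f x y \<partial>lborel \<partial>lborel)"
 by (rule lborel_pair.Fubini') measurable
 also have "... = (\<integral>\<^sup>+x. \<integral>\<^sup>+y. indicator A y * indicator B (y - Q x) \<partial>lborel \<partial>lborel)" unfolding 2 ..
 also have "... = (\<integral>\<^sup>+y. \<integral>\<^sup>+x. indicator A y * indicator B (y - Q x) \<partial>lborel \<partial>lborel)"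
 by (rule lborel_pair.Fubini'[symmetric]) measurable
 also have "... = emeasure lborel B * emeasure lborel A" unfolding 3 by (subst nn_integral_cmult) auto
 finally have eq: "emeasure lborel (Q -` A) * emeasure lborel B = emeasure lborel A * emeasure lborel B" by (simp add: mult.commute)
 have "emeasure lborel B \<noteq> \<infinity>" using emeasure_lborel_ball_finite[of 0 1] by (simp add: B_def less_top)
 moreover have "emeasure lborel B \<noteq> 0"
 using content_ball_pos[of 1 "0::'a"] by (auto simp: B_def measure_def)
 ultimately have "emeasure lborel (Q -` A) = emeasure lborel A"
 using eq by (simp add: mult.commute[of _ "emeasure lborel B"] ennreal_mult_cancel_left)
 then show "emeasure (distr lborel borel Q) A = emeasure lborel A" by (simp add: emeasure_distr)
qed simp

section \<open>The product of punctured balls behind \<open>vol_M\<close>\<close>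

definition shell :: "'n::finite vec3 set" where
 "shell = {x. ALL i. 0 < norm (blk x i) & norm (blk x i) <= 1}"

lemma borel_measurable_norm_blk [measurable]: "(%x. norm (blk x i)):borel_measurable borel"
 by (intro borel_measurable_continuous_onI continuous_intros)

lemma shell_measurable [measurable]: "(shell :: 'a::finite vec3 set):sets borel"
proof -
 have eq: "(shell :: 'a vec3 set) = (\<Inter>i. {x. 0 < norm (blk x i) & norm (blk x i) <= 1})" by (auto simp: shell_def)
 have "{x :: 'a vec3. 0 < norm (blk x i) & norm (blk x i) <= 1} = (%x. norm (blk x i)) -` {0<..1}" for i by auto
 then have "{x :: 'a vec3. 0 < norm (blk x i) & norm (blk x i) <= 1}:sets borel" for i
 using measurable_sets_borel[OF borel_measurable_norm_blk[of i], of "{0<..1}"] by simp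
 then show ?thesis unfolding eq by (intro sets.finite_INT) auto
qed

lemma normalise_measurable:
 "(normalise :: 'a::finite vec3 => _):measurable (restrict_space lborel shell) (restrict_space borel Mfd)"
proof (rule measurable_restrict_space2)
 show "(normalise :: 'a vec3 => _):space (restrict_space lborel shell) \<rightarrow> Mfd"
 proof
 fix x :: "'a vec3" assume "x:space (restrict_space lborel shell)"
 then have "blk x i \<noteq> 0" for i by (auto simp: space_restrict_space shell_def)
 then show "normalise x:Mfd" by (rule normalise_in_Mfd)
 qed
 have "continuous_on shell (normalise :: 'a vec3 => _)"
 unfolding continuous_on_eq_continuous_within
 proof
 fix x :: "'a vec3" assume "x:shell"
 then have "blk x i \<noteq> 0" for i by (auto simp: shell_def)
 then show "continuous (at x within shell) normalise"
 using has_derivative_normalise has_derivative_continuous continuous_at_imp_continuous_at_within by blast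
 qed
 then have "(normalise :: 'a vec3 => _):borel_measurable (restrict_space borel shell)"
 by (rule borel_measurable_continuous_on_restrict)
 moreover have "sets (restrict_space lborel shell) = sets (restrict_space borel (shell :: 'a vec3 set))"
 by (simp add: sets_restrict_space)
 ultimately show "(normalise :: 'a vec3 => _):borel_measurable (restrict_space lborel shell)"
 using measurable_cong_sets[OF _ refl] by blast
qed

lemma space_vol_M [simp]: "space vol_M = Mfd" and sets_vol_M: "sets vol_M = sets (restrict_space borel Mfd)"
 by (simp_all add: vol_M_def space_scale_measure space_restrict_space)

lemma emeasure_vol_M:
 assumes "A:sets (restrict_space borel (Mfd :: 'n::finite vec3 set))"
 shows "emeasure vol_M A = 3 ^ CARD('n) * emeasure lborel {x:shell. normalise x:A}"
proof -
 have "emeasure vol_M A = 3 ^ CARD('n) * emeasure (distr (restrict_space lborel shell) (restrict_space borel Mfd) normalise) A"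
 unfolding vol_M_def shell_def by (simp add: emeasure_scale_measure)
 also have "emeasure (distr (restrict_space lborel shell) (restrict_space borel Mfd) normalise) A
 = emeasure (restrict_space lborel shell) (normalise -` A \<inter> shell)"
 using emeasure_distr[OF normalise_measurable assms] by (simp add: space_restrict_space)
 also have "... = emeasure lborel (normalise -` A \<inter> shell)"
 by (rule emeasure_restrict_space) auto
 also have "normalise -` A \<inter> shell = {x:shell. normalise x:A}" by auto
 finally show ?thesis .
qed

lemma norm_le_sum_blk: "norm x <= (SUM i:UNIV. norm (blk x i))" for x :: "'n::finite vec3"
proof -
 have "x = (SUM i:UNIV. proj i x)" unfolding blk_eq_iff blk_sum by (simp add: blk_proj)
 then have "norm x <= (SUM i:UNIV. norm (proj i x))" by (metis norm_sum)
 then show ?thesis by (simp add: norm_proj)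
qed

lemma finite_measure_vol_M: "finite_measure (vol_M :: 'n::finite vec3 measure)"
proof (rule finite_measureI)
 have "(shell :: 'n vec3 set) \<subseteq> cball 0 (real CARD('n))"
 proof
 fix x :: "'n vec3" assume "x:shell"
 then have "(SUM i:UNIV. norm (blk x i)) <= (SUM i:(UNIV::'n set). 1)" by (intro sum_mono) (auto simp: shell_def)
 then show "x:cball 0 (real CARD('n))" using norm_le_sum_blk[of x] by simp
 qed
 then have "bounded (shell :: 'n vec3 set)" using bounded_cball bounded_subset by blast
 then have "emeasure lborel (shell :: 'n vec3 set) < \<infinity>" by (rule emeasure_bounded_finite)
 then have "emeasure lborel (shell :: 'n vec3 set) \<noteq> \<infinity>" by simp
 moreover have "{x:shell. normalise x:Mfd} = (shell :: 'n vec3 set)"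
 by (auto simp: shell_def intro!: normalise_in_Mfd)
 moreover have "(Mfd :: 'n vec3 set):sets (restrict_space borel Mfd)"
 using sets.top[of "restrict_space borel (Mfd :: 'n vec3 set)"] by (simp add: space_restrict_space)
 ultimately show "emeasure vol_M (space (vol_M :: 'n vec3 measure)) \<noteq> \<infinity>"
 by (simp add: emeasure_vol_M ennreal_mult_eq_top_iff power_eq_top_ennreal)
qed

lemma continuous_borel_vol_M: "continuous_on Mfd f ==> f:borel_measurable vol_M"
 using borel_measurable_continuous_on_restrict measurable_cong_sets[OF sets_vol_M refl] by blast

lemma bounded_on_Mfd: "continuous_on Mfd f ==> EX K>=0. ALL x:Mfd. norm (f x) <= K"
 for f :: "'n::finite vec3 => 'b::real_normed_vector"
proof -
 assume "continuous_on Mfd f"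
 then have "bounded (f ` Mfd)" using compact_continuous_image[OF _ compact_Mfd] compact_imp_bounded by blast
 then obtain K where "ALL x:Mfd. norm (f x) <= K" unfolding bounded_iff by auto
 then show ?thesis by (intro exI[of _ "max K 0"]) auto
qed

lemma integrable_continuous_vol_M: "continuous_on Mfd f ==> integrable vol_M f"
 for f :: "'n::finite vec3 => 'b::{banach, second_countable_topology}"
proof -
 assume f: "continuous_on Mfd f"
 obtain K where "ALL x:Mfd. norm (f x) <= K" using bounded_on_Mfd[OF f] by blast
 then show ?thesis
 by (intro finite_measure.integrable_const_bound[OF finite_measure_vol_M, of _ K] continuous_borel_vol_M f AE_I2) simp
qed

text \<open>Rotations about the axes are what differentiation uses; this larger group is convenient
  because its transitivity on \<open>Mfd\<close> is immediate, and transitivity makes the mass of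
  the kernel constant.\<close>

definition block_isometry :: "('n::finite vec3 => 'n vec3) => bool" where
 "block_isometry Q \<longleftrightarrow> linear Q & (ALL x i. norm (blk (Q x) i) = norm (blk x i))"

lemma block_isometry_rot: "block_isometry (rot a s)"
 by (simp add: block_isometry_def linear_rot)

lemma block_isometry_Mfd: "block_isometry Q ==> Q x:Mfd \<longleftrightarrow> x:Mfd"
 by (simp add: block_isometry_def Mfd_def)

lemma block_isometry_normalise:
 assumes "block_isometry Q"
 shows "Q (normalise x) = normalise (Q x)"
 unfolding blk_eq_iff
proof
 fix i
 have Q: "linear Q" "!!x i. norm (blk (Q x) i) = norm (blk x i)" using assms by (auto simp: block_isometry_def)
 have "norm (blk (Q (normalise x - inverse (norm (blk x i)) *\<^sub>R x)) i) = 0"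
 unfolding Q(2) by (simp add: blk_normalise)
 then have "blk (Q (normalise x)) i = inverse (norm (blk x i)) *\<^sub>R blk (Q x) i"
 by (simp add: linear_diff[OF Q(1)] linear_cmul[OF Q(1)])
 then show "blk (Q (normalise x)) i = blk (normalise (Q x)) i" by (simp add: blk_normalise Q(2))
qed

text \<open>\<open>normalise\<close> commutes with blockwise isometries and \<open>shell\<close> is
  invariant under them, so the invariance of Lebesgue measure descends to
  \<open>vol_M\<close>.\<close>

lemma distr_vol_M:
 fixes Q :: "'n::finite vec3 => 'n vec3"
 assumes Q: "block_isometry Q"
 shows "Q:measurable vol_M vol_M" "distr vol_M vol_M Q = vol_M"
proof -
 have lin: "linear Q" and nb: "!!x i. norm (blk (Q x) i) = norm (blk x i)" using Q by (auto simp: block_isometry_def)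
 have "norm (Q x) = norm x" for x
 using nb[of x] unfolding norm_eq inner_blk by simp
 note iso = lborel_distr_isometry[OF lin this]
 have bm: "Q:borel_measurable borel" by (rule linear_borel_measurable[OF lin])
 have "Q:measurable (restrict_space borel Mfd) (restrict_space borel Mfd)"
 by (intro measurable_restrict_space3 bm) (auto simp: block_isometry_Mfd[OF Q])
 then show m: "Q:measurable vol_M vol_M" using measurable_cong_sets[OF sets_vol_M sets_vol_M] by blast
 show "distr vol_M vol_M Q = vol_M"
 proof (rule measure_eqI)
 fix A :: "'n vec3 set" assume "A:sets (distr vol_M vol_M Q)"
 then have A: "A:sets vol_M" "A:sets (restrict_space borel Mfd)" by (simp_all add: sets_vol_M)
 have QA: "Q -` A \<inter> Mfd:sets (restrict_space borel Mfd)" using measurable_sets[OF m A(1)] by (simp add: sets_vol_M)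
 have meas: "{x:shell. normalise x:A}:sets borel"
 proof -
 have "normalise -` A \<inter> space (restrict_space lborel shell):sets (restrict_space lborel shell)"
 by (rule measurable_sets[OF normalise_measurable A(2)])
 then have "normalise -` A \<inter> shell:sets (lborel :: 'n vec3 measure)"
 by (simp add: space_restrict_space sets_restrict_space_iff)
 moreover have "normalise -` A \<inter> shell = {x:shell. normalise x:A}" by auto
 ultimately show ?thesis by simp
 qed
 have "emeasure (distr vol_M vol_M Q) A = emeasure vol_M (Q -` A \<inter> Mfd)"
 using emeasure_distr[OF m A(1)] by simp
 also have "... = 3 ^ CARD('n) * emeasure lborel {x:shell. normalise x:Q -` A \<inter> Mfd}" by (rule emeasure_vol_M[OF QA])
 also have "{x:shell. normalise x:Q -` A \<inter> Mfd} = Q -` {x:shell. normalise x:A}"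
 proof -
 have "x:shell ==> normalise x:Mfd" for x :: "'n vec3" by (rule normalise_in_Mfd) (auto simp: shell_def)
 moreover have "Q x:shell \<longleftrightarrow> x:shell" for x by (simp only: shell_def mem_Collect_eq nb)
 ultimately show ?thesis by (auto simp: block_isometry_normalise[OF Q])
 qed
 also have "emeasure lborel (Q -` {x:shell. normalise x:A}) = emeasure (distr lborel borel Q) {x:shell. normalise x:A}"
 using emeasure_distr[of Q lborel borel] bm meas by simp
 also have "3 ^ CARD('n) * ... = emeasure vol_M A" unfolding iso by (rule emeasure_vol_M[OF A(2), symmetric])
 finally show "emeasure (distr vol_M vol_M Q) A = emeasure vol_M A" .
 qed simp
qed

lemma integral_block_isometry:
 fixes f :: "'n::finite vec3 => real"
 assumes "block_isometry Q" "f:borel_measurable vol_M"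
 shows "(LINT x|vol_M. f (Q x)) = (LINT x|vol_M. f x)"
 using integral_distr[OF distr_vol_M(1)[OF assms(1)] assms(2)] by (simp add: distr_vol_M(2)[OF assms(1)])

text \<open>A small ball around \<open>x / 2\<close> lies in \<open>shell\<close> and is normalised
  into the given ball around \<open>x\<close>; its Lebesgue measure does not depend on
  \<open>x\<close>.\<close>

lemma vol_M_ball_lower_bound:
 assumes r: "r > 0"
 obtains v where "v > 0" "!!x :: 'n::finite vec3. x:Mfd ==> v <= measure vol_M {y:Mfd. dist y x < r}"
proof -
 let ?N = "real CARD('n)"
 \<comment> \<open>Radius at most \<open>1 / 4\<close> keeps the block norms in
   \<open>[1 / 4, 1]\<close>. Normalisation then displaces each block from that of \<open>x\<close>
   by at most \<open>4 * (rh + rh)\<close>, and the blocks add up to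
   \<open>8 * N * rh\<close>.\<close>
 define rh where "rh = min (1 / 4) (r / (8 * ?N + 1))"
 have rh: "rh > 0" "rh <= 1 / 4" "8 * ?N * rh < r"
 proof -
 have "r / (8 * ?N + 1) > 0" using r by (intro divide_pos_pos add_nonneg_pos) auto
 then show p1: "rh > 0" unfolding rh_def by simp
 show "rh <= 1 / 4" unfolding rh_def by (rule min.cobounded1)
 have "8 * ?N * rh < (8 * ?N + 1) * rh" using p1 by simp
 also have "... <= (8 * ?N + 1) * (r / (8 * ?N + 1))" unfolding rh_def by (intro mult_left_mono) auto
 also have "... = r" by (simp add: add_nonneg_eq_0_iff)
 finally show "8 * ?N * rh < r" .
 qed
 let ?c = "measure lborel (ball (0 :: 'n vec3) rh)"
 have sub: "ball (x /\<^sub>R 2) rh \<subseteq> {z:shell. normalise z:{y:Mfd. dist y x < r}}" if x: "x:Mfd" for x :: "'n vec3"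
 proof
 fix z assume z: "z:ball (x /\<^sub>R 2) rh"
 have b: "norm (blk z i - blk x i /\<^sub>R 2) < rh" for i
 using z norm_blk_le[of "z - x /\<^sub>R 2" i] by (simp add: dist_norm norm_minus_commute)
 have nx: "norm (blk x i) = 1" for i using x by (simp add: Mfd_def)
 have n: "\<bar>norm (blk z i) - 1 / 2\<bar> < rh" for i
 using b[of i] norm_triangle_ineq3[of "blk z i" "blk x i /\<^sub>R 2"] nx[of i] by simp
 have n4: "1 / 4 <= norm (blk z i)" "norm (blk z i) <= 1" for i using n[of i] rh(2) by linarith+
 have sh: "z:shell" unfolding shell_def
 proof (rule CollectI, rule allI)
 fix i show "0 < norm (blk z i) & norm (blk z i) <= 1" using n4[of i] by linarith
 qed
 have M: "normalise z:Mfd" by (rule normalise_in_Mfd) (use sh in \<open>auto simp: shell_def\<close>)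
 have "norm (blk (normalise z - x) i) <= 8 * rh" for i
 proof -
 have zp: "norm (blk z i) > 0" using n4[of i] by linarith
 have "blk (normalise z - x) i = inverse (norm (blk z i)) *\<^sub>R ((blk z i - blk x i /\<^sub>R 2) + (1 / 2 - norm (blk z i)) *\<^sub>R blk x i)"
 using zp by (simp add: blk_normalise algebra_simps)
 then have "norm (blk (normalise z - x) i) = inverse (norm (blk z i)) * norm ((blk z i - blk x i /\<^sub>R 2) + (1 / 2 - norm (blk z i)) *\<^sub>R blk x i)"
 by (simp only: norm_scaleR abs_of_pos[OF positive_imp_inverse_positive[OF zp]])
 moreover have "norm ((blk z i - blk x i /\<^sub>R 2) + (1 / 2 - norm (blk z i)) *\<^sub>R blk x i) <= rh + rh"
 using b[of i] n[of i] nx[of i] by (intro order_trans[OF norm_triangle_ineq] add_mono) (auto simp: abs_minus_commute)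
 moreover have "inverse (norm (blk z i)) <= 4" using le_imp_inverse_le[of "1/4" "norm (blk z i)"] n4[of i] by simp
 ultimately have "norm (blk (normalise z - x) i) <= 4 * (rh + rh)"
 using zp rh by (simp only:) (intro mult_mono, auto)
 then show ?thesis by simp
 qed
 then have "(SUM i:UNIV. norm (blk (normalise z - x) i)) <= (SUM i:(UNIV::'n set). 8 * rh)" by (rule sum_mono)
 then have "norm (normalise z - x) <= 8 * ?N * rh" using norm_le_sum_blk[of "normalise z - x"] by simp
 then have "dist (normalise z) x < r" using rh(3) by (simp add: dist_norm)
 with sh M show "z:{z:shell. normalise z:{y:Mfd. dist y x < r}}" by simp
 qed
 have "?c <= measure vol_M {y:Mfd. dist y x < r}" if x: "x:Mfd" for x :: "'n vec3"
 proof -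
 let ?A = "{y:Mfd. dist y x < r}"
 have A: "?A:sets (restrict_space borel Mfd)"
 proof -
 have "?A = Mfd \<inter> ball x r" by (auto simp: dist_commute)
 then show ?thesis by (simp add: sets_restrict_space)
 qed
 have meas: "{z:shell. normalise z:?A}:sets lborel"
 proof -
 have "normalise -` ?A \<inter> space (restrict_space lborel shell):sets (restrict_space lborel shell)"
 by (rule measurable_sets[OF normalise_measurable A])
 then have "normalise -` ?A \<inter> shell:sets (lborel :: 'n vec3 measure)"
 by (simp add: space_restrict_space sets_restrict_space_iff)
 moreover have "normalise -` ?A \<inter> shell = {z:shell. normalise z:?A}" by auto
 ultimately show ?thesis by simp
 qed
 have "emeasure lborel (ball (0 :: 'n vec3) rh) = emeasure lborel (ball (x /\<^sub>R 2) rh)"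
 using emeasure_ball[of rh "0 :: 'n vec3"] emeasure_ball[of rh "x /\<^sub>R 2"] rh by simp
 also have "... <= emeasure lborel {z:shell. normalise z:?A}" by (rule emeasure_mono[OF sub[OF x] meas])
 also have "... <= 3 ^ CARD('n) * emeasure lborel {z:shell. normalise z:?A}"
 proof -
 have "(1 :: ennreal) <= 3 ^ CARD('n)" by (rule one_le_power) simp
 from mult_right_mono[OF this, of "emeasure lborel {z:shell. normalise z:?A}"] show ?thesis by simp
 qed
 also have "... = emeasure vol_M ?A" by (rule emeasure_vol_M[OF A, symmetric])
 finally have "emeasure lborel (ball (0 :: 'n vec3) rh) <= emeasure vol_M ?A" .
 then show ?thesis
 unfolding measure_def using finite_measure.emeasure_finite[OF finite_measure_vol_M, of ?A]
 by (intro enn2real_mono) (auto simp: less_top)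
 qed
 moreover have "?c > 0" using content_ball_pos[OF rh(1)] by simp
 ultimately show ?thesis using that by blast
qed

lemma integral_zero_imp_zero:
 fixes f :: "'n::finite vec3 => real"
 assumes f: "continuous_on Mfd f" "!!x. x:Mfd ==> 0 <= f x" and z: "(LINT x|vol_M. f x) = 0" and x: "x:Mfd"
 shows "f x = 0"
proof (rule ccontr)
 assume "f x \<noteq> 0"
 then have fx: "f x > 0" using f(2)[OF x] by simp
 from f(1)[unfolded continuous_on_iff, rule_format, OF x, of "f x / 2"] fx
 obtain r where r: "r > 0" "ALL y:Mfd. dist y x < r --> dist (f y) (f x) < f x / 2" by auto
 obtain v where v: "v > 0" "!!x :: 'n vec3. x:Mfd ==> v <= measure vol_M {y:Mfd. dist y x < r}"
 by (rule vol_M_ball_lower_bound[OF r(1)]) (rule that; assumption)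
 let ?A = "{y:Mfd. dist y x < r}"
 have A: "?A:sets vol_M"
 proof -
 have "?A = Mfd \<inter> ball x r" by (auto simp: dist_commute)
 then show ?thesis by (simp add: sets_vol_M sets_restrict_space)
 qed
 have "(LINT y|vol_M. f x / 2 * indicator ?A y) <= (LINT y|vol_M. f y)"
 proof (rule integral_mono)
 show "integrable vol_M (%y. f x / 2 * indicator ?A y)"
 using A finite_measure.emeasure_finite[OF finite_measure_vol_M, of ?A]
 by (intro integrable_mult_right integrable_real_indicator) (auto simp: less_top)
 show "f x / 2 * indicator ?A y <= f y" if "y:space vol_M" for y
 proof (cases "y:?A")
 case True
 then have "dist (f y) (f x) < f x / 2" using r(2) by blast
 then have "\<bar>f y - f x\<bar> < f x / 2" by (simp add: dist_real_def)
 then have "f x / 2 <= f y" by linarith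
 then show ?thesis using True by simp
 next
 case False
 then show ?thesis using that f(2)[of y] by simp
 qed
 qed (rule integrable_continuous_vol_M[OF f(1)])
 moreover have "(LINT y|vol_M. f x / 2 * indicator ?A y) = f x / 2 * measure vol_M ?A"
 using A by (simp add: Int_absorb2 sets.sets_into_space)
 ultimately have "f x / 2 * measure vol_M ?A <= 0" using z by linarith
 moreover have "0 < measure vol_M ?A" using v(1) v(2)[OF x] by linarith
 then have "0 < f x / 2 * measure vol_M ?A" using fx by simp
 ultimately show False by linarith
qed

section \<open>Integration by parts\<close>

text \<open>The derivative at angle 0 suffices because it is required at every point: the group law
  carries it along the whole orbit.\<close>

definition rot_derivative :: "'n \<times> 3 => ('n::finite vec3 => real) => ('n vec3 => real) => bool" where
 "rot_derivative a f f' \<longleftrightarrow> continuous_on Mfd f & continuous_on Mfd f' &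
 (ALL x:Mfd. ((%s. f (rot a s x)) has_real_derivative f' x) (at 0))"

lemma rot_derivative_at:
 assumes "rot_derivative a f f'" "x:Mfd"
 shows "((%s. f (rot a s x)) has_real_derivative f' (rot a s x)) (at s)"
proof -
 have "((%r. f (rot a r (rot a s x))) has_real_derivative f' (rot a s x)) (at 0)"
 using assms by (simp add: rot_derivative_def)
 then have "((%r. f (rot a (r + s) x)) has_real_derivative f' (rot a s x)) (at 0)"
 by (simp add: rot_rot)
 then show ?thesis using DERIV_at_within_shift[of "%s. f (rot a s x)" "f' (rot a s x)" s 0 UNIV]
 by (simp add: add.commute)
qed

lemma continuous_on_rot: "continuous_on S (rot a s)"
 using bounded_linear_rot linear_continuous_on by blast

lemma continuous_on_Mfd_rot: "continuous_on Mfd f ==> continuous_on Mfd (%x. f (rot a s x))"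
 by (rule continuous_on_compose2[OF _ continuous_on_rot]) auto

text \<open>Dominated convergence with the mean value bound. With \<open>ps = 1\<close> it leads to
  the divergence theorem, with a power of the kernel it differentiates convolutions.\<close>

lemma integral_rot_quotient:
 fixes f :: "'n::finite vec3 => real"
 assumes f: "rot_derivative a f f'" and ps: "continuous_on Mfd ps"
 shows "(%n. LINT x|vol_M. (f (rot a (inverse (real (Suc n))) x) - f x) / inverse (real (Suc n)) * ps x)
 \<longlonglongrightarrow> (LINT x|vol_M. f' x * ps x)"
proof -
 have fc: "continuous_on Mfd f" "continuous_on Mfd f'" using f by (auto simp: rot_derivative_def)
 obtain K where K: "K >= 0" "!!x. x:Mfd ==> norm (f' x) <= K" using bounded_on_Mfd[OF fc(2)] by blast
 obtain P where P: "P >= 0" "!!x. x:Mfd ==> norm (ps x) <= P" using bounded_on_Mfd[OF ps] by blast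
 show ?thesis
 proof (rule integral_dominated_convergence[where w = "%_. K * P"])
 show "(%x. f' x * ps x):borel_measurable vol_M"
 by (intro continuous_borel_vol_M continuous_intros fc ps)
 show "(%x. (f (rot a (inverse (real (Suc n))) x) - f x) / inverse (real (Suc n)) * ps x):borel_measurable vol_M" for n
 by (intro continuous_borel_vol_M continuous_intros continuous_on_Mfd_rot fc ps) auto
 show "integrable vol_M (%_. K * P)" by (rule integrable_continuous_vol_M) simp
 show "AE x in vol_M. (%n. (f (rot a (inverse (real (Suc n))) x) - f x) / inverse (real (Suc n)) * ps x) \<longlonglongrightarrow> f' x * ps x"
 proof (rule AE_I2)
 fix x :: "'n vec3" assume "x:space vol_M"
 then have x: "x:Mfd" by simp
 have "((%s. f (rot a s x)) has_real_derivative f' x) (at 0)" using f x by (simp add: rot_derivative_def)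
 then have "((%s. (f (rot a s x) - f x) / s) \<longlongrightarrow> f' x) (at 0)" by (simp add: has_field_derivative_iff)
 moreover have "filterlim (%n. inverse (real (Suc n))) (at 0) sequentially"
 unfolding filterlim_at using LIMSEQ_inverse_real_of_nat by simp
 ultimately have "(%n. (f (rot a (inverse (real (Suc n))) x) - f x) / inverse (real (Suc n))) \<longlonglongrightarrow> f' x"
 by (rule filterlim_compose)
 then show "(%n. (f (rot a (inverse (real (Suc n))) x) - f x) / inverse (real (Suc n)) * ps x) \<longlonglongrightarrow> f' x * ps x"
 by (rule tendsto_mult_right)
 qed
 show "AE x in vol_M. norm ((f (rot a (inverse (real (Suc n))) x) - f x) / inverse (real (Suc n)) * ps x) <= K * P" for n
 proof (rule AE_I2)
 fix x :: "'n vec3" assume "x:space vol_M"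
 then have x: "x:Mfd" by simp
 let ?s = "inverse (real (Suc n))"
 have "norm (f (rot a ?s x) - f (rot a 0 x)) <= K * norm (?s - 0)"
 by (rule field_differentiable_bound[OF convex_UNIV has_field_derivative_at_within[OF rot_derivative_at[OF f x]]])
 (use K x in auto)
 then have "norm (f (rot a ?s x) - f x) <= K * ?s" by simp
 then have "norm ((f (rot a ?s x) - f x) / ?s) <= K" by (simp add: divide_le_eq)
 then have "norm ((f (rot a ?s x) - f x) / ?s) * norm (ps x) <= K * P"
 using K(1) P(2)[OF x] by (intro mult_mono) auto
 then show "norm ((f (rot a ?s x) - f x) / ?s * ps x) <= K * P" by (simp only: norm_mult)
 qed
 qed
qed

text \<open>\<open>vol_M\<close> is rotation invariant, so every difference quotient along the
  orbits already has integral zero.\<close>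

lemma integral_rot_derivative:
 fixes f :: "'n::finite vec3 => real"
 assumes f: "rot_derivative a f f'"
 shows "(LINT x|vol_M. f' x) = 0"
proof -
 have fc: "continuous_on Mfd f" using f by (auto simp: rot_derivative_def)
 have "(LINT x|vol_M. (f (rot a s x) - f x) / r * 1) = 0" for s r
 proof -
 have "(LINT x|vol_M. f (rot a s x) - f x) = (LINT x|vol_M. f (rot a s x)) - (LINT x|vol_M. f x)"
 by (intro Bochner_Integration.integral_diff integrable_continuous_vol_M continuous_on_Mfd_rot fc)
 also have "... = 0"
 using integral_block_isometry[OF block_isometry_rot[of a s] continuous_borel_vol_M[OF fc]] by simp
 finally show ?thesis by simp
 qed
 then have "(%n. 0 :: real) \<longlonglongrightarrow> (LINT x|vol_M. f' x * 1)"
 using integral_rot_quotient[OF f continuous_on_const[of Mfd 1]] by (simp only:)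
 then show ?thesis by (simp add: LIMSEQ_const_iff)
qed

lemma rot_derivativeI:
 assumes "!!m. m:Mfd ==> (f has_derivative f' m) (at m within Mfd)" "continuous_on Mfd (%m. f' m (xi a m))"
 shows "rot_derivative a f (%m. f' m (xi a m))"
 unfolding rot_derivative_def
proof (intro conjI ballI)
 show "continuous_on Mfd f"
 unfolding continuous_on_eq_continuous_within using assms(1) has_derivative_continuous by blast
 show "((%s. f (rot a s x)) has_real_derivative f' x (xi a x)) (at 0)" if "x:Mfd" for x
 using has_vector_derivative_along_rot[OF assms(1)[OF that] that, of a]
 by (simp add: has_real_derivative_iff_has_vector_derivative)
qed (rule assms(2))

text \<open>For tangential \<open>X\<close> the divergence is the sum of the derivatives of
  \<open>X \<bullet> xi a\<close> along \<open>xi a\<close>, and each of these integrates to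
  zero.\<close>

theorem divergence_theorem:
 fixes X :: "'n::finite vec3 => 'n vec3"
 assumes X: "!!m. m:Mfd ==> (X has_derivative X' m) (at m within Mfd)"
 and c: "!!a. continuous_on Mfd (%m. X' m (xi a m))" and t: "!!m. m:Mfd ==> X m:tangent m"
 shows "(LINT m|vol_M. div_M X m) = 0"
proof -
 have Xc: "continuous_on Mfd X"
 unfolding continuous_on_eq_continuous_within using X has_derivative_continuous by blast
 let ?D = "%a m v. X m \<bullet> xi a v + X' m v \<bullet> xi a m"
 have D: "((%y. X y \<bullet> xi a y) has_derivative ?D a m) (at m within Mfd)" if "m:Mfd" for a m
 by (rule has_derivative_inner[OF X[OF that] bounded_linear_imp_has_derivative[OF bounded_linear_xi]])
 have xc: "continuous_on Mfd (xi a)" for a using bounded_linear_xi linear_continuous_on by blast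
 have Dc: "continuous_on Mfd (%m. ?D a m (xi a m))" for a
 by (intro continuous_intros Xc c xc continuous_on_compose2[OF linear_continuous_on[OF bounded_linear_xi] xc]) auto
 have z: "(LINT m|vol_M. ?D a m (xi a m)) = 0" for a
 by (rule integral_rot_derivative[OF rot_derivativeI[where f = "%y. X y \<bullet> xi a y" and f' = "?D a", OF D Dc]])
 have "(LINT m|vol_M. div_M X m) = (LINT m|vol_M. (SUM a:UNIV. ?D a m (xi a m)))"
 by (rule Bochner_Integration.integral_cong) (use div_M_tangential[OF X _ t D] in auto)
 also have "... = (SUM a:UNIV. LINT m|vol_M. ?D a m (xi a m))"
 by (rule Bochner_Integration.integral_sum) (rule integrable_continuous_vol_M[OF Dc])
 also have "... = 0"
 unfolding z by simp
 finally show ?thesis .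
qed

lemma integration_by_parts:
 fixes X :: "'n::finite vec3 => 'n vec3"
 assumes f: "!!m. m:Mfd ==> (f has_derivative (%v. g m \<bullet> v)) (at m within Mfd)" "continuous_on Mfd g"
 and X: "!!m. m:Mfd ==> (X has_derivative X' m) (at m within Mfd)"
 and c: "!!a. continuous_on Mfd (%m. X' m (xi a m))" and t: "!!m. m:Mfd ==> X m:tangent m"
 shows "(LINT m|vol_M. g m \<bullet> X m) = - (LINT m|vol_M. f m * div_M X m)"
 and "!!m. m:Mfd ==> div_M (%y. f y *\<^sub>R X y) m = f m * div_M X m + g m \<bullet> X m"
 and "continuous_on Mfd (div_M X)"
proof -
 have Xc: "continuous_on Mfd X"
 unfolding continuous_on_eq_continuous_within using X has_derivative_continuous by blast
 have fc: "continuous_on Mfd f"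
 unfolding continuous_on_eq_continuous_within using f(1) has_derivative_continuous by blast
 have xc: "continuous_on Mfd (xi a)" for a using bounded_linear_xi linear_continuous_on by blast
 let ?Y = "%m v. f m *\<^sub>R X' m v + (g m \<bullet> v) *\<^sub>R X m"
 have Y: "((%y. f y *\<^sub>R X y) has_derivative ?Y m) (at m within Mfd)" if "m:Mfd" for m
 by (rule has_derivative_scaleR[OF f(1)[OF that] X[OF that]])
 have Yc: "continuous_on Mfd (%m. ?Y m (xi a m))" for a
 by (intro continuous_intros fc c f(2) xc Xc)
 have Yt: "f m *\<^sub>R X m:tangent m" if "m:Mfd" for m
 using t[OF that] subspace_tangent subspace_mul by blast
 have "continuous_on Mfd (%m. SUM a:UNIV. X' m (xi a m) \<bullet> xi a m)" by (intro continuous_intros c xc)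
 then show dc: "continuous_on Mfd (div_M X)" by (rule continuous_on_eq) (simp add: div_M_eq[OF X])
 show d: "div_M (%y. f y *\<^sub>R X y) m = f m * div_M X m + g m \<bullet> X m" if m: "m:Mfd" for m
 proof -
 have "(SUM a:UNIV. (g m \<bullet> xi a m) * (X m \<bullet> xi a m)) = g m \<bullet> X m"
 using sum_inner_xi[OF m t[OF m], of "g m"] by (simp add: mult.commute inner_commute)
 then show ?thesis
 by (simp add: div_M_eq[OF Y[OF m] m] div_M_eq[OF X[OF m] m] inner_add_left sum.distrib sum_distrib_left)
 qed
 have "0 = (LINT m|vol_M. div_M (%y. f y *\<^sub>R X y) m)"
 by (rule divergence_theorem[OF Y Yc Yt, symmetric])
 also have "... = (LINT m|vol_M. f m * div_M X m + g m \<bullet> X m)"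
 by (rule Bochner_Integration.integral_cong) (auto simp: d)
 also have "... = (LINT m|vol_M. f m * div_M X m) + (LINT m|vol_M. g m \<bullet> X m)"
 by (intro Bochner_Integration.integral_add integrable_continuous_vol_M continuous_intros fc dc f(2) Xc)
 finally show "(LINT m|vol_M. g m \<bullet> X m) = - (LINT m|vol_M. f m * div_M X m)" by simp
qed

section \<open>Density of polynomials in \<open>C\<^sup>2\<close>\<close>

text \<open>Convolution with powers of \<open>\<Prod>\<^sub>i (1 + x\<^sub>i \<bullet> y\<^sub>i) / 2\<close>: the result is a polynomial in \<open>x\<close>, and the convolution commutes
 with the rotations, hence with the angular derivatives.\<close>

definition kern :: "'n::finite vec3 => 'n vec3 => real" where
 "kern x y = (PROD i:UNIV. (1 + blk x i \<bullet> blk y i) / 2)"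

text \<open>Degenerate kernels: integrating out the second variable leaves a polynomial in the
  first, whose coefficients are moments of the density.\<close>

inductive kernel_form :: "('n::finite vec3 => 'n vec3 => real) => bool" where
 base: "poly_fun p ==> poly_fun q ==> kernel_form (%x y. p x * q y)"
| plus: "kernel_form F ==> kernel_form G ==> kernel_form (%x y. F x y + G x y)"

lemma kernel_form_mult_base:
 "kernel_form F ==> poly_fun p ==> poly_fun q ==> kernel_form (%x y. (p x * q y) * F x y)"
proof (induction rule: kernel_form.induct)
 case (base p' q')
 have "kernel_form (%x y. (p x * p' x) * (q y * q' y))"
 by (intro kernel_form.base real_polynomial_function.intros(4) base)
 then show ?case by (simp add: mult_ac)
next
 case (plus F G)
 then show ?case using kernel_form.plus[OF plus.IH(1) plus.IH(2)] by (simp add: distrib_left)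
qed

lemma kernel_form_mult: "kernel_form F ==> kernel_form G ==> kernel_form (%x y. F x y * G x y)"
proof (induction rule: kernel_form.induct)
 case (base p q)
 then show ?case using kernel_form_mult_base by blast
next
 case (plus F1 F2)
 show ?case using kernel_form.plus[OF plus.IH(1)[OF plus.prems] plus.IH(2)[OF plus.prems]] by (simp add: distrib_right)
qed

lemma kernel_form_const: "kernel_form (%x y. c)"
 using kernel_form.base[OF real_polynomial_function.intros(2)[of c] real_polynomial_function.intros(2)[of 1]] by simp

lemma kernel_form_kern: "kernel_form (%x y. kern x y ^ n)"
proof -
 have c: "poly_fun (%x::'a vec3. x $ p)" for p
 by (rule real_polynomial_function.intros(1)[OF bounded_linear_vec_nth])
 have i: "kernel_form (%x y :: 'a vec3. (1 + blk x i \<bullet> blk y i) / 2)" for i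
 proof -
 have "kernel_form (%x y :: 'a vec3. 1 / 2 + ((1 / 2 * x $ (i, 1)) * y $ (i, 1) + ((1 / 2 * x $ (i, 2)) * y $ (i, 2) + (1 / 2 * x $ (i, 3)) * y $ (i, 3))))"
 by (intro kernel_form.plus kernel_form_const kernel_form.base c poly_fun_scale)
 moreover have "(%x y :: 'a vec3. 1 / 2 + ((1 / 2 * x $ (i, 1)) * y $ (i, 1) + ((1 / 2 * x $ (i, 2)) * y $ (i, 2) + (1 / 2 * x $ (i, 3)) * y $ (i, 3))))
 = (%x y. (1 + blk x i \<bullet> blk y i) / 2)"
 by (simp add: fun_eq_iff inner_vec_def sum_3 field_simps)
 ultimately show ?thesis by simp
 qed
 have "kernel_form (%x y :: 'a vec3. PROD i:I. (1 + blk x i \<bullet> blk y i) / 2)" for I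
 proof (induction I rule: infinite_finite_induct)
 case (insert a I)
 then show ?case using kernel_form_mult[OF i[of a] insert.IH] by simp
 qed (simp_all add: kernel_form_const)
 then have k: "kernel_form (kern :: 'a vec3 => _)" unfolding kern_def[abs_def] .
 show ?thesis
 proof (induction n)
 case (Suc n)
 show ?case using kernel_form_mult[OF k Suc] by simp
 qed (simp add: kernel_form_const)
qed

lemma kernel_form_integral:
 assumes "kernel_form F" "continuous_on Mfd ph"
 shows "poly_fun (%x. LINT y|vol_M. ph y * F x y)" and "!!x. continuous_on Mfd (F x)"
 using assms
proof (induction rule: kernel_form.induct)
 case (base p q)
 { case 1
 have "(%x. LINT y|vol_M. ph y * (p x * q y)) = (%x. p x * (LINT y|vol_M. ph y * q y))"
 by (simp add: mult.left_commute[of "ph _"])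
 then show ?case using base by (simp add: real_polynomial_function.intros(2,4))
 next
 case 2 then show ?case by (intro continuous_intros continuous_on_poly_fun base) }
next
 case (plus F G)
 { case 1
 have "(LINT y|vol_M. ph y * (F x y + G x y)) = (LINT y|vol_M. ph y * F x y) + (LINT y|vol_M. ph y * G x y)" for x
 unfolding distrib_left
 by (intro Bochner_Integration.integral_add integrable_continuous_vol_M continuous_intros 1 plus.IH(2,4))
 then show ?case using plus.IH(1,3) 1 by (simp add: real_polynomial_function.intros(3))
 next
 case 2 then show ?case by (intro continuous_intros plus.IH(2,4)) }
qed

lemma kern_block_isometry:
 assumes "block_isometry Q"
 shows "kern (Q x) (Q y) = kern x y"
proof -
 have Q: "linear Q" "!!x i. norm (blk (Q x) i) = norm (blk x i)" using assms by (auto simp: block_isometry_def)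
 have "blk (Q x) i \<bullet> blk (Q y) i = blk x i \<bullet> blk y i" for i
 proof -
 have "blk (Q x) i \<bullet> blk (Q y) i = ((norm (blk (Q (x + y)) i))^2 - (norm (blk (Q x) i))^2 - (norm (blk (Q y) i))^2) / 2"
 by (simp add: linear_add[OF Q(1)] dot_norm)
 also have "... = blk x i \<bullet> blk y i" unfolding Q(2) by (simp add: dot_norm)
 finally show ?thesis .
 qed
 then show ?thesis by (simp add: kern_def)
qed

lemma kern_bounds:
 assumes "x:Mfd" "y:Mfd"
 shows "0 <= kern x y" "kern x y <= 1" "kern x x = 1" "x \<noteq> y ==> kern x y < 1"
proof -
 have n: "norm (blk x i) = 1" "norm (blk y i) = 1" for i using assms by (auto simp: Mfd_def)
 have cs: "\<bar>blk x i \<bullet> blk y i\<bar> <= 1" for i using Cauchy_Schwarz_ineq2[of "blk x i" "blk y i"] n by simp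
 have g: "\<bar>r\<bar> <= 1 ==> 0 <= (1 + r) / 2" "\<bar>r\<bar> <= 1 ==> (1 + r) / 2 <= 1"
 "\<bar>r\<bar> <= 1 ==> r \<noteq> 1 ==> (1 + r) / 2 < 1" for r :: real by auto
 have f1: "0 <= (1 + blk x i \<bullet> blk y i) / 2" for i by (rule g(1)[OF cs])
 have f2: "(1 + blk x i \<bullet> blk y i) / 2 <= 1" for i by (rule g(2)[OF cs])
 note f = f1 f2
 show "0 <= kern x y" unfolding kern_def by (intro prod_nonneg f)
 show "kern x y <= 1" unfolding kern_def by (intro prod_le_1) (use f in simp)
 have "blk x i \<bullet> blk x i = 1" for i using n(1)[of i] by (simp add: norm_eq_1)
 then show "kern x x = 1" unfolding kern_def by simp
 assume "x \<noteq> y"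
 then obtain i where i: "blk x i \<noteq> blk y i" unfolding blk_eq_iff by blast
 have "blk x i \<bullet> blk y i \<noteq> 1"
 proof
 assume "blk x i \<bullet> blk y i = 1"
 then have "(norm (blk x i - blk y i))^2 = 0" using n[of i] by (simp add: power2_norm_eq_inner inner_diff_left inner_diff_right inner_commute norm_eq_1)
 then show False using i by simp
 qed
 then have i1: "(1 + blk x i \<bullet> blk y i) / 2 < 1" by (rule g(3)[OF cs])
 have "kern x y = (1 + blk x i \<bullet> blk y i) / 2 * (PROD j:UNIV - {i}. (1 + blk x j \<bullet> blk y j) / 2)"
 unfolding kern_def by (rule prod.remove) auto
 also have "... <= (1 + blk x i \<bullet> blk y i) / 2 * 1"
 by (intro mult_left_mono prod_le_1 f) (use f in simp)
 finally show "kern x y < 1" using i1 by simp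
qed

lemma continuous_on_kern: "continuous_on S (%(x, y). kern x y)"
 unfolding kern_def case_prod_beta by (intro continuous_intros) auto

section \<open>Mass of the kernel powers and the approximate identity\<close>

lemma transitive_block_isometry:
 assumes "x:Mfd" "y:Mfd"
 obtains Q where "block_isometry Q" "Q x = y"
proof -
 have "EX f. orthogonal_transformation f & f (blk x i) = blk y i" for i
 proof -
 have "norm (blk x i) = norm (blk y i)" using assms by (simp add: Mfd_def)
 then obtain f where "orthogonal_transformation f" "f (blk x i) = blk y i" by (rule orthogonal_transformation_exists)
 then show ?thesis by blast
 qed
 then obtain f where f: "!!i. orthogonal_transformation (f i)" "!!i. f i (blk x i) = blk y i" by metis
 define Q where "Q z = (\<chi> p. f (fst p) (blk z (fst p)) $ snd p)" for z
 have b: "blk (Q z) i = f i (blk z i)" for z i by (simp add: Q_def vec_eq_iff)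
 have l: "linear (f i)" for i using f(1) orthogonal_transformation_linear by blast
 have "linear Q"
 by (rule linearI) (simp_all add: blk_eq_iff b linear_add[OF l] linear_cmul[OF l])
 moreover have "norm (blk (Q z) i) = norm (blk z i)" for z i
 using f(1) by (simp add: b orthogonal_transformation_norm)
 moreover have "Q x = y" unfolding blk_eq_iff b using f(2) by simp
 ultimately have "block_isometry Q" "Q x = y" unfolding block_isometry_def by blast+
 then show ?thesis by (rule that)
qed

text \<open>Mass at an arbitrary base point. By \<open>kern_mass\<close> the choice of the point
  does not matter for powers of \<open>kern\<close>, so normalising a convolution divides by a
  constant and commutes with angular derivatives.\<close>

definition ckern :: "('n::finite vec3 => 'n vec3 => real) => real" where
 "ckern F = (LINT y|vol_M. F (SOME x. x:Mfd) y)"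

lemma continuous_on_kern_right: "continuous_on S (%y. kern x y ^ n)"
 unfolding kern_def by (intro continuous_intros) auto

lemma kern_mass:
 fixes x :: "'a::finite vec3"
 assumes x: "x:Mfd"
 shows "(LINT y|vol_M. kern x y ^ n) = ckern (%x y :: 'a vec3. kern x y ^ n)"
proof -
 have "(SOME x. x:(Mfd :: 'a vec3 set)):Mfd" using Mfd_nonempty some_in_eq by blast
 then obtain Q where Q: "block_isometry Q" "Q (SOME x. x:Mfd) = x" using transitive_block_isometry x by metis
 have "(LINT y|vol_M. kern x y ^ n) = (LINT y|vol_M. kern x (Q y) ^ n)"
 by (rule integral_block_isometry[OF Q(1) continuous_borel_vol_M[OF continuous_on_kern_right], symmetric])
 then show ?thesis unfolding ckern_def Q(2)[symmetric] kern_block_isometry[OF Q(1)] .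
qed

text \<open>Concentration by powers: at distance at least \<open>r\<close> from the diagonal the
  kernel is at most \<open>q < 1\<close> by compactness, while it exceeds some \<open>q' > q\<close>
  on balls of measure at least \<open>v\<close>. The far part of the normalised mass is thus of
  order \<open>(q / q') ^ n\<close>.\<close>

lemma kern_approx_identity:
 fixes ph :: "'n::finite vec3 => real"
 assumes ph: "continuous_on Mfd ph" and eps: "eps > 0"
 shows "EX N. ALL n>=N. 0 < ckern (%x y :: 'n vec3. kern x y ^ n) &
 (ALL x:Mfd. \<bar>(LINT y|vol_M. ph y * kern x y ^ n) / ckern (%x y :: 'n vec3. kern x y ^ n) - ph x\<bar> <= eps)"
proof -
 obtain P where P: "P >= 0" "!!x. x:Mfd ==> norm (ph x) <= P" using bounded_on_Mfd[OF ph] by blast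
 have "uniformly_continuous_on Mfd ph" using compact_uniformly_continuous[OF ph compact_Mfd] .
 from this[unfolded uniformly_continuous_on_def, rule_format, of "eps / 2"] eps
 obtain r where r: "r > 0" "ALL x:Mfd. ALL y:Mfd. dist y x < r --> dist (ph y) (ph x) < eps / 2" by auto
 define K0 where "K0 = (Mfd \<times> Mfd) \<inter> {p :: 'n vec3 \<times> 'n vec3. r <= dist (fst p) (snd p)}"
 have "closed {p :: 'n vec3 \<times> 'n vec3. r <= dist (fst p) (snd p)}"
 by (intro closed_Collect_le continuous_intros)
 then have K0: "compact K0" unfolding K0_def by (intro compact_Int_closed compact_Times compact_Mfd)
 have "EX q. 0 <= q & q < 1 & (ALL p:K0. kern (fst p) (snd p) <= q)"
 proof (cases "K0 = {}")
 case False
 have "continuous_on K0 (%p. kern (fst p) (snd p))" using continuous_on_kern[of K0] by (simp add: case_prod_beta)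
 from continuous_attains_sup[OF K0 False this] obtain p where p: "p:K0" "ALL y:K0. kern (fst y) (snd y) <= kern (fst p) (snd p)" by blast
 have pp: "fst p:Mfd" "snd p:Mfd" "fst p \<noteq> snd p" using p(1) r(1) by (auto simp: K0_def)
 show ?thesis using kern_bounds(1,4)[OF pp(1,2)] pp(3) p(2) by blast
 qed (auto intro: exI[of _ 0])
 then obtain q where q: "0 <= q" "q < 1" "ALL p:K0. kern (fst p) (snd p) <= q" by blast
 define q' where "q' = (1 + q) / 2"
 have q': "q < q'" "q' < 1" "0 < q'" using q by (auto simp: q'_def)
 have "uniformly_continuous_on (Mfd \<times> Mfd) (%(x, y :: 'n vec3). kern x y)"
 by (rule compact_uniformly_continuous[OF continuous_on_kern compact_Times[OF compact_Mfd compact_Mfd]])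
 from this[unfolded uniformly_continuous_on_def, rule_format, of "1 - q'"] q'
 obtain r' where r': "r' > 0" "ALL p:Mfd \<times> Mfd. ALL p':Mfd \<times> Mfd. dist p' p < r' --> dist (kern (fst p') (snd p')) (kern (fst p) (snd p :: 'n vec3)) < 1 - q'"
 by (auto simp: case_prod_beta)
 obtain v where v: "v > 0" "!!x :: 'n vec3. x:Mfd ==> v <= measure vol_M {y:Mfd. dist y x < r'}"
 by (rule vol_M_ball_lower_bound[OF r'(1)]) (rule that; assumption)
 let ?c = "%n. ckern (%x y :: 'n vec3. kern x y ^ n)"
 define V where "V = measure (vol_M :: 'n vec3 measure) Mfd"
 have kc: "continuous_on Mfd (%y. kern x y ^ n)" for x :: "'n vec3" and n by (rule continuous_on_kern_right)
 have c_low: "q' ^ n * v <= ?c n" for n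
 proof -
 obtain x :: "'n vec3" where x: "x:Mfd" using Mfd_nonempty by blast
 let ?A = "{y:Mfd. dist y x < r'}"
 have A: "?A:sets vol_M"
 proof -
 have "?A = Mfd \<inter> ball x r'" by (auto simp: dist_commute)
 then show ?thesis by (simp add: sets_vol_M sets_restrict_space)
 qed
 have "(LINT y|vol_M. q' ^ n * indicator ?A y) <= (LINT y|vol_M. kern x y ^ n)"
 proof (rule integral_mono)
 show "integrable vol_M (%y. q' ^ n * indicator ?A y :: real)"
 using A finite_measure.emeasure_finite[OF finite_measure_vol_M, of ?A]
 by (intro integrable_mult_right integrable_real_indicator) (auto simp: less_top)
 show "q' ^ n * indicator ?A y <= kern x y ^ n" if "y:space vol_M" for y
 proof (cases "y:?A")
 case True
 have "dist (x, y) (x, x) < r'" using True by (simp add: dist_Pair_Pair)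
 then have "dist (kern x y) (kern x x) < 1 - q'" using r'(2)[rule_format, of "(x, x)" "(x, y)"] x True by simp
 then have "q' <= kern x y" using kern_bounds(3)[OF x x] by (simp add: dist_real_def)
 then have "q' ^ n <= kern x y ^ n" using q' by (intro power_mono) auto
 then show ?thesis using True by simp
 next
 case False
 then show ?thesis using kern_bounds(1)[OF x, of y] that by simp
 qed
 qed (rule integrable_continuous_vol_M[OF kc])
 moreover have "(LINT y|vol_M. q' ^ n * indicator ?A y) = q' ^ n * measure vol_M ?A"
 using A by (simp add: Int_absorb2 sets.sets_into_space)
 moreover have "q' ^ n * v <= q' ^ n * measure vol_M ?A" using v(2)[OF x] q' by (intro mult_left_mono) auto
 ultimately show ?thesis using kern_mass[OF x, of n] by linarith
 qed
 have c_pos: "0 < ?c n" for n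
 proof -
 have "0 < q' ^ n * v" using q' v by simp
 then show ?thesis using c_low[of n] by linarith
 qed
 have "(%n. (q / q') ^ n) \<longlonglongrightarrow> 0" using q q' by (intro LIMSEQ_power_zero) simp
 then have "(%n. 2 * P * V / v * (q / q') ^ n) \<longlonglongrightarrow> 0" by (rule tendsto_mult_right_zero)
 then have "eventually (%n. 2 * P * V / v * (q / q') ^ n < eps / 2) sequentially" by (rule order_tendstoD) (use eps in simp)
 then obtain N where N: "!!n. n >= N ==> 2 * P * V / v * (q / q') ^ n < eps / 2" by (auto simp: eventually_sequentially)
 have "\<bar>(LINT y|vol_M. ph y * kern x y ^ n) / ?c n - ph x\<bar> <= eps" if n: "n >= N" and x: "x:Mfd" for n and x :: "'n vec3"
 proof -
 have i1: "integrable vol_M (%y. ph y * kern x y ^ n)" "integrable vol_M (%y. ph x * kern x y ^ n)"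
 "integrable vol_M (%y. kern x y ^ n)" "integrable vol_M (%y. (ph y - ph x) * kern x y ^ n)"
 by (intro integrable_continuous_vol_M continuous_intros kc ph)+
 have "(LINT y|vol_M. (ph y - ph x) * kern x y ^ n) = (LINT y|vol_M. ph y * kern x y ^ n) - ph x * ?c n"
 unfolding left_diff_distrib kern_mass[OF x, symmetric] using i1 by simp
 then have "(LINT y|vol_M. ph y * kern x y ^ n) / ?c n - ph x = (LINT y|vol_M. (ph y - ph x) * kern x y ^ n) / ?c n"
 using c_pos[of n] by (simp add: field_simps)
 moreover have "\<bar>LINT y|vol_M. (ph y - ph x) * kern x y ^ n\<bar> <= (LINT y|vol_M. eps / 2 * kern x y ^ n + 2 * P * q ^ n)"
 proof (rule order_trans[OF integral_abs_bound], rule integral_mono)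
 show "integrable vol_M (%y. \<bar>(ph y - ph x) * kern x y ^ n\<bar>)" using i1(4) by (rule integrable_abs)
 show "integrable vol_M (%y. eps / 2 * kern x y ^ n + 2 * P * q ^ n)"
 by (intro integrable_continuous_vol_M continuous_intros kc)
 fix y assume "y:space (vol_M :: 'n vec3 measure)"
 then have y: "y:Mfd" by simp
 have k0: "0 <= kern x y ^ n" using kern_bounds(1)[OF x y] by simp
 show "\<bar>(ph y - ph x) * kern x y ^ n\<bar> <= eps / 2 * kern x y ^ n + 2 * P * q ^ n"
 proof (cases "dist y x < r")
 case True
 then have "\<bar>ph y - ph x\<bar> <= eps / 2" using r(2) x y by (simp add: dist_real_def less_imp_le)
 then have "\<bar>ph y - ph x\<bar> * kern x y ^ n <= eps / 2 * kern x y ^ n" using k0 by (rule mult_right_mono)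
 moreover have "0 <= 2 * P * q ^ n" using P q by simp
 ultimately show ?thesis using k0 by (simp add: abs_mult)
 next
 case False
 then have "(x, y):K0" using x y by (simp add: K0_def dist_commute)
 then have "kern x y <= q" using q(3) by fastforce
 then have "kern x y ^ n <= q ^ n" using kern_bounds(1)[OF x y] by (intro power_mono) auto
 moreover have "\<bar>ph y - ph x\<bar> <= 2 * P" using P(2)[OF x] P(2)[OF y] by (simp add: abs_le_iff)
 ultimately have "\<bar>ph y - ph x\<bar> * kern x y ^ n <= 2 * P * q ^ n" using k0 P by (intro mult_mono) auto
 moreover have "0 <= eps / 2 * kern x y ^ n" using eps k0 by simp
 ultimately show ?thesis using k0 by (simp add: abs_mult)
 qed
 qed
 moreover have "(LINT y|vol_M. eps / 2 * kern x y ^ n + 2 * P * q ^ n) = eps / 2 * ?c n + 2 * P * q ^ n * V"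
 proof -
 have "(LINT y|vol_M. eps / 2 * kern x y ^ n + 2 * P * q ^ n) = (LINT y|vol_M. eps / 2 * kern x y ^ n) + (LINT y|(vol_M :: 'n vec3 measure). 2 * P * q ^ n)"
 by (intro Bochner_Integration.integral_add integrable_continuous_vol_M continuous_intros kc)
 then show ?thesis by (simp add: kern_mass[OF x] V_def)
 qed
 moreover have "2 * P * q ^ n * V <= eps / 2 * ?c n"
 proof -
 have "2 * P * q ^ n * V = 2 * P * V / v * (q / q') ^ n * (q' ^ n * v)" using v q' by (simp add: power_divide)
 also have "... <= eps / 2 * (q' ^ n * v)" using N[OF n] q' v by (intro mult_right_mono) auto
 also have "... <= eps / 2 * ?c n" using c_low[of n] eps by (intro mult_left_mono) auto
 finally show ?thesis .
 qed
 ultimately have a: "\<bar>LINT y|vol_M. (ph y - ph x) * kern x y ^ n\<bar> <= eps * ?c n"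
 and b: "(LINT y|vol_M. ph y * kern x y ^ n) / ?c n - ph x = (LINT y|vol_M. (ph y - ph x) * kern x y ^ n) / ?c n" by linarith+
 show ?thesis unfolding b using a c_pos[of n] by (simp add: divide_le_eq)
 qed
 then show ?thesis using c_pos by blast
qed

text \<open>Kernel and measure are invariant, so rotating \<open>x\<close> in the convolution is the
  same as rotating the argument of \<open>f\<close>; the difference quotient moves under the
  integral onto \<open>f\<close>.\<close>

lemma Rd_kern_integral:
 fixes f :: "'n::finite vec3 => real"
 assumes f: "rot_derivative a f f'" and x: "x:Mfd"
 shows "Rd (axis a 1) (%x. LINT y|vol_M. f y * kern x y ^ n) x = (LINT y|vol_M. f' y * kern x y ^ n)"
proof -
 have fc: "continuous_on Mfd f" using f by (simp add: rot_derivative_def)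
 let ?F = "%x. LINT y|vol_M. f y * kern x y ^ n"
 have p: "poly_fun ?F" by (rule kernel_form_integral(1)[OF kernel_form_kern fc])
 have shift: "?F (rot a s x) = (LINT y|vol_M. f (rot a s y) * kern x y ^ n)" for s
 proof -
 have "(LINT y|vol_M. f (rot a s y) * kern (rot a s x) (rot a s y) ^ n) = ?F (rot a s x)"
 by (rule integral_block_isometry[OF block_isometry_rot])
 (intro continuous_borel_vol_M continuous_intros fc continuous_on_kern_right)
 then show ?thesis unfolding kern_block_isometry[OF block_isometry_rot] by simp
 qed
 have "((%s. ?F (rot a s x)) has_real_derivative Rd (axis a 1) ?F x) (at 0)"
 using has_real_derivative_rot[OF p, of a x 0] by simp
 then have "((%s. (?F (rot a s x) - ?F x) / s) \<longlongrightarrow> Rd (axis a 1) ?F x) (at 0)" by (simp add: has_field_derivative_iff)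
 moreover have "filterlim (%n. inverse (real (Suc n))) (at 0) sequentially"
 unfolding filterlim_at using LIMSEQ_inverse_real_of_nat by simp
 ultimately have 1: "(%j. (?F (rot a (inverse (real (Suc j))) x) - ?F x) / inverse (real (Suc j))) \<longlonglongrightarrow> Rd (axis a 1) ?F x"
 by (rule filterlim_compose)
 have "(?F (rot a s x) - ?F x) / s = (LINT y|vol_M. (f (rot a s y) - f y) / s * kern x y ^ n)" for s
 proof -
 have "(LINT y|vol_M. f (rot a s y) * kern x y ^ n - f y * kern x y ^ n) = ?F (rot a s x) - ?F x"
 unfolding shift
 by (intro Bochner_Integration.integral_diff integrable_continuous_vol_M continuous_intros fc continuous_on_Mfd_rot continuous_on_kern_right)
 then have "(?F (rot a s x) - ?F x) / s = (LINT y|vol_M. (f (rot a s y) * kern x y ^ n - f y * kern x y ^ n) / s)" by simp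
 then show ?thesis by (simp add: left_diff_distrib diff_divide_distrib)
 qed
 with 1 have "(%j. LINT y|vol_M. (f (rot a (inverse (real (Suc j))) y) - f y) / inverse (real (Suc j)) * kern x y ^ n) \<longlonglongrightarrow> Rd (axis a 1) ?F x"
 by (simp only:)
 then show ?thesis using integral_rot_quotient[OF f continuous_on_kern_right[of Mfd x n]] LIMSEQ_unique by blast
qed

text \<open>At a point of \<open>Mfd\<close> the derivative sees only the orbit, which stays in
  \<open>Mfd\<close>. This permits differentiating identities that hold on \<open>Mfd\<close> but
  not in the ambient space.\<close>

lemma Rd_cong_Mfd:
 assumes "poly_fun f" "poly_fun g" "!!x. x:Mfd ==> f x = g x" "x:Mfd"
 shows "Rd (axis a 1) f x = Rd (axis a 1) g x"
proof -
 have "(%s. f (rot a s x)) = (%s. g (rot a s x))" using assms(3,4) by simp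
 then show ?thesis
 using DERIV_unique[OF has_real_derivative_rot[OF assms(1), of a x 0]] has_real_derivative_rot[OF assms(2), of a x 0] by simp
qed

text \<open>All components of the jet are convolved with the same power of the kernel; by
  \<open>Rd_kern_integral\<close> the results form, on \<open>Mfd\<close>, the jet of one
  polynomial.\<close>

theorem jet_approx_C2:
 fixes G :: "('n \<times> 3) list => 'n::finite vec3 => real"
 assumes G: "!!as a. length as <= 1 ==> rot_derivative a (G as) (G (as @ [a]))"
 shows "jet_approx G"
 unfolding jet_approx_def
proof (intro allI impI)
 fix eps :: real assume eps: "eps > 0"
 have c: "continuous_on Mfd (G as)" if as: "length as <= 2" for as
 using as
 proof (cases rule: length_le_2_cases)
 case 1 then show ?thesis using G[of "[]" undefined] by (simp add: rot_derivative_def)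
 next
 case (2 a) then show ?thesis using G[of "[]" a] by (simp add: rot_derivative_def)
 next
 case (3 a b) then show ?thesis using G[of "[a]" b] by (simp add: rot_derivative_def)
 qed
 let ?c = "%n. ckern (%x y :: 'n vec3. kern x y ^ n)"
 have "EX N. ALL as. length as <= 2 --> (ALL n>=N as. ALL x:Mfd. \<bar>(LINT y|vol_M. G as y * kern x y ^ n) / ?c n - G as x\<bar> <= eps / 2)"
 proof (intro choice allI)
 fix as :: "('n \<times> 3) list"
 have "eps / 2 > 0" using eps by simp
 then show "EX N. length as <= 2 --> (ALL n>=N. ALL x:Mfd. \<bar>(LINT y|vol_M. G as y * kern x y ^ n) / ?c n - G as x\<bar> <= eps / 2)"
 using kern_approx_identity[OF c, of as "eps / 2"] by blast
 qed
 then obtain N where N: "!!as n x. length as <= 2 ==> n >= N as ==> x:Mfd ==> \<bar>(LINT y|vol_M. G as y * kern x y ^ n) / ?c n - G as x\<bar> <= eps / 2"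
 by blast
 have fin: "finite {as :: ('n \<times> 3) list. length as <= 2}"
 using finite_lists_length_le[of "UNIV :: ('n \<times> 3) set" 2] by simp
 \<comment> \<open>There are finitely many words of length at most 2, so one exponent serves them
   all.\<close>
 define n where "n = Max (N ` {as. length as <= 2})"
 have n: "N as <= n" if "length as <= 2" for as unfolding n_def using fin that by (intro Max_ge) auto
 define F where "F as = (%x. 1 / ?c n * (LINT y|vol_M. G as y * kern x y ^ n))" for as
 have pF: "poly_fun (F as)" if "length as <= 2" for as
 unfolding F_def by (intro poly_fun_scale kernel_form_integral(1)[OF kernel_form_kern c[OF that]])
 have RF: "Rd (axis a 1) (F as) x = F (as @ [a]) x" if "length as <= 1" "x:Mfd" for as a x
 proof -
 have "poly_fun (%x. LINT y|vol_M. G as y * kern x y ^ n)"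
 by (rule kernel_form_integral(1)[OF kernel_form_kern c]) (use that in simp)
 from Rd_scale[OF this] show ?thesis unfolding F_def by (simp only: Rd_kern_integral[OF G[OF that(1)] that(2)])
 qed
 have "\<bar>Rb as (F []) x - G as x\<bar> < eps" if as: "length as <= 2" and x: "x:Mfd" for as x
 proof -
 have "Rb as (F []) x = F as x"
 using as
 proof (cases rule: length_le_2_cases)
 case (2 a) then show ?thesis using RF[of "[]" x a] x by simp
 next
 case (3 a b)
 have "Rd (axis b 1) (Rd (axis a 1) (F [])) x = Rd (axis b 1) (F [a]) x"
 by (rule Rd_cong_Mfd[OF poly_fun_Rd[OF pF] pF _ x]) (use RF[of "[]" _ a] in auto)
 then show ?thesis using RF[of "[a]" x b] x 3 by simp
 qed simp
 then show ?thesis using N[OF as n[OF as] x] eps by (simp add: F_def)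
 qed
 then show "EX p. poly_fun p & (ALL as x. length as <= 2 & x:Mfd --> \<bar>Rb as p x - G as x\<bar> < eps)"
 using pF[of "[]"] by (intro exI[of _ "F []"]) auto
qed

section \<open>Weak gradients and Bochner spaces\<close>

lemma small_imp_zero:
 fixes x L :: real
 assumes "!!eps. eps > 0 ==> \<bar>x\<bar> <= eps * L" "L >= 0"
 shows "x = 0"
proof (rule ccontr)
 assume x: "x \<noteq> 0"
 have "\<bar>x\<bar> <= \<bar>x\<bar> / (L + 1) * L" by (rule assms(1)) (use x assms(2) in simp)
 then have "\<bar>x\<bar> * (L + 1) <= \<bar>x\<bar> * L" using assms(2) by (simp add: field_simps)
 with x show False by (simp add: algebra_simps)
qed

lemma borel_vol_M: "f:borel_measurable borel ==> f:borel_measurable vol_M"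
 by (simp add: measurable_cong_sets[OF sets_vol_M refl] measurable_restrict_space1)

lemma integrable_mult_continuous:
 fixes f ph :: "'n::finite vec3 => real"
 assumes f: "integrable vol_M f" and ph: "continuous_on Mfd ph"
 shows "integrable vol_M (%x. ph x * f x)"
proof -
 obtain K where K: "K >= 0" "!!x. x:Mfd ==> norm (ph x) <= K" using bounded_on_Mfd[OF ph] by blast
 show ?thesis
 proof (rule Bochner_Integration.integrable_bound)
 show "integrable vol_M (%x. K * \<bar>f x\<bar>)" using f by simp
 show "(%x. ph x * f x):borel_measurable vol_M"
 by (rule borel_measurable_times[OF continuous_borel_vol_M[OF ph] borel_measurable_integrable[OF f]])
 show "AE x in vol_M. norm (ph x * f x) <= norm (K * \<bar>f x\<bar>)"
 using K by (auto simp: abs_mult intro!: AE_I2 mult_right_mono)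
 qed
qed

lemma integral_continuous_zero:
 fixes f ph :: "'n::finite vec3 => real"
 assumes f: "integrable vol_M f" and z: "!!p. poly_fun p ==> (LINT x|vol_M. p x * f x) = 0"
 and ph: "continuous_on Mfd ph"
 shows "(LINT x|vol_M. ph x * f x) = 0"
proof (rule small_imp_zero)
 show "0 <= (LINT x|vol_M. \<bar>f x\<bar>)" by simp
 fix eps :: real assume "eps > 0"
 from kern_approx_identity[OF ph this] obtain N where N:
 "ALL x:Mfd. \<bar>(LINT y|vol_M. ph y * kern x y ^ N) / ckern (%x y :: 'n vec3. kern x y ^ N) - ph x\<bar> <= eps"
 by blast
 define p where "p = (%x. (1 / ckern (%x y :: 'n vec3. kern x y ^ N)) * (LINT y|vol_M. ph y * kern x y ^ N))"
 have p: "poly_fun p" unfolding p_def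
 by (rule poly_fun_scale, rule kernel_form_integral(1)[OF kernel_form_kern ph])
 have pc: "continuous_on Mfd p" by (rule continuous_on_poly_fun[OF p])
 have d: "\<bar>ph x - p x\<bar> <= eps" if "x:Mfd" for x using N that by (auto simp: p_def abs_minus_commute)
 have "(LINT x|vol_M. ph x * f x) = (LINT x|vol_M. ph x * f x) - (LINT x|vol_M. p x * f x)" using z[OF p] by simp
 also have "... = (LINT x|vol_M. (ph x - p x) * f x)"
 unfolding left_diff_distrib
 by (rule Bochner_Integration.integral_diff[symmetric]; rule integrable_mult_continuous[OF f]; fact)
 finally have eq: "(LINT x|vol_M. ph x * f x) = (LINT x|vol_M. (ph x - p x) * f x)" .
 have "\<bar>(LINT x|vol_M. (ph x - p x) * f x)\<bar> <= (LINT x|vol_M. \<bar>(ph x - p x) * f x\<bar>)"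
 using integral_norm_bound[of vol_M "%x. (ph x - p x) * f x"] by simp
 also have "... <= (LINT x|vol_M. eps * \<bar>f x\<bar>)"
 by (rule integral_mono)
 (use f d in \<open>auto intro!: integrable_mult_continuous integrable_abs continuous_intros ph pc mult_right_mono simp: abs_mult\<close>)
 finally show "\<bar>LINT x|vol_M. ph x * f x\<bar> <= eps * (LINT x|vol_M. \<bar>f x\<bar>)" by (simp add: eq)
qed

text \<open>Uniform approximation passes from polynomials to continuous functions, cut-offs of the
  distance pass to closed sets, and a Dynkin class argument passes to Borel sets; a density whose
  integral over every set is zero vanishes almost everywhere.\<close>

lemma L1_orthogonal_zero:
 fixes f :: "'n::finite vec3 => real"
 assumes f: "integrable vol_M f" and z: "!!p. poly_fun p ==> (LINT x|vol_M. p x * f x) = 0"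
 shows "AE x in vol_M. f x = 0"
proof (rule sigma_finite_measure.density_zero[OF finite_measure.axioms(1)[OF finite_measure_vol_M] f])
 have cz: "(LINT x|vol_M. ph x * f x) = 0" if "continuous_on Mfd ph" for ph
 by (rule integral_continuous_zero[OF f z that])
 have im: "(%x. indicator A x :: real):borel_measurable vol_M" if "A:sets (borel :: 'n vec3 measure)" for A
 using that by (intro borel_vol_M borel_measurable_indicator)
 have fm: "f:borel_measurable vol_M" using f by (rule borel_measurable_integrable)
 have ii: "integrable vol_M (%x. indicator A x * f x)" if "A:sets (borel :: 'n vec3 measure)" for A
 by (rule Bochner_Integration.integrable_bound[OF f borel_measurable_times[OF im[OF that] fm]])
 (auto simp: indicator_def)
 have ss: "A:sigma_sets UNIV (Collect closed) \<longleftrightarrow> A:sets borel" for A :: "'n vec3 set"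
 by (simp add: borel_eq_closed)
 have IS: "Int_stable (Collect closed :: 'n vec3 set set)" by (auto simp: Int_stable_def)
 have PW: "(Collect closed :: 'n vec3 set set) \<subseteq> Pow UNIV" by simp
 have P: "(LINT x|vol_M. indicator A x * f x) = 0" if A: "A:sigma_sets UNIV (Collect closed)" for A :: "'n vec3 set"
 using IS PW A
 proof (induction A rule: sigma_sets_induct_disjoint)
 case (basic A)
 then have cl: "closed A" by simp
 show ?case
 proof (cases "A = {}")
 case False
 \<comment> \<open>These continuous cut-offs decrease to the indicator of the closed set
   \<open>A\<close>.\<close>
 have c: "continuous_on Mfd (%x. max 0 (1 - real n * infdist x A))" for n
 by (intro continuous_intros)
 have "(%n. LINT x|vol_M. max 0 (1 - real n * infdist x A) * f x) \<longlonglongrightarrow> (LINT x|vol_M. indicator A x * f x)"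
 proof (rule integral_dominated_convergence[where w = "%x. \<bar>f x\<bar>"])
 show "(%x. indicator A x * f x):borel_measurable vol_M"
 by (rule borel_measurable_times[OF im fm]) (use cl in simp)
 show "(%x. max 0 (1 - real n * infdist x A) * f x):borel_measurable vol_M" for n
 by (rule borel_measurable_times[OF continuous_borel_vol_M[OF c] fm])
 show "integrable vol_M (%x. \<bar>f x\<bar>)" using f by simp
 show "AE x in vol_M. norm (max 0 (1 - real n * infdist x A) * f x) <= \<bar>f x\<bar>" for n
 proof (rule AE_I2)
 fix x
 have "\<bar>max 0 (1 - real n * infdist x A)\<bar> <= 1" using infdist_nonneg[of x A] by (auto simp: max_def)
 then show "norm (max 0 (1 - real n * infdist x A) * f x) <= \<bar>f x\<bar>"
 unfolding real_norm_def abs_mult by (rule mult_left_le_one_le[rotated 2]) auto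
 qed
 show "AE x in vol_M. (%n. max 0 (1 - real n * infdist x A) * f x) \<longlonglongrightarrow> indicator A x * f x"
 proof (rule AE_I2, rule tendsto_mult_right)
 fix x
 show "(%n. max 0 (1 - real n * infdist x A)) \<longlonglongrightarrow> indicator A x"
 proof (cases "x:A")
 case xA: False
 then have d: "infdist x A > 0" using cl False by (simp add: infdist_pos_not_in_closed)
 obtain N where N: "real N >= 1 / infdist x A" using real_arch_simple by blast
 have "max 0 (1 - real n * infdist x A) = 0" if "n >= N" for n
 proof -
 have "real n >= 1 / infdist x A" using N that by linarith
 then show ?thesis using d by (simp add: field_simps)
 qed
 then have "\<forall>\<^sub>F n in sequentially. max 0 (1 - real n * infdist x A) = indicator A x"
 using xA unfolding eventually_sequentially by auto
 then show ?thesis by (rule tendsto_eventually)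
 qed simp
 qed
 qed
 then show ?thesis unfolding cz[OF c] by (simp add: LIMSEQ_const_iff)
 qed simp
 next
 case (compl A)
 have "(LINT x|vol_M. indicator (UNIV - A) x * f x) = (LINT x|vol_M. f x - indicator A x * f x)"
 by (rule Bochner_Integration.integral_cong) (auto simp: indicator_def)
 also have "... = (LINT x|vol_M. f x) - (LINT x|vol_M. indicator A x * f x)"
 by (rule Bochner_Integration.integral_diff[OF f ii]) (use compl ss in auto)
 finally show ?case using compl cz[of "%_. 1"] by simp
 next
 case (union A)
 have Am: "A i:sets borel" for i using union(2) ss by blast
 have "(%k. LINT x|vol_M. indicator (\<Union>i<k. A i) x * f x) \<longlonglongrightarrow> (LINT x|vol_M. indicator (\<Union>i. A i) x * f x)"
 proof (rule integral_dominated_convergence[where w = "%x. \<bar>f x\<bar>"])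
 show "(%x. indicator (\<Union>i. A i) x * f x):borel_measurable vol_M"
 by (rule borel_measurable_times[OF im fm]) (use Am in blast)
 show "(%x. indicator (\<Union>i<k. A i) x * f x):borel_measurable vol_M" for k
 by (rule borel_measurable_times[OF im fm]) (use Am in blast)
 show "integrable vol_M (%x. \<bar>f x\<bar>)" using f by simp
 show "AE x in vol_M. norm (indicator (\<Union>i<k. A i) x * f x) <= \<bar>f x\<bar>" for k
 by (rule AE_I2) (simp add: indicator_def)
 show "AE x in vol_M. (%k. indicator (\<Union>i<k. A i) x * f x) \<longlonglongrightarrow> indicator (\<Union>i. A i) x * f x"
 by (rule AE_I2, rule tendsto_mult_right, rule LIMSEQ_indicator_UN)
 qed
 moreover have "(LINT x|vol_M. indicator (\<Union>i<k. A i) x * f x) = 0" for k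
 proof -
 have "(LINT x|vol_M. indicator (\<Union>i<k. A i) x * f x) = (LINT x|vol_M. (SUM i<k. indicator (A i) x * f x))"
 by (rule Bochner_Integration.integral_cong[OF refl])
 (simp add: indicator_UN_disjoint disjoint_family_on_mono[OF _ union(1)] sum_distrib_right)
 also have "... = (SUM i<k. LINT x|vol_M. indicator (A i) x * f x)"
 by (rule Bochner_Integration.integral_sum) (use ii Am in auto)
 finally show ?thesis using union(3) by simp
 qed
 ultimately show ?case by (simp add: LIMSEQ_const_iff)
 qed auto
 fix A assume "A:sets (vol_M :: 'n vec3 measure)"
 then obtain B where B: "B:sets borel" "A = Mfd \<inter> B" by (auto simp: sets_vol_M sets_restrict_space)
 have "set_lebesgue_integral vol_M A f = (LINT x|vol_M. indicator B x * f x)"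
 unfolding set_lebesgue_integral_def by (rule Bochner_Integration.integral_cong) (auto simp: B indicator_def)
 then show "set_lebesgue_integral vol_M A f = 0" using P[of B] B ss by simp
qed

section \<open>Polynomial test fields and uniqueness of weak gradients\<close>

lemma C1_MI:
 fixes X :: "'n::finite vec3 => 'b::euclidean_space"
 assumes X: "!!m. m:Mfd ==> (X has_derivative H m) (at m within Mfd)"
 and H: "!!e. continuous_on Mfd (%m. H m e)"
 shows "C1_M X"
proof -
 have bl: "blinfun_apply (Blinfun (H m)) = H m" if "m:Mfd" for m
 using bounded_linear_Blinfun_apply has_derivative_bounded_linear[OF X[OF that]] by blast
 have "continuous_on Mfd (%m. Blinfun (H m))"
 proof (rule continuous_on_blinfun_componentwise)
 fix e show "continuous_on Mfd (%x. blinfun_apply (Blinfun (H x)) e)"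
 using H[of e] by (rule continuous_on_eq) (auto simp: bl)
 qed
 then show ?thesis unfolding C1_M_def
 by (intro exI[of _ "%m. Blinfun (H m)"]) (auto simp: bl X)
qed

lemma poly_fun_frechet_derivative: "poly_fun f ==> poly_fun (%x. frechet_derivative f (at x) e)"
proof (induction f rule: real_polynomial_function.induct)
 case (linear f)
 have "frechet_derivative f (at x) = f" for x
 using frechet_derivative_at[OF bounded_linear_imp_has_derivative[OF linear]] by simp
 then show ?case by (simp add: real_polynomial_function.intros(2))
next
 case (const c)
 have "frechet_derivative (%x. c) (at x) = (%_. 0)" for x :: 'a
 using frechet_derivative_at[OF has_derivative_const] by metis
 then show ?case by (simp add: real_polynomial_function.intros(2))
next
 case (add f g)
 have "frechet_derivative (%x. f x + g x) (at x) e = frechet_derivative f (at x) e + frechet_derivative g (at x) e" for x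
 using frechet_derivative_at[OF has_derivative_add[OF poly_fun_differentiable[OF add.hyps(1)] poly_fun_differentiable[OF add.hyps(2)]], of x]
 by metis
 then show ?case by (simp add: real_polynomial_function.intros(3)[OF add.IH])
next
 case (mult f g)
 have "frechet_derivative (%x. f x * g x) (at x) e = f x * frechet_derivative g (at x) e + frechet_derivative f (at x) e * g x" for x
 using frechet_derivative_at[OF has_derivative_mult[OF poly_fun_differentiable[OF mult.hyps(1)] poly_fun_differentiable[OF mult.hyps(2)]], of x]
 by metis
 then show ?case
 by (simp only:) (rule real_polynomial_function.intros(3)[OF real_polynomial_function.intros(4)[OF mult.hyps(1) mult.IH(2)]
 real_polynomial_function.intros(4)[OF mult.IH(1) mult.hyps(2)]])
qed

lemma poly_xi_field:
 fixes p :: "'n::finite vec3 => real"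
 assumes p: "poly_fun p"
 shows "C1_M (%x. p x *\<^sub>R xi a x)"
proof (rule C1_MI)
 fix m :: "'n vec3"
 show "((%x. p x *\<^sub>R xi a x) has_derivative (%v. p m *\<^sub>R xi a v + frechet_derivative p (at m) v *\<^sub>R xi a m)) (at m within Mfd)"
 by (rule has_derivative_scaleR[OF poly_fun_differentiable[OF p] bounded_linear_imp_has_derivative[OF bounded_linear_xi]])
next
 fix e show "continuous_on Mfd (%m. p m *\<^sub>R xi a e + frechet_derivative p (at m) e *\<^sub>R xi a m)"
 by (intro continuous_intros continuous_on_poly_fun p poly_fun_frechet_derivative linear_continuous_on bounded_linear_xi)
qed

lemma integrable_L2_product:
 fixes f g :: "'a => 'b::euclidean_space"
 assumes "f:borel_measurable M" "g:borel_measurable M"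
 and "integrable M (%x. (norm (f x))^2)" "integrable M (%x. (norm (g x))^2)"
 shows "integrable M (%x. f x \<bullet> g x)"
proof (rule Bochner_Integration.integrable_bound)
 show "integrable M (%x. (norm (f x))^2 + (norm (g x))^2)" using assms by simp
 show "(%x. f x \<bullet> g x):borel_measurable M" using assms by simp
 show "AE x in M. norm (f x \<bullet> g x) <= norm ((norm (f x))^2 + (norm (g x))^2)"
 proof (rule AE_I2)
 fix x
 have "norm (f x \<bullet> g x) <= norm (f x) * norm (g x)" by (simp add: Cauchy_Schwarz_ineq2)
 also have "... <= (norm (f x))^2 + (norm (g x))^2"
 proof -
 have "0 <= (norm (f x) - norm (g x))^2" by simp
 moreover have "0 <= norm (f x) * norm (g x)" by simp
 ultimately show ?thesis unfolding power2_diff by linarith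
 qed
 finally show "norm (f x \<bullet> g x) <= norm ((norm (f x))^2 + (norm (g x))^2)" by simp
 qed
qed

lemma L2_M_D:
 assumes "f:L2_M"
 shows "f:borel_measurable vol_M" "integrable vol_M (%m. (f m)^2)" "integrable vol_M f"
proof -
 show m: "f:borel_measurable vol_M" and i: "integrable vol_M (%m. (f m)^2)" using assms by (auto simp: L2_M_def)
 have "integrable vol_M (%m. f m \<bullet> 1)"
 by (rule integrable_L2_product) (use m i in \<open>auto intro: integrable_continuous_vol_M\<close>)
 then show "integrable vol_M f" by simp
qed

lemma continuous_L2_M: "continuous_on Mfd f ==> f:L2_M"
 by (auto simp: L2_M_def intro!: continuous_borel_vol_M integrable_continuous_vol_M continuous_intros)

text \<open>A weak form of the Cauchy-Schwarz inequality that only needs \<open>\<bar>f et\<bar> \<le> f\<^sup>2 / (2N) + N et\<^sup>2 / 2\<close>.\<close>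

lemma L2_pairing_bound:
 assumes f: "f:L2_M" and et: "et:L2_M"
 shows "\<bar>LINT m|vol_M. f m * et m\<bar> <= L2_norm f * (1 + (LINT m|vol_M. (et m)^2)) / 2"
proof -
 define N where "N = L2_norm f"
 have N0: "N >= 0" by (simp add: N_def L2_norm_def)
 have N2: "(LINT m|vol_M. (f m)^2) = N^2" by (simp add: N_def L2_norm_def)
 note i = L2_M_D[OF f] L2_M_D[OF et]
 show ?thesis
 proof (cases "N = 0")
 case True
 then have "(LINT m|vol_M. (f m)^2) = 0" using N2 by simp
 then have "AE m in vol_M. (f m)^2 = 0" using integral_nonneg_eq_0_iff_AE[of vol_M "%m. (f m)^2"] i(2) by simp
 then have "AE m in vol_M. f m * et m = 0" by eventually_elim simp
 then have "(LINT m|vol_M. f m * et m) = 0" by (rule integral_eq_zero_AE)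
 then show ?thesis using True by (simp add: N_def)
 next
 case False
 then have N: "N > 0" using N0 by simp
 have "\<bar>LINT m|vol_M. f m * et m\<bar> <= (LINT m|vol_M. \<bar>f m * et m\<bar>)"
 using integral_norm_bound[of vol_M "%m. f m * et m"] by simp
 also have "... <= (LINT m|vol_M. (f m)^2 * (1 / (2 * N)) + (et m)^2 * (N / 2))"
 proof (rule integral_mono)
 have "integrable vol_M (%m. f m \<bullet> et m)" by (rule integrable_L2_product) (use i in auto)
 then show "integrable vol_M (%m. \<bar>f m * et m\<bar>)" by simp
 show "integrable vol_M (%m. (f m)^2 * (1 / (2 * N)) + (et m)^2 * (N / 2))" using i by simp
 fix m
 have "0 <= (\<bar>f m\<bar> - N * \<bar>et m\<bar>)^2" by simp
 then have "2 * N * \<bar>f m * et m\<bar> <= (f m)^2 + N^2 * (et m)^2"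
 by (simp add: power2_diff power_mult_distrib abs_mult algebra_simps)
 then have "\<bar>f m * et m\<bar> <= ((f m)^2 + N^2 * (et m)^2) / (2 * N)" using N by (simp add: field_simps)
 also have "... = (f m)^2 * (1 / (2 * N)) + (et m)^2 * (N / 2)" using N by (simp add: field_simps power2_eq_square)
 finally show "\<bar>f m * et m\<bar> <= (f m)^2 * (1 / (2 * N)) + (et m)^2 * (N / 2)" .
 qed
 also have "... = N^2 * (1 / (2 * N)) + (LINT m|vol_M. (et m)^2) * (N / 2)" using i by (simp add: N2)
 also have "... = N * (1 + (LINT m|vol_M. (et m)^2)) / 2" using N by (simp add: field_simps power2_eq_square)
 finally show ?thesis by (simp add: N_def)
 qed
qed

text \<open>Testing with \<open>p x *\<^sub>R xi a x\<close> for polynomials \<open>p\<close> shows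
  that all frame components agree almost everywhere, and a tangent vector is recovered from its
  frame components.\<close>

lemma weak_grad_unique:
 fixes f :: "'n::finite vec3 => real"
 assumes g1: "is_weak_grad f g1" and g2: "is_weak_grad f g2"
 shows "AE m in vol_M. g1 m = g2 m"
proof -
 note G1 = g1[unfolded is_weak_grad_def] note G2 = g2[unfolded is_weak_grad_def]
 have xc: "continuous_on Mfd (xi a)" for a :: "'n \<times> 3" by (intro linear_continuous_on bounded_linear_xi)
 have ix: "integrable vol_M (%m. g m \<bullet> X m)" if "is_weak_grad f g" "continuous_on Mfd X" for g X
 by (rule integrable_L2_product)
 (use that in \<open>auto simp: is_weak_grad_def intro!: continuous_borel_vol_M integrable_continuous_vol_M continuous_intros\<close>)
 have "AE m in vol_M. g1 m \<bullet> xi a m - g2 m \<bullet> xi a m = 0" for a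
 proof (rule L1_orthogonal_zero)
 show "integrable vol_M (%m. g1 m \<bullet> xi a m - g2 m \<bullet> xi a m)"
 using ix[OF g1 xc] ix[OF g2 xc] by simp
 fix p :: "'n vec3 => real" assume p: "poly_fun p"
 let ?X = "%x. p x *\<^sub>R xi a x"
 have X: "C1_M ?X & (ALL m:Mfd. ?X m:tangent m)"
 using poly_xi_field[OF p] by (simp add: subspace_scale[OF subspace_tangent])
 have Xc: "continuous_on Mfd ?X" by (intro continuous_intros continuous_on_poly_fun p xc)
 have "(LINT m|vol_M. p m * (g1 m \<bullet> xi a m - g2 m \<bullet> xi a m)) = (LINT m|vol_M. g1 m \<bullet> ?X m - g2 m \<bullet> ?X m)"
 by (simp add: right_diff_distrib)
 also have "... = (LINT m|vol_M. g1 m \<bullet> ?X m) - (LINT m|vol_M. g2 m \<bullet> ?X m)"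
 by (rule Bochner_Integration.integral_diff[OF ix[OF g1 Xc] ix[OF g2 Xc]])
 also have "... = 0"
 proof -
 have e: "(LINT m|vol_M. g1 m \<bullet> ?X m) = - (LINT m|vol_M. f m * div_M ?X m)"
 "(LINT m|vol_M. g2 m \<bullet> ?X m) = - (LINT m|vol_M. f m * div_M ?X m)" using G1 G2 X by blast+
 show ?thesis unfolding e by simp
 qed
 finally show "(LINT m|vol_M. p m * (g1 m \<bullet> xi a m - g2 m \<bullet> xi a m)) = 0" .
 qed
 then have "AE m in vol_M. ALL a:UNIV. g1 m \<bullet> xi a m - g2 m \<bullet> xi a m = 0" by (intro AE_finite_allI) auto
 moreover have "AE m in (vol_M :: 'n vec3 measure). m:Mfd" by (rule AE_I2) simp
 ultimately show ?thesis
 proof eventually_elim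
 case (elim m)
 have e: "g1 m \<bullet> xi a m = g2 m \<bullet> xi a m" for a using bspec[OF elim(1) UNIV_I, of a] by simp
 have "g1 m = (SUM a:UNIV. (g1 m \<bullet> xi a m) *\<^sub>R xi a m)" using G1 elim by (simp add: tangent_frame)
 also have "... = (SUM a:UNIV. (g2 m \<bullet> xi a m) *\<^sub>R xi a m)" by (simp only: e)
 also have "... = g2 m" using G2 elim by (simp add: tangent_frame)
 finally show ?case .
 qed
qed

text \<open>The gradient is an explicit argument, so that for classical functions neither the
  description in \<open>grad_M\<close> nor the choice in \<open>weak_grad\<close> has to be resolved
  again.\<close>

definition C1_grad :: "('n::finite vec3 => real) => ('n vec3 => 'n vec3) => bool" where
 "C1_grad f g \<longleftrightarrow> (ALL m:Mfd. (f has_derivative (%v. g m \<bullet> v)) (at m within Mfd)) & continuous_on Mfd g &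
 (ALL m:Mfd. g m:tangent m)"

lemma C1_grad_continuous: "C1_grad f g ==> continuous_on Mfd f"
 unfolding C1_grad_def continuous_on_eq_continuous_within using has_derivative_continuous by blast

lemma C1_grad_weak:
 assumes "C1_grad f g"
 shows "is_weak_grad f g"
 unfolding is_weak_grad_def
proof (intro conjI allI impI)
 have g: "continuous_on Mfd g" using assms by (simp add: C1_grad_def)
 then show "g:borel_measurable vol_M" by (rule continuous_borel_vol_M)
 show "integrable vol_M (%m. (norm (g m))^2)" by (intro integrable_continuous_vol_M continuous_intros g)
 show "ALL m:Mfd. g m:tangent m" using assms by (simp add: C1_grad_def)
 fix X :: "'a vec3 => 'a vec3" assume X: "C1_M X & (ALL m:Mfd. X m:tangent m)"
 then have "C1_M X" by simp
 then obtain X' where X': "!!m. m:Mfd ==> (X has_derivative X' m) (at m within Mfd)" "!!e. continuous_on Mfd (%m. X' m e)"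
 "continuous_on Mfd X" "!!a. continuous_on Mfd (%m. X' m (xi a m))" by (rule C1_M_D) (rule that; assumption)
 show "(LINT m|vol_M. g m \<bullet> X m) = - (LINT m|vol_M. f m * div_M X m)"
 by (rule integration_by_parts(1)[OF _ g X'(1) X'(4)]) (use X assms in \<open>auto simp: C1_grad_def\<close>)
qed

lemma H1_weak_grad: "f:H1 ==> is_weak_grad f (weak_grad f)"
 unfolding weak_grad_def by (rule someI_ex[of "is_weak_grad f"]) (simp add: H1_def)

lemma C1_grad_H1:
 assumes "C1_grad f g"
 shows "f:H1" "AE m in vol_M. weak_grad f m = g m"
 "H1_norm f = sqrt ((LINT m|vol_M. (f m)^2) + (LINT m|vol_M. (norm (g m))^2))"
proof -
 show H: "f:H1" unfolding H1_def
 using continuous_L2_M[OF C1_grad_continuous[OF assms]] C1_grad_weak[OF assms] by blast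
 show ae: "AE m in vol_M. weak_grad f m = g m"
 by (rule weak_grad_unique[OF H1_weak_grad[OF H] C1_grad_weak[OF assms]])
 have "(LINT m|vol_M. (norm (weak_grad f m))^2) = (LINT m|vol_M. (norm (g m))^2)"
 proof (rule integral_cong_AE)
 show "AE m in vol_M. (norm (weak_grad f m))^2 = (norm (g m))^2" using ae by eventually_elim simp
 qed (use H1_weak_grad[OF H] C1_grad_weak[OF assms] in \<open>auto simp: is_weak_grad_def\<close>)
 then show "H1_norm f = sqrt ((LINT m|vol_M. (f m)^2) + (LINT m|vol_M. (norm (g m))^2))"
 by (simp add: H1_norm_def)
qed

subsection \<open>Smooth bump functions on the line\<close>

text \<open>The functions \<open>x^(-j) exp(-1/x)\<close> extended by zero. Powers of
  \<open>1/x\<close> are included because the derivative of one member is then a combination of two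
  others, which reduces smoothness to a single computation.\<close>

definition flat :: "nat => real => real" where
 "flat j x = (if x > 0 then inverse x ^ j * exp (- inverse x) else 0)"

lemma power_div_fact_le_exp: "0 <= y ==> y ^ n / fact n <= exp y" for y :: real
proof -
 assume y: "0 <= y"
 have "sum (%n. y ^ n /\<^sub>R fact n) {n} <= (\<Sum>n. y ^ n /\<^sub>R fact n)"
 by (rule sum_le_suminf) (use y summable_exp_generic[of y] in auto)
 then show ?thesis by (simp add: exp_def divide_inverse mult.commute)
qed

text \<open>The exponential dominates its term of order \<open>j + 2\<close> at \<open>1/x\<close>.
  Hence each \<open>flat j\<close> vanishes to second order at 0 and has derivative 0 there.\<close>

lemma flat_bound: "\<bar>flat j x\<bar> <= fact (j + 2) * x^2"
proof (cases "x > 0")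
 case True
 have "inverse x ^ (j + 2) / fact (j + 2) <= exp (inverse x)"
 using True by (intro power_div_fact_le_exp) simp
 then have "inverse x ^ (j + 2) <= fact (j + 2) * exp (inverse x)"
 by (simp only: pos_divide_le_eq[OF fact_gt_zero] mult.commute)
 then have "inverse x ^ (j + 2) * (exp (- inverse x) * x^2) <= (fact (j + 2) * exp (inverse x)) * (exp (- inverse x) * x^2)"
 by (rule mult_right_mono) simp
 moreover have "exp (inverse x) * exp (- inverse x) = 1" by (simp add: exp_minus)
 moreover have "inverse x ^ (j + 2) * x^2 = inverse x ^ j"
 using True by (simp add: power_add power2_eq_square field_simps)
 ultimately have "inverse x ^ j * exp (- inverse x) <= fact (j + 2) * x^2"
 by (metis (no_types, opaque_lifting) mult.assoc mult.commute mult.left_neutral)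
 with True show ?thesis by (simp add: flat_def del: fact_Suc)
qed (simp add: flat_def)

lemma flat_derivative: "(flat j has_real_derivative (flat (j + 2) x - j * flat (j + 1) x)) (at x)"
proof -
 consider "x > 0" | "x < 0" | "x = 0" by linarith
 then show ?thesis
 proof cases
 case 1
 have D: "((%x. inverse x ^ j * exp (- inverse x)) has_real_derivative (flat (j + 2) x - j * flat (j + 1) x)) (at x)"
 using 1 by (cases j; auto intro!: derivative_eq_intros simp: flat_def field_simps power2_eq_square; metis One_nat_def power_eq_if)
 show ?thesis
 by (rule has_field_derivative_transform_within_open[OF D, of "{0<..}"]) (use 1 in \<open>auto simp: flat_def\<close>)
 next
 case 2
 have D: "((%x. 0) has_real_derivative (flat (j + 2) x - j * flat (j + 1) x)) (at x)"
 using 2 by (simp add: flat_def)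
 show ?thesis
 by (rule has_field_derivative_transform_within_open[OF D, of "{..<0}"]) (use 2 in \<open>auto simp: flat_def\<close>)
 next
 case 3
 have "((%h. flat j h / h) \<longlongrightarrow> 0) (at 0)"
 proof (rule Lim_null_comparison[where g = "%h. fact (j + 2) * \<bar>h\<bar>"])
 have "norm (flat j h / h) <= fact (j + 2) * \<bar>h\<bar>" for h
 proof (cases "h = 0")
 case False
 then show ?thesis using flat_bound[of j h]
 by (simp add: field_simps power2_eq_square abs_mult del: fact_Suc)
 qed simp
 then show "\<forall>\<^sub>F h in at 0. norm (flat j h / h) <= fact (j + 2) * \<bar>h\<bar>" by simp
 show "((%h. fact (j + 2) * \<bar>h\<bar>) \<longlongrightarrow> (0::real)) (at 0)" by (rule tendsto_eq_intros refl | simp)+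
 qed
 with 3 show ?thesis by (simp add: has_field_derivative_iff flat_def)
 qed
qed

text \<open>A class closed under differentiation, which settles at once all the iterated derivatives
  demanded by \<open>test_function\<close>.\<close>

inductive bump_span :: "(real => real) => bool" where
 base: "bump_span (%x. flat i (x - a) * flat j (b - x))"
| add: "bump_span f ==> bump_span g ==> bump_span (%x. f x + g x)"
| scale: "bump_span f ==> bump_span (%x. c * f x)"

lemma bump_span_derivative:
 "bump_span f ==> EX f'. bump_span f' & (ALL x. (f has_real_derivative f' x) (at x))"
proof (induction rule: bump_span.induct)
 case (base i a j b)
 have 1: "((%x. flat i (x - a)) has_real_derivative (flat (i + 2) (x - a) - i * flat (i + 1) (x - a)) * 1) (at x)" for x
 by (rule DERIV_chain2[OF flat_derivative]) (auto intro!: derivative_eq_intros)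
 have 2: "((%x. flat j (b - x)) has_real_derivative (flat (j + 2) (b - x) - j * flat (j + 1) (b - x)) * (-1)) (at x)" for x
 by (rule DERIV_chain2[OF flat_derivative]) (auto intro!: derivative_eq_intros)
 let ?f = "%x. (flat (i + 2) (x - a) * flat j (b - x) + (- real i) * (flat (i + 1) (x - a) * flat j (b - x)))
 + ((-1) * (flat i (x - a) * flat (j + 2) (b - x)) + real j * (flat i (x - a) * flat (j + 1) (b - x)))"
 have "bump_span ?f" by (intro bump_span.intros)
 moreover have "((%x. flat i (x - a) * flat j (b - x)) has_real_derivative ?f x) (at x)" for x
 by (rule DERIV_cong[OF DERIV_mult[OF 1 2]]) (simp add: algebra_simps)
 ultimately show ?case by (intro exI[of _ ?f]) simp
next
 case (add f g)
 then obtain f' g' where h: "bump_span f'" "!!x. (f has_real_derivative f' x) (at x)"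
 "bump_span g'" "!!x. (g has_real_derivative g' x) (at x)" by (elim exE conjE) simp
 show ?case
 by (rule exI[of _ "%x. f' x + g' x"]) (simp add: bump_span.add[OF h(1,3)] DERIV_add[OF h(2,4)])
next
 case (scale f c)
 then obtain f' where h: "bump_span f'" "!!x. (f has_real_derivative f' x) (at x)" by (elim exE conjE) simp
 show ?case
 by (rule exI[of _ "%x. c * f' x"]) (simp add: bump_span.scale[OF h(1)] DERIV_cmult[OF h(2)])
qed

lemma bump_span_deriv_iterate: "bump_span f ==> bump_span ((deriv ^^ k) f)"
proof (induction k)
 case (Suc k)
 obtain f' where f': "bump_span f'" "ALL x. ((deriv ^^ k) f has_real_derivative f' x) (at x)"
 using bump_span_derivative[OF Suc.IH[OF Suc.prems]] by (elim exE conjE)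
 have "deriv ((deriv ^^ k) f) = f'" using f'(2) by (intro ext DERIV_imp_deriv) simp
 with f'(1) show ?case by simp
qed simp

text \<open>\<open>A\<close> is a smooth step and \<open>B\<close> its derivative, a bump on
  \<open>[0, eps]\<close>. The difference of two translates of \<open>A\<close> has compact support,
  and its derivative is a difference of two bumps.\<close>

lemma bump_primitive:
 assumes e: "eps > 0"
 obtains A B :: "real => real" where "bump_span B" "!!p. bump_span (%x. B (x - p))"
 "!!x. (A has_real_derivative B x) (at x)" "!!x. x <= 0 ==> A x = 0" "!!x. x >= eps ==> A x = A eps"
 "A eps > 0" "!!x. 0 <= B x" "!!x. x <= 0 \<or> x >= eps ==> B x = 0" "continuous_on UNIV B"
proof -
 define B where "B = (%x. flat 0 (x - 0) * flat 0 (eps - x))"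
 have B: "bump_span B" unfolding B_def by (rule bump_span.base)
 have Bp: "bump_span (%x. B (x - p))" for p
 using bump_span.base[of 0 p 0 "eps + p"] by (simp add: B_def algebra_simps)
 have pos: "0 <= B x" for x by (simp add: B_def flat_def)
 have z: "B x = 0" if "x <= 0 \<or> x >= eps" for x using that by (auto simp: B_def flat_def)
 have nz: "B x > 0" if "0 < x" "x < eps" for x using that by (simp add: B_def flat_def)
 have c: "continuous_on S B" for S
 proof -
 obtain B' where "ALL x. (B has_real_derivative B' x) (at x)" using bump_span_derivative[OF B] by (elim exE conjE)
 then show ?thesis by (intro continuous_at_imp_continuous_on ballI) (rule DERIV_isCont, rule spec)
 qed
 \<comment> \<open>The lower limit lies to the left of the support of \<open>B\<close>, so
   \<open>A0\<close> is zero near it and differentiable on the whole line.\<close>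
 define A0 where "A0 = (%x. integral {-1..x} B)"
 have A0: "(A0 has_real_derivative B x) (at x)" for x
 proof (cases "x > -1")
 case True
 have "(A0 has_real_derivative B x) (at x within {-1..x + 1})"
 unfolding A0_def by (rule integral_has_real_derivative[OF c]) (use True in auto)
 moreover have "at x within {-1..x + 1} = at x" using True by (intro at_within_Icc_at) auto
 ultimately show ?thesis by simp
 next
 case False
 have D: "((%_. 0) has_real_derivative B x) (at x)" using False by (simp add: z)
 have "A0 y = 0" if "y < 0" for y
 proof -
 have "A0 y = integral {-1..y} (%_. 0)" unfolding A0_def by (rule integral_cong) (use that z in auto)
 then show ?thesis by simp
 qed
 then show ?thesis using False
 by (intro has_field_derivative_transform_within_open[OF D, of "{..<0}"]) auto
 qed
 define A where "A = (%x. A0 x - A0 0)"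
 have A: "(A has_real_derivative B x) (at x)" for x
 unfolding A_def by (rule DERIV_cong[OF DERIV_diff[OF A0 DERIV_const]]) simp
 have mvt: "EX z>a. z < b & A b - A a = (b - a) * B z" if "a < b" for a b
 by (rule MVT2[OF that]) (rule A)
 have A00: "A 0 = 0" by (simp add: A_def)
 have A1: "A x = 0" if "x <= 0" for x using mvt[of x 0] A00 that z by (cases "x = 0") auto
 have A2: "A x = A eps" if "x >= eps" for x using mvt[of eps x] that z by (cases "x = eps") auto
 have A3: "A eps > 0" using mvt[of 0 eps] e A00 nz by auto
 show ?thesis by (rule that[of B A]) (fact B | fact Bp | fact A | fact A1 | fact A2 | fact A3 | fact pos | fact z | fact c)+
qed

section \<open>From weak to classical derivatives in time\<close>

lemma lebesgue_on_integral_eq: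
 fixes f :: "real => real"
 assumes "continuous_on {a..b} f"
 shows "(LINT t|lebesgue_on {a..b}. f t) = integral {a..b} f"
 by (rule lebesgue_integral_eq_integral[OF continuous_imp_integrable_real[OF assms]]) simp

text \<open>With a primitive \<open>P\<close> of \<open>K\<close>, the function
  \<open>H = G - P\<close> has weak derivative zero. Testing with a function that steps up at
  \<open>p\<close> and down at \<open>q\<close> shows that bump averages of \<open>H\<close> near
  \<open>p\<close> and near \<open>q\<close> agree; for narrow bumps this forces
  \<open>H p = H q\<close>.\<close>

lemma du_Bois_Reymond:
 fixes G K :: "real => real"
 assumes T: "T > 0" and G: "continuous_on {0..T} G" and K: "continuous_on {0..T} K"
 and w: "!!ph. test_function T ph ==>
 (LINT t|lebesgue_on {0..T}. deriv ph t * G t) = - (LINT t|lebesgue_on {0..T}. ph t * K t)"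
 and t: "t:{0..T}"
 shows "(G has_real_derivative K t) (at t within {0..T})"
proof -
 define P where "P = (%t. integral {0..t} K)"
 have P: "(P has_real_derivative K t) (at t within {0..T})" if "t:{0..T}" for t
 unfolding P_def by (rule integral_has_real_derivative[OF K that])
 have Pc: "continuous_on {0..T} P"
 by (rule DERIV_continuous_on) (rule P)
 define H where "H = (%t. G t - P t)"
 have Hc: "continuous_on {0..T} H" unfolding H_def by (intro continuous_intros G Pc)
 have Hpq: "H p = H q" if pq: "0 < p" "p < q" "q < T" for p q
 proof (rule ccontr)
 assume "H p \<noteq> H q"
 \<comment> \<open>A quarter of the gap: each bump average errs by at most \<open>om\<close>, so the
   gap would be at most \<open>2 * om\<close>, half of itself.\<close>
 define om where "om = \<bar>H p - H q\<bar> / 4"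
 have om: "om > 0" using \<open>H p \<noteq> H q\<close> by (simp add: om_def)
 have "EX d>0. ALL x:{0..T}. dist x r < d --> dist (H x) (H r) < om" if "r:{0..T}" for r
 using Hc that om unfolding continuous_on_iff by blast
 from this[of p] this[of q] pq obtain d1 d2 where
 d1: "d1 > 0" "ALL x:{0..T}. dist x p < d1 --> dist (H x) (H p) < om" and
 d2: "d2 > 0" "ALL x:{0..T}. dist x q < d2 --> dist (H x) (H q) < om" by auto
 \<comment> \<open>Keeps the bump at \<open>q\<close> to the left of \<open>T\<close> and both bumps
   within the radii of continuity; halving makes the inequalities strict.\<close>
 define eps where "eps = min (T - q) (min d1 d2) / 2"
 have e: "eps > 0" "eps < T - q" "eps < d1" "eps < d2" using pq d1(1) d2(1) by (auto simp: eps_def)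
 obtain A B where B: "bump_span B" "!!p. bump_span (%x. B (x - p))"
 "!!x. (A has_real_derivative B x) (at x)" "!!x. x <= 0 ==> A x = 0" "!!x. x >= eps ==> A x = A eps"
 "A eps > 0" "!!x. 0 <= B x" "!!x. x <= 0 \<or> x >= eps ==> B x = 0" "continuous_on UNIV B"
 by (rule bump_primitive[OF e(1)]) (rule that; assumption)
 have Ar: "((%x. A (x - r)) has_real_derivative B (x - r)) (at x)" for r x
 by (rule DERIV_cong[OF DERIV_chain2[OF B(3)]]) (auto intro!: derivative_eq_intros)
 have Bc: "continuous_on S (%x. B (x - r))" for S r
 by (rule continuous_on_compose2[OF B(9)]) (auto intro!: continuous_intros)
 define ph where "ph = (%x. A (x - p) - A (x - q))"
 define f where "f = (%x. B (x - p) + (-1) * B (x - q))"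
 have f: "bump_span f" unfolding f_def by (intro bump_span.add bump_span.scale B(2))
 have phD: "(ph has_real_derivative f x) (at x)" for x
 unfolding ph_def f_def by (rule DERIV_cong[OF DERIV_diff[OF Ar Ar]]) simp
 have dph: "deriv ph = f" by (intro ext DERIV_imp_deriv phD)
 have fc: "continuous_on S f" for S unfolding f_def by (intro continuous_intros Bc)
 have phc: "continuous_on S ph" for S
 by (intro continuous_at_imp_continuous_on ballI DERIV_isCont[OF phD])
 have fd: "g field_differentiable at t" if g: "bump_span g" for g :: "real => real" and t
 using bump_span_derivative[OF g] unfolding field_differentiable_def by (elim exE conjE) (rule exI, rule spec)
 have test: "test_function T ph"
 unfolding test_function_def
 proof (rule conjI, intro allI)
 fix k t show "(deriv ^^ k) ph field_differentiable at t"
 proof (cases k)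
 case 0 then show ?thesis using phD by (auto simp: field_differentiable_def)
 next
 case (Suc k')
 have "(deriv ^^ k) ph = (deriv ^^ k') f" by (simp add: Suc funpow_Suc_right dph del: funpow.simps)
 then show ?thesis using fd[OF bump_span_deriv_iterate[OF f]] by simp
 qed
 next
 have "ph t = 0" if "t \<notin> {p..q + eps}" for t
 proof -
 have "t < p \<or> t > q + eps" using that by auto
 then show "ph t = 0"
 proof
 assume "t < p" then show ?thesis using pq by (simp add: ph_def B(4))
 next
 assume "t > q + eps" then show ?thesis using pq B(5)[of "t - p"] B(5)[of "t - q"] by (simp add: ph_def)
 qed
 qed
 then have "ALL t. t \<notin> {p..q + eps} --> ph t = 0" by blast
 with pq e show "EX a b. 0 < a & b < T & (ALL t. t \<notin> {a..b} --> ph t = 0)"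
 by - (rule exI[of _ p], rule exI[of _ "q + eps"], simp)
 qed
 have z: "ph 0 = 0" "ph T = 0" using pq e B(4)[of "- p"] B(4)[of "- q"] B(5)[of "T - p"] B(5)[of "T - q"] by (auto simp: ph_def)
 have "((%t. f t * P t + ph t * K t) has_integral (ph T * P T - ph 0 * P 0)) {0..T}"
 proof (rule fundamental_theorem_of_calculus)
 fix x assume x: "x:{0..T}"
 have "((%t. ph t * P t) has_real_derivative f x * P x + K x * ph x) (at x within {0..T})"
 by (rule DERIV_mult[OF has_field_derivative_at_within[OF phD] P[OF x]])
 then show "((%t. ph t * P t) has_vector_derivative f x * P x + ph x * K x) (at x within {0..T})"
 by (simp add: has_real_derivative_iff_has_vector_derivative mult.commute)
 qed (use T in simp)
 then have e1: "integral {0..T} (%t. f t * P t + ph t * K t) = 0" using z by (simp add: integral_unique)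
 have e2: "integral {0..T} (%t. f t * G t) = - integral {0..T} (%t. ph t * K t)"
 using w[OF test] unfolding dph
 by (subst (asm) lebesgue_on_integral_eq, intro continuous_intros fc G,
 subst (asm) lebesgue_on_integral_eq, intro continuous_intros phc K)
 have i: "(%t. f t * P t) integrable_on {0..T}" "(%t. ph t * K t) integrable_on {0..T}" "(%t. f t * G t) integrable_on {0..T}"
 by (intro integrable_continuous_real continuous_intros fc phc G K Pc)+
 have "integral {0..T} (%t. f t * H t) = integral {0..T} (%t. f t * G t - f t * P t)"
 by (simp add: H_def right_diff_distrib)
 also have "... = 0" using e1 e2 i by (simp add: integral_diff integral_add)
 finally have e3: "integral {0..T} (%t. f t * H t) = 0" .
 define I where "I = (%r. integral {0..T} (%x. B (x - r) * H x))"
 have iI: "(%x. B (x - r) * H x) integrable_on {0..T}" for r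
 by (intro integrable_continuous_real continuous_intros Bc Hc)
 have "integral {0..T} (%t. f t * H t) = integral {0..T} (%x. B (x - p) * H x - B (x - q) * H x)"
 by (simp add: f_def algebra_simps)
 then have Ipq: "I p = I q" using e3 iI[of p] iI[of q] by (simp add: I_def integral_diff)
 have est: "\<bar>I r - A eps * H r\<bar> <= A eps * om"
 if r: "0 < r" "r + eps < T" and dr: "!!x. x:{0..T} ==> \<bar>x - r\<bar> <= eps ==> \<bar>H x - H r\<bar> <= om" for r
 proof -
 have "((%x. B (x - r)) has_integral (A (T - r) - A (0 - r))) {0..T}"
 by (rule fundamental_theorem_of_calculus)
 (use T in simp, metis Ar has_field_derivative_at_within has_real_derivative_iff_has_vector_derivative)
 then have m: "((%x. B (x - r)) has_integral A eps) {0..T}" using r B(4)[of "0 - r"] B(5)[of "T - r"] by simp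
 have i1: "((%x. B (x - r) * H x) has_integral I r) {0..T}" unfolding I_def using iI by (rule integrable_integral)
 have i2: "((%x. B (x - r) * H x - B (x - r) * H r) has_integral (I r - A eps * H r)) {0..T}"
 by (rule has_integral_diff[OF i1 has_integral_mult_left[OF m]])
 have b: "\<bar>B (x - r) * H x - B (x - r) * H r\<bar> <= B (x - r) * om" if x: "x:{0..T}" for x
 proof (cases "x <= r \<or> x >= r + eps")
 case True then show ?thesis using B(8)[of "x - r"] by auto
 next
 case False
 then have "\<bar>H x - H r\<bar> <= om" using dr[OF x] by auto
 then have "B (x - r) * \<bar>H x - H r\<bar> <= B (x - r) * om" by (rule mult_left_mono) (rule B(7))
 then show ?thesis by (simp add: right_diff_distrib[symmetric] abs_mult B(7))
 qed
 have "norm (I r - A eps * H r) <= A eps * om"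
 using integral_norm_bound_integral[of "%x. B (x - r) * H x - B (x - r) * H r" "{0..T}" "%x. B (x - r) * om"]
 has_integral_integrable[OF i2] has_integral_integrable[OF has_integral_mult_left[OF m, of om]] b
 integral_unique[OF i2] integral_unique[OF has_integral_mult_left[OF m, of om]] om by auto
 then show ?thesis by simp
 qed
 have "\<bar>I p - A eps * H p\<bar> <= A eps * om"
 by (rule est) (use pq e d1 in \<open>auto simp: dist_real_def less_imp_le\<close>)
 moreover have "\<bar>I q - A eps * H q\<bar> <= A eps * om"
 by (rule est) (use pq e d2 in \<open>auto simp: dist_real_def less_imp_le\<close>)
 ultimately have "\<bar>A eps * H p - A eps * H q\<bar> <= 2 * (A eps * om)" using Ipq by linarith
 then have "A eps * \<bar>H p - H q\<bar> <= A eps * (2 * om)" using B(6) by (simp add: right_diff_distrib[symmetric] abs_mult)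
 then have "\<bar>H p - H q\<bar> <= 2 * om" using B(6) by simp
 then show False using om by (simp add: om_def)
 qed
 have Hconst: "H x = H (T / 2)" if "x:{0..T}" for x
 proof (rule continuous_constant_on_closure[of "{0<..<T}" H])
 show "continuous_on (closure {0<..<T}) H" using Hc T by simp
 show "x:closure {0<..<T}" using that T by simp
 fix y assume "y:{0<..<T}"
 then have y: "0 < y" "y < T" by auto
 have T2: "0 < T / 2" "T / 2 < T" using T by auto
 have l: "H y = H (T / 2)" if "y < T / 2" using Hpq[OF y(1) that T2(2)] .
 have g: "H y = H (T / 2)" if "T / 2 < y" using Hpq[OF T2(1) that y(2)] by (rule sym)
 show "H y = H (T / 2)"
 proof (cases "y = T / 2")
 case True
 then show ?thesis by (rule arg_cong)
 next
 case False
 then have "y < T / 2 \<or> T / 2 < y" by linarith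
 then show ?thesis using l g by blast
 qed
 qed
 have "((%s. P s + H (T / 2)) has_real_derivative K t) (at t within {0..T})"
 by (rule DERIV_cong[OF DERIV_add[OF P[OF t] DERIV_const]]) simp
 moreover have "G x = P x + H (T / 2)" if "x:{0..T}" for x
 proof -
 have "G x - P x = H (T / 2)" using Hconst[OF that] by (simp only: H_def)
 then show ?thesis by linarith
 qed
 ultimately show ?thesis
 unfolding has_field_derivative_def
 by - (rule has_derivative_transform[OF t, rotated]; assumption)
qed

subsection \<open>Classical solutions are weak solutions\<close>

text \<open>Lebesgue measure on a Lebesgue set is complete, so measurability passes along almost
  everywhere equality. This matters for integrands in time that are built from a weak solution and
  are known only almost everywhere.\<close>

lemma borel_measurable_lebesgue_on_AE:
 assumes S: "S:sets lebesgue" and f: "f:borel_measurable (lebesgue_on S)"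
 and ae: "AE t in lebesgue_on S. f t = g t"
 shows "g:borel_measurable (lebesgue_on S)"
proof -
 interpret complete_measure "lebesgue_on S"
 proof
 fix A B assume h: "A \<subseteq> B" "B:null_sets (lebesgue_on S)"
 then have B: "B \<subseteq> S" "B:null_sets lebesgue" using S by (simp_all add: null_sets_restrict_space)
 have "A:null_sets lebesgue" by (rule null_sets_completion_subset[OF h(1) B(2)])
 then have "A:sets lebesgue" by blast
 moreover have "A = S \<inter> A" using h B by blast
 ultimately show "A:sets (lebesgue_on S)" unfolding sets_restrict_space by blast
 qed
 show ?thesis
 proof (rule borel_measurableI)
 fix U :: "'b set" assume U: "open U"
 show "g -` U \<inter> space (lebesgue_on S):sets (lebesgue_on S)"
 proof (rule in_sets_AE)
 show "f -` U \<inter> space (lebesgue_on S):sets (lebesgue_on S)"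
 by (rule measurable_sets[OF f]) (use U in simp)
 show "AE x in lebesgue_on S. (x:f -` U \<inter> space (lebesgue_on S)) = (x:g -` U \<inter> space (lebesgue_on S))"
 using ae by eventually_elim auto
 qed auto
 qed
qed

lemma integral_lebesgue_on_cong_AE:
 fixes f g :: "real => real"
 assumes f: "f:borel_measurable (lebesgue_on {a..b})" and ae: "AE t in lebesgue_on {a..b}. f t = g t"
 shows "(LINT t|lebesgue_on {a..b}. f t) = (LINT t|lebesgue_on {a..b}. g t)"
 by (rule integral_cong_AE[OF f borel_measurable_lebesgue_on_AE[OF _ f ae] ae]) simp

lemma AE_lebesgue_on_neq: "AE t in lebesgue_on {a..b}. t \<noteq> c" for a b c :: real
 by (rule AE_I'[of "{c} \<inter> {a..b}"])
 (auto simp: null_sets_restrict_space negligible_iff_null_sets[symmetric] intro: negligible_subset[of "{c}"])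

section \<open>Bochner spaces contain continuous families\<close>

lemma L2_BochnerI:
 fixes u :: "real => 'x => real"
 assumes T: "T > 0" and u: "!!t. t:{0..T} ==> u t:V"
 and c: "!!eps. eps > 0 ==> EX dl>0. ALL s:{0..T}. ALL t:{0..T}. \<bar>s - t\<bar> < dl --> \<bar>p (%x. u s x - u t x)\<bar> < eps"
 and pc: "continuous_on {0..T} (%t. p (u t))"
 shows "L2_Bochner T V p u"
 unfolding L2_Bochner_def
proof (intro conjI)
 show "AE t in lebesgue_on {0..T}. u t:V" using u by (intro AE_I2) simp
 show "integrable (lebesgue_on {0..T}) (%t. (p (u t))^2)"
 by (intro continuous_imp_integrable_real continuous_intros pc)
 \<comment> \<open>Times are rounded to multiples of \<open>1 / (n + 1)\<close>; rounding down keeps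
   them in \<open>[0, T]\<close>.\<close>
 define k where "k = (%n t. real_of_int \<lfloor>real (Suc n) * t\<rfloor> / real (Suc n))"
 have k: "k n t:{0..T}" "\<bar>k n t - t\<bar> < 1 / real (Suc n)" if "t:{0..T}" for n t
 proof -
 have f: "real_of_int \<lfloor>real (Suc n) * t\<rfloor> <= real (Suc n) * t" "real (Suc n) * t < real_of_int \<lfloor>real (Suc n) * t\<rfloor> + 1"
 by linarith+
 have g: "0 <= real_of_int \<lfloor>real (Suc n) * t\<rfloor>" using that by simp
 have "k n t <= t" using f(1) unfolding k_def by (simp add: divide_le_eq mult.commute)
 moreover have "t < k n t + 1 / real (Suc n)"
 using f(2) unfolding k_def add_divide_distrib[symmetric] by (simp add: less_divide_eq mult.commute)
 moreover have "0 <= k n t" unfolding k_def using g by simp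
 ultimately show "k n t:{0..T}" "\<bar>k n t - t\<bar> < 1 / real (Suc n)" using that by auto
 qed
 show "EX s. (ALL n. simple_function (lebesgue_on {0..T}) (s n) & (ALL t:{0..T}. s n t:V)) &
 (AE t in lebesgue_on {0..T}. (%n. p (%x. s n t x - u t x)) \<longlonglongrightarrow> 0)"
 proof (intro exI[of _ "%n t. u (k n t)"] conjI allI)
 fix n
 have "simple_function (lebesgue_on {0..T}) (%t. real_of_int \<lfloor>real (Suc n) * t\<rfloor>)"
 proof (rule simple_function_borel_measurable)
 have "(%t. real_of_int \<lfloor>real (Suc n) * t\<rfloor>):borel_measurable borel" by measurable
 then show "(%t. real_of_int \<lfloor>real (Suc n) * t\<rfloor>):borel_measurable (lebesgue_on {0..T})"
 by (intro measurable_restrict_space1 measurable_completion) simp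
 have "(%t. real_of_int \<lfloor>real (Suc n) * t\<rfloor>) ` space (lebesgue_on {0..T}) \<subseteq> real_of_int ` {0..\<lfloor>real (Suc n) * T\<rfloor>}"
 by (auto intro!: imageI floor_mono mult_left_mono simp del: of_nat_Suc)
 then show "finite ((%t. real_of_int \<lfloor>real (Suc n) * t\<rfloor>) ` space (lebesgue_on {0..T}))"
 by (rule finite_subset) simp
 qed
 then show "simple_function (lebesgue_on {0..T}) (%t. u (k n t))"
 unfolding k_def by (rule simple_function_compose1[where g = "%y. u (y / real (Suc n))"])
 show "ALL t:{0..T}. u (k n t):V" using u k by blast
 next
 show "AE t in lebesgue_on {0..T}. (%n. p (%x. u (k n t) x - u t x)) \<longlonglongrightarrow> 0"
 proof (rule AE_I2, rule LIMSEQ_I)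
 fix t r :: real assume "t:space (lebesgue_on {0..T})" and r: "0 < r"
 then have t: "t:{0..T}" by simp
 obtain dl where dl: "dl > 0" "ALL s:{0..T}. ALL t:{0..T}. \<bar>s - t\<bar> < dl --> \<bar>p (%x. u s x - u t x)\<bar> < r"
 using c[OF r] by blast
 obtain N where N: "inverse (real (Suc N)) < dl" using reals_Archimedean[OF dl(1)] by blast
 show "EX no. ALL n>=no. norm (p (%x. u (k n t) x - u t x) - 0) < r"
 proof (intro exI[of _ N] allI impI)
 fix n assume "N <= n"
 then have "1 / real (Suc n) <= inverse (real (Suc N))" by (simp add: field_simps)
 then have "\<bar>k n t - t\<bar> < dl" using k(2)[OF t, of n] N by linarith
 then show "norm (p (%x. u (k n t) x - u t x) - 0) < r" using dl(2) k(1)[OF t, of n] t by simp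
 qed
 qed
 qed
qed

lemma uniform_in_time:
 fixes F :: "real => 'n::finite vec3 => 'b::real_normed_vector"
 assumes F: "continuous_on ({a..b} \<times> Mfd) (%(t, m). F t m)" and e: "eps > 0"
 shows "EX dl>0. ALL s:{a..b}. ALL t:{a..b}. \<bar>s - t\<bar> < dl --> (ALL m:Mfd. norm (F s m - F t m) < eps)"
proof -
 have "uniformly_continuous_on ({a..b} \<times> Mfd) (%(t, m). F t m)"
 by (rule compact_uniformly_continuous[OF F]) (intro compact_Times compact_Icc compact_Mfd)
 then obtain dl where dl: "dl > 0" "ALL x:{a..b} \<times> Mfd. ALL x':{a..b} \<times> Mfd. dist x' x < dl -->
 dist ((%(t, m). F t m) x') ((%(t, m). F t m) x) < eps"
 unfolding uniformly_continuous_on_def using e by meson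
 have "norm (F s m - F t m) < eps" if "s:{a..b}" "t:{a..b}" "\<bar>s - t\<bar> < dl" "m:Mfd" for s t m
 using dl(2)[rule_format, of "(t, m)" "(s, m)"] that by (simp add: dist_Pair_Pair dist_norm)
 then show ?thesis using dl(1) by blast
qed

lemma slice_continuous:
 assumes "continuous_on ({a..b} \<times> Mfd) (%(t, m). F t m)" "t:{a..b}"
 shows "continuous_on Mfd (F t)"
proof -
 have "continuous_on Mfd (%m. (%(t, m). F t m) (t, m))"
 by (rule continuous_on_compose2[OF assms(1)]) (use assms(2) in \<open>auto intro!: continuous_intros\<close>)
 then show ?thesis by simp
qed

lemma bounded_on_cylinder:
 fixes F :: "real => 'n::finite vec3 => 'b::real_normed_vector"
 assumes F: "continuous_on ({a..b} \<times> Mfd) (%(t, m). F t m)"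
 shows "EX K>=0. ALL t:{a..b}. ALL m:Mfd. norm (F t m) <= K"
proof -
 have "compact ((%(t, m). F t m) ` ({a..b} \<times> Mfd))"
 by (rule compact_continuous_image[OF F]) (intro compact_Times compact_Icc compact_Mfd)
 then obtain K where K: "ALL x:(%(t, m). F t m) ` ({a..b} \<times> Mfd). norm x <= K"
 using compact_imp_bounded bounded_iff by metis
 show ?thesis by (rule exI[of _ "max K 0"]) (use K in \<open>auto simp: le_max_iff_disj\<close>)
qed

definition vol :: "'n::finite itself => real" where
 "vol _ = (LINT m|(vol_M :: 'n vec3 measure). 1)"

lemma vol_nonneg: "0 <= vol TYPE('n::finite)"
 by (simp add: vol_def)

lemma integral_le_vol:
 fixes f :: "'n::finite vec3 => real"
 assumes f: "continuous_on Mfd f" "!!m. m:Mfd ==> f m <= K"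
 shows "(LINT m|vol_M. f m) <= K * vol TYPE('n)"
proof -
 have "(LINT m|vol_M. f m) <= (LINT m|(vol_M :: 'n vec3 measure). K * 1)"
 by (rule integral_mono) (use f in \<open>auto intro!: integrable_continuous_vol_M continuous_intros\<close>)
 also have "... = K * (LINT m|(vol_M :: 'n vec3 measure). 1)" by (rule integral_mult_right_zero)
 finally show ?thesis unfolding vol_def .
qed

lemma continuous_on_integral:
 fixes F :: "real => 'n::finite vec3 => real"
 assumes F: "continuous_on ({a..b} \<times> Mfd) (%(t, m). F t m)"
 shows "continuous_on {a..b} (%t. LINT m|vol_M. F t m)"
 unfolding continuous_on_iff
proof (intro ballI allI impI)
 fix t eps :: real assume t: "t:{a..b}" and e: "0 < eps"
 have "eps / (vol TYPE('n) + 1) > 0" using e vol_nonneg[where 'n='n] by simp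
 from uniform_in_time[OF F this] obtain dl where dl: "dl > 0"
 "ALL s:{a..b}. ALL t:{a..b}. \<bar>s - t\<bar> < dl --> (ALL m:Mfd. norm (F s m - F t m) < eps / (vol TYPE('n) + 1))" by blast
 have "dist (LINT m|vol_M. F s m) (LINT m|vol_M. F t m) < eps" if s: "s:{a..b}" "dist s t < dl" for s
 proof -
 note c = slice_continuous[OF F s(1)] slice_continuous[OF F t]
 have "dist (LINT m|vol_M. F s m) (LINT m|vol_M. F t m) = norm (LINT m|vol_M. F s m - F t m)"
 unfolding dist_norm by (subst Bochner_Integration.integral_diff) (use c in \<open>auto intro: integrable_continuous_vol_M\<close>)
 also have "... <= (LINT m|vol_M. norm (F s m - F t m))" by (rule integral_norm_bound)
 also have "... <= eps / (vol TYPE('n) + 1) * vol TYPE('n)"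
 proof (rule integral_le_vol)
 show "continuous_on Mfd (%m. norm (F s m - F t m))" by (intro continuous_intros c)
 show "norm (F s m - F t m) <= eps / (vol TYPE('n) + 1)" if "m:Mfd" for m
 using dl(2) s t that by (simp add: dist_real_def less_imp_le)
 qed
 also have "... < eps" using e vol_nonneg[where 'n='n] by (simp add: field_simps)
 finally show ?thesis .
 qed
 then show "EX d>0. ALL x':{a..b}. dist x' t < d --> dist (LINT m|vol_M. F x' m) (LINT m|vol_M. F t m) < eps"
 using dl(1) by blast
qed

lemma C1_grad_diff:
 assumes "C1_grad u g" "C1_grad w k"
 shows "C1_grad (%x. u x - w x) (%x. g x - k x)"
 unfolding C1_grad_def
proof (intro conjI ballI)
 fix m :: "'a vec3" assume m: "m:Mfd"
 show "((%x. u x - w x) has_derivative (%v. (g m - k m) \<bullet> v)) (at m within Mfd)"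
 unfolding inner_diff_left by (rule has_derivative_diff) (use assms m in \<open>auto simp: C1_grad_def\<close>)
 show "g m - k m:tangent m" using assms m by (auto simp: C1_grad_def intro: subspace_diff[OF subspace_tangent])
qed (use assms in \<open>auto simp: C1_grad_def intro!: continuous_intros\<close>)

lemma C1_grad_scale:
 assumes "C1_grad u g"
 shows "C1_grad (%x. k * u x) (%x. k *\<^sub>R g x)"
 unfolding C1_grad_def
proof (intro conjI ballI)
 fix m :: "'a vec3" assume m: "m:Mfd"
 show "((%x. k * u x) has_derivative (%v. (k *\<^sub>R g m) \<bullet> v)) (at m within Mfd)"
 unfolding inner_scaleR_left by (rule has_derivative_mult_right) (use assms m in \<open>auto simp: C1_grad_def\<close>)
 show "k *\<^sub>R g m:tangent m" using assms m by (auto simp: C1_grad_def intro: subspace_scale[OF subspace_tangent])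
qed (use assms in \<open>auto simp: C1_grad_def intro!: continuous_intros\<close>)

lemma C1_grad_zero: "C1_grad (%x. 0) (%x. 0)"
 by (auto simp: C1_grad_def subspace_0[OF subspace_tangent])

lemma H1_norm_scale: "C1_grad et g ==> H1_norm (%x. k * et x) = \<bar>k\<bar> * H1_norm et"
 by (simp add: C1_grad_H1(3) C1_grad_H1(3)[OF C1_grad_scale] power_mult_distrib distrib_left[symmetric] real_sqrt_mult)

lemma L2_Bochner_C1:
 fixes u :: "real => 'n::finite vec3 => real"
 assumes T: "T > 0" and u: "!!t. t:{0..T} ==> C1_grad (u t) (g t)"
 and c: "continuous_on ({0..T} \<times> Mfd) (%(t, m). u t m)" "continuous_on ({0..T} \<times> Mfd) (%(t, m). g t m)"
 shows "L2_Bochner T H1 H1_norm u"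
proof (rule L2_BochnerI[OF T])
 show "u t:H1" if "t:{0..T}" for t by (rule C1_grad_H1(1)[OF u[OF that]])
 have "continuous_on {0..T} (%t. sqrt ((LINT m|vol_M. (u t m)^2) + (LINT m|vol_M. (norm (g t m))^2)))"
 using c by (intro continuous_intros continuous_on_integral) (auto simp: case_prod_unfold intro!: continuous_intros)
 then show "continuous_on {0..T} (%t. H1_norm (u t))"
 by (rule continuous_on_eq) (simp add: C1_grad_H1(3)[OF u])
 fix eps :: real assume e: "eps > 0"
 let ?V = "vol TYPE('n)"
 have V: "?V >= 0" by (rule vol_nonneg)
 \<comment> \<open>Then \<open>eps^2 = 2 * rh^2 * (vol + 1)\<close>, so the two integrals, each at
   most \<open>rh^2 * vol\<close>, add up to strictly less than \<open>eps^2\<close>.\<close>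
 define rh where "rh = eps / sqrt (2 * (?V + 1))"
 have rh: "rh > 0" using e V by (simp add: rh_def)
 have rh2: "rh^2 = eps^2 / (2 * (?V + 1))" using V by (simp add: rh_def power_divide)
 obtain d1 where d1: "d1 > 0" "ALL s:{0..T}. ALL t:{0..T}. \<bar>s - t\<bar> < d1 --> (ALL m:Mfd. norm (u s m - u t m) < rh)"
 using uniform_in_time[OF c(1) rh] by blast
 obtain d2 where d2: "d2 > 0" "ALL s:{0..T}. ALL t:{0..T}. \<bar>s - t\<bar> < d2 --> (ALL m:Mfd. norm (g s m - g t m) < rh)"
 using uniform_in_time[OF c(2) rh] by blast
 show "EX dl>0. ALL s:{0..T}. ALL t:{0..T}. \<bar>s - t\<bar> < dl --> \<bar>H1_norm (%x. u s x - u t x)\<bar> < eps"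
 proof (intro exI[of _ "min d1 d2"] conjI ballI impI)
 fix s t assume st: "s:{0..T}" "t:{0..T}" "\<bar>s - t\<bar> < min d1 d2"
 note cs = slice_continuous[OF c(1) st(1)] slice_continuous[OF c(1) st(2)]
 slice_continuous[OF c(2) st(1)] slice_continuous[OF c(2) st(2)]
 have 1: "(LINT m|vol_M. (u s m - u t m)^2) <= rh^2 * ?V"
 proof (rule integral_le_vol)
 show "(u s m - u t m)^2 <= rh^2" if m: "m:Mfd" for m
 proof -
 have "\<bar>u s m - u t m\<bar> <= rh" using d1(2) st m by (simp add: less_imp_le)
 then show ?thesis using abs_le_square_iff[of "u s m - u t m" rh] rh by simp
 qed
 qed (intro continuous_intros cs)
 have 2: "(LINT m|vol_M. (norm (g s m - g t m))^2) <= rh^2 * ?V"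
 proof (rule integral_le_vol)
 show "(norm (g s m - g t m))^2 <= rh^2" if m: "m:Mfd" for m
 by (rule power_mono) (use d2(2) st m in \<open>auto simp: less_imp_le\<close>)
 qed (intro continuous_intros cs)
 have eq: "H1_norm (%x. u s x - u t x) = sqrt ((LINT m|vol_M. (u s m - u t m)^2) + (LINT m|vol_M. (norm (g s m - g t m))^2))"
 by (rule C1_grad_H1(3)[OF C1_grad_diff[OF u[OF st(1)] u[OF st(2)]]])
 have "eps^2 = rh^2 * (2 * (?V + 1))" using V by (simp add: rh2)
 then have "eps^2 = rh^2 * ?V + rh^2 * ?V + 2 * rh^2" by (simp add: algebra_simps)
 moreover have "rh^2 > 0" using rh by simp
 ultimately have lt: "rh^2 * ?V + rh^2 * ?V < eps^2" by linarith
 have "H1_norm (%x. u s x - u t x) < sqrt (eps^2)" unfolding eq by (rule real_sqrt_less_mono) (use 1 2 lt in linarith)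
 moreover have "0 <= H1_norm (%x. u s x - u t x)" unfolding eq by simp
 ultimately show "\<bar>H1_norm (%x. u s x - u t x)\<bar> < eps" using e by simp
 qed (use d1 d2 in simp)
qed

section \<open>The dual norm and pairings with continuous functions\<close>

lemma H1_L2: "f:H1 ==> f:L2_M"
 by (simp add: H1_def)

lemma L2_norm_le_H1_norm: "L2_norm f <= H1_norm f"
 by (simp add: L2_norm_def H1_norm_def)

lemma zero_unit_ball: "(%x. 0):{f:H1. H1_norm f <= 1}"
 by (simp add: C1_grad_H1(1)[OF C1_grad_zero] C1_grad_H1(3)[OF C1_grad_zero])

lemma Hm1_norm_le:
 "(!!f. f:H1 ==> H1_norm f <= 1 ==> \<bar>F f\<bar> <= C) ==> Hm1_norm F <= C"
 unfolding Hm1_norm_def by (rule cSUP_least) (use zero_unit_ball in auto)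

lemma Hm1_norm_upper:
 fixes F :: "('n::finite vec3 => real) => real"
 assumes F: "F:Hm1" and f: "f:H1" "H1_norm f <= 1"
 shows "\<bar>F f\<bar> <= Hm1_norm F"
 unfolding Hm1_norm_def
proof (rule cSUP_upper)
 obtain K where K: "ALL f:H1. \<bar>F f\<bar> <= K * H1_norm f" using F by (auto simp: Hm1_def)
 show "bdd_above ((%f. \<bar>F f\<bar>) ` {f:H1. H1_norm f <= 1})"
 proof (rule bdd_aboveI2[of _ _ "\<bar>K\<bar>"])
 fix f :: "'n vec3 => real" assume f: "f:{f:H1. H1_norm f <= 1}"
 have n: "0 <= H1_norm f" by (simp add: H1_norm_def)
 have "\<bar>F f\<bar> <= K * H1_norm f" using K f by blast
 also have "... <= \<bar>K\<bar> * H1_norm f" by (rule mult_right_mono[OF abs_ge_self n])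
 also have "... <= \<bar>K\<bar> * 1" by (rule mult_left_mono) (use f in auto)
 finally show "\<bar>F f\<bar> <= \<bar>K\<bar>" by simp
 qed
qed (use f in simp)

lemma Hm1_norm_nonneg: "F:Hm1 ==> 0 <= Hm1_norm F"
 using Hm1_norm_upper[of F "%x. 0"] zero_unit_ball by force

lemma Hm1_scale: "F:Hm1 ==> f:H1 ==> F (%m. k * f m) = k * F f"
proof -
 assume F: "F:Hm1" and f: "f:H1"
 then have "F (%m. k * f m + 0 * f m) = k * F f + 0 * F f" unfolding Hm1_def by blast
 then show ?thesis by simp
qed

text \<open>Scaling to the unit ball. For \<open>C^1\<close> functions the homogeneity of
  \<open>H1_norm\<close>, which rests on a chosen weak gradient, can be read off from the classical
  gradient.\<close>

lemma Hm1_pairing_le: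
 assumes F: "F:Hm1" and et: "C1_grad et g"
 shows "\<bar>F et\<bar> <= Hm1_norm F * H1_norm et"
proof (cases "H1_norm et = 0")
 case True
 obtain K where "ALL f:H1. \<bar>F f\<bar> <= K * H1_norm f" using F by (auto simp: Hm1_def)
 with C1_grad_H1(1)[OF et] True show ?thesis by force
next
 case False
 have "0 <= H1_norm et" by (simp add: H1_norm_def)
 with False have n: "H1_norm et > 0" by simp
 let ?k = "inverse (H1_norm et)"
 have "\<bar>F (%x. ?k * et x)\<bar> <= Hm1_norm F"
 by (rule Hm1_norm_upper[OF F C1_grad_H1(1)[OF C1_grad_scale[OF et]]]) (use n in \<open>simp add: H1_norm_scale[OF et]\<close>)
 then have "\<bar>?k * F et\<bar> <= Hm1_norm F" by (simp only: Hm1_scale[OF F C1_grad_H1(1)[OF et]])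
 then show ?thesis using n by (simp add: abs_mult field_simps)
qed

lemma Hm1_diff:
 assumes "F:Hm1" "G:Hm1"
 shows "(%f. F f - G f):Hm1"
proof -
 obtain K L where K: "ALL f:H1. \<bar>F f\<bar> <= K * H1_norm f" and L: "ALL f:H1. \<bar>G f\<bar> <= L * H1_norm f"
 using assms by (auto simp: Hm1_def)
 have "\<bar>F f - G f\<bar> <= (K + L) * H1_norm f" if f: "f:H1" for f
 proof -
 have "\<bar>F f\<bar> <= K * H1_norm f" "\<bar>G f\<bar> <= L * H1_norm f" using K L f by auto
 then show ?thesis by (simp add: distrib_right)
 qed
 moreover have "F (%m. a * f m + b * g m) - G (%m. a * f m + b * g m) = a * (F f - G f) + b * (F g - G g)"
 if "f:H1" "g:H1" for f g a b
 proof -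
 have "F (%m. a * f m + b * g m) = a * F f + b * F g" "G (%m. a * f m + b * g m) = a * G f + b * G g"
 using assms that unfolding Hm1_def by blast+
 then show ?thesis by (simp add: algebra_simps)
 qed
 ultimately show ?thesis unfolding Hm1_def by blast
qed

text \<open>The bound in \<open>L2_pairing_bound\<close> is not homogeneous in its second argument;
  dividing \<open>r\<close> by \<open>K\<close> first makes the result linear in
  \<open>K\<close>.\<close>

lemma pairing_le:
 fixes r :: "'n::finite vec3 => real"
 assumes r: "continuous_on Mfd r" "!!m. m:Mfd ==> \<bar>r m\<bar> <= K" and K: "K > 0" and et: "et:L2_M"
 shows "\<bar>LINT m|vol_M. et m * r m\<bar> <= L2_norm et * (K * (1 + vol TYPE('n)))"
proof -
 have rc: "continuous_on Mfd (%m. r m / K)" using K by (intro continuous_intros r) auto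
 have "(LINT m|vol_M. (r m / K)^2) <= 1 * vol TYPE('n)"
 proof (rule integral_le_vol)
 show "(r m / K)^2 <= 1" if "m:Mfd" for m
 using r(2)[OF that] K by (simp add: abs_square_le_1)
 qed (use rc in \<open>auto intro!: continuous_intros\<close>)
 moreover have "0 <= (LINT m|vol_M. (r m / K)^2)" by simp
 moreover have "0 <= L2_norm et" by (simp add: L2_norm_def)
 moreover have "0 <= vol TYPE('n)" by (rule vol_nonneg)
 ultimately have "L2_norm et * (1 + (LINT m|vol_M. (r m / K)^2)) / 2 <= L2_norm et * (1 + vol TYPE('n))"
 using mult_left_mono[of "(1 + (LINT m|vol_M. (r m / K)^2)) / 2" "1 + vol TYPE('n)" "L2_norm et"] by simp
 then have "\<bar>LINT m|vol_M. et m * (r m / K)\<bar> <= L2_norm et * (1 + vol TYPE('n))"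
 using L2_pairing_bound[OF et continuous_L2_M[OF rc]] by linarith
 then have le: "K * \<bar>LINT m|vol_M. et m * (r m / K)\<bar> <= K * (L2_norm et * (1 + vol TYPE('n)))"
 using K by (intro mult_left_mono) auto
 have eq: "(LINT m|vol_M. et m * r m) = K * (LINT m|vol_M. et m * (r m / K))"
 using K by (subst integral_mult_right_zero[symmetric]) (simp add: field_simps)
 have "\<bar>LINT m|vol_M. et m * r m\<bar> = K * \<bar>LINT m|vol_M. et m * (r m / K)\<bar>"
 unfolding eq abs_mult abs_of_pos[OF K] ..
 also note le
 also have "K * (L2_norm et * (1 + vol TYPE('n))) = L2_norm et * (K * (1 + vol TYPE('n)))" by (rule mult.left_commute)
 finally show ?thesis .
qed

lemma integrable_pairing: "continuous_on Mfd r ==> et:L2_M ==> integrable vol_M (%m. r m * et m)"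
 by (rule integrable_mult_continuous[OF L2_M_D(3)])

lemma pairing_Hm1:
 fixes r :: "'n::finite vec3 => real"
 assumes r: "continuous_on Mfd r"
 shows "(%et. LINT m|vol_M. r m * et m):Hm1"
proof -
 obtain K where K: "K >= 0" "!!x. x:Mfd ==> norm (r x) <= K" using bounded_on_Mfd[OF r] by blast
 have K1: "\<bar>r m\<bar> <= K + 1" if "m:Mfd" for m using K(2)[OF that] by simp
 have "\<bar>LINT m|vol_M. r m * et m\<bar> <= ((K + 1) * (1 + vol TYPE('n))) * H1_norm et" if et: "et:H1" for et
 proof -
 have "\<bar>LINT m|vol_M. et m * r m\<bar> <= L2_norm et * ((K + 1) * (1 + vol TYPE('n)))"
 by (rule pairing_le[OF r K1 _ H1_L2[OF et]]) (use K in auto)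
 also have "... <= H1_norm et * ((K + 1) * (1 + vol TYPE('n)))"
 using K vol_nonneg[where 'n='n] by (intro mult_right_mono L2_norm_le_H1_norm mult_nonneg_nonneg) auto
 finally show ?thesis by (simp add: mult.commute)
 qed
 moreover have "(LINT m|vol_M. r m * (a * f m + b * g m)) = a * (LINT m|vol_M. r m * f m) + b * (LINT m|vol_M. r m * g m)"
 if "f:H1" "g:H1" for f g a b
 proof -
 note i = integrable_pairing[OF r H1_L2[OF that(1)]] integrable_pairing[OF r H1_L2[OF that(2)]]
 have "(LINT m|vol_M. r m * (a * f m + b * g m)) = (LINT m|vol_M. a * (r m * f m) + b * (r m * g m))"
 by (simp add: algebra_simps)
 then show ?thesis using i by simp
 qed
 ultimately show ?thesis unfolding Hm1_def by blast
qed

text \<open>Uniform continuity of \<open>r\<close> on the compact cylinder makes the functionals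
  depend continuously on time, uniformly over the unit ball of \<open>H1\<close>.\<close>

lemma L2_Bochner_pairing:
 fixes r :: "real => 'n::finite vec3 => real"
 assumes T: "T > 0" and r: "continuous_on ({0..T} \<times> Mfd) (%(t, m). r t m)"
 shows "L2_Bochner T Hm1 Hm1_norm (%t et. LINT m|vol_M. r t m * et m)"
proof (rule L2_BochnerI[OF T])
 show mem: "(%et. LINT m|vol_M. r t m * et m):Hm1" if "t:{0..T}" for t
 by (rule pairing_Hm1[OF slice_continuous[OF r that]])
 have unif: "EX dl>0. ALL s:{0..T}. ALL t:{0..T}. \<bar>s - t\<bar> < dl -->
 (ALL et:H1. H1_norm et <= 1 --> \<bar>(LINT m|vol_M. r s m * et m) - (LINT m|vol_M. r t m * et m)\<bar> <= eps)"
 if e: "eps > 0" for eps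
 proof -
 let ?V = "1 + vol TYPE('n)"
 have V: "?V > 0" using vol_nonneg[where 'n='n] by simp
 then have e': "eps / ?V > 0" using e by simp
 obtain dl where dl: "dl > 0" "ALL s:{0..T}. ALL t:{0..T}. \<bar>s - t\<bar> < dl --> (ALL m:Mfd. norm (r s m - r t m) < eps / ?V)"
 using uniform_in_time[OF r e'] by blast
 show ?thesis
 proof (intro exI[of _ dl] conjI ballI impI)
 fix s t et assume h: "s:{0..T}" "t:{0..T}" "\<bar>s - t\<bar> < dl" "et:(H1 :: ('n vec3 => real) set)" "H1_norm et <= 1"
 note c = slice_continuous[OF r h(1)] slice_continuous[OF r h(2)]
 have "(LINT m|vol_M. r s m * et m) - (LINT m|vol_M. r t m * et m) = (LINT m|vol_M. r s m * et m - r t m * et m)"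
 by (rule Bochner_Integration.integral_diff[symmetric]; rule integrable_pairing[OF _ H1_L2[OF h(4)]]; rule c)
 also have "... = (LINT m|vol_M. et m * (r s m - r t m))" by (simp add: algebra_simps)
 finally have eq: "(LINT m|vol_M. r s m * et m) - (LINT m|vol_M. r t m * et m) = (LINT m|vol_M. et m * (r s m - r t m))" .
 have "\<bar>LINT m|vol_M. et m * (r s m - r t m)\<bar> <= L2_norm et * (eps / ?V * ?V)"
 by (rule pairing_le[OF _ _ e' H1_L2[OF h(4)]]) (use dl(2) h c in \<open>auto intro!: continuous_intros simp: less_imp_le\<close>)
 also have "... <= 1 * (eps / ?V * ?V)"
 by (rule mult_right_mono[OF order.trans[OF L2_norm_le_H1_norm h(5)]]) (use e V in simp)
 also have "... = eps" using V by simp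
 finally show "\<bar>(LINT m|vol_M. r s m * et m) - (LINT m|vol_M. r t m * et m)\<bar> <= eps" unfolding eq .
 qed (rule dl(1))
 qed
 have le: "Hm1_norm F <= Hm1_norm G + eps"
 if "G:Hm1" "!!et. et:H1 ==> H1_norm et <= 1 ==> \<bar>F et - G et\<bar> <= eps" for F G :: "('n vec3 => real) => real" and eps
 proof (rule Hm1_norm_le)
 fix f :: "'n vec3 => real" assume f: "f:H1" "H1_norm f <= 1"
 show "\<bar>F f\<bar> <= Hm1_norm G + eps" using Hm1_norm_upper[OF that(1) f] that(2)[OF f] by linarith
 qed
 show "continuous_on {0..T} (%t. Hm1_norm (%et. LINT m|vol_M. r t m * et m))"
 unfolding continuous_on_iff
 proof (intro ballI allI impI)
 fix t eps :: real assume t: "t:{0..T}" and e: "0 < eps"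
 then have "eps / 2 > 0" by simp
 from unif[OF this] obtain dl where dl: "dl > 0" "ALL s:{0..T}. ALL t:{0..T}. \<bar>s - t\<bar> < dl -->
 (ALL et:H1. H1_norm et <= 1 --> \<bar>(LINT m|vol_M. r s m * et m) - (LINT m|vol_M. r t m * et m)\<bar> <= eps / 2)" by blast
 show "EX d>0. ALL x':{0..T}. dist x' t < d -->
 dist (Hm1_norm (%et. LINT m|vol_M. r x' m * et m)) (Hm1_norm (%et. LINT m|vol_M. r t m * et m)) < eps"
 proof (intro exI[of _ dl] conjI ballI impI)
 fix s assume s: "s:{0..T}" "dist s t < dl"
 have "Hm1_norm (%et. LINT m|vol_M. r s m * et m) <= Hm1_norm (%et. LINT m|vol_M. r t m * et m) + eps / 2"
 by (rule le[OF mem[OF t]]) (use dl(2) s t in \<open>simp add: dist_real_def\<close>)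
 moreover have "Hm1_norm (%et. LINT m|vol_M. r t m * et m) <= Hm1_norm (%et. LINT m|vol_M. r s m * et m) + eps / 2"
 by (rule le[OF mem[OF s(1)]]) (use dl(2) s t in \<open>simp add: dist_real_def abs_minus_commute\<close>)
 ultimately show "dist (Hm1_norm (%et. LINT m|vol_M. r s m * et m)) (Hm1_norm (%et. LINT m|vol_M. r t m * et m)) < eps"
 unfolding dist_real_def using e by linarith
 qed (rule dl(1))
 qed
 fix eps :: real assume e: "eps > 0"
 then have "eps / 2 > 0" by simp
 from unif[OF this] obtain dl where dl: "dl > 0" "ALL s:{0..T}. ALL t:{0..T}. \<bar>s - t\<bar> < dl -->
 (ALL et:H1. H1_norm et <= 1 --> \<bar>(LINT m|vol_M. r s m * et m) - (LINT m|vol_M. r t m * et m)\<bar> <= eps / 2)" by blast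
 show "EX dl>0. ALL s:{0..T}. ALL t:{0..T}. \<bar>s - t\<bar> < dl -->
 \<bar>Hm1_norm (%et. (LINT m|vol_M. r s m * et m) - (LINT m|vol_M. r t m * et m))\<bar> < eps"
 proof (intro exI[of _ dl] conjI ballI impI)
 fix s t assume h: "s:{0..T}" "t:{0..T}" "\<bar>s - t\<bar> < dl"
 have "Hm1_norm (%et. (LINT m|vol_M. r s m * et m) - (LINT m|vol_M. r t m * et m)) <= eps / 2"
 by (rule Hm1_norm_le) (use dl(2) h in simp)
 moreover have "0 <= Hm1_norm (%et. (LINT m|vol_M. r s m * et m) - (LINT m|vol_M. r t m * et m))"
 by (rule Hm1_norm_nonneg[OF Hm1_diff[OF mem[OF h(1)] mem[OF h(2)]]])
 ultimately show "\<bar>Hm1_norm (%et. (LINT m|vol_M. r s m * et m) - (LINT m|vol_M. r t m * et m))\<bar> < eps" using e by linarith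
 qed (rule dl(1))
qed

lemma has_derivative_pairing:
 fixes w :: "real => 'n::finite vec3 => real"
 assumes w: "continuous_on ({a..b} \<times> Mfd) (%(t, m). w t m)"
 and wt: "continuous_on ({a..b} \<times> Mfd) (%(t, m). wt t m)"
 and d: "!!t m. t:{a..b} ==> m:Mfd ==> ((%s. w s m) has_real_derivative wt t m) (at t within {a..b})"
 and et: "et:L2_M" and t: "t:{a..b}"
 shows "((%s. LINT m|vol_M. w s m * et m) has_real_derivative (LINT m|vol_M. wt t m * et m)) (at t within {a..b})"
 unfolding has_field_derivative_iff tendsto_at_iff_sequentially comp_def
proof (intro allI impI)
 fix X :: "nat => real" assume X: "ALL i. X i:{a..b} - {t}" "X \<longlonglongrightarrow> t"
 obtain K where K: "K >= 0" "ALL t:{a..b}. ALL m:Mfd. norm (wt t m) <= K" using bounded_on_cylinder[OF wt] by blast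
 have Xc: "continuous_on Mfd (w (X n))" for n by (rule slice_continuous[OF w]) (use X in blast)
 note tc = slice_continuous[OF w t]
 have em: "et:borel_measurable vol_M" using L2_M_D(1)[OF et] .
 have lim: "(%n. LINT m|vol_M. (w (X n) m - w t m) / (X n - t) * et m) \<longlonglongrightarrow> (LINT m|vol_M. wt t m * et m)"
 proof (rule integral_dominated_convergence[where w = "%m. K * \<bar>et m\<bar>"])
 show "(%m. wt t m * et m):borel_measurable vol_M"
 by (intro borel_measurable_times em continuous_borel_vol_M slice_continuous[OF wt t])
 have dc: "continuous_on Mfd (%m. (w (X n) m - w t m) / (X n - t))" for n
 using X(1) by (intro continuous_intros Xc tc) auto
 show "(%m. (w (X n) m - w t m) / (X n - t) * et m):borel_measurable vol_M" for n
 by (rule borel_measurable_times[OF continuous_borel_vol_M[OF dc] em])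
 show "integrable vol_M (%m. K * \<bar>et m\<bar>)" using L2_M_D(3)[OF et] by simp
 show "AE m in vol_M. norm ((w (X n) m - w t m) / (X n - t) * et m) <= K * \<bar>et m\<bar>" for n
 proof (rule AE_I2)
 fix m :: "'n vec3" assume "m:space vol_M"
 then have m: "m:Mfd" by simp
 have "norm (w (X n) m - w t m) <= K * norm (X n - t)"
 by (rule field_differentiable_bound[where S = "{a..b}" and f' = "%t. wt t m"])
 (use d m K X t in auto)
 then have "\<bar>(w (X n) m - w t m) / (X n - t)\<bar> <= K" using X(1) by (simp add: divide_le_eq)
 then show "norm ((w (X n) m - w t m) / (X n - t) * et m) <= K * \<bar>et m\<bar>"
 unfolding real_norm_def abs_mult by (rule mult_right_mono) simp
 qed
 show "AE m in vol_M. (%n. (w (X n) m - w t m) / (X n - t) * et m) \<longlonglongrightarrow> wt t m * et m"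
 proof (rule AE_I2, rule tendsto_mult_right)
 fix m :: "'n vec3" assume "m:space vol_M"
 then have "m:Mfd" by simp
 then show "(%n. (w (X n) m - w t m) / (X n - t)) \<longlonglongrightarrow> wt t m"
 using d[OF t] X unfolding has_field_derivative_iff tendsto_at_iff_sequentially comp_def by blast
 qed
 qed
 have eq: "(LINT m|vol_M. (w (X n) m - w t m) / (X n - t) * et m)
 = ((LINT m|vol_M. w (X n) m * et m) - (LINT m|vol_M. w t m * et m)) / (X n - t)" for n
 proof -
 have "(LINT m|vol_M. (w (X n) m - w t m) / (X n - t) * et m)
 = (LINT m|vol_M. (w (X n) m * et m - w t m * et m) / (X n - t))" by (simp add: left_diff_distrib)
 also have "... = (LINT m|vol_M. w (X n) m * et m - w t m * et m) / (X n - t)" by simp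
 also have "(LINT m|vol_M. w (X n) m * et m - w t m * et m) = (LINT m|vol_M. w (X n) m * et m) - (LINT m|vol_M. w t m * et m)"
 by (rule Bochner_Integration.integral_diff; rule integrable_pairing[OF _ et]; rule Xc tc)
 finally show ?thesis .
 qed
 from lim show "(%n. ((LINT m|vol_M. w (X n) m * et m) - (LINT m|vol_M. w t m * et m)) / (X n - t))
 \<longlonglongrightarrow> (LINT m|vol_M. wt t m * et m)" unfolding eq .
qed

section \<open>From the pointwise equation to the weak formulation\<close>

lemma C12_C1_M_grad:
 assumes "C12 T w" "t:{0..T}"
 shows "C1_M (grad_M (w t))"
proof -
 obtain H where H: "ALL t:{0..T}. ALL m:Mfd. (grad_M (w t) has_derivative H t m) (at m within Mfd)"
 "ALL e. continuous_on ({0..T} \<times> Mfd) (%(t, m). H t m e)" using C12D(7)[OF assms(1)] by blast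
 show ?thesis
 by (rule C1_MI[where H = "H t"]) (use H(1) assms(2) in blast, rule slice_continuous[OF H(2)[rule_format] assms(2)])
qed

lemma C12_C1_grad: "C12 T w ==> t:{0..T} ==> C1_grad (w t) (grad_M (w t))"
 unfolding C1_grad_def using C12D(5,6)[of T w] slice_continuous[OF C12D(3)] by blast

lemma test_function_D:
 assumes "test_function T ph"
 shows "(ph has_real_derivative deriv ph t) (at t)" "continuous_on S ph" "continuous_on S (deriv ph)" "ph 0 = 0" "ph T = 0"
proof -
 have d: "(deriv ^^ k) ph field_differentiable at t" for k t using assms by (simp add: test_function_def)
 show "(ph has_real_derivative deriv ph t) (at t)" using d[of 0 t] DERIV_deriv_iff_field_differentiable by auto
 show "continuous_on S ph" using d[of 0] by (intro continuous_at_imp_continuous_on ballI field_differentiable_imp_continuous_at) auto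
 show "continuous_on S (deriv ph)" using d[of 1] by (intro continuous_at_imp_continuous_on ballI field_differentiable_imp_continuous_at) auto
 obtain a b where "0 < a" "b < T" "ALL t. t \<notin> {a..b} --> ph t = 0" using assms unfolding test_function_def by blast
 then show "ph 0 = 0" "ph T = 0" by auto
qed

lemma div_M_continuous:
 assumes "C1_M X" "!!m. m:Mfd ==> X m:tangent m"
 shows "continuous_on Mfd (div_M X)"
proof -
 obtain X' where X': "!!m. m:Mfd ==> (X has_derivative X' m) (at m within Mfd)" "!!e. continuous_on Mfd (%m. X' m e)"
 "continuous_on Mfd X" "!!a. continuous_on Mfd (%m. X' m (xi a m))" by (rule C1_M_D[OF assms(1)]) (rule that; assumption)
 have "((%_. 0) has_derivative (%v. 0 \<bullet> v)) (at m within Mfd)" for m :: "'a vec3" by simp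
 from integration_by_parts(3)[OF this _ X'(1,4) assms(2)] show ?thesis by simp
qed

text \<open>The distributional time derivative is the pairing with the classical one. At almost
  every time the equation is multiplied by \<open>ps t\<close>; as \<open>ps t\<close> is merely in
  \<open>H1\<close>, the Laplacian is integrated by parts through the weak gradient of
  \<open>ps t\<close>.\<close>

lemma classical_imp_weak:
 fixes w :: "real => 'n::finite vec3 => real"
 assumes T: "T > 0" and b: "continuous_on Mfd b" and c: "continuous_on ({0..T} \<times> Mfd) (%(t, m). c t m)"
 and sol: "classical_solution_L T \<nu> b c g w"
 shows "weak_solution_L T \<nu> b c g w"
proof -
 have C: "C12 T w" and eqn: "!!t m. t:{0..<T} ==> m:Mfd ==>
 - time_deriv T w t m - \<nu>^2 / 2 * laplace_beltrami (w t) m + b m \<bullet> grad_M (w t) m + c t m * w t m = 0"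
 and wT: "!!m. m:Mfd ==> w T m = g m"
 using sol unfolding classical_solution_L_def by auto
 note D = C12D[OF C]
 define v where "v = (%t et. LINT m|vol_M. time_deriv T w t m * et m)"
 show ?thesis unfolding weak_solution_L_def
 proof (intro exI[of _ v] conjI allI impI)
 show "L2_Bochner T H1 H1_norm w" by (rule L2_Bochner_C1[OF T C12_C1_grad[OF C] D(1,3)])
 show "L2_Bochner T Hm1 Hm1_norm v" unfolding v_def by (rule L2_Bochner_pairing[OF T D(2)])
 show "weak_time_deriv T w v" unfolding weak_time_deriv_def
 proof (intro allI impI, elim conjE)
 fix ph and et :: "'n vec3 => real" assume ph: "test_function T ph" and et: "et:H1"
 note P = test_function_D[OF ph]
 define G where "G = (%t. LINT m|vol_M. w t m * et m)"
 have G: "(G has_real_derivative v t et) (at t within {0..T})" if "t:{0..T}" for t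
 unfolding G_def v_def by (rule has_derivative_pairing[OF D(1,2,4) H1_L2[OF et] that])
 have Gc: "continuous_on {0..T} G" by (rule DERIV_continuous_on) (rule G)
 have vc: "continuous_on {0..T} (%t. v t et)"
 unfolding continuous_on_iff
 proof (intro ballI allI impI)
 fix t eps :: real assume t: "t:{0..T}" and e: "0 < eps"
 define L where "L = (LINT m|vol_M. \<bar>et m\<bar>)"
 have L: "L >= 0" by (simp add: L_def)
 have "eps / (L + 1) > 0" using e L by simp
 from uniform_in_time[OF D(2) this] obtain dl where dl: "dl > 0"
 "ALL s:{0..T}. ALL t:{0..T}. \<bar>s - t\<bar> < dl --> (ALL m:Mfd. norm (time_deriv T w s m - time_deriv T w t m) < eps / (L + 1))"
 by blast
 have "dist (v s et) (v t et) < eps" if s: "s:{0..T}" "dist s t < dl" for s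
 proof -
 note i = integrable_pairing[OF slice_continuous[OF D(2) s(1)] H1_L2[OF et]]
 integrable_pairing[OF slice_continuous[OF D(2) t] H1_L2[OF et]]
 have "dist (v s et) (v t et) = norm (LINT m|vol_M. time_deriv T w s m * et m - time_deriv T w t m * et m)"
 unfolding v_def dist_norm using i by simp
 also have "... <= (LINT m|vol_M. norm (time_deriv T w s m * et m - time_deriv T w t m * et m))"
 by (rule integral_norm_bound)
 also have "... <= (LINT m|vol_M. eps / (L + 1) * \<bar>et m\<bar>)"
 proof (rule integral_mono)
 show "integrable vol_M (%m. norm (time_deriv T w s m * et m - time_deriv T w t m * et m))" using i by simp
 show "integrable vol_M (%m. eps / (L + 1) * \<bar>et m\<bar>)" using L2_M_D(3)[OF H1_L2[OF et]] by simp
 fix m :: "'n vec3" assume "m:space vol_M"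
 then have "\<bar>time_deriv T w s m - time_deriv T w t m\<bar> <= eps / (L + 1)"
 using dl(2) s t by (simp add: dist_real_def less_imp_le)
 then have "\<bar>time_deriv T w s m - time_deriv T w t m\<bar> * \<bar>et m\<bar> <= eps / (L + 1) * \<bar>et m\<bar>" by (rule mult_right_mono) simp
 then show "norm (time_deriv T w s m * et m - time_deriv T w t m * et m) <= eps / (L + 1) * \<bar>et m\<bar>"
 by (simp only: real_norm_def left_diff_distrib[symmetric] abs_mult)
 qed
 also have "... = eps / (L + 1) * L" by (simp add: L_def)
 also have "... < eps" using e L by (simp add: field_simps)
 finally show ?thesis .
 qed
 then show "EX d>0. ALL x':{0..T}. dist x' t < d --> dist (v x' et) (v t et) < eps" using dl(1) by blast
 qed
 have "((%t. deriv ph t * G t + ph t * v t et) has_integral (ph T * G T - ph 0 * G 0)) {0..T}"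
 proof (rule fundamental_theorem_of_calculus)
 fix x assume x: "x:{0..T}"
 have "((%t. ph t * G t) has_real_derivative deriv ph x * G x + v x et * ph x) (at x within {0..T})"
 by (rule DERIV_mult[OF has_field_derivative_at_within[OF P(1)] G[OF x]])
 then show "((%t. ph t * G t) has_vector_derivative deriv ph x * G x + ph x * v x et) (at x within {0..T})"
 by (simp add: has_real_derivative_iff_has_vector_derivative mult.commute)
 qed (use T in simp)
 then have e1: "integral {0..T} (%t. deriv ph t * G t + ph t * v t et) = 0" using P by (simp add: integral_unique)
 have i: "(%t. deriv ph t * G t) integrable_on {0..T}" "(%t. ph t * v t et) integrable_on {0..T}"
 by (intro integrable_continuous_real continuous_intros P Gc vc)+
 have "integral {0..T} (%t. deriv ph t * G t) = - integral {0..T} (%t. ph t * v t et)"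
 using e1 integral_add[OF i] by simp
 moreover have "(LINT t|lebesgue_on {0..T}. deriv ph t * G t) = integral {0..T} (%t. deriv ph t * G t)"
 by (rule lebesgue_on_integral_eq) (intro continuous_intros P Gc)
 moreover have "(LINT t|lebesgue_on {0..T}. ph t * v t et) = integral {0..T} (%t. ph t * v t et)"
 by (rule lebesgue_on_integral_eq) (intro continuous_intros P vc)
 ultimately show "(LINT t|lebesgue_on {0..T}. deriv ph t * (LINT m|vol_M. w t m * et m)) = - (LINT t|lebesgue_on {0..T}. ph t * v t et)"
 unfolding G_def by simp
 qed
 show "has_terminal_value T w g" unfolding has_terminal_value_def
 proof (intro exI[of _ w] conjI ballI)
 fix t assume t: "t:{0..T}"
 show "w t:L2_M" by (rule continuous_L2_M[OF slice_continuous[OF D(1) t]])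
 have "continuous_on ({0..T} \<times> Mfd) (%x. w t (snd x))"
 by (rule continuous_on_compose2[OF slice_continuous[OF D(1) t]]) (auto intro!: continuous_intros)
 then have "continuous_on {0..T} (%s. LINT m|vol_M. (w s m - w t m)^2)"
 using D(1) by (intro continuous_on_integral) (auto simp: case_prod_unfold intro!: continuous_intros)
 then have "((%s. LINT m|vol_M. (w s m - w t m)^2) \<longlongrightarrow> (LINT m|vol_M. (w t m - w t m)^2)) (at t within {0..T})"
 using t unfolding continuous_on_def by blast
 then have "((%s. sqrt (LINT m|vol_M. (w s m - w t m)^2)) \<longlongrightarrow> sqrt (LINT m|vol_M. (w t m - w t m)^2)) (at t within {0..T})"
 by (rule tendsto_real_sqrt)
 then show "((%s. L2_norm (%m. w s m - w t m)) \<longlongrightarrow> 0) (at t within {0..T})" by (simp add: L2_norm_def)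
 qed (auto simp: wT intro!: AE_I2)
 fix ps :: "real => 'n vec3 => real" assume ps: "L2_Bochner T H1 H1_norm ps"
 have "AE t in lebesgue_on {0..T}. ps t:H1" using ps by (simp add: L2_Bochner_def)
 moreover have "AE t in lebesgue_on {0..T}. t:{0..T}" by (rule AE_I2) simp
 \<comment> \<open>The pointwise equation holds on \<open>[0, T)\<close>; the remaining time is a
   null set.\<close>
 moreover have "AE t in lebesgue_on {0..T}. t \<noteq> T" by (rule AE_lebesgue_on_neq)
 ultimately have "AE t in lebesgue_on {0..T}. - v t (ps t)
 + (LINT m|vol_M. \<nu>^2 / 2 * (weak_grad (w t) m \<bullet> weak_grad (ps t) m)
 + (b m \<bullet> weak_grad (w t) m) * ps t m + c t m * w t m * ps t m) = 0"
 proof eventually_elim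
 case (elim t)
 then have pst: "ps t:H1" and t: "t:{0..T}" and t': "t:{0..<T}" by auto
 define p where "p = ps t"
 have p: "p:H1" "p:L2_M" using pst H1_L2 by (auto simp: p_def)
 define gw where "gw = grad_M (w t)"
 define gp where "gp = weak_grad p"
 have gp: "is_weak_grad p gp" unfolding gp_def by (rule H1_weak_grad[OF p(1)])
 note cw = slice_continuous[OF D(1) t] and cwt = slice_continuous[OF D(2) t] and cg = slice_continuous[OF D(3) t]
 and cc = slice_continuous[OF c t]
 have C1: "C1_M gw" unfolding gw_def by (rule C12_C1_M_grad[OF C t])
 have tan: "!!m. m:Mfd ==> gw m:tangent m" unfolding gw_def by (rule D(6)[OF t])
 have cl: "continuous_on Mfd (div_M gw)" by (rule div_M_continuous[OF C1 tan])
 have i1: "integrable vol_M (%m. gp m \<bullet> gw m)"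
 by (rule integrable_L2_product) (use gp cg in \<open>auto simp: is_weak_grad_def gw_def intro!: continuous_borel_vol_M integrable_continuous_vol_M continuous_intros\<close>)
 have i2: "integrable vol_M (%m. (b m \<bullet> gw m) * p m)" "integrable vol_M (%m. (c t m * w t m) * p m)"
 "integrable vol_M (%m. time_deriv T w t m * p m)" "integrable vol_M (%m. div_M gw m * p m)"
 by (rule integrable_pairing[OF _ p(2)], intro continuous_intros b cc cw cwt cl cg[folded gw_def])+
 have ae: "AE m in vol_M. weak_grad (w t) m = gw m" unfolding gw_def by (rule C1_grad_H1(2)[OF C12_C1_grad[OF C t]])
 have wg: "weak_grad (w t):borel_measurable vol_M"
 using H1_weak_grad[OF C1_grad_H1(1)[OF C12_C1_grad[OF C t]]] by (simp add: is_weak_grad_def)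
 have gwm: "gw:borel_measurable vol_M" "b:borel_measurable vol_M" "c t:borel_measurable vol_M" "w t:borel_measurable vol_M"
 using cg b cc cw by (auto simp: gw_def intro: continuous_borel_vol_M)
 have gpm: "gp:borel_measurable vol_M" "p:borel_measurable vol_M" using gp p L2_M_D(1) by (auto simp: is_weak_grad_def)
 have "(LINT m|vol_M. \<nu>^2 / 2 * (weak_grad (w t) m \<bullet> gp m) + (b m \<bullet> weak_grad (w t) m) * p m + c t m * w t m * p m)
 = (LINT m|vol_M. \<nu>^2 / 2 * (gp m \<bullet> gw m) + (b m \<bullet> gw m) * p m + c t m * w t m * p m)"
 proof (rule integral_cong_AE)
 show "AE m in vol_M. \<nu>^2 / 2 * (weak_grad (w t) m \<bullet> gp m) + (b m \<bullet> weak_grad (w t) m) * p m + c t m * w t m * p m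
 = \<nu>^2 / 2 * (gp m \<bullet> gw m) + (b m \<bullet> gw m) * p m + c t m * w t m * p m"
 using ae by eventually_elim (simp add: inner_commute)
 qed (use wg gwm gpm in \<open>auto intro!: borel_measurable_add borel_measurable_times borel_measurable_inner\<close>)
 also have "... = \<nu>^2 / 2 * (LINT m|vol_M. gp m \<bullet> gw m) + (LINT m|vol_M. (b m \<bullet> gw m) * p m) + (LINT m|vol_M. c t m * w t m * p m)"
 using i1 i2 by simp
 \<comment> \<open>The defining property of the weak gradient of \<open>p\<close>, with the
   tangential \<open>C^1\<close> field \<open>grad_M (w t)\<close> as test field.\<close>
 also have "(LINT m|vol_M. gp m \<bullet> gw m) = - (LINT m|vol_M. p m * div_M gw m)"
 using gp C1 tan unfolding is_weak_grad_def by blast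
 finally have e: "(LINT m|vol_M. \<nu>^2 / 2 * (weak_grad (w t) m \<bullet> gp m) + (b m \<bullet> weak_grad (w t) m) * p m + c t m * w t m * p m)
 = \<nu>^2 / 2 * - (LINT m|vol_M. div_M gw m * p m) + (LINT m|vol_M. (b m \<bullet> gw m) * p m) + (LINT m|vol_M. c t m * w t m * p m)"
 by (simp add: mult.commute)
 have "0 = (LINT m|vol_M. (- time_deriv T w t m - \<nu>^2 / 2 * div_M gw m + b m \<bullet> gw m + c t m * w t m) * p m)"
 by (subst Bochner_Integration.integral_cong[OF refl, of _ _ "%m. 0"])
 (use eqn[OF t'] in \<open>auto simp: gw_def laplace_beltrami_def\<close>)
 also have "... = (LINT m|vol_M. - (time_deriv T w t m * p m) - \<nu>^2 / 2 * (div_M gw m * p m) + (b m \<bullet> gw m) * p m + c t m * w t m * p m)"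
 by (rule Bochner_Integration.integral_cong[OF refl]) (simp add: algebra_simps)
 also have "... = - (LINT m|vol_M. time_deriv T w t m * p m) - \<nu>^2 / 2 * (LINT m|vol_M. div_M gw m * p m)
 + (LINT m|vol_M. (b m \<bullet> gw m) * p m) + (LINT m|vol_M. c t m * w t m * p m)"
 using i2 by simp
 finally show ?case using e unfolding v_def p_def gp_def by simp
 qed
 then show "(LINT t|lebesgue_on {0..T}. - v t (ps t)
 + (LINT m|vol_M. \<nu>^2 / 2 * (weak_grad (w t) m \<bullet> weak_grad (ps t) m)
 + (b m \<bullet> weak_grad (w t) m) * ps t m + c t m * w t m * ps t m)) = 0"
 by (rule integral_eq_zero_AE)
 qed
qed

subsection \<open>Uniqueness of weak solutions by duality\<close>

text \<open>The formal \<open>L^2\<close> adjoint of the spatial operator in the linear equation;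
  the drift turns into a divergence, because \<open>b\<close> need not be divergence free.\<close>

definition adjoint_L ::
 "real => ('n::finite vec3 => 'n vec3) => (real => 'n vec3 => real) => real => ('n vec3 => real) => 'n vec3 => real" where
 "adjoint_L \<nu> b c t et m =
 - (\<nu>^2 / 2) * laplace_beltrami et m - div_M (%x. et x *\<^sub>R b x) m + c t m * et m"

definition L2_continuous :: "real => (real => 'n::finite vec3 => real) => bool" where
 "L2_continuous T u \<longleftrightarrow> (ALL t:{0..T}. u t:L2_M) &
 (ALL t:{0..T}. ((%s. L2_norm (%m. u s m - u t m)) \<longlongrightarrow> 0) (at t within {0..T}))"

lemma L2_M_diff: "f:L2_M ==> g:L2_M ==> (%m. f m - g m):L2_M"
proof -
 assume f: "f:L2_M" and g: "g:L2_M"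
 note i = L2_M_D[OF f] L2_M_D[OF g]
 have "integrable vol_M (%m. f m \<bullet> g m)" by (rule integrable_L2_product) (use i in auto)
 then have "integrable vol_M (%m. (f m)^2 + (g m)^2 - 2 * (f m * g m))" using i by simp
 then have "integrable vol_M (%m. (f m - g m)^2)" by (simp add: power2_diff mult.assoc algebra_simps)
 then show ?thesis using i by (simp add: L2_M_def)
qed

lemma pairing_diff:
 assumes "f:L2_M" "continuous_on Mfd r" "g:L2_M" "continuous_on Mfd q"
 shows "(LINT m|vol_M. f m * r m) - (LINT m|vol_M. g m * q m) = (LINT m|vol_M. f m * r m - g m * q m)"
 by (rule Bochner_Integration.integral_diff[symmetric])
 (use integrable_pairing[OF assms(2,1)] integrable_pairing[OF assms(4,3)] in \<open>simp_all add: mult.commute\<close>)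

text \<open>The second factor may vary with \<open>s\<close> and need only be bounded, so that
  difference quotients can be inserted for it.\<close>

lemma L2_continuous_pairing_tendsto:
 fixes u :: "real => 'n::finite vec3 => real"
 assumes u: "L2_continuous T u" and t: "t:{0..T}" and K: "K > 0"
 and S: "S \<subseteq> {0..T}" and q: "!!s. s:S ==> continuous_on Mfd (q s)" "!!s m. s:S ==> m:Mfd ==> \<bar>q s m\<bar> <= K"
 shows "((%s. LINT m|vol_M. (u s m - u t m) * q s m) \<longlongrightarrow> 0) (at t within S)"
proof (rule Lim_null_comparison)
 have uL: "u s:L2_M" if "s:{0..T}" for s using u that by (simp add: L2_continuous_def)
 have "((%s. L2_norm (%m. u s m - u t m)) \<longlongrightarrow> 0) (at t within {0..T})" using u t by (simp add: L2_continuous_def)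
 then have "((%s. L2_norm (%m. u s m - u t m)) \<longlongrightarrow> 0) (at t within S)" by (rule tendsto_within_subset[OF _ S])
 from tendsto_mult_left_zero[OF this, of "K * (1 + vol TYPE('n))"]
 show "((%s. L2_norm (%m. u s m - u t m) * (K * (1 + vol TYPE('n)))) \<longlongrightarrow> 0) (at t within S)" .
 have "\<bar>LINT m|vol_M. (u s m - u t m) * q s m\<bar> <= L2_norm (%m. u s m - u t m) * (K * (1 + vol TYPE('n)))" if s: "s:S" for s
 by (rule pairing_le[OF q(1)[OF s] q(2)[OF s] K L2_M_diff[OF uL uL[OF t]]]) (use s S in auto)
 then show "\<forall>\<^sub>F s in at t within S. norm (LINT m|vol_M. (u s m - u t m) * q s m) <= L2_norm (%m. u s m - u t m) * (K * (1 + vol TYPE('n)))"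
 by (simp add: eventually_at_filter)
qed

lemma L2_continuous_pairing_continuous:
 fixes u :: "real => 'n::finite vec3 => real"
 assumes u: "L2_continuous T u" and r: "continuous_on ({0..T} \<times> Mfd) (%(t, m). r t m)"
 shows "continuous_on {0..T} (%t. LINT m|vol_M. u t m * r t m)"
 unfolding continuous_on_def
proof
 fix t assume t: "t:{0..T}"
 have uL: "u s:L2_M" if "s:{0..T}" for s using u that by (simp add: L2_continuous_def)
 obtain K where K: "K >= 0" "ALL t:{0..T}. ALL m:Mfd. norm (r t m) <= K" using bounded_on_cylinder[OF r] by blast
 have 1: "((%s. LINT m|vol_M. (u s m - u t m) * r s m) \<longlongrightarrow> 0) (at t within {0..T})"
 by (rule L2_continuous_pairing_tendsto[OF u t, of "K + 1"])
 (use K slice_continuous[OF r] in \<open>auto simp: add_increasing2\<close>)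
 have 2: "((%s. LINT m|vol_M. u t m * (r s m - r t m)) \<longlongrightarrow> 0) (at t within {0..T})"
 proof (rule tendstoI)
 fix eps :: real assume e: "eps > 0"
 define L where "L = L2_norm (u t) * (1 + vol TYPE('n))"
 have L: "L >= 0" using vol_nonneg[where 'n='n] by (simp add: L_def L2_norm_def)
 have e': "eps / (L + 1) > 0" using e L by simp
 obtain dl where dl: "dl > 0" "ALL s:{0..T}. ALL t:{0..T}. \<bar>s - t\<bar> < dl --> (ALL m:Mfd. norm (r s m - r t m) < eps / (L + 1))"
 using uniform_in_time[OF r e'] by blast
 have "dist (LINT m|vol_M. u t m * (r s m - r t m)) 0 < eps" if s: "s:{0..T}" "dist s t < dl" for s
 proof -
 have c: "continuous_on Mfd (%m. r s m - r t m)" by (intro continuous_intros slice_continuous[OF r] s t)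
 have "\<bar>LINT m|vol_M. u t m * (r s m - r t m)\<bar> <= L2_norm (u t) * (eps / (L + 1) * (1 + vol TYPE('n)))"
 by (rule pairing_le[OF c _ e' uL[OF t]]) (use dl(2) s t in \<open>auto simp: dist_real_def less_imp_le\<close>)
 also have "... = eps / (L + 1) * L" by (simp add: L_def)
 also have "... < eps" using e L by (simp add: field_simps)
 finally show ?thesis by simp
 qed
 then show "\<forall>\<^sub>F s in at t within {0..T}. dist (LINT m|vol_M. u t m * (r s m - r t m)) 0 < eps"
 unfolding eventually_at using dl(1) by blast
 qed
 have "((%s. (LINT m|vol_M. (u s m - u t m) * r s m) + (LINT m|vol_M. u t m * (r s m - r t m)) + (LINT m|vol_M. u t m * r t m))
 \<longlongrightarrow> 0 + 0 + (LINT m|vol_M. u t m * r t m)) (at t within {0..T})"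
 by (intro tendsto_add 1 2 tendsto_const)
 moreover have "(LINT m|vol_M. (u s m - u t m) * r s m) + (LINT m|vol_M. u t m * (r s m - r t m)) + (LINT m|vol_M. u t m * r t m)
 = (LINT m|vol_M. u s m * r s m)" if s: "s:{0..T}" for s
 proof -
 note i = integrable_pairing[OF slice_continuous[OF r s] uL[OF s]] integrable_pairing[OF slice_continuous[OF r s] uL[OF t]]
 integrable_pairing[OF slice_continuous[OF r t] uL[OF t]]
 have "(LINT m|vol_M. (u s m - u t m) * r s m) = (LINT m|vol_M. r s m * u s m) - (LINT m|vol_M. r s m * u t m)"
 using i by (subst Bochner_Integration.integral_diff[symmetric]) (auto simp: algebra_simps)
 moreover have "(LINT m|vol_M. u t m * (r s m - r t m)) = (LINT m|vol_M. r s m * u t m) - (LINT m|vol_M. r t m * u t m)"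
 using i by (subst Bochner_Integration.integral_diff[symmetric]) (auto simp: algebra_simps)
 ultimately show ?thesis by (simp add: mult.commute)
 qed
 ultimately show "((%s. LINT m|vol_M. u s m * r s m) \<longlongrightarrow> (LINT m|vol_M. u t m * r t m)) (at t within {0..T})"
 using t by (auto elim!: Lim_transform_eventually simp: eventually_at_filter)
qed

lemma scaleR_field_C1:
 assumes et: "C1_grad et g" and b: "C1_M b" "!!m. m:Mfd ==> b m:tangent m"
 shows "C1_M (%x. et x *\<^sub>R b x)" "!!m. m:Mfd ==> et m *\<^sub>R b m:tangent m"
proof -
 obtain b' where b': "!!m. m:Mfd ==> (b has_derivative b' m) (at m within Mfd)" "!!e. continuous_on Mfd (%m. b' m e)"
 "continuous_on Mfd b" "!!a. continuous_on Mfd (%m. b' m (xi a m))" by (rule C1_M_D[OF b(1)]) (rule that; assumption)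
 have g: "continuous_on Mfd g" "!!m. m:Mfd ==> (et has_derivative (%v. g m \<bullet> v)) (at m within Mfd)"
 using et by (auto simp: C1_grad_def)
 show "C1_M (%x. et x *\<^sub>R b x)"
 proof (rule C1_MI)
 fix m :: "'a vec3" assume m: "m:Mfd"
 show "((%x. et x *\<^sub>R b x) has_derivative (%v. et m *\<^sub>R b' m v + (g m \<bullet> v) *\<^sub>R b m)) (at m within Mfd)"
 by (rule has_derivative_scaleR[OF g(2)[OF m] b'(1)[OF m]])
 next
 fix e show "continuous_on Mfd (%m. et m *\<^sub>R b' m e + (g m \<bullet> e) *\<^sub>R b m)"
 by (intro continuous_intros b' g C1_grad_continuous[OF et])
 qed
 show "!!m. m:Mfd ==> et m *\<^sub>R b m:tangent m" using b(2) by (simp add: subspace_scale[OF subspace_tangent])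
qed

lemma laplace_C1_grad:
 assumes et: "C1_grad et g" "C1_M g" and m: "m:Mfd"
 shows "laplace_beltrami et m = div_M g m"
proof -
 obtain g' where g': "!!m. m:Mfd ==> (g has_derivative g' m) (at m within Mfd)" "!!e. continuous_on Mfd (%m. g' m e)"
 "continuous_on Mfd g" "!!a. continuous_on Mfd (%m. g' m (xi a m))" by (rule C1_M_D[OF et(2)]) (rule that; assumption)
 have eq: "grad_M et x = g x" if "x:Mfd" for x
 by (rule grad_M_eqI) (use et(1) that in \<open>auto simp: C1_grad_def\<close>)
 have "(grad_M et has_derivative g' m) (at m within Mfd)"
 by (rule has_derivative_transform[OF m _ g'(1)[OF m]]) (rule eq)
 from div_M_eq[OF this m] div_M_eq[OF g'(1)[OF m] m] show ?thesis by (simp add: laplace_beltrami_def)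
qed

lemma adjoint_continuous:
 assumes et: "C1_grad et g" "C1_M g" and b: "C1_M b" "!!m. m:Mfd ==> b m:tangent m"
 shows "continuous_on Mfd (laplace_beltrami et)" "continuous_on Mfd (div_M (%x. et x *\<^sub>R b x))"
proof -
 have "continuous_on Mfd (div_M g)" by (rule div_M_continuous) (use et in \<open>auto simp: C1_grad_def\<close>)
 then show "continuous_on Mfd (laplace_beltrami et)"
 by (rule continuous_on_eq) (simp add: laplace_C1_grad[OF et])
 show "continuous_on Mfd (div_M (%x. et x *\<^sub>R b x))" by (rule div_M_continuous[OF scaleR_field_C1[OF et(1) b]])
qed

text \<open>Measurability comes from the almost everywhere limit of simple functions, integrability
  from \<open>y <= y^2 + 1\<close>, as the Bochner condition controls the square of the dual
  norm.\<close>

lemma L2_Bochner_Hm1_pairing: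
 assumes v: "L2_Bochner T Hm1 Hm1_norm v" and et: "C1_grad et g"
 shows "integrable (lebesgue_on {0..T}) (%t. v t et)"
proof -
 obtain s where s: "!!n. simple_function (lebesgue_on {0..T}) (s n)" "!!n t. t:{0..T} ==> s n t:Hm1"
 "AE t in lebesgue_on {0..T}. (%n. Hm1_norm (%x. s n t x - v t x)) \<longlonglongrightarrow> 0"
 using v unfolding L2_Bochner_def by blast
 have vH: "AE t in lebesgue_on {0..T}. v t:Hm1" and vi: "integrable (lebesgue_on {0..T}) (%t. (Hm1_norm (v t))^2)"
 using v by (auto simp: L2_Bochner_def)
 have inT: "AE t in lebesgue_on {0..T}. t:{0..T}" by (rule AE_I2) simp
 have sm: "(%t. s n t et):borel_measurable (lebesgue_on {0..T})" for n
 by (rule borel_measurable_simple_function, rule simple_function_compose1[OF s(1), of "%F. F et"])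
 have lim: "AE t in lebesgue_on {0..T}. (%n. s n t et) \<longlonglongrightarrow> v t et"
 using s(3) vH inT
 proof eventually_elim
 case (elim t)
 have "(%n. s n t et - v t et) \<longlonglongrightarrow> 0"
 proof (rule Lim_null_comparison)
 show "\<forall>\<^sub>F n in sequentially. norm (s n t et - v t et) <= Hm1_norm (%x. s n t x - v t x) * H1_norm et"
 using Hm1_pairing_le[OF Hm1_diff[OF s(2)[OF elim(3)] elim(2)] et] by (intro always_eventually allI) simp
 show "(%n. Hm1_norm (%x. s n t x - v t x) * H1_norm et) \<longlonglongrightarrow> 0" by (rule tendsto_mult_left_zero[OF elim(1)])
 qed
 then show ?case by (rule LIM_zero_cancel)
 qed
 have "(%t. lim (%n. s n t et)):borel_measurable (lebesgue_on {0..T})"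
 by (rule borel_measurable_lim_metric) (rule sm)
 moreover have "AE t in lebesgue_on {0..T}. lim (%n. s n t et) = v t et"
 using lim by eventually_elim (rule limI)
 ultimately have vm: "(%t. v t et):borel_measurable (lebesgue_on {0..T})"
 by (rule borel_measurable_lebesgue_on_AE[rotated]) simp
 show ?thesis
 proof (rule Bochner_Integration.integrable_bound[OF _ vm])
 have "integrable (lebesgue_on {0..T}) (%t. 1 :: real)" by (rule continuous_imp_integrable_real) simp
 then show "integrable (lebesgue_on {0..T}) (%t. ((Hm1_norm (v t))^2 + 1) * H1_norm et)"
 by (rule integrable_mult_left[OF Bochner_Integration.integrable_add[OF vi]])
 show "AE t in lebesgue_on {0..T}. norm (v t et) <= norm (((Hm1_norm (v t))^2 + 1) * H1_norm et)"
 using vH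
 proof eventually_elim
 case (elim t)
 have n: "0 <= H1_norm et" by (simp add: H1_norm_def)
 have "0 <= (Hm1_norm (v t) - 1)^2" by simp
 moreover have "0 <= (Hm1_norm (v t))^2" by simp
 ultimately have "Hm1_norm (v t) <= (Hm1_norm (v t))^2 + 1" unfolding power2_diff one_power2 by linarith
 then have "Hm1_norm (v t) * H1_norm et <= ((Hm1_norm (v t))^2 + 1) * H1_norm et" by (rule mult_right_mono[OF _ n])
 then show ?case using Hm1_pairing_le[OF elim et] by simp
 qed
 qed
qed

text \<open>Testing with \<open>ph t * et m\<close> identifies the pairing of \<open>w\<close> with
  the adjoint of \<open>et\<close> as the distributional derivative of the pairing with
  \<open>et\<close>. For the continuous representative \<open>u\<close> both are continuous, so
  \<open>du_Bois_Reymond\<close> makes the derivative classical, up to the endpoint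
  \<open>T\<close>.\<close>

lemma weak_solution_pairing:
 fixes w :: "real => 'n::finite vec3 => real"
 assumes T: "T > 0" and b: "C1_M b" "!!m. m:Mfd ==> b m:tangent m"
 and c: "continuous_on ({0..T} \<times> Mfd) (%(t, m). c t m)"
 and sol: "weak_solution_L T \<nu> b c g w"
 obtains u where "L2_continuous T u" "AE t in lebesgue_on {0..T}. AE m in vol_M. u t m = w t m"
 "AE m in vol_M. u T m = g m"
 "!!et k t. C1_grad et k ==> C1_M k ==> t:{0..T} ==>
 ((%t. LINT m|vol_M. u t m * et m) has_real_derivative (LINT m|vol_M. u t m * adjoint_L \<nu> b c t et m)) (at t within {0..T})"
proof -
 obtain v where v: "L2_Bochner T H1 H1_norm w" "L2_Bochner T Hm1 Hm1_norm v" "weak_time_deriv T w v" "has_terminal_value T w g"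
 and weak: "!!ps. L2_Bochner T H1 H1_norm ps ==> (LINT t|lebesgue_on {0..T}. - v t (ps t)
 + (LINT m|vol_M. \<nu>^2 / 2 * (weak_grad (w t) m \<bullet> weak_grad (ps t) m)
 + (b m \<bullet> weak_grad (w t) m) * ps t m + c t m * w t m * ps t m)) = 0"
 using sol unfolding weak_solution_L_def by (elim exE conjE) simp
 obtain u where u: "L2_continuous T u" "AE t in lebesgue_on {0..T}. AE m in vol_M. u t m = w t m" "AE m in vol_M. u T m = g m"
 using v(4) unfolding has_terminal_value_def L2_continuous_def by blast
 have uL: "u s:L2_M" if "s:{0..T}" for s using u(1) that by (simp add: L2_continuous_def)
 have wH: "AE t in lebesgue_on {0..T}. w t:H1" and vH: "AE t in lebesgue_on {0..T}. v t:Hm1"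
 using v by (auto simp: L2_Bochner_def)
 have inT: "AE t in lebesgue_on {0..T}. t:{0..T}" by (rule AE_I2) simp
 obtain b' where b': "!!m. m:Mfd ==> (b has_derivative b' m) (at m within Mfd)" "!!e. continuous_on Mfd (%m. b' m e)"
 "continuous_on Mfd b" "!!a. continuous_on Mfd (%m. b' m (xi a m))" by (rule C1_M_D[OF b(1)]) (rule that; assumption)
 show ?thesis
 proof (rule that[OF u])
 fix et :: "'n vec3 => real" and k t
 assume et: "C1_grad et k" "C1_M k" and t: "t:{0..T}"
 note etc = C1_grad_continuous[OF et(1)]
 have kc: "continuous_on Mfd k" and kt: "!!m. m:Mfd ==> k m:tangent m" using et(1) by (auto simp: C1_grad_def)
 note ac = adjoint_continuous[OF et b]
 define A where "A = (%t m. adjoint_L \<nu> b c t et m)"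
 have snd_c: "continuous_on ({0..T} \<times> Mfd) (%x. f (snd x))" if "continuous_on Mfd f" for f :: "'n vec3 => real"
 by (rule continuous_on_compose2[OF that]) (auto intro!: continuous_intros)
 have Ac: "continuous_on ({0..T} \<times> Mfd) (%(t, m). A t m)"
 using c snd_c[OF ac(1)] snd_c[OF ac(2)] snd_c[OF etc]
 unfolding A_def adjoint_L_def case_prod_unfold by (intro continuous_intros)
 define G where "G = (%t. LINT m|vol_M. u t m * et m)"
 define K where "K = (%t. LINT m|vol_M. u t m * A t m)"
 have Gc: "continuous_on {0..T} G" unfolding G_def
 by (rule L2_continuous_pairing_continuous[OF u(1)]) (use snd_c[OF etc] in \<open>simp add: case_prod_unfold\<close>)
 have Kc: "continuous_on {0..T} K" unfolding K_def by (rule L2_continuous_pairing_continuous[OF u(1) Ac])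
 have vi: "integrable (lebesgue_on {0..T}) (%t. v t et)" by (rule L2_Bochner_Hm1_pairing[OF v(2) et(1)])
 have "(G has_real_derivative K t) (at t within {0..T})"
 proof (rule du_Bois_Reymond[OF T Gc Kc _ t])
 fix ph assume ph: "test_function T ph"
 note P = test_function_D[OF ph]
 define ps where "ps = (%t m. ph t * et m)"
 have fst_c: "continuous_on ({0..T} \<times> Mfd) (%x :: real \<times> 'n vec3. ph (fst x))"
 by (rule continuous_on_compose2[OF P(2)[of UNIV]]) (auto intro!: continuous_intros)
 have kc2: "continuous_on ({0..T} \<times> Mfd) (%x :: real \<times> 'n vec3. k (snd x))"
 by (rule continuous_on_compose2[OF kc]) (auto intro!: continuous_intros)
 have ps: "L2_Bochner T H1 H1_norm ps"
 unfolding ps_def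
 by (rule L2_Bochner_C1[OF T C1_grad_scale[OF et(1)]])
 (use fst_c snd_c[OF etc] kc2 in \<open>auto simp: case_prod_unfold intro!: continuous_intros\<close>)
 have ae: "AE t in lebesgue_on {0..T}. - (ph t * v t et) + ph t * K t = - v t (ps t)
 + (LINT m|vol_M. \<nu>^2 / 2 * (weak_grad (w t) m \<bullet> weak_grad (ps t) m)
 + (b m \<bullet> weak_grad (w t) m) * ps t m + c t m * w t m * ps t m)"
 using wH vH inT u(2)
 proof eventually_elim
 case (elim t)
 define q where "q = weak_grad (w t)"
 have q: "is_weak_grad (w t) q" unfolding q_def by (rule H1_weak_grad[OF elim(1)])
 have qm: "q:borel_measurable vol_M" using q by (simp add: is_weak_grad_def)
 note wL = H1_L2[OF elim(1)]
 note cc = slice_continuous[OF c elim(3)]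
 have iq: "integrable vol_M (%m. q m \<bullet> X m)" if "continuous_on Mfd X" for X
 by (rule integrable_L2_product)
 (use q that in \<open>auto simp: is_weak_grad_def intro!: continuous_borel_vol_M integrable_continuous_vol_M continuous_intros\<close>)
 note i = iq[OF kc] iq[OF continuous_on_scaleR[OF etc b'(3)]] integrable_pairing[OF continuous_on_mult[OF cc etc] wL]
 have ae1: "AE m in vol_M. weak_grad (ps t) m = ph t *\<^sub>R k m"
 unfolding ps_def by (rule C1_grad_H1(2)[OF C1_grad_scale[OF et(1)]])
 have wgm: "weak_grad (ps t):borel_measurable vol_M"
 using H1_weak_grad[OF C1_grad_H1(1)[OF C1_grad_scale[OF et(1), of "ph t"]]] by (simp add: is_weak_grad_def ps_def)
 have mm: "b:borel_measurable vol_M" "c t:borel_measurable vol_M" "et:borel_measurable vol_M" "k:borel_measurable vol_M"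
 "w t:borel_measurable vol_M"
 using b'(3) cc etc kc L2_M_D(1)[OF wL] by (auto intro: continuous_borel_vol_M)
 have "(LINT m|vol_M. \<nu>^2 / 2 * (q m \<bullet> weak_grad (ps t) m) + (b m \<bullet> q m) * ps t m + c t m * w t m * ps t m)
 = (LINT m|vol_M. ph t * (\<nu>^2 / 2 * (q m \<bullet> k m) + q m \<bullet> (et m *\<^sub>R b m) + (c t m * et m) * w t m))"
 proof (rule integral_cong_AE)
 show "AE m in vol_M. \<nu>^2 / 2 * (q m \<bullet> weak_grad (ps t) m) + (b m \<bullet> q m) * ps t m + c t m * w t m * ps t m
 = ph t * (\<nu>^2 / 2 * (q m \<bullet> k m) + q m \<bullet> (et m *\<^sub>R b m) + (c t m * et m) * w t m)"
 using ae1 by eventually_elim (simp add: ps_def algebra_simps inner_commute[of "b _"])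
 qed (use qm wgm mm in \<open>auto simp: ps_def intro!: borel_measurable_add borel_measurable_times borel_measurable_inner borel_measurable_scaleR\<close>)
 also have "... = ph t * (\<nu>^2 / 2 * (LINT m|vol_M. q m \<bullet> k m) + (LINT m|vol_M. q m \<bullet> (et m *\<^sub>R b m)) + (LINT m|vol_M. (c t m * et m) * w t m))"
 using i by simp
 \<comment> \<open>Both derivative terms are moved to \<open>et\<close>: the weak gradient is tested
   with \<open>k\<close> and with the product of \<open>et\<close> and \<open>b\<close>.\<close>
 also have "(LINT m|vol_M. q m \<bullet> k m) = - (LINT m|vol_M. w t m * div_M k m)"
 using q et(2) kt unfolding is_weak_grad_def by blast
 also have "(LINT m|vol_M. q m \<bullet> (et m *\<^sub>R b m)) = - (LINT m|vol_M. w t m * div_M (%m. et m *\<^sub>R b m) m)"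
 using q scaleR_field_C1[OF et(1) b] unfolding is_weak_grad_def by blast
 also have "(LINT m|vol_M. w t m * div_M k m) = (LINT m|vol_M. laplace_beltrami et m * w t m)"
 by (rule Bochner_Integration.integral_cong[OF refl]) (simp add: laplace_C1_grad[OF et])
 finally have e1: "(LINT m|vol_M. \<nu>^2 / 2 * (q m \<bullet> weak_grad (ps t) m) + (b m \<bullet> q m) * ps t m + c t m * w t m * ps t m)
 = ph t * (\<nu>^2 / 2 * - (LINT m|vol_M. laplace_beltrami et m * w t m) + - (LINT m|vol_M. div_M (%m. et m *\<^sub>R b m) m * w t m)
 + (LINT m|vol_M. (c t m * et m) * w t m))" by (simp add: mult.commute)
 note i' = integrable_pairing[OF ac(1) wL] integrable_pairing[OF ac(2) wL] i(3)
 have "K t = (LINT m|vol_M. w t m * A t m)"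
 unfolding K_def
 proof (rule integral_cong_AE)
 show "AE m in vol_M. u t m * A t m = w t m * A t m" using elim(4) by eventually_elim simp
 qed (use L2_M_D(1)[OF uL[OF elim(3)]] mm continuous_borel_vol_M[OF slice_continuous[OF Ac elim(3)]] in \<open>auto intro: borel_measurable_times\<close>)
 also have "... = (LINT m|vol_M. - (\<nu>^2 / 2) * (laplace_beltrami et m * w t m) - div_M (%m. et m *\<^sub>R b m) m * w t m + (c t m * et m) * w t m)"
 by (rule Bochner_Integration.integral_cong[OF refl]) (simp add: A_def adjoint_L_def algebra_simps)
 also have "... = - (\<nu>^2 / 2) * (LINT m|vol_M. laplace_beltrami et m * w t m) - (LINT m|vol_M. div_M (%m. et m *\<^sub>R b m) m * w t m)
 + (LINT m|vol_M. (c t m * et m) * w t m)"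
 using i' by simp
 finally have e2: "K t = ..." .
 have e3: "v t (ps t) = ph t * v t et" unfolding ps_def by (rule Hm1_scale[OF elim(2) C1_grad_H1(1)[OF et(1)]])
 show ?case unfolding e3 e1[unfolded q_def] e2 by simp
 qed
 obtain B where B: "B >= 0" "!!t. t:{0..T} ==> \<bar>ph t\<bar> <= B"
 proof -
 have "bounded (ph ` {0..T})" by (intro compact_imp_bounded compact_continuous_image P) simp
 then obtain B where "ALL x:ph ` {0..T}. norm x <= B" using bounded_iff by metis
 then show ?thesis by (intro that[of "max B 0"]) (auto simp: le_max_iff_disj)
 qed
 have phm: "ph:borel_measurable (lebesgue_on {0..T})"
 by (rule borel_measurable_integrable[OF continuous_imp_integrable_real[OF P(2)]])
 have i1: "integrable (lebesgue_on {0..T}) (%t. ph t * v t et)"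
 proof (rule Bochner_Integration.integrable_bound)
 show "integrable (lebesgue_on {0..T}) (%t. B * \<bar>v t et\<bar>)" using vi by simp
 show "(%t. ph t * v t et):borel_measurable (lebesgue_on {0..T})"
 by (rule borel_measurable_times[OF phm borel_measurable_integrable[OF vi]])
 show "AE t in lebesgue_on {0..T}. norm (ph t * v t et) <= norm (B * \<bar>v t et\<bar>)"
 by (rule AE_I2) (use B in \<open>auto simp: abs_mult intro!: mult_right_mono\<close>)
 qed
 have i2: "integrable (lebesgue_on {0..T}) (%t. ph t * K t)"
 by (intro continuous_imp_integrable_real continuous_intros P Kc)
 \<comment> \<open>Measurability of the integrand in the weak formulation is not given; it is
   inherited from this side of the almost everywhere equality.\<close>
 have "(%t. - (ph t * v t et) + ph t * K t):borel_measurable (lebesgue_on {0..T})" using i1 i2 by auto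
 from integral_lebesgue_on_cong_AE[OF this ae] weak[OF ps]
 have "(LINT t|lebesgue_on {0..T}. - (ph t * v t et) + ph t * K t) = 0" by simp
 then have e: "(LINT t|lebesgue_on {0..T}. ph t * K t) = (LINT t|lebesgue_on {0..T}. ph t * v t et)" using i1 i2 by simp
 have iG: "integrable (lebesgue_on {0..T}) (%t. deriv ph t * G t)"
 by (intro continuous_imp_integrable_real continuous_intros P Gc)
 have "(LINT t|lebesgue_on {0..T}. deriv ph t * G t) = (LINT t|lebesgue_on {0..T}. deriv ph t * (LINT m|vol_M. w t m * et m))"
 proof (rule integral_lebesgue_on_cong_AE[OF borel_measurable_integrable[OF iG]])
 show "AE t in lebesgue_on {0..T}. deriv ph t * G t = deriv ph t * (LINT m|vol_M. w t m * et m)"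
 using u(2) inT wH
 proof eventually_elim
 case (elim t)
 have "G t = (LINT m|vol_M. w t m * et m)" unfolding G_def
 proof (rule integral_cong_AE)
 show "AE m in vol_M. u t m * et m = w t m * et m" using elim(1) by eventually_elim simp
 qed (use L2_M_D(1)[OF uL[OF elim(2)]] L2_M_D(1)[OF H1_L2[OF elim(3)]] continuous_borel_vol_M[OF etc] in auto)
 then show ?case by simp
 qed
 qed
 also have "... = - (LINT t|lebesgue_on {0..T}. ph t * v t et)"
 using v(3) ph C1_grad_H1(1)[OF et(1)] unfolding weak_time_deriv_def by blast
 finally show "(LINT t|lebesgue_on {0..T}. deriv ph t * G t) = - (LINT t|lebesgue_on {0..T}. ph t * K t)" by (simp add: e)
 qed
 then show "((%t. LINT m|vol_M. u t m * et m) has_real_derivative (LINT m|vol_M. u t m * adjoint_L \<nu> b c t et m)) (at t within {0..T})"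
 unfolding G_def K_def A_def .
 qed
qed

text \<open>This problem runs forward from \<open>s0\<close>, whereas the linear equation runs
  backward from \<open>T\<close>; with these signs the pairing of the two solutions is constant in
  time.\<close>

definition adjoint_solution ::
 "real => real => ('n::finite vec3 => 'n vec3) => (real => 'n vec3 => real) => real => (real => 'n vec3 => real) => bool" where
 "adjoint_solution T \<nu> b c s0 ph \<longleftrightarrow>
 continuous_on ({s0..T} \<times> Mfd) (%(t, m). ph t m) &
 continuous_on ({s0..T} \<times> Mfd) (%(t, m). adjoint_L \<nu> b c t (ph t) m) &
 (ALL t:{s0..T}. EX k. C1_grad (ph t) k & C1_M k) &
 (ALL t:{s0..T}. ALL m:Mfd. ((%s. ph s m) has_real_derivative - adjoint_L \<nu> b c t (ph t) m) (at t within {s0..T}))"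

lemma adjoint_pairing_constant:
 fixes u :: "real => 'n::finite vec3 => real"
 assumes u: "L2_continuous T u"
 and d: "!!et k t. C1_grad et k ==> C1_M k ==> t:{0..T} ==>
 ((%t. LINT m|vol_M. u t m * et m) has_real_derivative (LINT m|vol_M. u t m * adjoint_L \<nu> b c t et m)) (at t within {0..T})"
 and s0: "0 <= s0" "s0 < T" and ph: "adjoint_solution T \<nu> b c s0 ph"
 shows "(LINT m|vol_M. u s0 m * ph s0 m) = (LINT m|vol_M. u T m * ph T m)"
proof -
 let ?I = "{s0..T}"
 have sub: "?I \<subseteq> {0..T}" using s0 by auto
 have uL: "u s:L2_M" if "s:?I" for s using u that sub by (auto simp: L2_continuous_def)
 have pc: "continuous_on (?I \<times> Mfd) (%(t, m). ph t m)"
 and ac: "continuous_on (?I \<times> Mfd) (%(t, m). adjoint_L \<nu> b c t (ph t) m)"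
 and C: "!!t. t:?I ==> EX k. C1_grad (ph t) k & C1_M k"
 and pt: "!!t m. t:?I ==> m:Mfd ==> ((%s. ph s m) has_real_derivative - adjoint_L \<nu> b c t (ph t) m) (at t within ?I)"
 using ph unfolding adjoint_solution_def by blast+
 have ac': "continuous_on (?I \<times> Mfd) (%(t, m). - adjoint_L \<nu> b c t (ph t) m)"
 using ac unfolding case_prod_unfold by (intro continuous_intros)
 obtain K where K: "K >= 0" "ALL t:?I. ALL m:Mfd. norm (- adjoint_L \<nu> b c t (ph t) m) <= K" using bounded_on_cylinder[OF ac'] by blast
 have cs: "continuous_on Mfd (ph s)" if "s:?I" for s by (rule slice_continuous[OF pc that])
 define F where "F = (%t. LINT m|vol_M. u t m * ph t m)"
 have F: "(F has_real_derivative 0) (at t within ?I)" if t: "t:?I" for t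
 proof -
 obtain k where k: "C1_grad (ph t) k" "C1_M k" using C[OF t] by blast
 have D1: "((%s. LINT m|vol_M. u s m * ph t m) has_real_derivative (LINT m|vol_M. u t m * adjoint_L \<nu> b c t (ph t) m)) (at t within ?I)"
 by (rule DERIV_subset[OF d[OF k] sub]) (use t sub in blast)
 have "((%s. LINT m|vol_M. ph s m * u t m) has_real_derivative (LINT m|vol_M. - adjoint_L \<nu> b c t (ph t) m * u t m)) (at t within ?I)"
 by (rule has_derivative_pairing[OF pc ac' pt uL[OF t] t])
 then have D2: "((%s. LINT m|vol_M. u t m * ph s m) has_real_derivative - (LINT m|vol_M. u t m * adjoint_L \<nu> b c t (ph t) m)) (at t within ?I)"
 by (simp add: mult.commute)
 \<comment> \<open>The pairing of the increments has derivative 0 at \<open>t\<close>: the increment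
   of \<open>u\<close> tends to 0 in \<open>L^2\<close>, and the difference quotients of
   \<open>ph\<close> stay bounded.\<close>
 define R where "R = (%s. LINT m|vol_M. (u s m - u t m) * (ph s m - ph t m))"
 have "((%s. (R s - R t) / (s - t)) \<longlongrightarrow> 0) (at t within ?I)"
 proof -
 have "((%s. LINT m|vol_M. (u s m - u t m) * ((ph s m - ph t m) / (s - t))) \<longlongrightarrow> 0) (at t within (?I - {t}))"
 proof (rule L2_continuous_pairing_tendsto[OF u, of _ "K + 1"])
 fix s assume s: "s:?I - {t}"
 show "continuous_on Mfd (%m. (ph s m - ph t m) / (s - t))" using s t by (intro continuous_intros cs) auto
 fix m :: "'n vec3" assume m: "m:Mfd"
 have "norm (ph s m - ph t m) <= K * norm (s - t)"
 by (rule field_differentiable_bound[where S = ?I and f' = "%t. - adjoint_L \<nu> b c t (ph t) m"]) (use pt m K s t in auto)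
 then have "\<bar>ph s m - ph t m\<bar> <= (K + 1) * \<bar>s - t\<bar>" by (simp add: distrib_right)
 then show "\<bar>(ph s m - ph t m) / (s - t)\<bar> <= K + 1" using s by (simp add: divide_le_eq)
 qed (use t sub K in auto)
 then have "((%s. LINT m|vol_M. (u s m - u t m) * ((ph s m - ph t m) / (s - t))) \<longlongrightarrow> 0) (at t within ?I)"
 by (simp add: at_within_def Diff_idemp)
 moreover have eq: "(LINT m|vol_M. (u s m - u t m) * ((ph s m - ph t m) / (s - t))) = (R s - R t) / (s - t)" for s
 by (simp add: R_def)
 ultimately show ?thesis by (simp only: eq)
 qed
 then have D3: "(R has_real_derivative 0) (at t within ?I)" by (simp add: has_field_derivative_iff)
 have D: "((%s. (LINT m|vol_M. u s m * ph t m) + (LINT m|vol_M. u t m * ph s m) + R s - F t) has_real_derivative 0) (at t within ?I)"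
 by (rule DERIV_cong[OF DERIV_diff[OF DERIV_add[OF DERIV_add[OF D1 D2] D3] DERIV_const]]) simp
 have "F s = (LINT m|vol_M. u s m * ph t m) + (LINT m|vol_M. u t m * ph s m) + R s - F t" if s: "s:?I" for s
 proof -
 note i = integrable_pairing[OF cs[OF s] uL[OF s]] integrable_pairing[OF cs[OF s] uL[OF t]]
 integrable_pairing[OF cs[OF t] uL[OF s]] integrable_pairing[OF cs[OF t] uL[OF t]]
 have "R s = (LINT m|vol_M. ph s m * u s m - ph s m * u t m - (ph t m * u s m - ph t m * u t m))"
 by (simp add: R_def algebra_simps)
 also have "... = (LINT m|vol_M. ph s m * u s m) - (LINT m|vol_M. ph s m * u t m) - ((LINT m|vol_M. ph t m * u s m) - (LINT m|vol_M. ph t m * u t m))"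
 using i by simp
 finally show ?thesis by (simp add: F_def mult.commute)
 qed
 then show ?thesis
 using D unfolding has_field_derivative_def by - (rule has_derivative_transform[OF t]; assumption)
 qed
 have "EX c. ALL x:?I. F x = c"
 by (rule has_field_derivative_zero_constant) (use F in auto)
 then have "F s0 = F T" using s0 by force
 then show ?thesis by (simp add: F_def)
qed

text \<open>The adjoint solution started at time \<open>t\<close> from a polynomial transports the
  pairing to time \<open>T\<close>, where both solutions have the same value. The difference at time
  \<open>t\<close> is therefore orthogonal to all polynomials.\<close>

lemma weak_solution_unique:
 fixes w1 w2 :: "real => 'n::finite vec3 => real"
 assumes T: "T > 0" and b: "C1_M b" "!!m. m:Mfd ==> b m:tangent m"
 and c: "continuous_on ({0..T} \<times> Mfd) (%(t, m). c t m)"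
 and adj: "!!s0 p. 0 <= s0 ==> s0 < T ==> poly_fun p ==> EX ph. adjoint_solution T \<nu> b c s0 ph & (ALL m:Mfd. ph s0 m = p m)"
 and w1: "weak_solution_L T \<nu> b c g w1" and w2: "weak_solution_L T \<nu> b c g w2"
 shows "AE t in lebesgue_on {0..T}. AE m in vol_M. w1 t m = w2 t m"
proof -
 obtain u1 where u1: "L2_continuous T u1" "AE t in lebesgue_on {0..T}. AE m in vol_M. u1 t m = w1 t m"
 "AE m in vol_M. u1 T m = g m"
 "!!et k t. C1_grad et k ==> C1_M k ==> t:{0..T} ==>
 ((%t. LINT m|vol_M. u1 t m * et m) has_real_derivative (LINT m|vol_M. u1 t m * adjoint_L \<nu> b c t et m)) (at t within {0..T})"
 by (rule weak_solution_pairing[OF T b c w1]) (assumption | (rule that; assumption))+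
 obtain u2 where u2: "L2_continuous T u2" "AE t in lebesgue_on {0..T}. AE m in vol_M. u2 t m = w2 t m"
 "AE m in vol_M. u2 T m = g m"
 "!!et k t. C1_grad et k ==> C1_M k ==> t:{0..T} ==>
 ((%t. LINT m|vol_M. u2 t m * et m) has_real_derivative (LINT m|vol_M. u2 t m * adjoint_L \<nu> b c t et m)) (at t within {0..T})"
 by (rule weak_solution_pairing[OF T b c w2]) (assumption | (rule that; assumption))+
 have L1: "u1 t:L2_M" and L2: "u2 t:L2_M" if "t:{0..T}" for t
 using u1(1) u2(1) that by (simp_all add: L2_continuous_def)
 have key: "AE m in vol_M. u1 t m = u2 t m" if t: "0 <= t" "t < T" for t
 proof -
 have t': "t:{0..T}" "T:{0..T}" using t T by auto
 have "AE m in vol_M. u1 t m - u2 t m = 0"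
 proof (rule L1_orthogonal_zero)
 show "integrable vol_M (%m. u1 t m - u2 t m)" using L2_M_D(3)[OF L1[OF t'(1)]] L2_M_D(3)[OF L2[OF t'(1)]] by simp
 fix p :: "'n vec3 => real" assume p: "poly_fun p"
 obtain ph where ph: "adjoint_solution T \<nu> b c t ph" "ALL m:Mfd. ph t m = p m" using adj[OF t p] by blast
 have pT: "continuous_on Mfd (ph T)" and pt: "continuous_on Mfd (ph t)"
 using ph(1) slice_continuous[of t T ph] t unfolding adjoint_solution_def by auto
 have "AE m in vol_M. u1 T m * ph T m = u2 T m * ph T m" using u1(3) u2(3) by eventually_elim simp
 then have "(LINT m|vol_M. u1 T m * ph T m) = (LINT m|vol_M. u2 T m * ph T m)"
 by (rule integral_cong_AE[rotated 2])
 (use L2_M_D(1)[OF L1[OF t'(2)]] L2_M_D(1)[OF L2[OF t'(2)]] continuous_borel_vol_M[OF pT] in auto)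
 then have "(LINT m|vol_M. u1 t m * ph t m) = (LINT m|vol_M. u2 t m * ph t m)"
 using adjoint_pairing_constant[OF u1(1,4) t ph(1)] adjoint_pairing_constant[OF u2(1,4) t ph(1)] by simp
 then have "0 = (LINT m|vol_M. u1 t m * ph t m - u2 t m * ph t m)"
 using pairing_diff[OF L1[OF t'(1)] pt L2[OF t'(1)] pt] by simp
 also have "... = (LINT m|vol_M. p m * (u1 t m - u2 t m))"
 by (rule Bochner_Integration.integral_cong[OF refl]) (use ph(2) in \<open>simp add: algebra_simps\<close>)
 finally show "(LINT m|vol_M. p m * (u1 t m - u2 t m)) = 0" by simp
 qed
 then show ?thesis by eventually_elim simp
 qed
 have "AE t in lebesgue_on {0..T}. t:{0..T}" by (rule AE_I2) simp
 moreover have "AE t in lebesgue_on {0..T}. t \<noteq> T" by (rule AE_lebesgue_on_neq)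
 ultimately show ?thesis using u1(2) u2(2)
 proof eventually_elim
 case (elim t)
 then have "AE m in vol_M. u1 t m = u2 t m" by (intro key) auto
 then show ?case using elim(3,4) by eventually_elim simp
 qed
qed

section \<open>Existence of classical solutions\<close>

lemma poly_fun_Rb: "poly_fun p ==> length as <= 2 ==> poly_fun (Rb as p)"
 by (erule length_le_2_cases) (simp_all add: poly_fun_Rd)

lemma jet_approx_continuous:
 fixes F :: "('n \<times> 3) list => 'n::finite vec3 => real"
 assumes F: "jet_approx F" and as: "length as <= 2"
 shows "continuous_on Mfd (F as)"
 unfolding continuous_on_iff
proof (intro ballI allI impI)
 fix x :: "'n vec3" and eps :: real assume x: "x:Mfd" and e: "0 < eps"
 then have "eps / 3 > 0" by simp
 then obtain p where p: "poly_fun p" "!!as x. length as <= 2 ==> x:Mfd ==> \<bar>Rb as p x - F as x\<bar> < eps / 3"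
 using F unfolding jet_approx_def by meson
 have "continuous_on Mfd (Rb as p)" by (rule continuous_on_poly_fun[OF poly_fun_Rb[OF p(1) as]])
 then obtain d where d: "d > 0" "ALL y:Mfd. dist y x < d --> dist (Rb as p y) (Rb as p x) < eps / 3"
 using x \<open>eps / 3 > 0\<close> unfolding continuous_on_iff by meson
 have "dist (F as y) (F as x) < eps" if y: "y:Mfd" "dist y x < d" for y
 using d(2)[rule_format, OF y] p(2)[OF as y(1)] p(2)[OF as x] unfolding dist_real_def by linarith
 then show "EX d>0. ALL x':Mfd. dist x' x < d --> dist (F as x') (F as x) < eps" using d(1) by blast
qed

lemma jet_family_continuous:
 fixes u :: "('n \<times> 3) list => real => 'n::finite vec3 => real"
 assumes J: "!!t. t:{a..b} ==> jet_approx (%as. u as t)"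
 and c: "!!eps. eps > 0 ==> EX dl>0. ALL s:{a..b}. ALL t:{a..b}. \<bar>t - s\<bar> < dl -->
 (ALL as x. length as <= 2 & x:Mfd --> \<bar>u as t x - u as s x\<bar> < eps)"
 and as: "length as <= 2"
 shows "continuous_on ({a..b} \<times> Mfd) (%(t, x). u as t x)"
 unfolding continuous_on_iff
proof (intro ballI allI impI)
 fix z :: "real \<times> 'n vec3" and eps :: real assume z: "z:{a..b} \<times> Mfd" and e: "0 < eps"
 obtain t x where tx: "z = (t, x)" "t:{a..b}" "x:Mfd" using z by auto
 have e2: "eps / 2 > 0" using e by simp
 obtain d1 where d1: "d1 > 0" "!!s t as x. s:{a..b} ==> t:{a..b} ==> \<bar>t - s\<bar> < d1 ==> length as <= 2 ==> x:Mfd ==>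
 \<bar>u as t x - u as s x\<bar> < eps / 2" using c[OF e2] by meson
 have "continuous_on Mfd (u as t)" using jet_approx_continuous[OF J[OF tx(2)] as] .
 then obtain d2 where d2: "d2 > 0" "ALL y:Mfd. dist y x < d2 --> dist (u as t y) (u as t x) < eps / 2"
 using tx e2 unfolding continuous_on_iff by meson
 have "dist ((%(t, x). u as t x) z') ((%(t, x). u as t x) z) < eps"
 if z': "z':{a..b} \<times> Mfd" "dist z' z < min d1 d2" for z'
 proof -
 obtain s y where sy: "z' = (s, y)" "s:{a..b}" "y:Mfd" using z' by auto
 have "dist s t < d1" "dist y x < d2"
 using z'(2) dist_fst_le[of z' z] dist_snd_le[of z' z] by (auto simp: sy tx)
 then have "\<bar>u as s y - u as t y\<bar> < eps / 2" "\<bar>u as t y - u as t x\<bar> < eps / 2"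
 using d1(2)[OF tx(2) sy(2) _ as sy(3)] d2(2) sy by (auto simp: dist_real_def)
 then show ?thesis unfolding sy(1) tx(1) dist_real_def prod.case by linarith
 qed
 then show "EX d>0. ALL x':{a..b} \<times> Mfd. dist x' z < d --> dist ((%(t, x). u as t x) x') ((%(t, x). u as t x) z) < eps"
 using d1(1) d2(1) by (intro exI[of _ "min d1 d2"]) simp
qed

lemma continuous_on_xi: "continuous_on S (xi a)"
 by (rule linear_continuous_on[OF bounded_linear_xi])

lemma continuous_on_snd_Mfd:
 "continuous_on Mfd f ==> continuous_on (A \<times> Mfd) (%x. f (snd x))"
 by (rule continuous_on_compose2[of Mfd f]) (auto intro!: continuous_intros)

lemma jet_approx_C1_grad:
 fixes F :: "('n \<times> 3) list => 'n::finite vec3 => real"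
 assumes F: "jet_approx F"
 shows "C1_grad (F []) (grad_M (F []))" "C1_M (grad_M (F []))"
proof -
 have c: "continuous_on Mfd (F as)" if "length as <= 2" for as by (rule jet_approx_continuous[OF F that])
 show "C1_grad (F []) (grad_M (F []))" unfolding C1_grad_def
 proof (intro conjI ballI)
 fix m :: "'n vec3" assume m: "m:Mfd"
 show "(F [] has_derivative (%v. grad_M (F []) m \<bullet> v)) (at m within Mfd)" by (rule jet_approx_grad(2)[OF F m])
 show "grad_M (F []) m:tangent m"
 unfolding jet_approx_grad(1)[OF F m] by (intro subspace_sum[OF subspace_tangent] subspace_scale[OF subspace_tangent]) simp
 next
 have "continuous_on Mfd (%m. SUM a:UNIV. F [a] m *\<^sub>R xi a m)"
 by (intro continuous_intros c continuous_on_xi) simp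
 then show "continuous_on Mfd (grad_M (F []))"
 by (rule continuous_on_eq) (simp add: jet_approx_grad(1)[OF F])
 qed
 show "C1_M (grad_M (F []))"
 proof (rule C1_MI[OF jet_approx_hess[OF F]], assumption)
 fix e show "continuous_on Mfd (%m. jet_hess F m e)"
 unfolding jet_hess_def by (intro continuous_intros c continuous_on_xi) simp_all
 qed
qed

lemma jet_family_C12:
 fixes J :: "('n \<times> 3) list => real => 'n::finite vec3 => real"
 assumes T: "T > 0" and J: "!!t. t:{0..T} ==> jet_approx (%as. J as t)"
 and c: "!!as. length as <= 2 ==> continuous_on ({0..T} \<times> Mfd) (%(t, x). J as t x)"
 and Jt: "continuous_on ({0..T} \<times> Mfd) (%(t, x). Jt t x)"
 "!!t x. t:{0..T} ==> x:Mfd ==> ((%s. J [] s x) has_real_derivative Jt t x) (at t within {0..T})"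
 shows "C12 T (J [])" "!!t m. t:{0..T} ==> m:Mfd ==> time_deriv T (J []) t m = Jt t m"
proof -
 define g where "g = (%t m. SUM a:UNIV. J [a] t m *\<^sub>R xi a m)"
 have g: "grad_M (J [] t) m = g t m" if "t:{0..T}" "m:Mfd" for t m
 using jet_approx_grad(1)[OF J[OF that(1)] that(2)] by (simp add: g_def)
 have c': "continuous_on ({0..T} \<times> Mfd) (%x. J as (fst x) (snd x))" if "length as <= 2" for as
 using c[OF that] by (simp add: case_prod_unfold)
 have xc: "continuous_on ({0..T} \<times> Mfd) (%x. xi a (snd x))" for a :: "'n \<times> 3"
 by (rule continuous_on_snd_Mfd[OF continuous_on_xi])
 have 1: "continuous_on ({0..T} \<times> Mfd) (%(t, m). g t m)"
 unfolding g_def case_prod_unfold by (intro continuous_intros c' xc) simp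
 have 2: "g t m:tangent m" for t m unfolding g_def
 by (intro subspace_sum[OF subspace_tangent] subspace_scale[OF subspace_tangent]) simp
 have 3: "(J [] t has_derivative (%v. g t m \<bullet> v)) (at m within Mfd)" if "t:{0..T}" "m:Mfd" for t m
 using jet_approx_grad(2)[OF J[OF that(1)] that(2)] by (simp add: g[OF that])
 have 4: "(g t has_derivative jet_hess (%as. J as t) m) (at m within Mfd)" if "t:{0..T}" "m:Mfd" for t m
 by (rule has_derivative_transform[OF that(2) _ jet_approx_hess[OF J[OF that(1)] that(2)]]) (simp add: g[OF that(1)])
 have 5: "continuous_on ({0..T} \<times> Mfd) (%(t, m). jet_hess (%as. J as t) m e)" for e
 unfolding jet_hess_def case_prod_unfold by (intro continuous_intros c' xc) simp_all
 show "C12 T (J [])" by (rule C12I(1)[OF T c Jt 1 2 3 4 5]) simp_all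
 show "time_deriv T (J []) t m = Jt t m" if "t:{0..T}" "m:Mfd" for t m
 by (rule C12I(2)[OF T c Jt 1 2 3 4 5]) (use that in simp_all)
qed

lemma jet_approx_scale:
 assumes F: "jet_approx F"
 shows "jet_approx (%as x. k * F as x)"
 unfolding jet_approx_def
proof (intro allI impI)
 fix eps :: real assume "eps > 0"
 then have "eps / (\<bar>k\<bar> + 1) > 0" by simp
 then obtain p where p: "poly_fun p" "!!as x. length as <= 2 ==> x:Mfd ==> \<bar>Rb as p x - F as x\<bar> < eps / (\<bar>k\<bar> + 1)"
 using F unfolding jet_approx_def by meson
 have s: "Rb as (%x. k * p x) x = k * Rb as p x" if "length as <= 2" for as x
 using that by (rule length_le_2_cases) (simp_all add: Rd_scale p(1) poly_fun_Rd)
 have "\<bar>Rb as (%x. k * p x) x - k * F as x\<bar> < eps" if h: "length as <= 2" "x:Mfd" for as x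
 proof -
 have "\<bar>Rb as p x - F as x\<bar> * (\<bar>k\<bar> + 1) < eps" using p(2)[OF h] by (simp add: pos_less_divide_eq)
 moreover have "\<bar>k\<bar> * \<bar>Rb as p x - F as x\<bar> <= \<bar>Rb as p x - F as x\<bar> * (\<bar>k\<bar> + 1)" by (simp add: algebra_simps)
 ultimately show ?thesis unfolding s[OF h(1)] right_diff_distrib[symmetric] abs_mult by linarith
 qed
 then show "EX p. poly_fun p & (ALL as x. length as <= 2 & x:Mfd --> \<bar>Rb as p x - k * F as x\<bar> < eps)"
 using poly_fun_scale[OF p(1)] by (intro exI[of _ "%x. k * p x"]) simp
qed

text \<open>The set \<open>I\<close> admits both directions of the substitution, an exponential on
  the whole line and a logarithm on the positive half-line. The squared gradient arises from the
  Parseval identity of the frame.\<close>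

lemma C12_compose:
 fixes w :: "real => 'n::finite vec3 => real"
 assumes T: "T > 0" and w: "C12 T w" and wI: "!!t m. t:{0..T} ==> m:Mfd ==> w t m:I"
 and d1: "!!y. y:I ==> (ph has_real_derivative ph1 y) (at y)"
 and d2: "!!y. y:I ==> (ph1 has_real_derivative ph2 y) (at y)"
 and c2: "continuous_on I ph2"
 shows "C12 T (%t m. ph (w t m))"
 "!!t m. t:{0..T} ==> m:Mfd ==> time_deriv T (%t m. ph (w t m)) t m = ph1 (w t m) * time_deriv T w t m"
 "!!t m. t:{0..T} ==> m:Mfd ==> grad_M (%m. ph (w t m)) m = ph1 (w t m) *\<^sub>R grad_M (w t) m"
 "!!t m. t:{0..T} ==> m:Mfd ==> laplace_beltrami (%m. ph (w t m)) m
 = ph1 (w t m) * laplace_beltrami (w t) m + ph2 (w t m) * (norm (grad_M (w t) m))^2"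
proof -
 note D = C12D[OF w]
 obtain H where H: "!!t m. t:{0..T} ==> m:Mfd ==> (grad_M (w t) has_derivative H t m) (at m within Mfd)"
 "!!e. continuous_on ({0..T} \<times> Mfd) (%(t, m). H t m e)" using D(7) by blast
 have c0: "continuous_on I ph" "continuous_on I ph1"
 by (intro continuous_at_imp_continuous_on ballI DERIV_isCont[OF d1] DERIV_isCont[OF d2]; assumption)+
 have cw: "continuous_on ({0..T} \<times> Mfd) (%x. w (fst x) (snd x))" using D(1) by (simp add: case_prod_unfold)
 have cf: "continuous_on ({0..T} \<times> Mfd) (%x. f (w (fst x) (snd x)))" if "continuous_on I f" for f :: "real => real"
 by (rule continuous_on_compose2[OF that cw]) (use wI in auto)
 define g where "g = (%t m. ph1 (w t m) *\<^sub>R grad_M (w t) m)"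
 define H' where "H' = (%t m v. ph1 (w t m) *\<^sub>R H t m v + (ph2 (w t m) * (grad_M (w t) m \<bullet> v)) *\<^sub>R grad_M (w t) m)"
 have 1: "continuous_on ({0..T} \<times> Mfd) (%(t, m). ph (w t m))" using cf[OF c0(1)] by (simp add: case_prod_unfold)
 have 2: "continuous_on ({0..T} \<times> Mfd) (%(t, m). ph1 (w t m) * time_deriv T w t m)"
 using D(2) cf[OF c0(2)] unfolding case_prod_unfold by (intro continuous_intros)
 have 3: "((%s. ph (w s m)) has_real_derivative ph1 (w t m) * time_deriv T w t m) (at t within {0..T})"
 if "t:{0..T}" "m:Mfd" for t m
 by (rule DERIV_chain2[OF d1[OF wI[OF that]] D(4)[OF that]])
 have 4: "continuous_on ({0..T} \<times> Mfd) (%(t, m). g t m)"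
 using D(3) cf[OF c0(2)] unfolding g_def case_prod_unfold by (intro continuous_intros)
 have 5: "g t m:tangent m" if "t:{0..T}" "m:Mfd" for t m
 unfolding g_def by (rule subspace_scale[OF subspace_tangent D(6)[OF that]])
 have comp: "((%m. f (w t m)) has_derivative (%v. f' * (grad_M (w t) m \<bullet> v))) (at m within Mfd)"
 if "t:{0..T}" "m:Mfd" "(f has_real_derivative f') (at (w t m))" for t m f f'
 by (rule has_derivative_compose[OF D(5)[OF that(1,2)] that(3)[unfolded has_field_derivative_def]])
 have 6: "((%m. ph (w t m)) has_derivative (%v. g t m \<bullet> v)) (at m within Mfd)" if "t:{0..T}" "m:Mfd" for t m
 using comp[OF that d1[OF wI[OF that]]] by (simp add: g_def)
 have 7: "(g t has_derivative H' t m) (at m within Mfd)" if "t:{0..T}" "m:Mfd" for t m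
 unfolding g_def H'_def by (rule has_derivative_scaleR[OF comp[OF that d2[OF wI[OF that]]] H(1)[OF that]])
 have 8: "continuous_on ({0..T} \<times> Mfd) (%(t, m). H' t m e)" for e
 using D(3) H(2)[of e] cf[OF c0(2)] cf[OF c2] unfolding H'_def case_prod_unfold by (intro continuous_intros)
 note I = C12I[of T "%t m. ph (w t m)" "%t m. ph1 (w t m) * time_deriv T w t m" g H', OF T 1 2 3 4 5 6 7 8]
 show "C12 T (%t m. ph (w t m))" by (rule I(1))
 show "time_deriv T (%t m. ph (w t m)) t m = ph1 (w t m) * time_deriv T w t m" if "t:{0..T}" "m:Mfd" for t m
 by (rule I(2)) (use that in simp_all)
 have gr: "grad_M (%m. ph (w t m)) m = g t m" if "t:{0..T}" "m:Mfd" for t m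
 by (rule I(3)) (use that in simp_all)
 then show "grad_M (%m. ph (w t m)) m = ph1 (w t m) *\<^sub>R grad_M (w t) m" if "t:{0..T}" "m:Mfd" for t m
 using that by (simp add: g_def)
 show "laplace_beltrami (%m. ph (w t m)) m
 = ph1 (w t m) * laplace_beltrami (w t) m + ph2 (w t m) * (norm (grad_M (w t) m))^2" if tm: "t:{0..T}" "m:Mfd" for t m
 proof -
 have "(grad_M (%m. ph (w t m)) has_derivative H' t m) (at m within Mfd)"
 by (rule has_derivative_transform[OF tm(2) _ 7[OF tm]]) (rule gr[OF tm(1)])
 from div_M_eq[OF this tm(2)] have "laplace_beltrami (%m. ph (w t m)) m = (SUM a:UNIV. H' t m (xi a m) \<bullet> xi a m)"
 by (simp add: laplace_beltrami_def)
 also have "... = ph1 (w t m) * (SUM a:UNIV. H t m (xi a m) \<bullet> xi a m)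
 + ph2 (w t m) * (SUM a:UNIV. (grad_M (w t) m \<bullet> xi a m) * (grad_M (w t) m \<bullet> xi a m))"
 by (simp add: H'_def inner_add_left sum.distrib sum_distrib_left mult.assoc)
 also have "(SUM a:UNIV. H t m (xi a m) \<bullet> xi a m) = laplace_beltrami (w t) m"
 using div_M_eq[OF H(1)[OF tm] tm(2)] by (simp add: laplace_beltrami_def)
 also have "(SUM a:UNIV. (grad_M (w t) m \<bullet> xi a m) * (grad_M (w t) m \<bullet> xi a m)) = (norm (grad_M (w t) m))^2"
 by (simp add: sum_inner_xi[OF tm(2) D(6)[OF tm]] power2_norm_eq_inner)
 finally show ?thesis .
 qed
qed

text \<open>Viewing \<open>h\<close> as constant in time makes the chain rule
  \<open>C12_compose\<close>, and after it \<open>C12_jets\<close>, applicable to the terminal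
  datum.\<close>

lemma C2_M_C12:
 assumes T: "T > 0" and h: "C2_M h"
 shows "C12 T (%t. h)"
proof -
 have hC: "C1_M h" "C1_M (grad_M h)" using h by (simp_all add: C2_M_def)
 obtain h' where h': "!!m. m:Mfd ==> (h has_derivative h' m) (at m within Mfd)" "!!e. continuous_on Mfd (%m. h' m e)"
 "continuous_on Mfd h" "!!a. continuous_on Mfd (%m. h' m (xi a m))"
 by (rule C1_M_D[OF hC(1)]) (rule that; assumption)
 obtain H where H: "!!m. m:Mfd ==> (grad_M h has_derivative H m) (at m within Mfd)" "!!e. continuous_on Mfd (%m. H m e)"
 "continuous_on Mfd (grad_M h)" "!!a. continuous_on Mfd (%m. H m (xi a m))"
 by (rule C1_M_D[OF hC(2)]) (rule that; assumption)
 define g where "g = (%m. SUM a:UNIV. h' m (xi a m) *\<^sub>R xi a m)"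
 have gt: "g m:tangent m" for m unfolding g_def
 by (intro subspace_sum[OF subspace_tangent] subspace_scale[OF subspace_tangent]) simp
 \<comment> \<open>The hypothesis supplies some derivative of \<open>h\<close>, which is determined
   on tangent vectors only; composing it with the derivative of \<open>normalise\<close> shows that
   \<open>grad_M h\<close> represents it.\<close>
 have gd: "(h has_derivative (%v. grad_M h m \<bullet> v)) (at m within Mfd) & grad_M h m:tangent m" if m: "m:Mfd" for m
 proof -
 have lin: "linear (h' m)" using has_derivative_linear[OF h'(1)[OF m]] .
 have nd: "(normalise has_derivative dnormalise m) (at m within Mfd)"
 by (rule has_derivative_at_withinI[OF has_derivative_normalise[OF blk_nonzero[OF m]]])
 have idd: "((%x. x) has_derivative dnormalise m) (at m within Mfd)"
 by (rule has_derivative_transform[OF m _ nd]) simp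
 have hc: "(h has_derivative (%v. h' m (dnormalise m v))) (at m within Mfd)"
 using has_derivative_in_compose[OF idd, of h "h' m"] h'(1)[OF m] by simp
 have "h' m (dnormalise m v) = g m \<bullet> v" for v
 proof -
 have t: "dnormalise m v:tangent m"
 using dnormalise_tangent[of m v] blk_nonzero[OF m] m by simp
 have "h' m (dnormalise m v) = h' m (SUM a:UNIV. (dnormalise m v \<bullet> xi a m) *\<^sub>R xi a m)"
 by (simp add: tangent_frame[OF m t])
 also have "... = (SUM a:UNIV. (v \<bullet> xi a m) * h' m (xi a m))"
 by (simp add: linear_sum[OF lin] linear_scale[OF lin] dnormalise_inner_xi[OF m])
 also have "... = g m \<bullet> v" unfolding g_def inner_sum_left inner_scaleR_left
 by (intro sum.cong refl) (simp add: inner_commute)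
 finally show ?thesis .
 qed
 with hc have hg: "(h has_derivative (%v. g m \<bullet> v)) (at m within Mfd)" by simp
 then have "grad_M h m = g m" by (rule grad_M_eqI[OF _ gt m])
 with hg gt show ?thesis by simp
 qed
 show ?thesis
 proof (rule C12I(1)[where wt = "%t m. 0" and g = "%t. grad_M h" and H = "%t. H"])
 show "continuous_on ({0..T} \<times> Mfd) (%(t, m). h m)" using continuous_on_snd_Mfd[OF h'(3)] by (simp add: case_prod_unfold)
 show "continuous_on ({0..T} \<times> Mfd) (%(t, m). grad_M h m)" using continuous_on_snd_Mfd[OF H(3)] by (simp add: case_prod_unfold)
 show "continuous_on ({0..T} \<times> Mfd) (%(t, m). H m e)" for e using continuous_on_snd_Mfd[OF H(2)[of e]] by (simp add: case_prod_unfold)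
 qed (use T gd H(1) in auto)
qed

lemma C12_jets:
 fixes w :: "real => 'n::finite vec3 => real"
 assumes w: "C12 T w" and t: "t:{0..T}"
 obtains G where "jet_approx G" "G [] = w t"
proof -
 obtain H where H: "!!m. m:Mfd ==> (grad_M (w t) has_derivative H m) (at m within Mfd)" "!!e. continuous_on Mfd (%m. H m e)"
 "continuous_on Mfd (grad_M (w t))" "!!a. continuous_on Mfd (%m. H m (xi a m))"
 by (rule C1_M_D[OF C12_C1_M_grad[OF w t]]) (rule that; assumption)
 \<comment> \<open>For two letters, the component of the gradient along \<open>xi a\<close> is
   differentiated along \<open>xi b\<close>; the first summand comes from the variation of the field
   \<open>xi a\<close> itself.\<close>
 define G :: "('n \<times> 3) list => 'n vec3 => real" where "G = (%as. case as of [] => w t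
 | a # bs => (case bs of [] => %m. grad_M (w t) m \<bullet> xi a m
 | b # cs => %m. grad_M (w t) m \<bullet> xi a (xi b m) + H m (xi b m) \<bullet> xi a m))"
 have cx: "continuous_on Mfd (%m. xi a (xi b m))" for a b :: "'n \<times> 3"
 by (rule continuous_on_compose2[OF continuous_on_xi[of UNIV] continuous_on_xi]) simp
 have 0: "rot_derivative a (w t) (%m. grad_M (w t) m \<bullet> xi a m)" for a
 by (rule rot_derivativeI[OF C12D(5)[OF w t]]) (assumption, intro continuous_intros H continuous_on_xi)
 have 1: "rot_derivative b (%m. grad_M (w t) m \<bullet> xi a m) (%m. grad_M (w t) m \<bullet> xi a (xi b m) + H m (xi b m) \<bullet> xi a m)" for a b
 by (rule rot_derivativeI[OF has_derivative_inner[OF H(1) bounded_linear_imp_has_derivative[OF bounded_linear_xi]]])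
 (assumption, intro continuous_intros H continuous_on_xi cx)
 have "jet_approx G"
 proof (rule jet_approx_C2)
 fix as :: "('n \<times> 3) list" and a assume "length as <= 1"
 then consider "as = []" | b where "as = [b]" by (cases as) auto
 then show "rot_derivative a (G as) (G (as @ [a]))" by cases (simp_all add: G_def 0 1)
 qed
 then show ?thesis by (rule that) (simp add: G_def)
qed

subsection \<open>Polynomial vector fields\<close>

definition poly_field :: "('n::finite vec3 => 'n vec3) => bool" where
 "poly_field X \<longleftrightarrow> (ALL v. poly_fun (%m. X m \<bullet> v))"

lemma inner_axis_sum: "x \<bullet> y = (SUM p:UNIV. (x \<bullet> axis p 1) * (y \<bullet> axis p 1))" for x y :: "'n::finite vec3"
 by (simp add: inner_vec_def[of x y] inner_axis)

lemma poly_field_inner: "poly_field X ==> poly_field Y ==> poly_fun (%m. X m \<bullet> Y m)"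
 unfolding inner_axis_sum[of "X _" "Y _"]
 by (rule real_polynomial_function_sum) (simp_all add: poly_field_def real_polynomial_function.intros(4))

lemma poly_field_linear: "bounded_linear X ==> poly_field X"
 unfolding poly_field_def
 by (intro allI real_polynomial_function.intros(1) bounded_linear_compose[OF bounded_linear_inner_left])

lemma poly_field_diff: "poly_field X ==> poly_field Y ==> poly_field (%m. X m - Y m)"
 unfolding poly_field_def inner_diff_left by (intro allI real_polynomial_function_diff) simp_all

lemma poly_field_scale: "poly_field X ==> poly_field (%m. k *\<^sub>R X m)"
 unfolding poly_field_def inner_scaleR_left by (intro allI poly_fun_scale) simp

lemma poly_field_cross:
 fixes X Y :: "'n::finite vec3 => 'n vec3"
 assumes "poly_field X" "poly_field Y"
 shows "poly_field (%m. cross_vec (X m) (Y m))"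
proof -
 have eq: "cross_vec (X m) (Y m) \<bullet> v = (SUM p:UNIV. (X m \<bullet> axis p 1) * (Y m \<bullet> cross_vec v (axis p 1)))" for m v
 proof -
 have "cross_vec (X m) (Y m) \<bullet> v = X m \<bullet> cross_vec (Y m) v" by (rule inner_cross_vec)
 also have "... = (SUM p:UNIV. (X m \<bullet> axis p 1) * (cross_vec (Y m) v \<bullet> axis p 1))" by (rule inner_axis_sum)
 finally show ?thesis by (simp only: inner_cross_vec[of "Y m"])
 qed
 show ?thesis unfolding poly_field_def eq
 by (intro allI real_polynomial_function_sum real_polynomial_function.intros(4))
 (use assms in \<open>simp_all add: poly_field_def\<close>)
qed

lemma poly_field_C1:
 fixes X :: "'n::finite vec3 => 'n vec3"
 assumes "poly_field X"
 shows "C1_M X"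
proof (rule C1_MI)
 have p: "poly_fun (%m. X m \<bullet> axis p 1)" for p using assms by (simp add: poly_field_def)
 let ?H = "%m v. SUM p:UNIV. frechet_derivative (%m. X m \<bullet> axis p 1) (at m) v *\<^sub>R (axis p 1 :: 'n vec3)"
 have eq: "X = (%m. SUM p:UNIV. (X m \<bullet> axis p 1) *\<^sub>R axis p 1)"
 by (rule ext) (simp only: inner_axis inner_real_def mult_1_right scalar_mult_eq_scaleR[symmetric] basis_expansion)
 show "(X has_derivative ?H m) (at m within Mfd)" for m
 by (subst eq) (intro has_derivative_sum bounded_linear.has_derivative[OF bounded_linear_scaleR_left] poly_fun_differentiable p)
 show "continuous_on Mfd (%m. ?H m e)" for e
 by (intro continuous_intros continuous_on_poly_fun poly_fun_frechet_derivative p)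
qed

text \<open>An ambient polynomial that agrees with \<open>div_M b\<close> on \<open>Mfd\<close>; the
  forward equation takes polynomials as coefficients.\<close>

definition div_poly :: "('n::finite vec3 => 'n vec3) => 'n vec3 => real" where
 "div_poly b m = (SUM a:UNIV. Rd (axis a 1) (%m. b m \<bullet> xi a m) m)"

lemma div_M_poly:
 fixes b :: "'n::finite vec3 => 'n vec3"
 assumes b: "poly_field b" "!!m. m:Mfd ==> b m:tangent m" and m: "m:Mfd"
 shows "div_M b m = div_poly b m" "poly_fun (div_poly b)"
proof -
 have p: "poly_fun (%m. b m \<bullet> xi a m)" for a
 by (rule poly_field_inner[OF b(1) poly_field_linear[OF bounded_linear_xi]])
 obtain b' where b': "!!m. m:Mfd ==> (b has_derivative b' m) (at m within Mfd)" "!!e. continuous_on Mfd (%m. b' m e)"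
 "continuous_on Mfd b" "!!a. continuous_on Mfd (%m. b' m (xi a m))"
 by (rule C1_M_D[OF poly_field_C1[OF b(1)]]) (rule that; assumption)
 show "div_M b m = div_poly b m"
 unfolding div_poly_def Rd_def
 by (subst div_M_tangential[OF b'(1)[OF m] m b(2)[OF m], of "%a. frechet_derivative (%m. b m \<bullet> xi a m) (at m)"])
 (simp_all add: poly_fun_differentiable[OF p] xi_def[symmetric])
 show "poly_fun (div_poly b)" unfolding div_poly_def
 by (rule real_polynomial_function_sum) (simp_all add: poly_fun_Rd p)
qed

lemma continuous_lipschitz:
 fixes tht :: "real => 'a::real_normed_vector"
 assumes "!!s t. s:S ==> t:S ==> norm (tht t - tht s) <= \<Lambda> * \<bar>t - s\<bar>"
 shows "continuous_on S tht"
proof (rule continuous_on_iff[THEN iffD2], intro ballI allI impI)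
 fix t eps assume t: "t:S" and e: "(0::real) < eps"
 have "dist (tht s) (tht t) < eps" if s: "s:S" "dist s t < eps / (\<bar>\<Lambda>\<bar> + 1)" for s
 proof -
 have "norm (tht s - tht t) <= \<Lambda> * \<bar>s - t\<bar>" by (rule assms[OF t s(1)])
 also have "... <= (\<bar>\<Lambda>\<bar> + 1) * \<bar>s - t\<bar>" by (rule mult_right_mono) auto
 also have "... < eps" using s(2) by (simp add: dist_real_def field_simps)
 finally show ?thesis by (simp add: dist_norm)
 qed
 then show "EX d>0. ALL x':S. dist x' t < d --> dist (tht x') (tht t) < eps"
 using e by (intro exI[of _ "eps / (\<bar>\<Lambda>\<bar> + 1)"]) simp
qed

context angular_parabolic
begin

lemma jet_solution_continuous:
 assumes "jet_solution G u"
 shows "length as <= 2 ==> continuous_on ({0..T} \<times> Mfd) (%(t, x). u as t x)"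
 "continuous_on ({0..T} \<times> Mfd) (%(t, x). LJ t (%as. u as t) x)"
proof -
 show c: "continuous_on ({0..T} \<times> Mfd) (%(t, x). u as t x)" if "length as <= 2" for as
 by (rule jet_family_continuous[OF _ _ that]) (use assms in \<open>simp_all add: jet_solution_def\<close>)
 have c': "continuous_on ({0..T} \<times> Mfd) (%x. u as (fst x) (snd x))" if "length as <= 2" for as
 using c[OF that] by (simp add: case_prod_unfold)
 have "continuous_on {0..T} tht" by (rule continuous_lipschitz) (rule lipschitz)
 then have th: "continuous_on ({0..T} \<times> Mfd) (%x. tht (fst x))"
 by (rule continuous_on_compose2) (auto intro!: continuous_intros)
 show "continuous_on ({0..T} \<times> Mfd) (%(t, x). LJ t (%as. u as t) x)"
 unfolding LJ_def gm_def case_prod_unfold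
 by (intro continuous_intros c' th continuous_on_snd_Mfd[OF continuous_on_poly_fun] poly_be poly_gm0) simp_all
qed

end

section \<open>Adjoint and terminal value problems as forward equations\<close>

lemma DERIV_shift_within:
 assumes "(f has_real_derivative D) (at (g t) within B)" "(g has_real_derivative E) (at t within A)" "g ` A \<subseteq> B"
 shows "((%s. f (g s)) has_real_derivative D * E) (at t within A)"
 using DERIV_image_chain[OF DERIV_subset[OF assms(1,3)] assms(2)] by (simp add: comp_def)

text \<open>Minus the adjoint operator is \<open>\<nu>^2 / 2\<close> times the Laplacian plus the
  derivative along \<open>b\<close> plus multiplication by \<open>div b - c\<close>. After shifting
  time by \<open>s0\<close> this is an instance of the forward equation, with the frame components
  of \<open>b\<close> as drift coefficients.\<close>

lemma adjoint_solution_exists: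
 fixes b :: "'n::finite vec3 => 'n vec3" and c :: "real => 'n vec3 => real"
 assumes \<nu>: "\<nu> > 0" and b: "poly_field b" "!!m. m:Mfd ==> b m:tangent m"
 and c: "!!t m. t:{0..T} ==> m:Mfd ==> c t m = k0 - tht t \<bullet> m"
 and lip: "!!s t. s:{0..T} ==> t:{0..T} ==> norm (tht t - tht s) <= \<Lambda> * \<bar>t - s\<bar>"
 and s0: "0 <= s0" "s0 < T" and p: "poly_fun p"
 shows "EX ph. adjoint_solution T \<nu> b c s0 ph & (ALL m:Mfd. ph s0 m = p m)"
proof -
 have pb: "poly_fun (%m. b m \<bullet> xi a m)" for a
 by (rule poly_field_inner[OF b(1) poly_field_linear[OF bounded_linear_xi]])
 obtain m0 :: "'n vec3" where "m0:Mfd" using Mfd_nonempty by blast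
 note dp = div_M_poly(2)[OF b this]
 interpret ap: angular_parabolic "\<nu>^2 / 2" "T - s0" "%a m. b m \<bullet> xi a m" "%m. div_poly b m - k0" "%r. tht (s0 + r)" \<Lambda>
 proof
 show "norm (tht (s0 + t) - tht (s0 + s)) <= \<Lambda> * \<bar>t - s\<bar>" if "s:{0..T - s0}" "t:{0..T - s0}" for s t
 using lip[of "s0 + s" "s0 + t"] that s0 by simp
 qed (use \<nu> s0 in \<open>simp_all add: pb real_polynomial_function_diff[OF dp real_polynomial_function.intros(2)]\<close>)
 have "jet_approx (%as. Rb as p)" unfolding jet_approx_def using p by (intro allI impI exI[of _ p]) simp
 then obtain u where u: "ap.jet_solution (%as. Rb as p) u" by (rule ap.general_solution)
 have J: "jet_approx (%as. u as r)" if "r:{0..T - s0}" for r using u that by (simp add: ap.jet_solution_def)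
 have u0: "u [] 0 m = p m" if "m:Mfd" for m using u that by (simp add: ap.jet_solution_def)
 have ut: "((%s. u [] s x) has_real_derivative ap.LJ t (%as. u as t) x) (at t within {0..T - s0})"
 if "t:{0..T - s0}" "x:Mfd" for t x using u that by (simp add: ap.jet_solution_def)
 define ph where "ph = (%t. u [] (t - s0))"
 have adj: "adjoint_L \<nu> b c t (ph t) m = - ap.LJ (t - s0) (%as. u as (t - s0)) m" if t: "t:{s0..T}" and m: "m:Mfd" for t m
 proof -
 have r: "t - s0:{0..T - s0}" using t by auto
 note Jr = J[OF r]
 have g: "C1_grad (ph t) (grad_M (ph t))" using jet_approx_C1_grad(1)[OF Jr] by (simp add: ph_def)
 obtain b' where b': "!!m. m:Mfd ==> (b has_derivative b' m) (at m within Mfd)" "!!e. continuous_on Mfd (%m. b' m e)"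
 "continuous_on Mfd b" "!!a. continuous_on Mfd (%m. b' m (xi a m))"
 by (rule C1_M_D[OF poly_field_C1[OF b(1)]]) (rule that; assumption)
 have "div_M (%x. ph t x *\<^sub>R b x) m = ph t m * div_M b m + grad_M (ph t) m \<bullet> b m"
 by (rule integration_by_parts(2)[OF _ _ b'(1,4) b(2) m]) (use g in \<open>simp_all add: C1_grad_def\<close>)
 also have "grad_M (ph t) m \<bullet> b m = (SUM a:UNIV. (b m \<bullet> xi a m) * u [a] (t - s0) m)"
 unfolding ph_def jet_approx_grad(1)[OF Jr m] by (simp add: inner_sum_left inner_commute[of "b m"] mult.commute)
 also have "div_M b m = div_poly b m" by (rule div_M_poly(1)[OF b m])
 finally have e1: "div_M (%x. ph t x *\<^sub>R b x) m = u [] (t - s0) m * div_poly b m + (SUM a:UNIV. (b m \<bullet> xi a m) * u [a] (t - s0) m)"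
 by (simp only: ph_def)
 have e2: "laplace_beltrami (ph t) m = (SUM a:UNIV. u [a, a] (t - s0) m)"
 unfolding ph_def by (rule jet_approx_laplace[OF Jr m])
 have e3: "c t m = k0 - tht t \<bullet> m" using c t m s0 by simp
 have e4: "s0 + (t - s0) = t" by simp
 show ?thesis
 unfolding adjoint_L_def ap.LJ_def ap.gm_def e1 e2 e3 e4 by (simp only: ph_def) (simp add: algebra_simps)
 qed
 have cont: "continuous_on ({s0..T} \<times> Mfd) (%(t, m). F (t - s0) m)"
 if "continuous_on ({0..T - s0} \<times> Mfd) (%(t, m). F t m)" for F :: "real => 'n vec3 => real"
 proof -
 have "continuous_on ({s0..T} \<times> Mfd) (%x. (%(t, m). F t m) (fst x - s0, snd x))"
 by (rule continuous_on_compose2[OF that]) (auto intro!: continuous_intros)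
 then show ?thesis by (simp add: case_prod_unfold)
 qed
 have "adjoint_solution T \<nu> b c s0 ph" unfolding adjoint_solution_def
 proof (intro conjI ballI)
 show "continuous_on ({s0..T} \<times> Mfd) (%(t, m). ph t m)"
 unfolding ph_def by (rule cont[OF ap.jet_solution_continuous(1)[OF u]]) simp
 have "continuous_on ({s0..T} \<times> Mfd) (%(t, m). - ap.LJ (t - s0) (%as. u as (t - s0)) m)"
 using cont[OF ap.jet_solution_continuous(2)[OF u]] unfolding case_prod_unfold by (intro continuous_intros)
 then show "continuous_on ({s0..T} \<times> Mfd) (%(t, m). adjoint_L \<nu> b c t (ph t) m)"
 by (rule continuous_on_eq) (auto simp: adj)
 show "EX k. C1_grad (ph t) k & C1_M k" if "t:{s0..T}" for t
 using jet_approx_C1_grad[OF J, of "t - s0"] that by (intro exI[of _ "grad_M (ph t)"]) (simp add: ph_def)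
 show "((%s. ph s m) has_real_derivative - adjoint_L \<nu> b c t (ph t) m) (at t within {s0..T})"
 if t: "t:{s0..T}" and m: "m:Mfd" for t m
 proof -
 have "((%s. u [] (s - s0) m) has_real_derivative ap.LJ (t - s0) (%as. u as (t - s0)) m * 1) (at t within {s0..T})"
 by (rule DERIV_shift_within[OF ut]) (use t m in \<open>auto intro!: derivative_eq_intros\<close>)
 then show ?thesis unfolding adj[OF t m] by (simp add: ph_def)
 qed
 qed
 then show ?thesis using u0 by (intro exI[of _ ph]) (simp add: ph_def)
qed

text \<open>The shift by \<open>\<Gamma>\<close> makes the zeroth-order coefficient nonnegative, so that the lower bound of
 the initial value is preserved.\<close>

lemma classical_solution_exists:
 fixes b :: "'n::finite vec3 => 'n vec3" and c :: "real => 'n vec3 => real"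
 assumes \<nu>: "\<nu> > 0" and T: "T > 0" and b: "poly_field b" "!!m. m:Mfd ==> b m:tangent m"
 and c: "!!t m. t:{0..T} ==> m:Mfd ==> c t m = k0 - tht t \<bullet> m"
 and \<Gamma>: "!!t m. t:{0..T} ==> m:Mfd ==> c t m <= \<Gamma>"
 and lip: "!!s t. s:{0..T} ==> t:{0..T} ==> norm (tht t - tht s) <= \<Lambda> * \<bar>t - s\<bar>"
 and G: "jet_approx G" and \<mu>: "\<mu> > 0" "!!m. m:Mfd ==> \<mu> <= G [] m"
 shows "EX w. classical_solution_L T \<nu> b c (G []) w & (ALL t:{0..T}. ALL m:Mfd. w t m > 0)"
proof -
 have pb: "poly_fun (%m. - (b m \<bullet> xi a m))" for a
 by (rule real_polynomial_function_minus[OF poly_field_inner[OF b(1) poly_field_linear[OF bounded_linear_xi]]])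
 \<comment> \<open>Reversing time by \<open>r = T - t\<close> turns the terminal value problem into
   the forward equation with drift \<open>- b\<close> and zeroth-order coefficient
   \<open>\<Gamma> - c\<close>.\<close>
 interpret ap: angular_parabolic "\<nu>^2 / 2" T "%a m. - (b m \<bullet> xi a m)" "%m. \<Gamma> - k0" "%r. tht (T - r)" \<Lambda>
 proof
 show "norm (tht (T - t) - tht (T - s)) <= \<Lambda> * \<bar>t - s\<bar>" if "s:{0..T}" "t:{0..T}" for s t
 using lip[of "T - s" "T - t"] that by (simp add: abs_minus_commute)
 qed (use \<nu> T in \<open>simp_all add: pb real_polynomial_function.intros(2)\<close>)
 have gm: "ap.gm (T - t) m = \<Gamma> - c t m" if "t:{0..T}" "m:Mfd" for t m
 using c[OF that] by (simp add: ap.gm_def)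
 have gm0: "ALL t:{0..T}. ALL x:Mfd. 0 <= ap.gm t x"
 proof (intro ballI)
 fix t and x :: "'n vec3" assume h: "t:{0..T}" "x:Mfd"
 then have t': "T - t:{0..T}" by auto
 show "0 <= ap.gm t x" using gm[OF t' h(2)] \<Gamma>[OF t' h(2)] by simp
 qed
 obtain u where u: "ap.jet_solution G u" and low:
 "!!m t x. (ALL t:{0..T}. ALL x:Mfd. 0 <= ap.gm t x) ==> m > 0 ==> ALL x:Mfd. m <= G [] x ==> t:{0..T} ==> x:Mfd ==> m <= u [] t x"
 by (rule ap.general_solution[OF G]) (rule that; assumption)
 have J: "jet_approx (%as. u as r)" if "r:{0..T}" for r using u that by (simp add: ap.jet_solution_def)
 have u0: "u [] 0 m = G [] m" if "m:Mfd" for m using u that by (simp add: ap.jet_solution_def)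
 have ut: "((%s. u [] s x) has_real_derivative ap.LJ t (%as. u as t) x) (at t within {0..T})"
 if "t:{0..T}" "x:Mfd" for t x using u that by (simp add: ap.jet_solution_def)
 \<comment> \<open>Undoes the shift: \<open>E\<close> has derivative \<open>\<Gamma> * E\<close> and
   the value 1 at \<open>T\<close>, so the terminal datum is unchanged.\<close>
 define E where "E = (%t. exp (- (\<Gamma> * (T - t))))"
 define W where "W = (%as t x. E t * u as (T - t) x)"
 define Wt where "Wt = (%t x. \<Gamma> * W [] t x - E t * ap.LJ (T - t) (%as. u as (T - t)) x)"
 have Ec: "continuous_on S E" for S unfolding E_def by (intro continuous_intros)
 have Ec': "continuous_on ({0..T} \<times> Mfd) (%x :: real \<times> 'n vec3. E (fst x))"
 by (rule continuous_on_compose2[OF Ec[of UNIV]]) (auto intro!: continuous_intros)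
 have rev: "continuous_on ({0..T} \<times> Mfd) (%x. F (T - fst x) (snd x))"
 if "continuous_on ({0..T} \<times> Mfd) (%(t, m). F t m)" for F :: "real => 'n vec3 => real"
 proof -
 have "continuous_on ({0..T} \<times> Mfd) (%x. (%(t, m). F t m) (T - fst x, snd x))"
 by (rule continuous_on_compose2[OF that]) (auto intro!: continuous_intros)
 then show ?thesis by (simp add: case_prod_unfold)
 qed
 note uc = rev[OF ap.jet_solution_continuous(1)[OF u]] and lc = rev[OF ap.jet_solution_continuous(2)[OF u]]
 have WJ: "jet_approx (%as. W as t)" if "t:{0..T}" for t
 unfolding W_def by (rule jet_approx_scale[OF J]) (use that in simp)
 have Wc: "continuous_on ({0..T} \<times> Mfd) (%(t, x). W as t x)" if "length as <= 2" for as
 unfolding W_def case_prod_unfold by (intro continuous_intros Ec' uc[OF that])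
 have Wtc: "continuous_on ({0..T} \<times> Mfd) (%(t, x). Wt t x)"
 using Wc[of "[]"] lc unfolding Wt_def case_prod_unfold by (intro continuous_intros Ec') simp_all
 have Wd: "((%s. W [] s x) has_real_derivative Wt t x) (at t within {0..T})" if tx: "t:{0..T}" "x:Mfd" for t x
 proof -
 have 1: "(E has_real_derivative \<Gamma> * E t) (at t within {0..T})"
 unfolding E_def by (auto intro!: derivative_eq_intros)
 have 2: "((%s. u [] (T - s) x) has_real_derivative ap.LJ (T - t) (%as. u as (T - t)) x * (-1)) (at t within {0..T})"
 by (rule DERIV_shift_within[OF ut]) (use tx in \<open>auto intro!: derivative_eq_intros\<close>)
 show ?thesis unfolding W_def Wt_def
 by (rule DERIV_cong[OF DERIV_mult[OF 1 2]]) (simp add: algebra_simps)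
 qed
 have C1: "C12 T (W [])" by (rule jet_family_C12(1)[OF T WJ Wc Wtc Wd]) simp_all
 have C2: "time_deriv T (W []) t m = Wt t m" if "t:{0..T}" "m:Mfd" for t m
 by (rule jet_family_C12(2)[OF T WJ Wc Wtc Wd]) (use that in simp_all)
 have "classical_solution_L T \<nu> b c (G []) (W [])" unfolding classical_solution_L_def
 proof (intro conjI ballI)
 show "C12 T (W [])" by (rule C1)
 show "W [] T m = G [] m" if "m:Mfd" for m using u0[OF that] by (simp add: W_def E_def)
 fix t and m :: "'n vec3" assume "t:{0..<T}" and m: "m:Mfd"
 then have t: "t:{0..T}" by simp
 have g: "b m \<bullet> grad_M (W [] t) m = E t * (SUM a:UNIV. (b m \<bullet> xi a m) * u [a] (T - t) m)"
 unfolding jet_approx_grad(1)[OF WJ[OF t] m] by (simp add: inner_sum_right W_def sum_distrib_left mult_ac)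
 have l: "laplace_beltrami (W [] t) m = E t * (SUM a:UNIV. u [a, a] (T - t) m)"
 unfolding jet_approx_laplace[OF WJ[OF t] m] by (simp add: W_def sum_distrib_left)
 have L: "ap.LJ (T - t) (%as. u as (T - t)) m = \<nu>^2 / 2 * (SUM a:UNIV. u [a, a] (T - t) m)
 - (SUM a:UNIV. (b m \<bullet> xi a m) * u [a] (T - t) m) + (\<Gamma> - c t m) * u [] (T - t) m"
 unfolding ap.LJ_def gm[OF t m] by (simp add: sum_negf)
 show "- time_deriv T (W []) t m - \<nu>^2 / 2 * laplace_beltrami (W [] t) m + b m \<bullet> grad_M (W [] t) m + c t m * W [] t m = 0"
 unfolding C2[OF t m] g l Wt_def L by (simp add: W_def algebra_simps)
 qed
 moreover have "W [] t m > 0" if t: "t:{0..T}" and m: "m:Mfd" for t m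
 proof -
 have "\<mu> <= u [] (T - t) m" by (rule low[OF gm0 \<mu>(1) _ _ m]) (use \<mu>(2) t in auto)
 then show ?thesis using \<mu>(1) by (simp add: W_def E_def)
 qed
 ultimately show ?thesis by blast
qed

text \<open>The squared \<open>L^2\<close> distance is continuous in time and zero almost
  everywhere, hence zero at each time; there the continuous integrand vanishes pointwise, because
  \<open>vol_M\<close> charges every ball around a point of \<open>Mfd\<close>.\<close>

lemma classical_solution_unique:
 fixes w1 w2 :: "real => 'n::finite vec3 => real"
 assumes T: "T > 0" and c1: "continuous_on ({0..T} \<times> Mfd) (%(t, m). w1 t m)"
 and c2: "continuous_on ({0..T} \<times> Mfd) (%(t, m). w2 t m)"
 and ae: "AE t in lebesgue_on {0..T}. AE m in vol_M. w1 t m = w2 t m"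
 and t: "t:{0..T}" and m: "m:Mfd"
 shows "w1 t m = w2 t m"
proof -
 define d where "d = (%t. LINT m|vol_M. (w1 t m - w2 t m)^2)"
 have dc: "continuous_on {0..T} d" unfolding d_def
 using c1 c2 by (intro continuous_on_integral) (auto simp: case_prod_unfold intro!: continuous_intros)
 have "AE t in lebesgue_on {0..T}. d t = 0"
 using ae
 proof eventually_elim
 case (elim t)
 then have "AE m in vol_M. (w1 t m - w2 t m)^2 = 0" by eventually_elim simp
 then show ?case unfolding d_def by (rule integral_eq_zero_AE)
 qed
 then have "(LINT t|lebesgue_on {0..T}. d t) = 0" by (rule integral_eq_zero_AE)
 then have "(d has_integral 0) {0..T}"
 using lebesgue_on_integral_eq[OF dc] integrable_integral[OF integrable_continuous_real[OF dc]] by simp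
 then have "d t = 0"
 using has_integral_0_cbox_imp_0[of 0 T d t] dc t T by (simp add: d_def)
 then have z: "(LINT m|vol_M. (w1 t m - w2 t m)^2) = 0" by (simp only: d_def)
 have "continuous_on Mfd (%m. (w1 t m - w2 t m)^2)"
 by (intro continuous_intros slice_continuous[OF c1 t] slice_continuous[OF c2 t])
 from integral_zero_imp_zero[OF this zero_le_power2 z m] have "(w1 t m - w2 t m)^2 = 0" .
 then show ?thesis by simp
qed

section \<open>The control problem\<close>

lemma tangent_cross_vec_right: "cross_vec m y:tangent m"
 by (simp add: tangent_def dot_cross_self)

lemma Sigma_mat_mult: "Sigma_mat \<alpha> m *v y = cross_vec m y - \<alpha> *\<^sub>R cross_vec m (cross_vec m y)"
proof -
 have s: "sigma_mat m *v x = cross_vec m x" for x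
 unfolding sigma_mat_def by (rule fun_cong[OF matrix_vector_mul(3)[OF cross_vec.bounded_linear_right]])
 show ?thesis
 unfolding Sigma_mat_def matrix_vector_mul_assoc[symmetric] matrix_vector_mult_diff_rdistrib
 matrix_vector_mul_lid scaleR_matrix_vector_assoc[symmetric] s ..
qed

lemma b_field_tangent: "b_field \<alpha> Q m:tangent m"
 unfolding b_field_def Sigma_mat_mult
 by (intro subspace_diff[OF subspace_tangent] subspace_scale[OF subspace_tangent] tangent_cross_vec_right)

lemma poly_field_b_field: "poly_field (b_field \<alpha> Q)"
proof -
 have id: "poly_field (%m. m)" by (rule poly_field_linear[OF bounded_linear_ident])
 have q: "poly_field (%m. Q *v m)" by (rule poly_field_linear[OF matrix_vector_mul_bounded_linear])
 have "poly_field (%m. cross_vec m (Q *v m) - \<alpha> *\<^sub>R cross_vec m (cross_vec m (Q *v m)))"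
 by (intro poly_field_diff poly_field_scale poly_field_cross id q)
 then show ?thesis by (simp add: b_field_def[abs_def] Sigma_mat_mult)
qed

lemma norm_cross_vec_tangent:
 fixes m v :: "'n::finite vec3"
 assumes m: "m:Mfd" and v: "v:tangent m"
 shows "cross_vec v m \<bullet> cross_vec v m = v \<bullet> v"
 unfolding inner_blk
proof (rule sum.cong[OF refl])
 fix i :: 'n
 have o: "blk v i \<bullet> blk m i = 0" using v by (simp add: tangent_def inner_commute[of "blk v i"])
 have n: "norm (blk m i) = 1" using m by (simp add: Mfd_def)
 have b: "blk (cross_vec v m) i = cross3 (blk v i) (blk m i)" by simp
 show "blk (cross_vec v m) i \<bullet> blk (cross_vec v m) i = blk v i \<bullet> blk v i"
 using norm_cross[of "blk v i" "blk m i"] unfolding b o n power2_norm_eq_inner by simp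
qed

lemma Sigma_mat_adjoint:
 "(Sigma_mat \<alpha> m *v y) \<bullet> p = y \<bullet> (cross_vec p m - \<alpha> *\<^sub>R cross_vec (cross_vec p m) m)"
proof -
 have c: "cross_vec m z \<bullet> q = z \<bullet> cross_vec q m" for z q
 by (metis inner_cross_vec inner_commute)
 show ?thesis unfolding Sigma_mat_mult inner_diff_left inner_diff_right inner_scaleR_left inner_scaleR_right c ..
qed

text \<open>On tangent vectors the cross product with \<open>m\<close> is an isometry, and one and
  two applications of it give orthogonal vectors, so the squares of the two parts add. This is the
  source of the factor \<open>1 + \<alpha>^2\<close> in \<open>\<beta>\<close>.\<close>

lemma Sigma_mat_adjoint_norm:
 fixes m p q :: "'n::finite vec3" and \<alpha> :: real
 assumes m: "m:Mfd" and p: "p:tangent m"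
 and q: "q = cross_vec p m - \<alpha> *\<^sub>R cross_vec (cross_vec p m) m"
 shows "q \<bullet> q = (1 + \<alpha>^2) * (p \<bullet> p)"
proof -
 define a where "a = cross_vec p m"
 define d where "d = cross_vec a m"
 have aa: "a \<bullet> a = p \<bullet> p" unfolding a_def by (rule norm_cross_vec_tangent[OF m p])
 have dd: "d \<bullet> d = a \<bullet> a" unfolding d_def by (rule norm_cross_vec_tangent[OF m]) (simp add: a_def)
 have "d \<bullet> a = a \<bullet> cross_vec m a" unfolding d_def by (rule inner_cross_vec)
 then have da: "d \<bullet> a = 0" "a \<bullet> d = 0" by (simp_all add: inner_commute)
 have "q \<bullet> q = a \<bullet> a + \<alpha>^2 * (d \<bullet> d)"
 unfolding q a_def[symmetric] d_def[symmetric] by (simp add: inner_diff_left inner_diff_right da power2_eq_square)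
 then show ?thesis by (simp add: dd aa algebra_simps)
qed

text \<open>Completing the square: the supremum is attained at \<open>u = - (C / lam) q\<close>.\<close>

lemma hamiltonian_sup:
 fixes m p :: "'n::finite vec3"
 assumes lam: "lam > 0" and m: "m:Mfd" and p: "p:tangent m"
 shows "(SUP u. - (f_field \<alpha> C Q m u \<bullet> p) - lam / 2 * (norm u)^2)
 = b_field \<alpha> Q m \<bullet> p + C^2 * (1 + \<alpha>^2) / (2 * lam) * (norm p)^2"
proof -
 define q where "q = cross_vec p m - \<alpha> *\<^sub>R cross_vec (cross_vec p m) m"
 have q: "q \<bullet> q = (1 + \<alpha>^2) * (p \<bullet> p)" by (rule Sigma_mat_adjoint_norm[OF m p q_def])
 have f: "f_field \<alpha> C Q m u \<bullet> p = - (b_field \<alpha> Q m \<bullet> p) + C * (u \<bullet> q)" for u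
 unfolding f_field_def b_field_def Sigma_mat_adjoint q_def[symmetric] by (simp add: inner_add_left inner_diff_left)
 have sq: "- (f_field \<alpha> C Q m u \<bullet> p) - lam / 2 * (norm u)^2
 = b_field \<alpha> Q m \<bullet> p + C^2 * (1 + \<alpha>^2) / (2 * lam) * (norm p)^2 - lam / 2 * (norm (u + (C / lam) *\<^sub>R q))^2" for u
 proof -
 have sqk: "(norm (u + k *\<^sub>R q))^2 = u \<bullet> u + 2 * k * (u \<bullet> q) + k^2 * (q \<bullet> q)" for k :: real
 unfolding power2_norm_eq_inner
 by (simp add: inner_add_left inner_add_right inner_commute[of q u] power2_eq_square algebra_simps)
 have k: "lam / 2 * (norm (u + (C / lam) *\<^sub>R q))^2 = lam / 2 * (u \<bullet> u) + C * (u \<bullet> q) + C^2 / (2 * lam) * (q \<bullet> q)"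
 unfolding sqk using lam by (simp add: field_simps power2_eq_square)
 have e: "C^2 / (2 * lam) * (q \<bullet> q) = C^2 * (1 + \<alpha>^2) / (2 * lam) * (norm p)^2"
 by (simp add: q power2_norm_eq_inner)
 have n: "(norm u)^2 = u \<bullet> u" by (rule power2_norm_eq_inner)
 show ?thesis unfolding f n using k e by linarith
 qed
 show ?thesis
 proof (rule cSup_eq_maximum)
 show "b_field \<alpha> Q m \<bullet> p + C^2 * (1 + \<alpha>^2) / (2 * lam) * (norm p)^2:range (%u. - (f_field \<alpha> C Q m u \<bullet> p) - lam / 2 * (norm u)^2)"
 unfolding sq by (rule image_eqI[of _ _ "- (C / lam) *\<^sub>R q"]) simp_all
 fix x assume "x:range (%u. - (f_field \<alpha> C Q m u \<bullet> p) - lam / 2 * (norm u)^2)"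
 then show "x <= b_field \<alpha> Q m \<bullet> p + C^2 * (1 + \<alpha>^2) / (2 * lam) * (norm p)^2"
 unfolding sq using lam by auto
 qed
qed

text \<open>\<open>ph1\<close> and \<open>ph2\<close> stand for the first two derivatives of
  \<open>- (1 / be) * ln\<close> at \<open>w\<close>, \<open>N\<close> for
  \<open>\<nu>^2 / 2\<close> and \<open>G\<close> for the squared gradient norm. The relation
  \<open>ph2 = be * ph1^2\<close> makes the second-order term of the chain rule cancel the quadratic
  term of the Hamiltonian.\<close>

lemma hopf_cole_forward:
 fixes wt N L bg c w ph1 ph2 be G :: real
 assumes "ph2 = be * ph1^2" "ph1 * w = - (1 / be)" "- wt - N * L + bg + c * w = 0"
 shows "- (ph1 * wt) + (- N * (ph1 * L + ph2 * G) - c / be + (ph1 * bg + N * be * (ph1^2 * G))) = 0"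
proof -
 have "- (ph1 * wt) + (- N * (ph1 * L + ph2 * G) - c / be + (ph1 * bg + N * be * (ph1^2 * G)))
 = ph1 * (- wt - N * L + bg + c * w) - c * (ph1 * w) - c / be"
 unfolding assms(1) by (simp add: algebra_simps)
 then show ?thesis unfolding assms(2,3) by simp
qed

text \<open>The same cancellation for \<open>exp (- be * W)\<close>: its derivative
  \<open>ph1\<close> factors out of the linear equation, and \<open>ph2 = - be * ph1\<close> turns
  the chain rule term into the quadratic one.\<close>

lemma hopf_cole_backward:
 fixes Wt N L bg c w ph1 ph2 be G :: real
 assumes "be \<noteq> 0" "ph1 = - be * w" "ph2 = be^2 * w" "- Wt + (- N * L - c / be + (bg + N * be * G)) = 0"
 shows "- (ph1 * Wt) - N * (ph1 * L + ph2 * G) + ph1 * bg + c * w = 0"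
proof -
 have "- (ph1 * Wt) - N * (ph1 * L + ph2 * G) + ph1 * bg + c * w
 = ph1 * (- Wt + (- N * L - c / be + (bg + N * be * G)))"
 unfolding assms(2,3) using assms(1) by (simp add: field_simps power2_eq_square)
 then show ?thesis unfolding assms(4) by simp
qed

lemma C2_curve_lipschitz:
 assumes "C2_curve T gm"
 obtains \<Lambda> where "!!s t. s:{0..T} ==> t:{0..T} ==> norm (gm t - gm s) <= \<Lambda> * \<bar>t - s\<bar>"
proof -
 obtain d d2 where d: "!!t. t:{0..T} ==> (gm has_vector_derivative d t) (at t within {0..T})"
 "!!t. t:{0..T} ==> (d has_vector_derivative d2 t) (at t within {0..T})"
 using assms unfolding C2_curve_def by blast
 have "continuous_on {0..T} d"
 unfolding continuous_on_eq_continuous_within using d(2) has_vector_derivative_continuous by blast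
 then have "bounded (d ` {0..T})" by (intro compact_imp_bounded compact_continuous_image compact_Icc)
 then obtain B where B: "!!t. t:{0..T} ==> norm (d t) <= B" unfolding bounded_iff by blast
 show ?thesis
 proof (rule that)
 fix s t assume st: "s:{0..T}" "t:{0..T}"
 have "norm (gm t - gm s) <= B * norm (t - s)"
 proof (rule differentiable_bound[where S = "{0..T}" and f' = "%t x. x *\<^sub>R d t"])
 show "(gm has_derivative (%x. x *\<^sub>R d x')) (at x' within {0..T})" if "x':{0..T}" for x'
 using d(1)[OF that] by (simp add: has_vector_derivative_def)
 show "onorm (%x. x *\<^sub>R d x') <= B" if "x':{0..T}" for x'
 proof (rule onorm_le)
 fix y :: real show "norm (y *\<^sub>R d x') <= B * norm y"
 using mult_right_mono[OF B[OF that], of "\<bar>y\<bar>"] by (simp add: mult.commute)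
 qed
 qed (use st in auto)
 then show "norm (gm t - gm s) <= B * \<bar>t - s\<bar>" by simp
 qed
qed

theorem theorem3p1:
  fixes T lam \<nu> \<alpha> \<delta> Cext \<beta> :: real
    and J D Q :: "'n::finite mat3"
    and h :: "'n vec3 \<Rightarrow> real"
    and mt :: "real \<Rightarrow> 'n vec3"
    and c :: "real \<Rightarrow> 'n vec3 \<Rightarrow> real"
  assumes "T > 0" and "lam > 0" and "\<nu> > 0" and "\<alpha> \<ge> 0" and "\<delta> \<ge> 0" and "Cext \<noteq> 0"
    and J_sym: "transpose J = J" and J_psd: "\<forall>x. x \<bullet> (J *v x) \<ge> 0"
    and D_diag: "\<forall>p q. p \<noteq> q \<longrightarrow> D $ p $ q = 0"
    and Q: "Q = J + D"
    and h: "C2_M h"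
    and mt: "C2_curve T mt"
    and beta: "\<beta> = Cext\<^sup>2 * (1 + \<alpha>\<^sup>2) / (lam * \<nu>\<^sup>2)"
    and c: "c = (\<lambda>t m. \<beta> * \<delta> * (norm (m - mt t))\<^sup>2)"
  shows "\<exists>w :: real \<Rightarrow> 'n vec3 \<Rightarrow> real.
      classical_solution_L T \<nu> (b_field \<alpha> Q) c (\<lambda>m. exp (- \<beta> * h m)) w
    \<and> (\<forall>w'. classical_solution_L T \<nu> (b_field \<alpha> Q) c (\<lambda>m. exp (- \<beta> * h m)) w'
          \<longrightarrow> (\<forall>t\<in>{0..T}. \<forall>m\<in>Mfd. w' t m = w t m))
    \<and> weak_solution_L T \<nu> (b_field \<alpha> Q) c (\<lambda>m. exp (- \<beta> * h m)) w
    \<and> (\<forall>w'. weak_solution_L T \<nu> (b_field \<alpha> Q) c (\<lambda>m. exp (- \<beta> * h m)) w'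
          \<longrightarrow> (AE t in lebesgue_on {0..T}. AE m in vol_M. w' t m = w t m))
    \<and> (\<forall>t\<in>{0..T}. \<forall>m\<in>Mfd. w t m > 0)
    \<and> classical_solution_HJB T (hamiltonian lam \<nu> \<delta> mt (f_field \<alpha> Cext Q)) h
          (\<lambda>t m. - (1 / \<beta>) * ln (w t m))
    \<and> (\<forall>W. classical_solution_HJB T (hamiltonian lam \<nu> \<delta> mt (f_field \<alpha> Cext Q)) h W
          \<longrightarrow> (\<forall>t\<in>{0..T}. \<forall>m\<in>Mfd. W t m = - (1 / \<beta>) * ln (w t m)))"
proof -
 note T = \<open>T > 0\<close> and lam = \<open>lam > 0\<close> and \<nu> = \<open>\<nu> > 0\<close>
 have "1 + \<alpha>^2 > 0" using zero_le_power2[of \<alpha>] by linarith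
 then have \<beta>: "\<beta> > 0" unfolding beta using lam \<nu> \<open>Cext \<noteq> 0\<close> by simp
 then have \<beta>0: "\<beta> \<noteq> 0" by simp
 \<comment> \<open>The value of \<open>\<beta>\<close> is the one for which the coefficient of the
   squared gradient in the Hamiltonian becomes \<open>\<nu>^2 / 2 * \<beta>\<close>, as the
   logarithmic substitution demands.\<close>
 have K: "Cext^2 * (1 + \<alpha>^2) / (2 * lam) = \<nu>^2 / 2 * \<beta>" unfolding beta using lam \<nu> by (simp add: field_simps)
 define b where "b = b_field \<alpha> Q"
 define g where "g = (%m. exp (- \<beta> * h m))"
 have bp: "poly_field b" unfolding b_def by (rule poly_field_b_field)
 have bt: "b m:tangent m" for m unfolding b_def by (rule b_field_tangent)
 have bC: "C1_M b" by (rule poly_field_C1[OF bp])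
 have bc: "continuous_on Mfd b" by (rule C1_M_D[OF bC])
 have mtM: "mt t:Mfd" if "t:{0..T}" for t using mt that by (simp add: C2_curve_def)
 obtain \<Lambda>0 where \<Lambda>0: "!!s t. s:{0..T} ==> t:{0..T} ==> norm (mt t - mt s) <= \<Lambda>0 * \<bar>t - s\<bar>"
 by (rule C2_curve_lipschitz[OF mt]) (rule that; assumption)
 have mtc: "continuous_on {0..T} mt" by (rule continuous_lipschitz) (rule \<Lambda>0)
 have mtc': "continuous_on ({0..T} \<times> (Mfd :: 'n vec3 set)) (%x. mt (fst x))"
 by (rule continuous_on_compose2[OF mtc]) (auto intro!: continuous_intros)
 have cc: "continuous_on ({0..T} \<times> Mfd) (%(t, m). c t m)"
 unfolding c case_prod_unfold by (intro continuous_intros mtc')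
 obtain \<Gamma> where \<Gamma>: "!!t m. t:{0..T} ==> m:Mfd ==> c t m <= \<Gamma>"
 using bounded_on_cylinder[OF cc] unfolding real_norm_def by (metis abs_le_D1)
 \<comment> \<open>All points of \<open>Mfd\<close> have squared norm \<open>CARD('n)\<close>, so on
   \<open>Mfd\<close> the quadratic cost is affine in \<open>m\<close>; \<open>\<theta>\<close>
   carries its time dependence into the forward equation.\<close>
 define \<theta> where "\<theta> = (%t. (2 * (\<beta> * \<delta>)) *\<^sub>R mt t)"
 define k0 where "k0 = \<beta> * \<delta> * (2 * real CARD('n))"
 have ck: "c t m = k0 - \<theta> t \<bullet> m" if "t:{0..T}" "m:Mfd" for t m
 proof -
 have "(norm (m - mt t))^2 = (norm m)^2 + (norm (mt t))^2 - 2 * (mt t \<bullet> m)"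
 by (simp add: power2_norm_eq_inner inner_diff_left inner_diff_right inner_commute[of m "mt t"])
 then have e: "(norm (m - mt t))^2 = 2 * real CARD('n) - 2 * (mt t \<bullet> m)"
 unfolding norm_Mfd[OF that(2)] norm_Mfd[OF mtM[OF that(1)]] by simp
 show ?thesis unfolding c \<theta>_def k0_def e by (simp add: algebra_simps)
 qed
 have lip: "norm (\<theta> t - \<theta> s) <= (2 * (\<beta> * \<delta>)) * \<Lambda>0 * \<bar>t - s\<bar>" if "s:{0..T}" "t:{0..T}" for s t
 proof -
 have "norm (\<theta> t - \<theta> s) = (2 * (\<beta> * \<delta>)) * norm (mt t - mt s)"
 unfolding \<theta>_def scaleR_diff_right[symmetric] using \<beta> \<open>\<delta> >= 0\<close> by simp
 also have "... <= (2 * (\<beta> * \<delta>)) * (\<Lambda>0 * \<bar>t - s\<bar>)"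
 by (rule mult_left_mono[OF \<Lambda>0[OF that]]) (use \<beta> \<open>\<delta> >= 0\<close> in simp)
 finally show ?thesis by (simp add: mult.assoc)
 qed
 have hC: "C12 T (%t. h)" by (rule C2_M_C12[OF T h])
 have hc: "continuous_on Mfd h" using h unfolding C2_M_def by (auto elim: C1_M_D)
 have d1: "((%y. exp (- \<beta> * y)) has_real_derivative - \<beta> * exp (- \<beta> * y)) (at y)" for y
 by (auto intro!: derivative_eq_intros)
 have d2: "((%y. - \<beta> * exp (- \<beta> * y)) has_real_derivative \<beta>^2 * exp (- \<beta> * y)) (at y)" for y
 by (auto intro!: derivative_eq_intros simp: power2_eq_square)
 have d3: "continuous_on UNIV (%y. \<beta>^2 * exp (- \<beta> * y))" by (intro continuous_intros)
 note expC = C12_compose[OF T _ UNIV_I d1 d2 d3]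
 have gC: "C12 T (%t. g)" using expC(1)[OF hC] by (simp add: g_def)
 have T0: "0:{0..T}" "T:{0..T}" using T by auto
 obtain G where G: "jet_approx G" "G [] = g" by (rule C12_jets[OF gC T0(1)])
 \<comment> \<open>Boundedness of \<open>h\<close> on the compact manifold keeps the terminal datum
   above the positive constant \<open>exp (- \<beta> * Kh)\<close>.\<close>
 obtain Kh where Kh: "!!m. m:Mfd ==> \<bar>h m\<bar> <= Kh" using bounded_on_Mfd[OF hc] by auto
 have low: "exp (- \<beta> * Kh) <= G [] m" if "m:Mfd" for m
 using Kh[OF that] \<beta> by (simp add: G(2) g_def)
 have "EX w. classical_solution_L T \<nu> b c (G []) w & (ALL t:{0..T}. ALL m:Mfd. w t m > 0)"
 by (rule classical_solution_exists[OF \<nu> T bp bt ck \<Gamma> lip G(1) exp_gt_zero low])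
 then obtain w where w: "classical_solution_L T \<nu> b c g w" and pos: "!!t m. t:{0..T} ==> m:Mfd ==> w t m > 0"
 unfolding G(2) by blast
 have weak: "weak_solution_L T \<nu> b c g w'" if "classical_solution_L T \<nu> b c g w'" for w'
 by (rule classical_imp_weak[OF T bc cc that])
 have adj: "EX \<phi>. adjoint_solution T \<nu> b c s0 \<phi> & (ALL m:Mfd. \<phi> s0 m = p m)" if "0 <= s0" "s0 < T" "poly_fun p" for s0 p
 by (rule adjoint_solution_exists[OF \<nu> bp bt ck lip that])
 have weak_unique: "AE t in lebesgue_on {0..T}. AE m in vol_M. w' t m = w t m" if "weak_solution_L T \<nu> b c g w'" for w'
 by (rule weak_solution_unique[OF T bC bt cc adj that weak[OF w]])
 have wC: "C12 T w" and wT: "!!m. m:Mfd ==> w T m = g m" and weq: "!!t m. t:{0..<T} ==> m:Mfd ==>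
 - time_deriv T w t m - \<nu>^2 / 2 * laplace_beltrami (w t) m + b m \<bullet> grad_M (w t) m + c t m * w t m = 0"
 using w unfolding classical_solution_L_def by auto
 have unique: "w' t m = w t m" if w': "classical_solution_L T \<nu> b c g w'" and tm: "t:{0..T}" "m:Mfd" for w' t m
 proof (rule classical_solution_unique[OF T _ C12D(1)[OF wC] weak_unique[OF weak[OF w']] tm])
 show "continuous_on ({0..T} \<times> Mfd) (%(t, m). w' t m)"
 using w' by (intro C12D(1)) (simp add: classical_solution_L_def)
 qed
 have H: "hamiltonian lam \<nu> \<delta> mt (f_field \<alpha> Cext Q) t W m
 = - (\<nu>^2 / 2) * laplace_beltrami W m - c t m / \<beta> + (b m \<bullet> grad_M W m + \<nu>^2 / 2 * \<beta> * (norm (grad_M W m))^2)"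
 if "m:Mfd" "grad_M W m:tangent m" for t W m
 unfolding hamiltonian_def hamiltonian_sup[OF lam that] K b_def using \<beta> by (simp add: c)
 define V where "V = (%t m. - (1 / \<beta>) * ln (w t m))"
 have l1: "((%y. - (1 / \<beta>) * ln y) has_real_derivative - (1 / \<beta>) * inverse y) (at y)" if "y:{0<..}" for y
 using that \<beta> by (auto intro!: derivative_eq_intros simp: divide_inverse)
 have l2: "((%y. - (1 / \<beta>) * inverse y) has_real_derivative (1 / \<beta>) * (inverse y)^2) (at y)" if "y:{0<..}" for y
 using that \<beta> by (auto intro!: derivative_eq_intros simp: power2_eq_square)
 have l3: "continuous_on {0<..} (%y. (1 / \<beta>) * (inverse y)^2)" by (intro continuous_intros) auto
 have posI: "w t m:{0<..}" if "t:{0..T}" "m:Mfd" for t m using pos[OF that] by simp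
 have VC: "C12 T V" unfolding V_def by (rule C12_compose(1)[OF T wC posI l1 l2 l3])
 have HJB: "classical_solution_HJB T (hamiltonian lam \<nu> \<delta> mt (f_field \<alpha> Cext Q)) h V"
 unfolding classical_solution_HJB_def
 proof (intro conjI ballI)
 show "V T m = h m" if "m:Mfd" for m using wT[OF that] \<beta> by (simp add: V_def g_def)
 fix t and m :: "'n vec3" assume t': "t:{0..<T}" and m: "m:Mfd"
 then have t: "t:{0..T}" by simp
 have Vt: "V t = (%m. - (1 / \<beta>) * ln (w t m))" by (simp add: V_def)
 have e1: "time_deriv T V t m = - (1 / \<beta>) * inverse (w t m) * time_deriv T w t m"
 unfolding V_def by (rule C12_compose(2)[OF T wC posI l1 l2 l3 t m])
 have e2: "grad_M (V t) m = (- (1 / \<beta>) * inverse (w t m)) *\<^sub>R grad_M (w t) m"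
 unfolding Vt by (rule C12_compose(3)[OF T wC posI l1 l2 l3 t m])
 have e3: "laplace_beltrami (V t) m = - (1 / \<beta>) * inverse (w t m) * laplace_beltrami (w t) m
 + (1 / \<beta>) * (inverse (w t m))^2 * (norm (grad_M (w t) m))^2"
 unfolding Vt by (rule C12_compose(4)[OF T wC posI l1 l2 l3 t m])
 have n: "(norm (grad_M (V t) m))^2 = (- (1 / \<beta>) * inverse (w t m))^2 * (norm (grad_M (w t) m))^2"
 by (simp only: e2 norm_scaleR power_mult_distrib power2_abs)
 have bV: "b m \<bullet> grad_M (V t) m = (- (1 / \<beta>) * inverse (w t m)) * (b m \<bullet> grad_M (w t) m)"
 by (simp only: e2 inner_scaleR_right)
 have wn: "w t m \<noteq> 0" using pos[OF t m] by simp
 have p1: "(1 / \<beta>) * (inverse (w t m))^2 = \<beta> * (- (1 / \<beta>) * inverse (w t m))^2"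
 using \<beta> wn by (simp add: power2_eq_square field_simps)
 have p2: "(- (1 / \<beta>) * inverse (w t m)) * w t m = - (1 / \<beta>)"
 by (simp only: mult.assoc left_inverse[OF wn] mult_1_right)
 show "- time_deriv T V t m + hamiltonian lam \<nu> \<delta> mt (f_field \<alpha> Cext Q) t (V t) m = 0"
 unfolding H[OF m C12D(6)[OF VC t m]] e1 e3 n bV
 by (rule hopf_cole_forward[OF p1 p2 weq[OF t' m]])
 qed (rule VC)
 have HJB_unique: "W t m = V t m" if W: "classical_solution_HJB T (hamiltonian lam \<nu> \<delta> mt (f_field \<alpha> Cext Q)) h W"
 and tm: "t:{0..T}" "m:Mfd" for W t m
 proof -
 have WC: "C12 T W" and WT: "!!m. m:Mfd ==> W T m = h m" and Weq: "!!t m. t:{0..<T} ==> m:Mfd ==>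
 - time_deriv T W t m + hamiltonian lam \<nu> \<delta> mt (f_field \<alpha> Cext Q) t (W t) m = 0"
 using W unfolding classical_solution_HJB_def by auto
 \<comment> \<open>Uniqueness is pulled back to the linear equation, since \<open>w'\<close> solves
   it with the same terminal datum and the exponential is injective.\<close>
 define w' where "w' = (%t m. exp (- \<beta> * W t m))"
 have "classical_solution_L T \<nu> b c g w'" unfolding classical_solution_L_def
 proof (intro conjI ballI)
 show "C12 T w'" unfolding w'_def by (rule expC(1)[OF WC])
 show "w' T m = g m" if "m:Mfd" for m using WT[OF that] by (simp add: w'_def g_def)
 fix t and m :: "'n vec3" assume t': "t:{0..<T}" and m: "m:Mfd"
 then have t: "t:{0..T}" by simp
 have wt: "w' t = (%m. exp (- \<beta> * W t m))" by (simp add: w'_def)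
 have e1: "time_deriv T w' t m = - \<beta> * exp (- \<beta> * W t m) * time_deriv T W t m"
 unfolding w'_def by (rule expC(2)[OF WC t m])
 have e2: "b m \<bullet> grad_M (w' t) m = - \<beta> * exp (- \<beta> * W t m) * (b m \<bullet> grad_M (W t) m)"
 unfolding wt expC(3)[OF WC t m] by simp
 have e3: "laplace_beltrami (w' t) m = - \<beta> * exp (- \<beta> * W t m) * laplace_beltrami (W t) m
 + \<beta>^2 * exp (- \<beta> * W t m) * (norm (grad_M (W t) m))^2"
 unfolding wt by (rule expC(4)[OF WC t m])
 have e4: "w' t m = exp (- \<beta> * W t m)" by (simp add: w'_def)
 show "- time_deriv T w' t m - \<nu>^2 / 2 * laplace_beltrami (w' t) m + b m \<bullet> grad_M (w' t) m + c t m * w' t m = 0"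
 unfolding e1 e2 e3 e4
 by (rule hopf_cole_backward[OF \<beta>0 refl refl Weq[OF t' m, unfolded H[OF m C12D(6)[OF WC t m]]]])
 qed
 from unique[OF this tm] have "exp (- \<beta> * W t m) = w t m" by (simp add: w'_def)
 then have "ln (w t m) = - \<beta> * W t m" using ln_exp by metis
 then show ?thesis using \<beta> by (simp add: V_def)
 qed
 show ?thesis
 by (intro exI[of _ w] conjI allI impI ballI)
 (rule w[unfolded b_def g_def] weak[OF w, unfolded b_def g_def] HJB[unfolded V_def]
 | (rule unique[unfolded b_def g_def] weak_unique[unfolded b_def g_def] HJB_unique[unfolded V_def] pos; assumption))+
qed

end
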